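(* Let $k$ be an algebraically closed field of characteristic $0$ and let $\Lambda=kQ/\langle M\rangle=T_SV/\langle M\rangle$ be a basic Koszul finite-dimensional $k$-algebra of global dimension $n\geq1$, where $Q$ is a quiver, $S=kQ_0$, $V=kQ_1$ and $M\subset V\otimes_SV$. Let $\mathcal B(K_\ell)$ denote a $k$-basis of the Koszul $S$-bimodule $K_\ell$ (compatible with $K_\ell=\bigoplus_{i,j}e_jK_\ell e_i$). Then there is an isomorphism of $\Lambda$-bimodules $$\mathrm{Ext}^n_{\Lambda^e}(\Lambda,\Lambda^e)\cong\Big(\bigoplus_{\substack{q:i\to j\\ q\in\mathcal B(K_n)}}\Lambda e_i\otimes_ke_j\Lambda\Big)\Big/\langle I\rangle,$$ where $\langle I\rangle$ is the sub-bimodule generated by $$I=\Big\{\sum_{\substack{q:i\to j\\ q\in\mathcal B(K_n)}}(e_i\otimes e_j\delta^{\mathcal R}_p(q))_q+(-1)^n\sum_{\substack{q:i\to j\\ q\in\mathcal B(K_n)}}(\delta^{\mathcal L}_p(q)e_i\otimes e_j)_q\ \Big|\ p\in\mathcal B(K_{n-1})\Big\}.$$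
   Context: $\Lambda^e=\Lambda\otimes_k\Lambda^{op}$. Paths are composed right to left: $q:i\to j$ means $q\in e_jK_ne_i$, and a path is written $v_\ell\otimes\cdots\otimes v_1$ with $v_1$ first. $(-\otimes-)_q$ denotes an element of the $q$-th summand of the direct sum. Koszul: $\Lambda$, graded by path length, is Koszul if the graded left module $S$ has a graded projective resolution whose $\ell$-th term is generated in degree $\ell$. Koszul bimodules: $K_0=S$, $K_1=V$, $K_\ell=\bigcap_\mu V^{\otimes_S\mu}\otimes_SM\otimes_SV^{\otimes_S\ell-\mu-2}$ for $\ell\geq2$. The maps $\delta^{\mathcal L}_p,\delta^{\mathcal R}_p$ are linear, with $\delta^{\mathcal L}_p(q)=a$ if $q=p\otimes a$ and $0$ otherwise, and $\delta^{\mathcal R}_p(q)=a$ if $q=a\otimes p$ and $0$ otherwise, on basis elements. Thus for $q\in K_n\subset(K_{n-1}\otimes_SV)\cap(V\otimes_SK_{n-1})$, the elements $\delta^{\mathcal L}_p(q),\delta^{\mathcal R}_p(q)\in V$ are the coefficients in $q=\sum_{p\in\mathcal B(K_{n-1})}p\otimes\delta^{\mathcal L}_p(q)=\sum_{p\in\mathcal B(K_{n-1})}\delta^{\mathcal R}_p(q)\otimes p$. *)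

theory Defs
  imports
    "HOL-Algebra.QuotRing"
    "HOL-Algebra.Module"
    "HOL-Library.Poly_Mapping"
    "HOL-Library.Extended_Nat"
    "HOL-Computational_Algebra.Polynomial"
    "Graph_Theory.Arc_Walk"
begin

section \<open>Modules over a noncommutative ring\<close>

text \<open>
  We use the library record \<open>('r, 'm) module\<close> both for left modules over a ring and for
  algebras over a field of type \<^typ>\<open>'k\<close> (then \<open>smult\<close> is the action of \<^typ>\<open>'k\<close>). The fields
  \<open>mult\<close> and \<open>one\<close> of a record that is only used as a module carry no meaning. The library
  locale \<open>module\<close> requires a commutative ring, hence the following one.
\<close>

locale left_module = R?: ring R + M?: abelian_group M
    for R (structure) and M (structure) +
  assumes smult_closed: "\<lbrakk>a \<in> carrier R; x \<in> carrier M\<rbrakk> \<Longrightarrow> a \<odot>\<^bsub>M\<^esub> x \<in> carrier M"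
    and smult_l_distr: "\<lbrakk>a \<in> carrier R; b \<in> carrier R; x \<in> carrier M\<rbrakk> \<Longrightarrow>
      (a \<oplus>\<^bsub>R\<^esub> b) \<odot>\<^bsub>M\<^esub> x = a \<odot>\<^bsub>M\<^esub> x \<oplus>\<^bsub>M\<^esub> b \<odot>\<^bsub>M\<^esub> x"
    and smult_r_distr: "\<lbrakk>a \<in> carrier R; x \<in> carrier M; y \<in> carrier M\<rbrakk> \<Longrightarrow>
      a \<odot>\<^bsub>M\<^esub> (x \<oplus>\<^bsub>M\<^esub> y) = a \<odot>\<^bsub>M\<^esub> x \<oplus>\<^bsub>M\<^esub> a \<odot>\<^bsub>M\<^esub> y"
    and smult_assoc: "\<lbrakk>a \<in> carrier R; b \<in> carrier R; x \<in> carrier M\<rbrakk> \<Longrightarrow>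
      (a \<otimes>\<^bsub>R\<^esub> b) \<odot>\<^bsub>M\<^esub> x = a \<odot>\<^bsub>M\<^esub> (b \<odot>\<^bsub>M\<^esub> x)"
    and smult_one: "x \<in> carrier M \<Longrightarrow> \<one>\<^bsub>R\<^esub> \<odot>\<^bsub>M\<^esub> x = x"

definition mod_hom ::
  "('r, 's) ring_scheme \<Rightarrow> ('r, 'm, 't) module_scheme \<Rightarrow> ('r, 'n, 'u) module_scheme \<Rightarrow> ('m \<Rightarrow> 'n) set"
where
  "mod_hom R M N = {f \<in> carrier M \<rightarrow> carrier N.
     (\<forall>x\<in>carrier M. \<forall>y\<in>carrier M. f (x \<oplus>\<^bsub>M\<^esub> y) = f x \<oplus>\<^bsub>N\<^esub> f y) \<and>
     (\<forall>a\<in>carrier R. \<forall>x\<in>carrier M. f (a \<odot>\<^bsub>M\<^esub> x) = a \<odot>\<^bsub>N\<^esub> f x)}"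

definition regular :: "('r, 's) ring_scheme \<Rightarrow> ('r, 'r) module" where
  "regular R = ring.extend (ring.truncate R) (module.fields (monoid.mult R))"

definition quot :: "('r, 'm, 's) module_scheme \<Rightarrow> 'm set \<Rightarrow> ('r, 'm set) module" where
  "quot M N = ring.extend (M Quot N) (module.fields (\<lambda>a X. \<Union>x\<in>X. N +>\<^bsub>M\<^esub> (a \<odot>\<^bsub>M\<^esub> x)))"

definition free_mod :: "('r, 's) ring_scheme \<Rightarrow> 'x set \<Rightarrow> ('r, 'x \<Rightarrow> 'r) module" where
  "free_mod R X =
    \<lparr>carrier = {f. (\<forall>x\<in>X. f x \<in> carrier R) \<and> (\<forall>x. x \<notin> X \<longrightarrow> f x = \<zero>\<^bsub>R\<^esub>) \<and>
       finite {x. f x \<noteq> \<zero>\<^bsub>R\<^esub>}},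
     monoid.mult = undefined, monoid.one = undefined,
     ring.zero = (\<lambda>_. \<zero>\<^bsub>R\<^esub>), ring.add = (\<lambda>f g x. f x \<oplus>\<^bsub>R\<^esub> g x),
     module.smult = (\<lambda>a f x. a \<otimes>\<^bsub>R\<^esub> f x)\<rparr>"

text \<open>
  A module is projective if it is a direct summand of a free module. Restricting to bases
  in the type of the module is harmless: a projective module \<open>P\<close> is a direct summand of the free
  module on the set \<open>carrier P\<close>.
\<close>

definition projective :: "('r, 's) ring_scheme \<Rightarrow> ('r, 'm, 't) module_scheme \<Rightarrow> bool" where
  "projective R P \<longleftrightarrow> left_module R P \<and>
     (\<exists>(X :: 'm set) i r. i \<in> mod_hom R P (free_mod R X) \<and> r \<in> mod_hom R (free_mod R X) P \<and>
        (\<forall>x\<in>carrier P. r (i x) = x))"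

definition projective_resolution ::
  "('r, 's) ring_scheme \<Rightarrow> ('r, 'm, 't) module_scheme \<Rightarrow>
   (nat \<Rightarrow> ('r, 'p) module) \<Rightarrow> (nat \<Rightarrow> 'p \<Rightarrow> 'p) \<Rightarrow> ('p \<Rightarrow> 'm) \<Rightarrow> bool"
where
  "projective_resolution R X P d \<epsilon> \<longleftrightarrow>
     left_module R X \<and> (\<forall>l. projective R (P l)) \<and>
     \<epsilon> \<in> mod_hom R (P 0) X \<and> (\<forall>l. d l \<in> mod_hom R (P (Suc l)) (P l)) \<and>
     \<epsilon> ` carrier (P 0) = carrier X \<and>
     {x \<in> carrier (P 0). \<epsilon> x = \<zero>\<^bsub>X\<^esub>} = d 0 ` carrier (P 1) \<and>
     (\<forall>l. {x \<in> carrier (P (Suc l)). d l x = \<zero>\<^bsub>P l\<^esub>} = d (Suc l) ` carrier (P (Suc (Suc l))))"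

text \<open>
  HOL cannot quantify over all types inside a definition, so an existentially quantified
  resolution needs a type for its terms. The following one is always large enough: the free module
  \<open>F\<close> on the lists over \<open>carrier X \<times> carrier R\<close> has no more elements than there are such lists, so
  \<open>X\<close> and every submodule of \<open>F\<close> are quotients of \<open>F\<close>. Hence \<open>X\<close> has a resolution all of whose
  terms are \<open>F\<close>, and if the projective dimension is \<open>m\<close> it can be truncated at the \<open>m\<close>-th syzygy,
  a projective submodule of \<open>F\<close>.
\<close>

type_synonym ('r, 'm) resolution_term = "('r, ('m \<times> 'r) list \<Rightarrow> 'r) module"

definition proj_dim :: "('r, 's) ring_scheme \<Rightarrow> ('r, 'm, 't) module_scheme \<Rightarrow> enat" where
  "proj_dim R X = Inf {enat m | m.
     \<exists>(P :: nat \<Rightarrow> ('r, 'm) resolution_term) d \<epsilon>.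
       projective_resolution R X P d \<epsilon> \<and> (\<forall>l>m. carrier (P l) = {\<zero>\<^bsub>P l\<^esub>})}"

text \<open>
  The supremum ranges over the modules with carrier in \<^typ>\<open>'r set\<close>. These include all
  cyclic modules \<open>R / I\<close> (as sets of cosets), which already determine the global
  dimension by Auslander's theorem, so the restriction does not change the value.
\<close>

definition gl_dim :: "('r, 's) ring_scheme \<Rightarrow> enat" where
  "gl_dim R = (SUP X \<in> {X :: ('r, 'r set) module. left_module R X}. proj_dim R X)"

definition primitive_idempotent :: "('r, 's) ring_scheme \<Rightarrow> 'r \<Rightarrow> bool" where
  "primitive_idempotent R e \<longleftrightarrow> e \<in> carrier R \<and> e \<otimes>\<^bsub>R\<^esub> e = e \<and> e \<noteq> \<zero>\<^bsub>R\<^esub> \<and>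
     \<not> (\<exists>f\<in>carrier R. \<exists>g\<in>carrier R. f \<noteq> \<zero>\<^bsub>R\<^esub> \<and> g \<noteq> \<zero>\<^bsub>R\<^esub> \<and> e = f \<oplus>\<^bsub>R\<^esub> g \<and>
          f \<otimes>\<^bsub>R\<^esub> f = f \<and> g \<otimes>\<^bsub>R\<^esub> g = g \<and> f \<otimes>\<^bsub>R\<^esub> g = \<zero>\<^bsub>R\<^esub> \<and> g \<otimes>\<^bsub>R\<^esub> f = \<zero>\<^bsub>R\<^esub>)"

definition principal_left :: "('r, 's) ring_scheme \<Rightarrow> 'r \<Rightarrow> 'r set" where
  "principal_left R e = (\<lambda>x. x \<otimes>\<^bsub>R\<^esub> e) ` carrier R"

definition principal_right :: "('r, 's) ring_scheme \<Rightarrow> 'r \<Rightarrow> 'r set" where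
  "principal_right R e = (\<lambda>x. e \<otimes>\<^bsub>R\<^esub> x) ` carrier R"

definition basic :: "('r, 's) ring_scheme \<Rightarrow> bool" where
  "basic R \<longleftrightarrow> (\<exists>E. finite E \<and> (\<forall>e\<in>E. primitive_idempotent R e) \<and>
     (\<forall>e\<in>E. \<forall>f\<in>E. e \<noteq> f \<longrightarrow> e \<otimes>\<^bsub>R\<^esub> f = \<zero>\<^bsub>R\<^esub>) \<and> finsum R (\<lambda>e. e) E = \<one>\<^bsub>R\<^esub> \<and>
     (\<forall>e\<in>E. \<forall>f\<in>E. e \<noteq> f \<longrightarrow>
        \<not> (\<exists>h \<in> mod_hom R ((regular R)\<lparr>carrier := principal_left R e\<rparr>)
                           ((regular R)\<lparr>carrier := principal_left R f\<rparr>).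
             bij_betw h (principal_left R e) (principal_left R f))))"


section \<open>Bimodules and Ext\<close>

record ('r, 'm) bimodule = "('r, 'm) module" +
  rsmult :: "'m \<Rightarrow> 'r \<Rightarrow> 'm"

definition bimodule_iso ::
  "('r, 's) ring_scheme \<Rightarrow> ('r, 'm) bimodule \<Rightarrow> ('r, 'n) bimodule \<Rightarrow> ('m \<Rightarrow> 'n) set"
where
  "bimodule_iso A M N = {h \<in> mod_hom A M N. bij_betw h (carrier M) (carrier N) \<and>
     (\<forall>x\<in>carrier M. \<forall>a\<in>carrier A. h (rsmult M x a) = rsmult N (h x) a)}"

definition sub_bimodule :: "('r, 's) ring_scheme \<Rightarrow> 'm set \<Rightarrow> ('r, 'm) bimodule \<Rightarrow> bool" where
  "sub_bimodule A N M \<longleftrightarrow> submodule N A M \<and> (\<forall>x\<in>N. \<forall>a\<in>carrier A. rsmult M x a \<in> N)"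

definition gen_sub_bimodule :: "('r, 's) ring_scheme \<Rightarrow> ('r, 'm) bimodule \<Rightarrow> 'm set \<Rightarrow> 'm set" where
  "gen_sub_bimodule A M I = \<Inter>{N. sub_bimodule A N M \<and> I \<subseteq> N}"

definition quot_bimodule :: "('r, 'm) bimodule \<Rightarrow> 'm set \<Rightarrow> ('r, 'm set) bimodule" where
  "quot_bimodule M N =
     module.extend (quot M N)
       (bimodule.fields (\<lambda>X a. \<Union>x\<in>X. N +>\<^bsub>M\<^esub> (rsmult M x a)))"

definition dsum_bimodule :: "'q set \<Rightarrow> ('q \<Rightarrow> ('r, 'm) bimodule) \<Rightarrow> ('r, 'q \<Rightarrow> 'm) bimodule" where
  "dsum_bimodule B T =
    \<lparr>carrier = {g \<in> (\<Pi>\<^sub>E q\<in>B. carrier (T q)). finite {q\<in>B. g q \<noteq> \<zero>\<^bsub>T q\<^esub>}},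
     monoid.mult = undefined, monoid.one = undefined,
     ring.zero = (\<lambda>q\<in>B. \<zero>\<^bsub>T q\<^esub>), ring.add = (\<lambda>g h. \<lambda>q\<in>B. g q \<oplus>\<^bsub>T q\<^esub> h q),
     module.smult = (\<lambda>a g. \<lambda>q\<in>B. a \<odot>\<^bsub>T q\<^esub> g q),
     rsmult = (\<lambda>g a. \<lambda>q\<in>B. rsmult (T q) (g q) a)\<rparr>"

text \<open>
  \<open>Y\<close> is a left module over the ring \<open>E\<close>, and \<open>W\<close> is the same abelian group with a bimodule
  structure (over some other ring) that commutes with the action of \<open>E\<close>; it makes
  \<open>Hom\<^sub>E(P, Y)\<close> and \<open>Ext\<^sub>E(X, Y)\<close> bimodules.
\<close>

definition hom_bimodule ::
  "('e, 's) ring_scheme \<Rightarrow> ('e, 'p) module \<Rightarrow> ('e, 'y) module \<Rightarrow> ('r, 'y) bimodule \<Rightarrow>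
   ('r, 'p \<Rightarrow> 'y) bimodule"
where
  "hom_bimodule E P Y W =
    \<lparr>carrier = mod_hom E P Y \<inter> extensional (carrier P),
     monoid.mult = undefined, monoid.one = undefined,
     ring.zero = (\<lambda>p\<in>carrier P. \<zero>\<^bsub>Y\<^esub>), ring.add = (\<lambda>f g. \<lambda>p\<in>carrier P. f p \<oplus>\<^bsub>Y\<^esub> g p),
     module.smult = (\<lambda>a f. \<lambda>p\<in>carrier P. a \<odot>\<^bsub>W\<^esub> f p),
     rsmult = (\<lambda>f a. \<lambda>p\<in>carrier P. rsmult W (f p) a)\<rparr>"

definition cocycles ::
  "('e, 's) ring_scheme \<Rightarrow> (nat \<Rightarrow> ('e, 'p) module) \<Rightarrow> (nat \<Rightarrow> 'p \<Rightarrow> 'p) \<Rightarrow> ('e, 'y) module \<Rightarrow>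
   ('r, 'y) bimodule \<Rightarrow> nat \<Rightarrow> ('p \<Rightarrow> 'y) set"
where
  "cocycles E P d Y W n = {f \<in> carrier (hom_bimodule E (P n) Y W).
     \<forall>p\<in>carrier (P (Suc n)). f (d n p) = \<zero>\<^bsub>Y\<^esub>}"

fun coboundaries ::
  "('e, 's) ring_scheme \<Rightarrow> (nat \<Rightarrow> ('e, 'p) module) \<Rightarrow> (nat \<Rightarrow> 'p \<Rightarrow> 'p) \<Rightarrow> ('e, 'y) module \<Rightarrow>
   ('r, 'y) bimodule \<Rightarrow> nat \<Rightarrow> ('p \<Rightarrow> 'y) set"
where
  "coboundaries E P d Y W 0 = {\<zero>\<^bsub>hom_bimodule E (P 0) Y W\<^esub>}"
| "coboundaries E P d Y W (Suc n) =
     (\<lambda>g. \<lambda>p\<in>carrier (P (Suc n)). g (d n p)) ` carrier (hom_bimodule E (P n) Y W)"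

text \<open>
  \<open>Ext\<^sub>E\<^sup>n(X, Y)\<close>, computed as the cohomology of \<open>Hom\<^sub>E(P, Y)\<close> for a projective resolution
  \<open>(P, d)\<close> of \<open>X\<close>. A statement about Ext is a statement about all projective resolutions.
\<close>

definition Ext_bimodule ::
  "('e, 's) ring_scheme \<Rightarrow> (nat \<Rightarrow> ('e, 'p) module) \<Rightarrow> (nat \<Rightarrow> 'p \<Rightarrow> 'p) \<Rightarrow> ('e, 'y) module \<Rightarrow>
   ('r, 'y) bimodule \<Rightarrow> nat \<Rightarrow> ('r, ('p \<Rightarrow> 'y) set) bimodule"
where
  "Ext_bimodule E P d Y W n =
     quot_bimodule ((hom_bimodule E (P n) Y W)\<lparr>carrier := cocycles E P d Y W n\<rparr>)
       (coboundaries E P d Y W n)"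


section \<open>Linear algebra, tensor products and the enveloping algebra\<close>

definition fscale :: "'k::field \<Rightarrow> ('x \<Rightarrow>\<^sub>0 'k) \<Rightarrow> ('x \<Rightarrow>\<^sub>0 'k)" where
  "fscale c f = Poly_Mapping.map ((*) c) f"

lemma lookup_fscale [simp]: "Poly_Mapping.lookup (fscale c f) x = c * Poly_Mapping.lookup f x"
  by (simp add: fscale_def Poly_Mapping.map.rep_eq when_def)

global_interpretation fs: vector_space fscale
  by unfold_locales (simp_all add: poly_mapping_eqI lookup_add algebra_simps)

definition lin_ext :: "('x \<Rightarrow> ('y \<Rightarrow>\<^sub>0 'k::field)) \<Rightarrow> ('x \<Rightarrow>\<^sub>0 'k) \<Rightarrow> ('y \<Rightarrow>\<^sub>0 'k)" where
  "lin_ext h f = (\<Sum>x\<in>Poly_Mapping.keys f. fscale (Poly_Mapping.lookup f x) (h x))"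

text \<open>The algebra with basis \<open>X\<close>, unit \<open>u\<close>, and multiplication \<open>m\<close> on basis elements.\<close>

definition algebra_on_basis ::
  "'x set \<Rightarrow> ('x \<Rightarrow> 'x \<Rightarrow> ('x \<Rightarrow>\<^sub>0 'k::field)) \<Rightarrow> ('x \<Rightarrow>\<^sub>0 'k) \<Rightarrow> ('k, 'x \<Rightarrow>\<^sub>0 'k) module"
where
  "algebra_on_basis X m u =
    \<lparr>carrier = {f. Poly_Mapping.keys f \<subseteq> X},
     monoid.mult = (\<lambda>f g. lin_ext (\<lambda>x. lin_ext (m x) g) f), monoid.one = u,
     ring.zero = 0, ring.add = (+), module.smult = fscale\<rparr>"

definition fin_dim :: "('k, 'b, 's) module_scheme \<Rightarrow> bool" where
  "fin_dim A \<longleftrightarrow> (\<exists>X. finite X \<and> X \<subseteq> carrier A \<and>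
     (\<forall>a\<in>carrier A. \<exists>c. a = finsum A (\<lambda>x. c x \<odot>\<^bsub>A\<^esub> x) X))"

text \<open>
  \<open>A \<otimes>\<^sub>k B\<close> is the free vector space on \<open>carrier A \<times> carrier B\<close> modulo the bilinearity
  relations. If \<open>A\<close> and \<open>B\<close> are algebras, the free vector space is the monoid algebra of the
  product of their multiplicative monoids, the relations form an ideal, and the quotient is the
  tensor product of algebras.
\<close>

definition pair_algebra ::
  "('k::field, 'a, 's) module_scheme \<Rightarrow> ('k, 'b, 't) module_scheme \<Rightarrow> ('k, ('a \<times> 'b) \<Rightarrow>\<^sub>0 'k) module"
where
  "pair_algebra A B = algebra_on_basis (carrier A \<times> carrier B)
     (\<lambda>(a, b) (a', b'). Poly_Mapping.single (a \<otimes>\<^bsub>A\<^esub> a', b \<otimes>\<^bsub>B\<^esub> b') 1)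
     (Poly_Mapping.single (\<one>\<^bsub>A\<^esub>, \<one>\<^bsub>B\<^esub>) 1)"

definition tensor_rel ::
  "('k::field, 'a, 's) module_scheme \<Rightarrow> ('k, 'b, 't) module_scheme \<Rightarrow> (('a \<times> 'b) \<Rightarrow>\<^sub>0 'k) set"
where
  "tensor_rel A B = (let s = (\<lambda>a b. Poly_Mapping.single (a, b) 1) in fs.span (
     {s (a \<oplus>\<^bsub>A\<^esub> a') b - s a b - s a' b | a a' b.
        a \<in> carrier A \<and> a' \<in> carrier A \<and> b \<in> carrier B} \<union>
     {s a (b \<oplus>\<^bsub>B\<^esub> b') - s a b - s a b' | a b b'.
        a \<in> carrier A \<and> b \<in> carrier B \<and> b' \<in> carrier B} \<union>
     {s (c \<odot>\<^bsub>A\<^esub> a) b - fscale c (s a b) | c a b. a \<in> carrier A \<and> b \<in> carrier B} \<union>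
     {s a (c \<odot>\<^bsub>B\<^esub> b) - fscale c (s a b) | c a b. a \<in> carrier A \<and> b \<in> carrier B}))"

definition tensor ::
  "('k::field, 'a, 's) module_scheme \<Rightarrow> ('k, 'b, 't) module_scheme \<Rightarrow>
   ('k, (('a \<times> 'b) \<Rightarrow>\<^sub>0 'k) set) module"
where
  "tensor A B = quot (pair_algebra A B) (tensor_rel A B)"

definition tensor_elem ::
  "('k::field, 'a, 's) module_scheme \<Rightarrow> ('k, 'b, 't) module_scheme \<Rightarrow> 'a \<Rightarrow> 'b \<Rightarrow>
   (('a \<times> 'b) \<Rightarrow>\<^sub>0 'k) set"
where
  "tensor_elem A B a b = tensor_rel A B +>\<^bsub>pair_algebra A B\<^esub> Poly_Mapping.single (a, b) 1"

definition tensor_map ::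
  "('k::field, 'a, 's) module_scheme \<Rightarrow> ('k, 'b, 't) module_scheme \<Rightarrow> ('a \<Rightarrow> 'a) \<Rightarrow> ('b \<Rightarrow> 'b) \<Rightarrow>
   (('a \<times> 'b) \<Rightarrow>\<^sub>0 'k) set \<Rightarrow> (('a \<times> 'b) \<Rightarrow>\<^sub>0 'k) set"
where
  "tensor_map A B \<phi> \<psi> t = (\<Union>f\<in>t. tensor_rel A B +>\<^bsub>pair_algebra A B\<^esub>
     lin_ext (\<lambda>(x, y). Poly_Mapping.single (\<phi> x, \<psi> y) 1) f)"

definition tensor_bimodule ::
  "('k::field, 'b) module \<Rightarrow> 'b set \<Rightarrow> 'b set \<Rightarrow> ('b, (('b \<times> 'b) \<Rightarrow>\<^sub>0 'k) set) bimodule"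
  \<comment> \<open>\<open>L \<otimes>\<^sub>k R\<close> for a left ideal \<open>L\<close> and a right ideal \<open>R\<close> of \<open>A\<close>\<close>
where
  "tensor_bimodule A L R = (let AL = A\<lparr>carrier := L\<rparr>; AR = A\<lparr>carrier := R\<rparr>; T = tensor AL AR in
    \<lparr>carrier = carrier T, monoid.mult = undefined, monoid.one = undefined,
     ring.zero = \<zero>\<^bsub>T\<^esub>, ring.add = ring.add T,
     module.smult = (\<lambda>a. tensor_map AL AR (\<lambda>x. a \<otimes>\<^bsub>A\<^esub> x) (\<lambda>y. y)),
     rsmult = (\<lambda>t a. tensor_map AL AR (\<lambda>x. x) (\<lambda>y. y \<otimes>\<^bsub>A\<^esub> a) t)\<rparr>)"

definition op_algebra :: "('k, 'b) module \<Rightarrow> ('k, 'b) module" where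
  "op_algebra A = A\<lparr>monoid.mult := (\<lambda>x y. y \<otimes>\<^bsub>A\<^esub> x)\<rparr>"

definition env :: "('k::field, 'b) module \<Rightarrow> ('k, (('b \<times> 'b) \<Rightarrow>\<^sub>0 'k) set) module" where
  "env A = tensor A (op_algebra A)"

text \<open>\<open>A\<close> as a left module over \<open>env A\<close>: \<open>(a \<otimes> b) \<cdot> x = a x b\<close>.\<close>

definition env_diagonal :: "('k::field, 'b) module \<Rightarrow> ((('b \<times> 'b) \<Rightarrow>\<^sub>0 'k) set, 'b) module" where
  "env_diagonal A = ring.extend (ring.truncate A)
     (module.fields (\<lambda>t x. the_elem ((\<lambda>f.
        finsum A (\<lambda>(a, b). Poly_Mapping.lookup f (a, b) \<odot>\<^bsub>A\<^esub> (a \<otimes>\<^bsub>A\<^esub> x \<otimes>\<^bsub>A\<^esub> b))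
          (Poly_Mapping.keys f)) ` t)))"

text \<open>
  The bimodule structure on \<open>A \<otimes> A\<^sup>o\<^sup>p\<close> by right multiplication of the enveloping algebra on itself:
  \<open>a \<cdot> (x \<otimes> y) = x \<otimes> a y\<close> and \<open>(x \<otimes> y) \<cdot> a = x a \<otimes> y\<close>. It commutes with left multiplication.
\<close>

definition env_inner :: "('k::field, 'b) module \<Rightarrow> ('b, (('b \<times> 'b) \<Rightarrow>\<^sub>0 'k) set) bimodule" where
  "env_inner A = (let E = env A; t = tensor_elem A (op_algebra A) in
    \<lparr>carrier = carrier E, monoid.mult = undefined, monoid.one = undefined,
     ring.zero = \<zero>\<^bsub>E\<^esub>, ring.add = ring.add E,
     module.smult = (\<lambda>a x. x \<otimes>\<^bsub>E\<^esub> t \<one>\<^bsub>A\<^esub> a),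
     rsmult = (\<lambda>x a. x \<otimes>\<^bsub>E\<^esub> t a \<one>\<^bsub>A\<^esub>)\<rparr>)"


section \<open>Quadratic algebras of quivers\<close>

text \<open>
  A path is a pair of its start vertex and the list of its arrows, the first arrow coming first
  in the list. In the path algebra paths compose right to left: \<open>p q\<close> is \<open>q\<close> followed by \<open>p\<close>.
\<close>

type_synonym ('v, 'a, 'k) path_elem = "('v \<times> 'a list) \<Rightarrow>\<^sub>0 'k"

definition paths :: "('v, 'a) pre_digraph \<Rightarrow> ('v \<times> 'a list) set" where
  "paths Q = {(u, p). \<exists>v. pre_digraph.awalk Q u p v}"

definition path_target :: "('v, 'a) pre_digraph \<Rightarrow> 'v \<times> 'a list \<Rightarrow> 'v" where
  "path_target Q p = pre_digraph.awlast Q (fst p) (snd p)"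

definition vertex_idem :: "'v \<Rightarrow> ('v, 'a, 'k::field) path_elem" where
  "vertex_idem v = Poly_Mapping.single (v, []) 1"

definition path_algebra :: "('v, 'a) pre_digraph \<Rightarrow> ('k::field, ('v, 'a, 'k) path_elem) module" where
  "path_algebra Q = algebra_on_basis (paths Q)
     (\<lambda>p q. if path_target Q q = fst p then Poly_Mapping.single (fst q, snd q @ snd p) 1 else 0)
     (\<Sum>v\<in>verts Q. vertex_idem v)"

text \<open>
  \<open>T\<^sub>S V = kQ\<close> identifies \<open>V\<^bsup>\<otimes>\<ell>\<^esup>\<close> (tensor power over \<open>S = kQ\<^sub>0\<close>) with the span of the paths of
  length \<open>\<ell>\<close>. As \<open>S\<close> is semisimple, \<open>X \<otimes>\<^sub>S Y\<close> for sub-bimodules \<open>X\<close>, \<open>Y\<close> of tensor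
  powers is then the span of the products in \<open>kQ\<close>.
\<close>

definition path_part :: "('v, 'a) pre_digraph \<Rightarrow> nat \<Rightarrow> ('v, 'a, 'k::field) path_elem set" where
  "path_part Q l = {f. Poly_Mapping.keys f \<subseteq> {p \<in> paths Q. length (snd p) = l}}"

definition prod_space :: "('v, 'a) pre_digraph \<Rightarrow> ('v, 'a, 'k::field) path_elem set \<Rightarrow>
    ('v, 'a, 'k) path_elem set \<Rightarrow> ('v, 'a, 'k) path_elem set" where
  "prod_space Q X Y = fs.span {x \<otimes>\<^bsub>path_algebra Q\<^esub> y | x y. x \<in> X \<and> y \<in> Y}"

definition quadratic_relations :: "('v, 'a) pre_digraph \<Rightarrow> ('v, 'a, 'k::field) path_elem set \<Rightarrow> bool"
  \<comment> \<open>\<open>M\<close> is an \<open>S\<close>-sub-bimodule of \<open>V \<otimes>\<^sub>S V\<close>\<close>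
where
  "quadratic_relations Q M \<longleftrightarrow> fs.subspace M \<and> M \<subseteq> path_part Q 2 \<and>
     (\<forall>s\<in>path_part Q 0. \<forall>m\<in>M. s \<otimes>\<^bsub>path_algebra Q\<^esub> m \<in> M \<and> m \<otimes>\<^bsub>path_algebra Q\<^esub> s \<in> M)"

definition qideal :: "('v, 'a) pre_digraph \<Rightarrow> ('v, 'a, 'k::field) path_elem set \<Rightarrow>
    ('v, 'a, 'k) path_elem set" where
  "qideal Q M = Idl\<^bsub>path_algebra Q :: ('k, ('v, 'a, 'k) path_elem) module\<^esub> M"

definition qalg :: "('v, 'a) pre_digraph \<Rightarrow> ('v, 'a, 'k::field) path_elem set \<Rightarrow>
    ('k, ('v, 'a, 'k) path_elem set) module" where
  "qalg Q M = quot (path_algebra Q) (qideal Q M)"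

definition qcls :: "('v, 'a) pre_digraph \<Rightarrow> ('v, 'a, 'k::field) path_elem set \<Rightarrow>
    ('v, 'a, 'k) path_elem \<Rightarrow> ('v, 'a, 'k) path_elem set" where
  "qcls Q M x = qideal Q M +>\<^bsub>path_algebra Q\<^esub> x"

definition koszul_space :: "('v, 'a) pre_digraph \<Rightarrow> ('v, 'a, 'k::field) path_elem set \<Rightarrow> nat \<Rightarrow>
    ('v, 'a, 'k) path_elem set" where
  "koszul_space Q M l = (if l \<le> 1 then path_part Q l else
     (\<Inter>\<mu>\<in>{0..l-2}. prod_space Q (prod_space Q (path_part Q \<mu>) M) (path_part Q (l - \<mu> - 2))))"


section \<open>Koszul algebras\<close>

definition graded_module ::
  "('r, 's) ring_scheme \<Rightarrow> (int \<Rightarrow> 'r set) \<Rightarrow> ('r, 'm, 't) module_scheme \<Rightarrow> (int \<Rightarrow> 'm set) \<Rightarrow> bool"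
where
  "graded_module R RG M MG \<longleftrightarrow> left_module R M \<and>
     (\<forall>i. subgroup (MG i) (add_monoid M)) \<and>
     (\<forall>x\<in>carrier M. \<exists>!c. (\<forall>i. c i \<in> MG i) \<and> finite {i. c i \<noteq> \<zero>\<^bsub>M\<^esub>} \<and>
        x = finsum M c {i. c i \<noteq> \<zero>\<^bsub>M\<^esub>}) \<and>
     (\<forall>i j. \<forall>a\<in>RG i. \<forall>x\<in>MG j. a \<odot>\<^bsub>M\<^esub> x \<in> MG (i + j))"

definition generated_by :: "('r, 's) ring_scheme \<Rightarrow> ('r, 'm, 't) module_scheme \<Rightarrow> 'm set \<Rightarrow> bool" where
  "generated_by R M X \<longleftrightarrow> \<Inter>{N. submodule N R M \<and> X \<subseteq> N} = carrier M"

definition qgrading :: "('v, 'a) pre_digraph \<Rightarrow> ('v, 'a, 'k::field) path_elem set \<Rightarrow> int \<Rightarrow>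
    ('v, 'a, 'k) path_elem set set" where
  "qgrading Q M i = (if 0 \<le> i then qcls Q M ` path_part Q (nat i) else {\<zero>\<^bsub>qalg Q M\<^esub>})"

text \<open>\<open>S = kQ\<^sub>0\<close> as a left module, i.e. the quotient by the ideal of elements of positive degree.\<close>

definition qtop :: "('v, 'a) pre_digraph \<Rightarrow> ('v, 'a, 'k::field) path_elem set \<Rightarrow>
    (('v, 'a, 'k) path_elem set, ('v, 'a, 'k) path_elem set set) module" where
  "qtop Q M = quot (regular (qalg Q M))
     (qcls Q M ` {f. Poly_Mapping.keys f \<subseteq> {p \<in> paths Q. length (snd p) \<ge> 1}})"

definition qtop_grading :: "('v, 'a) pre_digraph \<Rightarrow> ('v, 'a, 'k::field) path_elem set \<Rightarrow> int \<Rightarrow>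
    ('v, 'a, 'k) path_elem set set set" where
  "qtop_grading Q M i = (if i = 0 then carrier (qtop Q M) else {\<zero>\<^bsub>qtop Q M\<^esub>})"

definition koszul :: "('v, 'a) pre_digraph \<Rightarrow> ('v, 'a, 'k::field) path_elem set \<Rightarrow> bool" where
  "koszul Q M \<longleftrightarrow> (\<exists>(P :: nat \<Rightarrow>
       (('v, 'a, 'k) path_elem set, ('v, 'a, 'k) path_elem set set) resolution_term) PG d \<epsilon>.
     projective_resolution (qalg Q M) (qtop Q M) P d \<epsilon> \<and>
     (\<forall>l. graded_module (qalg Q M) (qgrading Q M) (P l) (PG l) \<and>
          generated_by (qalg Q M) (P l) (PG l (int l))) \<and>
     (\<forall>i. \<epsilon> ` PG 0 i \<subseteq> qtop_grading Q M i) \<and>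
     (\<forall>l i. d l ` PG (Suc l) i \<subseteq> PG l i))"


section \<open>The bimodule presentation\<close>

definition compatible_basis :: "('v, 'a) pre_digraph \<Rightarrow> ('v, 'a, 'k::field) path_elem set \<Rightarrow>
    ('v, 'a, 'k) path_elem set \<Rightarrow> bool" where
  "compatible_basis Q K B \<longleftrightarrow> B \<subseteq> K \<and> \<not> fs.dependent B \<and> fs.span B = K \<and>
     (\<forall>q\<in>B. \<exists>i\<in>verts Q. \<exists>j\<in>verts Q.
        vertex_idem j \<otimes>\<^bsub>path_algebra Q\<^esub> q \<otimes>\<^bsub>path_algebra Q\<^esub> vertex_idem i = q)"

text \<open>The vertices with \<open>q : i \<rightarrow> j\<close>, for \<open>q \<noteq> 0\<close> in \<open>e\<^sub>j kQ e\<^sub>i\<close>.\<close>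

definition source :: "('v, 'a) pre_digraph \<Rightarrow> ('v, 'a, 'k::field) path_elem \<Rightarrow> 'v" where
  "source Q q = (THE i. i \<in> verts Q \<and> q \<otimes>\<^bsub>path_algebra Q\<^esub> vertex_idem i = q)"

definition target :: "('v, 'a) pre_digraph \<Rightarrow> ('v, 'a, 'k::field) path_elem \<Rightarrow> 'v" where
  "target Q q = (THE j. j \<in> verts Q \<and> vertex_idem j \<otimes>\<^bsub>path_algebra Q\<^esub> q = q)"

text \<open>
  The coefficients in \<open>q = \<Sum>\<^sub>p p \<otimes> \<delta>\<^sup>L\<^sub>p(q)\<close> and \<open>q = \<Sum>\<^sub>p \<delta>\<^sup>R\<^sub>p(q) \<otimes> p\<close>, where \<open>p\<close> runs over the finite
  basis \<open>B\<close>. They are unique because the tensor products are over \<open>S\<close>: the coefficient of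
  \<open>p : i \<rightarrow> j\<close> is taken in \<open>e\<^sub>i V\<close> and in \<open>V e\<^sub>j\<close>, respectively.
\<close>

definition delta_L :: "('v, 'a) pre_digraph \<Rightarrow> ('v, 'a, 'k::field) path_elem set \<Rightarrow>
    ('v, 'a, 'k) path_elem \<Rightarrow> ('v, 'a, 'k) path_elem \<Rightarrow> ('v, 'a, 'k) path_elem" where
  "delta_L Q B p q = (THE c. (\<forall>p. p \<notin> B \<longrightarrow> c p = 0) \<and>
     (\<forall>p\<in>B. c p \<in> path_part Q 1 \<and> vertex_idem (source Q p) \<otimes>\<^bsub>path_algebra Q\<^esub> c p = c p) \<and>
     q = (\<Sum>p\<in>B. p \<otimes>\<^bsub>path_algebra Q\<^esub> c p)) p"

definition delta_R :: "('v, 'a) pre_digraph \<Rightarrow> ('v, 'a, 'k::field) path_elem set \<Rightarrow>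
    ('v, 'a, 'k) path_elem \<Rightarrow> ('v, 'a, 'k) path_elem \<Rightarrow> ('v, 'a, 'k) path_elem" where
  "delta_R Q B p q = (THE c. (\<forall>p. p \<notin> B \<longrightarrow> c p = 0) \<and>
     (\<forall>p\<in>B. c p \<in> path_part Q 1 \<and> c p \<otimes>\<^bsub>path_algebra Q\<^esub> vertex_idem (target Q p) = c p) \<and>
     q = (\<Sum>p\<in>B. c p \<otimes>\<^bsub>path_algebra Q\<^esub> p)) p"

definition left_proj :: "('v, 'a) pre_digraph \<Rightarrow> ('v, 'a, 'k::field) path_elem set \<Rightarrow> 'v \<Rightarrow>
    ('v, 'a, 'k) path_elem set set" where
  "left_proj Q M i = principal_left (qalg Q M) (qcls Q M (vertex_idem i))"

definition right_proj :: "('v, 'a) pre_digraph \<Rightarrow> ('v, 'a, 'k::field) path_elem set \<Rightarrow> 'v \<Rightarrow>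
    ('v, 'a, 'k) path_elem set set" where
  "right_proj Q M j = principal_right (qalg Q M) (qcls Q M (vertex_idem j))"

definition top_bimodule where
  "top_bimodule Q M Bn = dsum_bimodule Bn
     (\<lambda>q. tensor_bimodule (qalg Q M) (left_proj Q M (source Q q)) (right_proj Q M (target Q q)))"

definition top_relation where
  "top_relation Q M n Bn Bn' p = (\<lambda>q\<in>Bn.
     let \<Lambda> = qalg Q M;
         AL = \<Lambda>\<lparr>carrier := left_proj Q M (source Q q)\<rparr>;
         AR = \<Lambda>\<lparr>carrier := right_proj Q M (target Q q)\<rparr>;
         T = tensor AL AR;
         ei = qcls Q M (vertex_idem (source Q q));
         ej = qcls Q M (vertex_idem (target Q q))
     in tensor_elem AL AR ei (ej \<otimes>\<^bsub>\<Lambda>\<^esub> qcls Q M (delta_R Q Bn' p q)) \<oplus>\<^bsub>T\<^esub>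
        (- 1) ^ n \<odot>\<^bsub>T\<^esub> tensor_elem AL AR (qcls Q M (delta_L Q Bn' p q) \<otimes>\<^bsub>\<Lambda>\<^esub> ei) ej)"

end

theory Submission
 imports Defs
begin

text \<open>
 Choose compatible bases \<open>B\<^sub>l\<close> of all Koszul spaces. Koszulity says that the complex with terms
 \<open>\<Oplus>\<^sub>q \<Lambda> e\<^bsub>t q\<^esub>\<close>, \<open>q \<in> B\<^sub>l\<close>, and differential \<open>q \<mapsto> \<Sum>\<^sub>p \<delta>\<^sup>R\<^sub>p(q) p\<close> resolves \<open>S\<close>: degree by degree, it is isomorphic to a
 graded resolution with terms generated on the diagonal. It is minimal, so \<open>K\<^sub>n\<^sub>+\<^sub>1 = 0\<close> if the global
 dimension is \<open>n\<close>. Filtering by the degree of the right tensor factor, one obtains that the complex with terms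
 \<open>\<Oplus>\<^sub>q \<Lambda> e\<^bsub>t q\<^esub> \<otimes> e\<^bsub>s q\<^esub> \<Lambda>\<close> and differential \<open>q \<mapsto> \<Sum>\<^sub>p \<delta>\<^sup>R\<^sub>p(q) p \<plusminus> p \<delta>\<^sup>L\<^sub>p(q)\<close> resolves \<open>\<Lambda>\<close>, since the differential of the
 associated graded complex is that of the left Koszul complex. By the comparison theorem,
 \<open>Ext\<^sup>n\<close> is the cokernel of the last differential of its dual; exchanging the tensor factors turns
 the value \<open>(e\<^sub>j \<otimes> e\<^sub>i) \<Lambda>\<^sup>e\<close> of the dual at \<open>q : i \<rightarrow> j\<close> into \<open>\<Lambda> e\<^sub>i \<otimes> e\<^sub>j \<Lambda>\<close>.
\<close>

\<comment> \<open>Koszulity, global dimension and Ext bring in resolutions over unrelated types, so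
  the comparison theorem is stated for retracts of free modules on bases of any type. It serves
  twice: a homotopy from the identity to a map through zero bounds the Koszul complex, and homotopy
  equivalence frees Ext from the chosen resolution. The graded resolution comes without reference to
  the K_l. Generation on the diagonal makes its differentials injective in lowest degree, which pins
  the generators of each term to K_l. The kernel of the resulting surjection is a direct summand
  inside the radical, and vanishes because \<Lambda>, being finite-dimensional, is zero in high
  degrees. The filtration argument is carried out in coordinates: classes of certain paths form a
  basis of \<Lambda>, and an element of the enveloping algebra is a family of slices indexed by
  them. Multiplication by an arrow in the right factor only feeds slices at longer paths. That the
  enveloping algebra is a ring is part of the hypothesis that the given complex resolves a module
  over it.\<close>
syntax "_index" :: "logic => index"  ("\<^sub>_" [1000] 1000)

section \<open>Modules and homomorphisms\<close>

lemma (in abelian_group) finsum_additive_closed: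
 assumes "finite A" "!!i. i \<in> A ==> c i \<in> H" "\<zero> \<in> H" "H \<subseteq> carrier G"
  "!!x y. [|x \<in> H; y \<in> H|] ==> x \<oplus> y \<in> H"
 shows "finsum G c A \<in> H"
 using assms(1,2)
proof (induction A rule: finite_induct)
 case empty then show ?case using assms by simp
next
 case (insert a A)
 then have "c \<in> A \<rightarrow> carrier G" "c a \<in> carrier G" using assms(4) by auto
 then show ?case using insert assms(5) by (simp add: finsum_insert)
qed

lemma (in abelian_group) a_inv_zero: "\<ominus> \<zero> = \<zero>"
 by (rule minus_equality) simp_all

lemma finsum_hom:
 assumes "abelian_group G" "abelian_group H" "finite A" "!!i. i \<in> A ==> c i \<in> carrier G"
  "!!x. x \<in> carrier G ==> h x \<in> carrier H" "h \<zero>\<^sub>G = \<zero>\<^sub>H"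
  "!!x y. [|x \<in> carrier G; y \<in> carrier G|] ==> h (x \<oplus>\<^sub>G y) = h x \<oplus>\<^sub>H h y"
 shows "h (finsum G c A) = finsum H (%i. h (c i)) A"
 using assms(3,4)
proof (induction A rule: finite_induct)
 case empty
 then show ?case using assms by (simp add: abelian_monoid.finsum_empty abelian_group.axioms)
next
 case (insert a A)
 interpret G: abelian_group G by fact
 interpret H: abelian_group H by fact
 have "c \<in> A \<rightarrow> carrier G" "c a \<in> carrier G" using insert by auto
 then show ?case using insert assms(5,7)
  by (simp add: G.finsum_insert H.finsum_insert Pi_def)
qed

lemma additive_zero:
 assumes "abelian_group G" "abelian_group H" "h \<zero>\<^sub>G \<in> carrier H"
  "h (\<zero>\<^sub>G \<oplus>\<^sub>G \<zero>\<^sub>G) = h \<zero>\<^sub>G \<oplus>\<^sub>H h \<zero>\<^sub>G"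
 shows "h \<zero>\<^sub>G = \<zero>\<^sub>H"
proof -
 interpret G: abelian_group G by fact
 interpret H: abelian_group H by fact
 show ?thesis using assms(3,4) by (simp add: H.add.r_cancel_one)
qed

lemma (in left_module) smult_zero_left [simp]: "x \<in> carrier M ==> \<zero>\<^sub>R \<odot>\<^sub>M x = \<zero>\<^sub>M"
proof -
 assume x: "x \<in> carrier M"
 have "\<zero>\<^sub>R \<odot>\<^sub>M x \<oplus>\<^sub>M \<zero>\<^sub>R \<odot>\<^sub>M x = \<zero>\<^sub>R \<odot>\<^sub>M x"
  using smult_l_distr[OF R.zero_closed R.zero_closed x] by simp
 then show ?thesis using smult_closed[OF R.zero_closed x] M.add.r_cancel_one by blast
qed

lemma (in left_module) smult_zero_right [simp]: "a \<in> carrier R ==> a \<odot>\<^sub>M \<zero>\<^sub>M = \<zero>\<^sub>M"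
proof -
 assume x: "a \<in> carrier R"
 have "a \<odot>\<^sub>M \<zero>\<^sub>M \<oplus>\<^sub>M a \<odot>\<^sub>M \<zero>\<^sub>M = a \<odot>\<^sub>M \<zero>\<^sub>M"
  using smult_r_distr[OF x M.zero_closed M.zero_closed] by simp
 then show ?thesis using smult_closed[OF x M.zero_closed] M.add.r_cancel_one by blast
qed

lemma (in left_module) finsum_smult_right:
 assumes "finite A" "a \<in> carrier R" "!!i. i \<in> A ==> c i \<in> carrier M"
 shows "a \<odot>\<^sub>M finsum M c A = finsum M (%i. a \<odot>\<^sub>M c i) A"
 by (rule finsum_hom) (use assms in \<open>auto simp: smult_r_distr smult_closed M.abelian_group_axioms\<close>)

lemma (in left_module) finsum_smult_left:
 assumes "finite A" "x \<in> carrier M" "!!i. i \<in> A ==> c i \<in> carrier R"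
 shows "finsum R c A \<odot>\<^sub>M x = finsum M (%i. c i \<odot>\<^sub>M x) A"
 by (rule finsum_hom[where h="%a. a \<odot>\<^sub>M x"])
  (use assms in \<open>auto simp: smult_l_distr smult_closed M.abelian_group_axioms R.is_abelian_group\<close>)

lemma left_moduleI:
 assumes "ring R" "abelian_group M"
  and "!!a x. [|a \<in> carrier R; x \<in> carrier M|] ==> a \<odot>\<^sub>M x \<in> carrier M"
  and "!!a b x. [|a \<in> carrier R; b \<in> carrier R; x \<in> carrier M|] ==>
   (a \<oplus>\<^sub>R b) \<odot>\<^sub>M x = a \<odot>\<^sub>M x \<oplus>\<^sub>M b \<odot>\<^sub>M x"
  and "!!a x y. [|a \<in> carrier R; x \<in> carrier M; y \<in> carrier M|] ==>
   a \<odot>\<^sub>M (x \<oplus>\<^sub>M y) = a \<odot>\<^sub>M x \<oplus>\<^sub>M a \<odot>\<^sub>M y"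
  and "!!a b x. [|a \<in> carrier R; b \<in> carrier R; x \<in> carrier M|] ==>
   (a \<otimes>\<^sub>R b) \<odot>\<^sub>M x = a \<odot>\<^sub>M (b \<odot>\<^sub>M x)"
  and "!!x. x \<in> carrier M ==> \<one>\<^sub>R \<odot>\<^sub>M x = x"
 shows "left_module R M"
 using assms by (intro left_module.intro left_module_axioms.intro) auto

lemma left_moduleD: "left_module R M ==> ring R" "left_module R M ==> abelian_group M"
 by (simp_all add: left_module_def)

lemma mod_homI:
 assumes "!!x. x \<in> carrier M ==> f x \<in> carrier N"
  "!!x y. [|x \<in> carrier M; y \<in> carrier M|] ==> f (x \<oplus>\<^sub>M y) = f x \<oplus>\<^sub>N f y"
  "!!a x. [|a \<in> carrier R; x \<in> carrier M|] ==> f (a \<odot>\<^sub>M x) = a \<odot>\<^sub>N f x"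
 shows "f \<in> mod_hom R M N"
 using assms by (auto simp: mod_hom_def)

lemma mod_homD:
 assumes "f \<in> mod_hom R M N"
 shows mod_hom_closed: "x \<in> carrier M ==> f x \<in> carrier N"
  and mod_hom_add: "[|x \<in> carrier M; y \<in> carrier M|] ==> f (x \<oplus>\<^sub>M y) = f x \<oplus>\<^sub>N f y"
  and mod_hom_smult: "[|a \<in> carrier R; x \<in> carrier M|] ==> f (a \<odot>\<^sub>M x) = a \<odot>\<^sub>N f x"
 using assms by (auto simp: mod_hom_def)

lemma mod_hom_cong:
 assumes "f \<in> mod_hom R M N" "!!x. x \<in> carrier M ==> g x = f x"
  "left_module R M"
 shows "g \<in> mod_hom R M N"
proof -
 interpret left_module R M by fact
 show ?thesis using assms(1,2) by (auto simp: mod_hom_def smult_closed Pi_def)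
qed

lemma mod_hom_zero:
 assumes "f \<in> mod_hom R M N" "left_module R M" "left_module R N"
 shows "f \<zero>\<^sub>M = \<zero>\<^sub>N"
proof -
 interpret M: left_module R M by fact
 show ?thesis
  by (rule additive_zero[OF left_moduleD(2)[OF assms(2)] left_moduleD(2)[OF assms(3)]])
   (simp_all only: mod_homD[OF assms(1)] M.M.zero_closed)
qed

lemma mod_hom_minus:
 assumes "f \<in> mod_hom R M N" "left_module R M" "left_module R N"
  "x \<in> carrier M" "y \<in> carrier M"
 shows "f (x \<ominus>\<^sub>M y) = f x \<ominus>\<^sub>N f y"
proof -
 interpret M: left_module R M by fact
 interpret N: left_module R N by fact
 note f = mod_homD[OF assms(1)]
 have "f (\<ominus>\<^sub>M y) \<oplus>\<^sub>N f y = f ((\<ominus>\<^sub>M y) \<oplus>\<^sub>M y)"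
  using assms(5) f(2) by (metis M.M.a_inv_closed)
 also have "\<dots> = \<zero>\<^sub>N" using assms(5) by (simp add: M.M.l_neg mod_hom_zero[OF assms(1-3)])
 finally have "f (\<ominus>\<^sub>M y) = \<ominus>\<^sub>N f y"
  using assms(5) f(1) by (simp add: N.M.minus_equality)
 then show ?thesis using assms f by (simp add: a_minus_def)
qed

lemma mod_hom_finsum:
 assumes "f \<in> mod_hom R M N" "left_module R M" "left_module R N" "finite A"
  "!!i. i \<in> A ==> c i \<in> carrier M"
 shows "f (finsum M c A) = finsum N (%i. f (c i)) A"
 by (rule finsum_hom) (use assms in \<open>auto simp: left_moduleD mod_homD[OF assms(1)] mod_hom_zero\<close>)

lemma mod_hom_comp:
 assumes "f \<in> mod_hom R M N" "g \<in> mod_hom R N K"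
 shows "(%x. g (f x)) \<in> mod_hom R M K"
 using assms by (auto simp: mod_hom_def Pi_def)

lemma mod_hom_add_fun:
 assumes "f \<in> mod_hom R M N" "g \<in> mod_hom R M N" "left_module R N"
 shows "(%x. f x \<oplus>\<^sub>N g x) \<in> mod_hom R M N"
proof -
 interpret N: left_module R N by fact
 note f = mod_homD[OF assms(1)] and g = mod_homD[OF assms(2)]
 show ?thesis
  by (rule mod_homI) (simp_all add: f g N.M.a_ac N.smult_r_distr)
qed

lemma mod_hom_minus_fun:
 assumes "f \<in> mod_hom R M N" "g \<in> mod_hom R M N" "left_module R N"
 shows "(%x. f x \<ominus>\<^sub>N g x) \<in> mod_hom R M N"
proof -
 interpret N: left_module R N by fact
 note f = mod_homD[OF assms(1)] and g = mod_homD[OF assms(2)]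
 have neg: "\<ominus>\<^sub>N (a \<odot>\<^sub>N x) = a \<odot>\<^sub>N (\<ominus>\<^sub>N x)" if "a \<in> carrier R" "x \<in> carrier N" for a x
 proof -
  have "a \<odot>\<^sub>N (\<ominus>\<^sub>N x) \<oplus>\<^sub>N a \<odot>\<^sub>N x = \<zero>\<^sub>N"
   using that by (simp flip: N.smult_r_distr add: N.M.l_neg)
  then show ?thesis using that N.smult_closed by (simp add: N.M.minus_equality)
 qed
 show ?thesis
  by (rule mod_homI)
   (simp_all add: f g N.M.a_ac N.smult_r_distr a_minus_def N.M.minus_add neg N.smult_closed)
qed

lemma mod_hom_id: "(%x. x) \<in> mod_hom R M M"
 by (auto simp: mod_hom_def)

lemma mod_hom_zero_fun:
 assumes "left_module R N" shows "(%x. \<zero>\<^sub>N) \<in> mod_hom R M N"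
proof -
 interpret N: left_module R N by fact
 show ?thesis by (rule mod_homI) auto
qed

section \<open>Free modules and their retracts\<close>

lemma left_module_free_mod:
 assumes "ring R" shows "left_module R (free_mod R X)"
proof -
 interpret ring R by fact
 have supp: "finite {x. f x \<oplus>\<^sub>R g x \<noteq> \<zero>\<^sub>R}"
  if "finite {x. f x \<noteq> \<zero>\<^sub>R}" "finite {x. g x \<noteq> \<zero>\<^sub>R}" for f g :: "'x => 'a"
  by (rule finite_subset[OF _ finite_UnI[OF that]]) auto
 have supp2: "finite {x. a \<otimes>\<^sub>R f x \<noteq> \<zero>\<^sub>R}"
  if "finite {x. f x \<noteq> \<zero>\<^sub>R}" "a \<in> carrier R" for f :: "'x => 'a" and a
  by (rule finite_subset[OF _ that(1)]) (use that(2) in auto)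
 have carr: "f x \<in> carrier R" if "f \<in> carrier (free_mod R X)" for f x
  using that by (cases "x \<in> X") (auto simp: free_mod_def)
 have ab: "abelian_group (free_mod R X)"
 proof (rule abelian_groupI, goal_cases)
  case (1 x y) then show ?case by (auto simp: free_mod_def supp)
 next
  case 2 then show ?case by (auto simp: free_mod_def)
 next
  case (3 x y z)
  have "x i \<oplus>\<^sub>R y i \<oplus>\<^sub>R z i = x i \<oplus>\<^sub>R (y i \<oplus>\<^sub>R z i)" for i
   using carr[OF 3(1)] carr[OF 3(2)] carr[OF 3(3)] by (rule a_assoc)
  then show ?case by (simp add: free_mod_def)
 next
  case (4 x y)
  have "x i \<oplus>\<^sub>R y i = y i \<oplus>\<^sub>R x i" for i using carr[OF 4(1)] carr[OF 4(2)] by (rule a_comm)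
  then show ?case by (simp add: free_mod_def)
 next
  case (5 x)
  have "\<zero>\<^sub>R \<oplus>\<^sub>R x i = x i" for i using carr[OF 5] by simp
  then show ?case by (simp add: free_mod_def)
 next
  case (6 x)
  have "(%i. \<ominus>\<^sub>R x i) \<in> carrier (free_mod R X)"
  proof -
   have "{i. \<ominus>\<^sub>R x i \<noteq> \<zero>\<^sub>R} \<subseteq> {i. x i \<noteq> \<zero>\<^sub>R}" by auto
   then show ?thesis using 6 by (auto simp: free_mod_def intro: finite_subset)
  qed
  moreover have "(%i. \<ominus>\<^sub>R x i) \<oplus>\<^bsub>free_mod R X\<^esub> x = \<zero>\<^bsub>free_mod R X\<^esub>"
   using carr[OF 6] by (auto simp: free_mod_def l_neg)
  ultimately show ?case by blast
 qed
 show ?thesis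
 proof (rule left_moduleI[OF assms ab], goal_cases)
  case (1 a x) then show ?case by (auto simp: free_mod_def supp2)
 next
  case (2 a b x)
  have "(a \<oplus>\<^sub>R b) \<otimes>\<^sub>R x i = a \<otimes>\<^sub>R x i \<oplus>\<^sub>R b \<otimes>\<^sub>R x i" for i
   by (rule l_distr[OF 2(1,2) carr[OF 2(3)]])
  then show ?case by (simp add: free_mod_def)
 next
  case (3 a x y)
  have "a \<otimes>\<^sub>R (x i \<oplus>\<^sub>R y i) = a \<otimes>\<^sub>R x i \<oplus>\<^sub>R a \<otimes>\<^sub>R y i" for i
   by (rule r_distr[OF carr[OF 3(2)] carr[OF 3(3)] 3(1)])
  then show ?case by (simp add: free_mod_def)
 next
  case (4 a b x)
  have "(a \<otimes>\<^sub>R b) \<otimes>\<^sub>R x i = a \<otimes>\<^sub>R (b \<otimes>\<^sub>R x i)" for i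
   by (rule m_assoc[OF 4(1,2) carr[OF 4(3)]])
  then show ?case by (simp add: free_mod_def)
 next
  case (5 x)
  have "\<one>\<^sub>R \<otimes>\<^sub>R x i = x i" for i by (rule l_one[OF carr[OF 5]])
  then show ?case by (simp add: free_mod_def)
 qed
qed

definition lin_comb :: "('r, 's) ring_scheme => ('r, 'm, 't) module_scheme => ('x => 'm) => ('x => 'r) => 'm"
 where "lin_comb R M y f = finsum M (%x. f x \<odot>\<^sub>M y x) {x. f x \<noteq> \<zero>\<^sub>R}"

lemma lin_comb_superset:
 assumes "left_module R M" "finite A" "A \<subseteq> X" "{x. f x \<noteq> \<zero>\<^sub>R} \<subseteq> A"
  "f \<in> carrier (free_mod R X)" "!!x. x \<in> X ==> y x \<in> carrier M"
 shows "lin_comb R M y f = finsum M (%x. f x \<odot>\<^sub>M y x) A"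
proof -
 interpret left_module R M by fact
 show ?thesis unfolding lin_comb_def
  by (rule M.add.finprod_mono_neutral_cong_left)
   (use assms in \<open>auto simp: free_mod_def smult_closed subset_iff\<close>)
qed

lemma lin_comb_mod_hom:
 assumes "left_module R M" "!!x. x \<in> X ==> y x \<in> carrier M"
 shows "lin_comb R M y \<in> mod_hom R (free_mod R X) M"
proof -
 interpret left_module R M by fact
 have car: "f x \<odot>\<^sub>M y x \<in> carrier M" if "f \<in> carrier (free_mod R X)" "x \<in> X" for f x
  using that assms(2) by (auto simp: free_mod_def smult_closed)
 have supp: "{x. f x \<noteq> \<zero>\<^sub>R} \<subseteq> X" "finite {x. f x \<noteq> \<zero>\<^sub>R}"
  if "f \<in> carrier (free_mod R X)" for f
  using that by (auto simp: free_mod_def)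
 show ?thesis
 proof (rule mod_homI, goal_cases)
  case (1 f) then show ?case unfolding lin_comb_def
   using supp[OF 1] car[OF 1] by (auto intro!: M.finsum_closed)
 next
  case (2 f g)
  let ?A = "{x. f x \<noteq> \<zero>\<^sub>R} \<union> {x. g x \<noteq> \<zero>\<^sub>R}"
  have A: "finite ?A" "?A \<subseteq> X" using supp 2 by blast+
  interpret F: left_module R "free_mod R X" by (rule left_module_free_mod) unfold_locales
  have fg: "f \<oplus>\<^bsub>free_mod R X\<^esub> g \<in> carrier (free_mod R X)" using 2 by simp
  have eq: "(f \<oplus>\<^bsub>free_mod R X\<^esub> g) x \<odot>\<^sub>M y x = f x \<odot>\<^sub>M y x \<oplus>\<^sub>M g x \<odot>\<^sub>M y x" if "x \<in> X" for x
   using that 2 assms(2) by (simp add: free_mod_def smult_l_distr)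
  have "lin_comb R M y (f \<oplus>\<^bsub>free_mod R X\<^esub> g) = finsum M (%x. (f \<oplus>\<^bsub>free_mod R X\<^esub> g) x \<odot>\<^sub>M y x) ?A"
   by (rule lin_comb_superset[OF assms(1) A _ fg assms(2)]) (auto simp: free_mod_def)
  also have "\<dots> = finsum M (%x. f x \<odot>\<^sub>M y x \<oplus>\<^sub>M g x \<odot>\<^sub>M y x) ?A"
   by (rule M.finsum_cong') (use A 2 car in \<open>auto simp: eq subset_iff\<close>)
  also have "\<dots> = finsum M (%x. f x \<odot>\<^sub>M y x) ?A \<oplus>\<^sub>M finsum M (%x. g x \<odot>\<^sub>M y x) ?A"
   by (rule M.finsum_addf) (use A 2 car in \<open>auto simp: Pi_def subset_iff\<close>)
  also have "finsum M (%x. f x \<odot>\<^sub>M y x) ?A = lin_comb R M y f"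
   by (rule lin_comb_superset[OF assms(1) A _ 2(1) assms(2), symmetric]) auto
  also have "finsum M (%x. g x \<odot>\<^sub>M y x) ?A = lin_comb R M y g"
   by (rule lin_comb_superset[OF assms(1) A _ 2(2) assms(2), symmetric]) auto
  finally show ?case .
 next
  case (3 a f)
  let ?A = "{x. f x \<noteq> \<zero>\<^sub>R}"
  interpret F: left_module R "free_mod R X" by (rule left_module_free_mod) unfold_locales
  have af: "a \<odot>\<^bsub>free_mod R X\<^esub> f \<in> carrier (free_mod R X)" using 3 by (simp add: F.smult_closed)
  have "lin_comb R M y (a \<odot>\<^bsub>free_mod R X\<^esub> f) = finsum M (%x. (a \<odot>\<^bsub>free_mod R X\<^esub> f) x \<odot>\<^sub>M y x) ?A"
   by (rule lin_comb_superset[OF assms(1) supp(2,1)[OF 3(2)] _ af assms(2)])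
    (use 3 in \<open>auto simp: free_mod_def\<close>)
  also have "\<dots> = finsum M (%x. a \<odot>\<^sub>M (f x \<odot>\<^sub>M y x)) ?A"
  proof (rule M.finsum_cong')
   fix x assume "x \<in> ?A"
   then have x: "x \<in> X" using supp 3 by blast
   then have "f x \<in> carrier R" using 3 by (simp add: free_mod_def)
   then show "(a \<odot>\<^bsub>free_mod R X\<^esub> f) x \<odot>\<^sub>M y x = a \<odot>\<^sub>M (f x \<odot>\<^sub>M y x)"
    using 3 x assms(2)[OF x] by (simp add: free_mod_def smult_assoc)
  qed (use supp[OF 3(2)] car[OF 3(2)] 3(1) in \<open>auto intro!: smult_closed[OF 3(1)]\<close>)
  also have "\<dots> = a \<odot>\<^sub>M lin_comb R M y f" unfolding lin_comb_def
   by (rule finsum_smult_right[symmetric]) (use supp[OF 3(2)] 3 car in auto)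
  finally show ?case .
 qed
qed

text \<open>The basis may have any type here, while \<open>projective\<close> takes it in the type
  of the module. The Koszul terms are retracts of free modules on basis elements of a Koszul space,
  and they have to be compared with resolutions of other types.\<close>

definition retract_of_free :: "('r, 's) ring_scheme => 'x set => ('r, 'm, 't) module_scheme => bool"
 where "retract_of_free R X P \<longleftrightarrow> left_module R P \<and>
   (\<exists>i r. i \<in> mod_hom R P (free_mod R X) \<and> r \<in> mod_hom R (free_mod R X) P \<and>
    (\<forall>x\<in>carrier P. r (i x) = x))"

lemma projective_iff: "projective R P \<longleftrightarrow> (\<exists>X. retract_of_free R (X :: 'm set) P)"
 for P :: "('r, 'm, 't) module_scheme"
 by (auto simp: projective_def retract_of_free_def)

text \<open>Instead of surjectivity of \<open>g\<close>, the image of \<open>f\<close> is asked to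
  lie in that of \<open>g\<close>: this is what exactness at one place of a resolution provides. The
  lift is defined on the free module by choosing preimages for the unit vectors, and is then
  restricted along \<open>i\<close>.\<close>

lemma lifting:
 assumes P: "retract_of_free R X P" and M: "left_module R M" and N: "left_module R N"
  and g: "g \<in> mod_hom R M N" and f: "f \<in> mod_hom R P N"
  and sub: "!!x. x \<in> carrier P ==> f x \<in> g ` carrier M"
 shows "\<exists>h \<in> mod_hom R P M. \<forall>x\<in>carrier P. g (h x) = f x"
proof -
 interpret P: left_module R P using P by (simp add: retract_of_free_def)
 interpret M: left_module R M by fact
 interpret N: left_module R N by fact
 interpret F: left_module R "free_mod R X" by (rule left_module_free_mod) unfold_locales
 obtain i r where i: "i \<in> mod_hom R P (free_mod R X)" and r: "r \<in> mod_hom R (free_mod R X) P"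
  and ri: "!!x. x\<in>carrier P ==> r (i x) = x" using P unfolding retract_of_free_def by blast
 define u where "u x = (%z. if z = x then \<one>\<^sub>R else \<zero>\<^sub>R)" for x :: 'c
 have u: "u x \<in> carrier (free_mod R X)" if "x \<in> X" for x
  using that by (auto simp: free_mod_def u_def)
 have "\<forall>x\<in>X. \<exists>m\<in>carrier M. g m = f (r (u x))"
  using sub mod_hom_closed[OF r u] by (metis imageE)
 then obtain y where y: "!!x. x \<in> X ==> y x \<in> carrier M" "!!x. x \<in> X ==> g (y x) = f (r (u x))"
  by metis
 have lc: "lin_comb R M y \<in> mod_hom R (free_mod R X) M" by (rule lin_comb_mod_hom[OF M y(1)])
 have key: "g (lin_comb R M y v) = f (r v)" if v: "v \<in> carrier (free_mod R X)" for v
 proof -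
  let ?A = "{x. v x \<noteq> \<zero>\<^sub>R}"
  have A: "finite ?A" "?A \<subseteq> X" using v by (auto simp: free_mod_def)
  have vx: "v x \<in> carrier R" if "x \<in> X" for x using v that by (auto simp: free_mod_def)
  have "v = lin_comb R (free_mod R X) u v"
  proof
   fix z
   have "lin_comb R (free_mod R X) u v z = finsum R (%x. (v x \<odot>\<^bsub>free_mod R X\<^esub> u x) z) ?A"
    unfolding lin_comb_def
    by (rule finsum_hom[where h="%f. f z" and G="free_mod R X" and H=R])
     (use A u vx in \<open>auto simp: F.M.abelian_group_axioms P.R.is_abelian_group F.smult_closed subset_iff\<close>,
     auto simp: free_mod_def, (metis P.R.zero_closed)?)
   also have "\<dots> = finsum R (%x. if x = z then v x else \<zero>\<^sub>R) ?A"
    by (rule P.R.finsum_cong') (use A vx in \<open>auto simp: free_mod_def u_def subset_iff\<close>)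
   also have "\<dots> = v z"
   proof (cases "z \<in> ?A")
    case True
    then show ?thesis using P.R.add.finprod_singleton_swap[of z ?A v] A vx by auto
   next
    case False
    then have "finsum R (%x. if x = z then v x else \<zero>\<^sub>R) ?A = \<zero>\<^sub>R"
     by (intro P.R.add.finprod_one_eqI) auto
    then show ?thesis using False by simp
   qed
   finally show "v z = lin_comb R (free_mod R X) u v z" by simp
  qed
  then have fr: "f (r v) = f (r (finsum (free_mod R X) (%x. v x \<odot>\<^bsub>free_mod R X\<^esub> u x) ?A))"
   by (simp add: lin_comb_def)
  also have "\<dots> = finsum N (%x. f (r (v x \<odot>\<^bsub>free_mod R X\<^esub> u x))) ?A"
   by (rule mod_hom_finsum[OF mod_hom_comp[OF r f]])
    (use A u vx in \<open>auto simp: F.left_module_axioms N F.smult_closed subset_iff\<close>)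
  also have "\<dots> = finsum N (%x. g (v x \<odot>\<^sub>M y x)) ?A"
   by (rule N.M.finsum_cong')
    (use A u vx y in \<open>auto simp: mod_homD[OF r] mod_homD[OF f] mod_homD[OF g] M.smult_closed N.smult_closed subset_iff\<close>)
  also have "\<dots> = g (lin_comb R M y v)" unfolding lin_comb_def
   by (rule mod_hom_finsum[OF g M N, symmetric])
    (use A u vx y in \<open>auto simp: M.smult_closed subset_iff\<close>)
  finally show ?thesis by simp
 qed
 show ?thesis
 proof (rule bexI)
  show "(%x. lin_comb R M y (i x)) \<in> mod_hom R P M" by (rule mod_hom_comp[OF i lc])
  show "\<forall>x\<in>carrier P. g (lin_comb R M y (i x)) = f x"
   using key mod_hom_closed[OF i] ri by simp
 qed
qed

section \<open>Resolutions and the comparison theorem\<close>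

text \<open>Differs from \<open>projective_resolution\<close> only in the free type of the bases
  \<open>A l\<close>, so that resolutions living in unrelated types satisfy the same
  predicate.\<close>

definition resolution ::
 "('r, 's) ring_scheme => ('r, 'm, 't) module_scheme => (nat => 'x set) =>
  (nat => ('r, 'p) module) => (nat => 'p => 'p) => ('p => 'm) => bool"
where
 "resolution R X A P d \<epsilon> \<longleftrightarrow>
   left_module R X \<and> (\<forall>l. retract_of_free R (A l) (P l)) \<and>
   \<epsilon> \<in> mod_hom R (P 0) X \<and> (\<forall>l. d l \<in> mod_hom R (P (Suc l)) (P l)) \<and>
   \<epsilon> ` carrier (P 0) = carrier X \<and>
   {x \<in> carrier (P 0). \<epsilon> x = \<zero>\<^sub>X} = d 0 ` carrier (P 1) \<and>
   (\<forall>l. {x \<in> carrier (P (Suc l)). d l x = \<zero>\<^bsub>P l\<^esub>} = d (Suc l) ` carrier (P (Suc (Suc l))))"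

lemma projective_resolution_imp_resolution:
 fixes P :: "nat => ('r, 'p) module"
 assumes "projective_resolution R X P d \<epsilon>"
 shows "\<exists>A :: nat => 'p set. resolution R X A P d \<epsilon>"
proof -
 have "\<forall>l. \<exists>X :: 'p set. retract_of_free R X (P l)"
  using assms by (simp add: projective_resolution_def projective_iff)
 then obtain A :: "nat => 'p set" where "!!l. retract_of_free R (A l) (P l)" by metis
 then have "resolution R X A P d \<epsilon>"
  using assms by (simp add: projective_resolution_def resolution_def)
 then show ?thesis by blast
qed

lemma resolutionD:
 assumes "resolution R X A P d \<epsilon>"
 shows "left_module R X" "left_module R (P l)" "retract_of_free R (A l) (P l)"
  "\<epsilon> \<in> mod_hom R (P 0) X" "d l \<in> mod_hom R (P (Suc l)) (P l)"
  "\<epsilon> ` carrier (P 0) = carrier X"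
  "x \<in> carrier (P 0) ==> \<epsilon> x = \<zero>\<^sub>X ==> x \<in> d 0 ` carrier (P (Suc 0))"
  "z \<in> carrier (P (Suc 0)) ==> \<epsilon> (d 0 z) = \<zero>\<^sub>X"
  "y \<in> carrier (P (Suc l)) ==> d l y = \<zero>\<^bsub>P l\<^esub> ==> y \<in> d (Suc l) ` carrier (P (Suc (Suc l)))"
  "w \<in> carrier (P (Suc (Suc l))) ==> d l (d (Suc l) w) = \<zero>\<^bsub>P l\<^esub>"
proof -
 note a = assms[unfolded resolution_def]
 note a2 = a[THEN conjunct2] note a3 = a2[THEN conjunct2] note a4 = a3[THEN conjunct2]
 note a5 = a4[THEN conjunct2] note a6 = a5[THEN conjunct2] note a7 = a6[THEN conjunct2]
 have r: "retract_of_free R (A l) (P l)" for l by (rule a2[THEN conjunct1, rule_format])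
 show "left_module R X" by (rule a[THEN conjunct1])
 show "retract_of_free R (A l) (P l)" by (rule r)
 show "\<epsilon> \<in> mod_hom R (P 0) X" by (rule a3[THEN conjunct1])
 show "d l \<in> mod_hom R (P (Suc l)) (P l)" by (rule a4[THEN conjunct1, rule_format])
 show "\<epsilon> ` carrier (P 0) = carrier X" by (rule a5[THEN conjunct1])
 show "left_module R (P l)" using r[of l] by (simp add: retract_of_free_def)
 have e0: "{x \<in> carrier (P 0). \<epsilon> x = \<zero>\<^sub>X} = d 0 ` carrier (P (Suc 0))"
  and el: "!!l. {x \<in> carrier (P (Suc l)). d l x = \<zero>\<^bsub>P l\<^esub>} = d (Suc l) ` carrier (P (Suc (Suc l)))"
  using a6[THEN conjunct1] a7 by simp_all
 show "x \<in> carrier (P 0) ==> \<epsilon> x = \<zero>\<^sub>X ==> x \<in> d 0 ` carrier (P (Suc 0))"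
  "z \<in> carrier (P (Suc 0)) ==> \<epsilon> (d 0 z) = \<zero>\<^sub>X" using e0 by blast+
 show "y \<in> carrier (P (Suc l)) ==> d l y = \<zero>\<^bsub>P l\<^esub> ==> y \<in> d (Suc l) ` carrier (P (Suc (Suc l)))"
  "w \<in> carrier (P (Suc (Suc l))) ==> d l (d (Suc l) w) = \<zero>\<^bsub>P l\<^esub>" using el[of l] by blast+
qed

definition chain_map ::
 "('r, 's) ring_scheme => (nat => ('r, 'p) module) => (nat => 'p => 'p) => ('p => 'm) =>
  (nat => ('r, 'q) module) => (nat => 'q => 'q) => ('q => 'm) => (nat => 'p => 'q) => bool"
where
 "chain_map R P d \<epsilon> P' d' \<epsilon>' \<phi> \<longleftrightarrow> (\<forall>l. \<phi> l \<in> mod_hom R (P l) (P' l)) \<and>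
   (\<forall>x\<in>carrier (P 0). \<epsilon>' (\<phi> 0 x) = \<epsilon> x) \<and>
   (\<forall>l. \<forall>x\<in>carrier (P (Suc l)). d' l (\<phi> (Suc l) x) = \<phi> l (d l x))"

lemma chain_mapD:
 assumes "chain_map R P d \<epsilon> P' d' \<epsilon>' \<phi>"
 shows "\<phi> l \<in> mod_hom R (P l) (P' l)"
  "x \<in> carrier (P 0) ==> \<epsilon>' (\<phi> 0 x) = \<epsilon> x"
  "y \<in> carrier (P (Suc l)) ==> d' l (\<phi> (Suc l) y) = \<phi> l (d l y)"
proof -
 note a = assms[unfolded chain_map_def]
 show "\<phi> l \<in> mod_hom R (P l) (P' l)" by (rule a[THEN conjunct1, rule_format])
 show "x \<in> carrier (P 0) ==> \<epsilon>' (\<phi> 0 x) = \<epsilon> x"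
  by (rule a[THEN conjunct2, THEN conjunct1, rule_format])
 show "y \<in> carrier (P (Suc l)) ==> d' l (\<phi> (Suc l) y) = \<phi> l (d l y)"
  by (rule a[THEN conjunct2, THEN conjunct2, rule_format])
qed

lemma chain_map_exists:
 assumes A: "resolution R X A P d \<epsilon>" and B: "resolution R X B P' d' \<epsilon>'"
 shows "\<exists>\<phi>. chain_map R P d \<epsilon> P' d' \<epsilon>' \<phi>"
proof -
 note a = resolutionD[OF A] and b = resolutionD[OF B]
 \<comment> \<open>The second clause is what the lift in degree \<open>Suc n\<close> requires:
   boundaries go into boundaries. In degree 0 it follows from compatibility with the augmentations,
   later from exactness.\<close>
 define S where "S n \<phi> \<longleftrightarrow> \<phi> \<in> mod_hom R (P n) (P' n) \<and>
  (\<forall>z\<in>carrier (P (Suc n)). \<phi> (d n z) \<in> d' n ` carrier (P' (Suc n))) \<and>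
  (n = 0 --> (\<forall>x\<in>carrier (P 0). \<epsilon>' (\<phi> x) = \<epsilon> x))" for n \<phi>
 have "\<exists>f. \<forall>n. S n (f n) \<and> (\<forall>x\<in>carrier (P (Suc n)). d' n (f (Suc n) x) = f n (d n x))"
 proof (rule dependent_nat_choice)
  obtain h where h: "h \<in> mod_hom R (P 0) (P' 0)" "!!x. x\<in>carrier (P 0) ==> \<epsilon>' (h x) = \<epsilon> x"
   using lifting[OF a(3) b(2) a(1) b(4) a(4)] b(6) mod_hom_closed[OF a(4)] by blast
  have "h (d 0 z) \<in> d' 0 ` carrier (P' (Suc 0))" if "z \<in> carrier (P (Suc 0))" for z
   using mod_hom_closed[OF a(5) that] a(8)[OF that] h b(7) by (simp add: mod_hom_closed)
  then show "\<exists>x. S 0 x" using h by (auto simp: S_def)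
 next
  fix f n assume f: "S n f"
  then have "(%x. f (d n x)) \<in> mod_hom R (P (Suc n)) (P' n)"
   using mod_hom_comp[OF a(5)] by (auto simp: S_def)
  then obtain h where h: "h \<in> mod_hom R (P (Suc n)) (P' (Suc n))"
   "!!x. x\<in>carrier (P (Suc n)) ==> d' n (h x) = f (d n x)"
   using lifting[OF a(3) b(2) b(2) b(5)] f unfolding S_def by blast
  have "h (d (Suc n) z) \<in> d' (Suc n) ` carrier (P' (Suc (Suc n)))" if z: "z \<in> carrier (P (Suc (Suc n)))" for z
  proof (rule b(9))
   show "h (d (Suc n) z) \<in> carrier (P' (Suc n))"
    using h(1) a(5) z by (meson mod_hom_closed)
   have "d' n (h (d (Suc n) z)) = f (d n (d (Suc n) z))" by (rule h(2)[OF mod_hom_closed[OF a(5) z]])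
   also have "\<dots> = f \<zero>\<^bsub>P n\<^esub>" by (simp only: a(10)[OF z])
   also have "\<dots> = \<zero>\<^bsub>P' n\<^esub>" by (rule mod_hom_zero[OF _ a(2) b(2)]) (use f in \<open>simp add: S_def\<close>)
   finally show "d' n (h (d (Suc n) z)) = \<zero>\<^bsub>P' n\<^esub>" .
  qed
  then show "\<exists>y. S (Suc n) y \<and> (\<forall>x\<in>carrier (P (Suc n)). d' n (y x) = f (d n x))"
   using h by (auto simp: S_def)
 qed
 then obtain f where f: "\<forall>n. S n (f n) \<and> (\<forall>x\<in>carrier (P (Suc n)). d' n (f (Suc n) x) = f n (d n x))" ..
 then have "chain_map R P d \<epsilon> P' d' \<epsilon>' f"
  by (simp add: S_def chain_map_def)
 then show ?thesis by (intro exI[of _ f])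
qed

text \<open>The homotopy identity is stated in degrees \<open>Suc l\<close>, where it always has
  both terms. Positive degrees are those in which it is applied, the global dimension being at least
  1.\<close>

lemma chain_homotopy_exists:
 assumes A: "resolution R X A P d \<epsilon>" and B: "resolution R X B P' d' \<epsilon>'"
  and \<phi>: "chain_map R P d \<epsilon> P' d' \<epsilon>' \<phi>" and \<psi>: "chain_map R P d \<epsilon> P' d' \<epsilon>' \<psi>"
 shows "\<exists>s. (\<forall>l. s l \<in> mod_hom R (P l) (P' (Suc l))) \<and>
  (\<forall>l. \<forall>x\<in>carrier (P (Suc l)). \<phi> (Suc l) x \<ominus>\<^bsub>P' (Suc l)\<^esub> \<psi> (Suc l) x =
    d' (Suc l) (s (Suc l) x) \<oplus>\<^bsub>P' (Suc l)\<^esub> s l (d l x))"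
proof -
 note a = resolutionD[OF A] and b = resolutionD[OF B]
 define \<theta> where "\<theta> l x = \<phi> l x \<ominus>\<^bsub>P' l\<^esub> \<psi> l x" for l x
 have ph: "\<phi> l \<in> mod_hom R (P l) (P' l)" and ps: "\<psi> l \<in> mod_hom R (P l) (P' l)" for l
  by (rule chain_mapD(1)[OF \<phi>] chain_mapD(1)[OF \<psi>])+
 have th: "\<theta> l \<in> mod_hom R (P l) (P' l)" for l
  unfolding \<theta>_def by (rule mod_hom_minus_fun[OF ph ps b(2)])
 have th0: "\<epsilon>' (\<theta> 0 x) = \<zero>\<^sub>X" if "x \<in> carrier (P 0)" for x
 proof -
  interpret X: left_module R X by (rule a(1))
  show ?thesis unfolding \<theta>_def
   using that mod_hom_closed[OF ph that] mod_hom_closed[OF ps that] mod_hom_closed[OF a(4) that]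
    chain_mapD(2)[OF \<phi> that] chain_mapD(2)[OF \<psi> that]
   by (simp add: mod_hom_minus[OF b(4) b(2) a(1)]) (simp add: a_minus_def X.M.r_neg)
 qed
 have thd: "d' l (\<theta> (Suc l) x) = \<theta> l (d l x)" if "x \<in> carrier (P (Suc l))" for l x
  unfolding \<theta>_def
  using that mod_hom_closed[OF ph that] mod_hom_closed[OF ps that]
   chain_mapD(3)[OF \<phi> that] chain_mapD(3)[OF \<psi> that]
  by (simp add: mod_hom_minus[OF b(5) b(2) b(2)])
 \<comment> \<open>The part of \<theta> that the homotopy has not yet accounted for is a cycle, so
   exactness provides the next \<open>s\<close>.\<close>
 define S where "S n s \<longleftrightarrow> s \<in> mod_hom R (P n) (P' (Suc n)) \<and>
  (\<forall>z\<in>carrier (P (Suc n)). d' n (\<theta> (Suc n) z \<ominus>\<^bsub>P' (Suc n)\<^esub> s (d n z)) = \<zero>\<^bsub>P' n\<^esub>)" for n s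
 have "\<exists>f. \<forall>n. S n (f n) \<and> (\<forall>x\<in>carrier (P (Suc n)).
   \<theta> (Suc n) x = d' (Suc n) (f (Suc n) x) \<oplus>\<^bsub>P' (Suc n)\<^esub> f n (d n x))"
 proof (rule dependent_nat_choice)
  interpret P0: left_module R "P' 0" by (rule b(2))
  have "\<theta> 0 x \<in> d' 0 ` carrier (P' (Suc 0))" if "x \<in> carrier (P 0)" for x
   using b(7) th0[OF that] mod_hom_closed[OF th that] by simp
  then obtain h where h: "h \<in> mod_hom R (P 0) (P' (Suc 0))" "!!x. x\<in>carrier (P 0) ==> d' 0 (h x) = \<theta> 0 x"
   using lifting[OF a(3) b(2) b(2) b(5) th] by blast
  have "d' 0 (\<theta> (Suc 0) z \<ominus>\<^bsub>P' (Suc 0)\<^esub> h (d 0 z)) = \<zero>\<^bsub>P' 0\<^esub>" if z: "z \<in> carrier (P (Suc 0))" for z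
  proof -
   have c: "d 0 z \<in> carrier (P 0)" by (rule mod_hom_closed[OF a(5) z])
   then show ?thesis
    using thd[OF z] h mod_hom_closed[OF th c] mod_hom_closed[OF th z] mod_hom_closed[OF h(1) c]
    by (simp add: mod_hom_minus[OF b(5) b(2) b(2)]) (simp add: P0.M.r_neg a_minus_def)
  qed
  then show "\<exists>x. S 0 x" using h by (auto simp: S_def)
 next
  fix s n assume s: "S n s"
  interpret P1: left_module R "P' (Suc n)" by (rule b(2))
  have sd: "(%x. s (d n x)) \<in> mod_hom R (P (Suc n)) (P' (Suc n))"
   using s mod_hom_comp[OF a(5)] by (auto simp: S_def)
  have g: "(%x. \<theta> (Suc n) x \<ominus>\<^bsub>P' (Suc n)\<^esub> s (d n x)) \<in> mod_hom R (P (Suc n)) (P' (Suc n))"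
   by (rule mod_hom_minus_fun[OF th sd b(2)])
  then have "\<theta> (Suc n) x \<ominus>\<^bsub>P' (Suc n)\<^esub> s (d n x) \<in> d' (Suc n) ` carrier (P' (Suc (Suc n)))"
   if "x \<in> carrier (P (Suc n))" for x
   using b(9) s that mod_hom_closed[OF g that] by (simp add: S_def)
  then obtain h where h: "h \<in> mod_hom R (P (Suc n)) (P' (Suc (Suc n)))"
   "!!x. x\<in>carrier (P (Suc n)) ==> d' (Suc n) (h x) = \<theta> (Suc n) x \<ominus>\<^bsub>P' (Suc n)\<^esub> s (d n x)"
   using lifting[OF a(3) b(2) b(2) b(5) g] by blast
  have eq: "\<theta> (Suc n) x = d' (Suc n) (h x) \<oplus>\<^bsub>P' (Suc n)\<^esub> s (d n x)" if x: "x \<in> carrier (P (Suc n))" for x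
   using mod_hom_closed[OF th x] mod_hom_closed[OF sd x] h(2)[OF x]
   by (simp add: a_minus_def P1.M.a_assoc P1.M.l_neg)
  have "d' (Suc n) (\<theta> (Suc (Suc n)) z \<ominus>\<^bsub>P' (Suc (Suc n))\<^esub> h (d (Suc n) z)) = \<zero>\<^bsub>P' (Suc n)\<^esub>"
   if z: "z \<in> carrier (P (Suc (Suc n)))" for z
  proof -
   have c: "d (Suc n) z \<in> carrier (P (Suc n))" by (rule mod_hom_closed[OF a(5) z])
   have s0: "s (d n (d (Suc n) z)) = \<zero>\<^bsub>P' (Suc n)\<^esub>"
    unfolding a(10)[OF z] by (rule mod_hom_zero[OF _ a(2) b(2)]) (use s in \<open>simp add: S_def\<close>)
   show ?thesis
    using thd[OF z] h(2)[OF c] mod_hom_closed[OF th c] mod_hom_closed[OF th z] mod_hom_closed[OF h(1) c]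
    by (simp add: mod_hom_minus[OF b(5) b(2) b(2)] s0) (simp add: P1.M.r_neg a_minus_def P1.M.a_inv_zero)
  qed
  then show "\<exists>y. S (Suc n) y \<and> (\<forall>x\<in>carrier (P (Suc n)).
    \<theta> (Suc n) x = d' (Suc n) (y x) \<oplus>\<^bsub>P' (Suc n)\<^esub> s (d n x))"
   using h eq by (auto simp: S_def)
 qed
 then obtain f where f: "\<forall>n. S n (f n) \<and> (\<forall>x\<in>carrier (P (Suc n)).
   \<theta> (Suc n) x = d' (Suc n) (f (Suc n) x) \<oplus>\<^bsub>P' (Suc n)\<^esub> f n (d n x))" ..
 then show ?thesis by (intro exI[of _ f]) (simp add: S_def \<theta>_def)
qed

lemma chain_map_id: "chain_map R P d \<epsilon> P d \<epsilon> (%l x. x)"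
 by (simp add: chain_map_def mod_hom_id)

lemma chain_map_comp:
 assumes "chain_map R P d \<epsilon> P' d' \<epsilon>' \<phi>" "chain_map R P' d' \<epsilon>' P'' d'' \<epsilon>'' \<psi>"
 shows "chain_map R P d \<epsilon> P'' d'' \<epsilon>'' (%l x. \<psi> l (\<phi> l x))"
 unfolding chain_map_def
proof (intro conjI allI ballI)
 note f = chain_mapD[OF assms(1)] and g = chain_mapD[OF assms(2)]
 show "(%x. \<psi> l (\<phi> l x)) \<in> mod_hom R (P l) (P'' l)" for l by (rule mod_hom_comp[OF f(1) g(1)])
 show "\<epsilon>'' (\<psi> 0 (\<phi> 0 x)) = \<epsilon> x" if "x \<in> carrier (P 0)" for x
  using f(2)[OF that] g(2)[OF mod_hom_closed[OF f(1) that]] by simp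
 show "d'' l (\<psi> (Suc l) (\<phi> (Suc l) x)) = \<psi> l (\<phi> l (d l x))" if "x \<in> carrier (P (Suc l))" for l x
  using f(3)[OF that] g(3)[OF mod_hom_closed[OF f(1) that]] by simp
qed

section \<open>Sums of modules generated by idempotents\<close>

text \<open>Negatives in \<open>H\<close> arise from the action of the negative of the unit.\<close>

lemma left_module_restrict:
 assumes "left_module R M" "H \<subseteq> carrier M" "\<zero>\<^sub>M \<in> H"
  "!!x y. [|x \<in> H; y \<in> H|] ==> x \<oplus>\<^sub>M y \<in> H"
  "!!a x. [|a \<in> carrier R; x \<in> H|] ==> a \<odot>\<^sub>M x \<in> H"
 shows "left_module R (M\<lparr>carrier := H\<rparr>)"
proof -
 interpret left_module R M by fact
 have H: "x \<in> carrier M" if "x \<in> H" for x using assms(2) that by blast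
 have inv: "\<exists>y\<in>H. y \<oplus>\<^sub>M x = \<zero>\<^sub>M" if x: "x \<in> H" for x
 proof
  show "(\<ominus>\<^sub>R \<one>\<^sub>R) \<odot>\<^sub>M x \<in> H" using assms(5) x by simp
  have "(\<ominus>\<^sub>R \<one>\<^sub>R) \<odot>\<^sub>M x \<oplus>\<^sub>M \<one>\<^sub>R \<odot>\<^sub>M x = \<zero>\<^sub>M"
   using H[OF x] by (simp flip: smult_l_distr add: R.l_neg)
  then show "(\<ominus>\<^sub>R \<one>\<^sub>R) \<odot>\<^sub>M x \<oplus>\<^sub>M x = \<zero>\<^sub>M" using H[OF x] by (simp add: smult_one)
 qed
 have "abelian_group (M\<lparr>carrier := H\<rparr>)"
  by (rule abelian_groupI) (use assms(3,4) H inv in \<open>simp_all add: M.a_ac\<close>)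
 then show ?thesis
  by (intro left_moduleI)
   (simp_all add: R.ring_axioms assms(5) H smult_l_distr smult_r_distr smult_assoc smult_one)
qed

lemma mod_hom_restrict:
 assumes "f \<in> mod_hom R M N" "H \<subseteq> carrier M"
 shows "f \<in> mod_hom R (M\<lparr>carrier := H\<rparr>) N"
 by (rule mod_homI) (simp_all add: mod_homD[OF assms(1)] subsetD[OF assms(2)])

text \<open>The direct sum of the left ideals R e_q for q in \<open>B\<close>, inside the free
  module: for an idempotent e_q, an element lies in R e_q iff right multiplication by e_q fixes
  it.\<close>

definition idem_module :: "('r, 's) ring_scheme => 'x set => ('x => 'r) => ('r, 'x => 'r) module"
 where "idem_module R B e =
  (free_mod R B)\<lparr>carrier := {f \<in> carrier (free_mod R B). \<forall>q\<in>B. f q \<otimes>\<^sub>R e q = f q}\<rparr>"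

definition idem_unit :: "('r, 's) ring_scheme => ('x => 'r) => 'x => 'x => 'r"
 where "idem_unit R e q = (%x. if x = q then e q else \<zero>\<^sub>R)"

locale idem_family = ring R for R (structure) +
 fixes B :: "'x set" and e :: "'x => 'a"
 assumes fin: "finite B" and e_carrier: "q \<in> B ==> e q \<in> carrier R"
  and e_idem: "q \<in> B ==> e q \<otimes> e q = e q"
begin

lemma idem_carrier:
 "f \<in> carrier (idem_module R B e) \<longleftrightarrow>
   (\<forall>q\<in>B. f q \<in> carrier R \<and> f q \<otimes> e q = f q) \<and> (\<forall>q. q \<notin> B --> f q = \<zero>)"
proof -
 have "finite {q. f q \<noteq> \<zero>}" if "\<forall>q. q \<notin> B --> f q = \<zero>"
  by (rule finite_subset[OF _ fin]) (use that in blast)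
 then show ?thesis by (auto simp: idem_module_def free_mod_def)
qed

lemma idem_ops [simp]:
 "f \<oplus>\<^bsub>idem_module R B e\<^esub> g = (%q. f q \<oplus> g q)" "\<zero>\<^bsub>idem_module R B e\<^esub> = (%q. \<zero>)"
 "a \<odot>\<^bsub>idem_module R B e\<^esub> f = (%q. a \<otimes> f q)"
 by (simp_all add: idem_module_def free_mod_def)

lemma idem_value [simp]: "f \<in> carrier (idem_module R B e) ==> f q \<in> carrier R"
 by (cases "q \<in> B") (auto simp: idem_carrier)

lemma left_module_idem: "left_module R (idem_module R B e)"
 unfolding idem_module_def
proof (rule left_module_restrict[OF left_module_free_mod], goal_cases)
 case 1 show ?case by unfold_locales
next
 case 2 then show ?case by auto
next
 case 3 then show ?case using e_carrier by (auto simp: free_mod_def)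
next
 case (4 x y)
 interpret F: left_module R "free_mod R B" by (rule left_module_free_mod) unfold_locales
 have "x \<oplus>\<^bsub>free_mod R B\<^esub> y \<in> carrier (free_mod R B)" using 4 by simp
 moreover have "(x q \<oplus> y q) \<otimes> e q = x q \<oplus> y q" if "q \<in> B" for q
  using 4 that e_carrier by (simp add: l_distr free_mod_def)
 ultimately show ?case by (simp add: free_mod_def)
next
 case (5 a x)
 interpret F: left_module R "free_mod R B" by (rule left_module_free_mod) unfold_locales
 have "a \<odot>\<^bsub>free_mod R B\<^esub> x \<in> carrier (free_mod R B)" using 5 by (simp add: F.smult_closed)
 moreover have "(a \<otimes> x q) \<otimes> e q = a \<otimes> x q" if "q \<in> B" for q
  using 5 that e_carrier by (simp add: m_assoc free_mod_def)
 ultimately show ?case by (simp add: free_mod_def)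
qed

lemma idem_unit_carrier: "q \<in> B ==> idem_unit R e q \<in> carrier (idem_module R B e)"
 using e_carrier e_idem by (auto simp: idem_carrier idem_unit_def)

lemma idem_finsum:
 assumes "finite A" "!!i. i \<in> A ==> F i \<in> carrier (idem_module R B e)"
 shows "finsum (idem_module R B e) F A q = finsum R (%i. F i q) A"
proof -
 interpret I: left_module R "idem_module R B e" by (rule left_module_idem)
 show ?thesis
  by (rule finsum_hom[where h="%f. f q"])
   (use assms in \<open>auto simp: I.M.abelian_group_axioms is_abelian_group\<close>)
qed

lemma lin_comb_idem_hom:
 assumes "left_module R N" "!!q. q \<in> B ==> y q \<in> carrier N"
 shows "lin_comb R N y \<in> mod_hom R (idem_module R B e) N"
 unfolding idem_module_def by (rule mod_hom_restrict[OF lin_comb_mod_hom[OF assms]]) auto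

lemma lin_comb_idem:
 assumes "left_module R N" "!!q. q \<in> B ==> y q \<in> carrier N" "f \<in> carrier (idem_module R B e)"
 shows "lin_comb R N y f = finsum N (%q. f q \<odot>\<^sub>N y q) B"
proof (rule lin_comb_superset[OF assms(1) fin subset_refl _ _ assms(2)])
 show "{x. f x \<noteq> \<zero>} \<subseteq> B" using assms(3) by (auto simp: idem_carrier)
 show "f \<in> carrier (free_mod R B)" using assms(3) by (simp add: idem_module_def)
qed

text \<open>The generator of the summand R e_q is not sent to \<open>y q\<close> itself but to its
  multiple by e_q, because e_q fixes the generator and hence its image.\<close>

lemma lin_comb_unit:
 assumes "left_module R N" "!!q. q \<in> B ==> y q \<in> carrier N" "q \<in> B"
 shows "lin_comb R N y (idem_unit R e q) = e q \<odot>\<^sub>N y q"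
proof -
 interpret N: left_module R N by fact
 have "lin_comb R N y (idem_unit R e q) = finsum N (%x. idem_unit R e q x \<odot>\<^sub>N y x) B"
  by (rule lin_comb_idem[OF assms(1,2) idem_unit_carrier[OF assms(3)]])
 also have "\<dots> = finsum N (%x. if q = x then e x \<odot>\<^sub>N y x else \<zero>\<^sub>N) B"
  by (rule N.M.finsum_cong')
   (use assms(2) e_carrier in \<open>auto simp: idem_unit_def intro!: N.smult_closed\<close>)
 also have "\<dots> = e q \<odot>\<^sub>N y q"
  by (rule N.M.finsum_singleton) (use assms fin e_carrier in \<open>auto intro!: N.smult_closed\<close>)
 finally show ?thesis .
qed

lemma idem_expand:
 assumes "f \<in> carrier (idem_module R B e)"
 shows "f = finsum (idem_module R B e) (%q. f q \<odot>\<^bsub>idem_module R B e\<^esub> idem_unit R e q) B"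
proof
 interpret I: left_module R "idem_module R B e" by (rule left_module_idem)
 fix p
 have fq: "f q \<in> carrier R" "q \<in> B ==> f q \<otimes> e q = f q" for q
  using assms by (auto simp: idem_carrier)
 have "finsum (idem_module R B e) (%q. f q \<odot>\<^bsub>idem_module R B e\<^esub> idem_unit R e q) B p =
  finsum R (%q. (f q \<odot>\<^bsub>idem_module R B e\<^esub> idem_unit R e q) p) B"
  by (rule idem_finsum[OF fin]) (rule I.smult_closed[OF fq(1) idem_unit_carrier])
 also have "\<dots> = finsum R (%q. if p = q then f q else \<zero>) B"
  by (rule finsum_cong') (use fq in \<open>auto simp: idem_unit_def\<close>)
 also have "\<dots> = f p"
 proof (cases "p \<in> B")
  case True then show ?thesis using finsum_singleton[of p B f] fin fq by auto
 next
  case False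
  then have "finsum R (%q. if p = q then f q else \<zero>) B = finsum R (%q. \<zero>) B"
   by (intro finsum_cong') auto
  then show ?thesis using False assms by (simp add: idem_carrier)
 qed
 finally show "f p = finsum (idem_module R B e) (%q. f q \<odot>\<^bsub>idem_module R B e\<^esub> idem_unit R e q) B p" ..
qed

lemma idem_hom_expand:
 assumes "h \<in> mod_hom R (idem_module R B e) N" "left_module R N" "f \<in> carrier (idem_module R B e)"
 shows "h f = finsum N (%q. f q \<odot>\<^sub>N h (idem_unit R e q)) B"
proof -
 interpret I: left_module R "idem_module R B e" by (rule left_module_idem)
 interpret N: left_module R N by fact
 have "h f = h (finsum (idem_module R B e) (%q. f q \<odot>\<^bsub>idem_module R B e\<^esub> idem_unit R e q) B)"
  by (subst idem_expand[OF assms(3)]) simp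
 also have "\<dots> = finsum N (%q. h (f q \<odot>\<^bsub>idem_module R B e\<^esub> idem_unit R e q)) B"
  by (rule mod_hom_finsum[OF assms(1) I.left_module_axioms assms(2) fin])
   (rule I.smult_closed[OF idem_value[OF assms(3)] idem_unit_carrier])
 also have "\<dots> = finsum N (%q. f q \<odot>\<^sub>N h (idem_unit R e q)) B"
  by (rule N.M.finsum_cong')
   (auto intro!: N.smult_closed mod_hom_closed[OF assms(1)] mod_hom_smult[OF assms(1)]
    idem_value[OF assms(3)] idem_unit_carrier simp del: idem_ops)
 finally show ?thesis .
qed

text \<open>The retraction multiplies the q-th coordinate by e_q on the right.\<close>

lemma retract_of_free_idem: "retract_of_free R B (idem_module R B e)"
 unfolding retract_of_free_def
proof (intro conjI exI ballI)
 show "left_module R (idem_module R B e)" by (rule left_module_idem)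
 show "(%f. f) \<in> mod_hom R (idem_module R B e) (free_mod R B)"
  unfolding idem_module_def by (rule mod_hom_restrict[OF mod_hom_id]) auto
 show "lin_comb R (idem_module R B e) (idem_unit R e) \<in> mod_hom R (free_mod R B) (idem_module R B e)"
  by (rule lin_comb_mod_hom[OF left_module_idem idem_unit_carrier])
 fix f assume f: "f \<in> carrier (idem_module R B e)"
 show "lin_comb R (idem_module R B e) (idem_unit R e) f = f"
  using lin_comb_idem[OF left_module_idem idem_unit_carrier f] idem_expand[OF f] by simp
qed

end

text \<open>Homomorphisms of left modules are matrices acting on row vectors from the right.\<close>

lemma idem_matrix_apply:
 assumes "idem_family R B e" "idem_family R B' e'"
  "!!q. q \<in> B ==> y q \<in> carrier (idem_module R B' e')" "f \<in> carrier (idem_module R B e)"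
 shows "lin_comb R (idem_module R B' e') y f p = finsum R (%q. f q \<otimes>\<^sub>R y q p) B"
proof -
 interpret I: idem_family R B e by fact
 interpret I': idem_family R B' e' by fact
 interpret N: left_module R "idem_module R B' e'" by (rule I'.left_module_idem)
 have "lin_comb R (idem_module R B' e') y f p =
  finsum (idem_module R B' e') (%q. f q \<odot>\<^bsub>idem_module R B' e'\<^esub> y q) B p"
  by (rule fun_cong[OF I.lin_comb_idem[OF I'.left_module_idem assms(3,4)]])
 also have "\<dots> = finsum R (%q. (f q \<odot>\<^bsub>idem_module R B' e'\<^esub> y q) p) B"
  by (rule I'.idem_finsum[OF I.fin]) (rule N.smult_closed[OF I.idem_value[OF assms(4)] assms(3)])
 finally show ?thesis by simp
qed

section \<open>Linear extension\<close>

abbreviation "keys \<equiv> Poly_Mapping.keys"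
abbreviation "lookup \<equiv> Poly_Mapping.lookup"
abbreviation "single \<equiv> Poly_Mapping.single"
abbreviation "plen p \<equiv> length (snd p)"

lemma lin_ext_superset:
 assumes "finite A" "keys f \<subseteq> A"
 shows "lin_ext h f = (\<Sum>x\<in>A. fscale (lookup f x) (h x))"
 unfolding lin_ext_def
 by (rule sum.mono_neutral_left) (use assms in \<open>auto simp: in_keys_iff\<close>)

lemma lin_ext_add: "lin_ext h (f + g) = lin_ext h f + lin_ext h g"
proof -
 let ?A = "keys f \<union> keys g"
 have "keys (f + g) \<subseteq> ?A" by (rule keys_add)
 then show ?thesis
  by (simp add: lin_ext_superset[of ?A] lookup_add fs.scale_left_distrib sum.distrib)
qed

lemma lin_ext_scale: "lin_ext h (fscale c f) = fscale c (lin_ext h f)"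
proof -
 have "keys (fscale c f) \<subseteq> keys f" by (auto simp: in_keys_iff)
 then show ?thesis
  by (simp add: lin_ext_superset[of "keys f"] fs.scale_sum_right)
qed

lemma lin_ext_single [simp]: "lin_ext h (single x c) = fscale c (h x)"
 by (subst lin_ext_superset[of "{x}"]) auto

lemma linear_lin_ext: "Vector_Spaces.linear fscale fscale (lin_ext h)"
 by (auto simp: Vector_Spaces.linear_iff fs.vector_space_axioms lin_ext_add lin_ext_scale)

lemma linear_fscaleI:
 assumes "!!f g. F (f + g) = F f + F g" "!!c f. F (fscale c f) = fscale c (F f)"
 shows "Vector_Spaces.linear fscale fscale F"
 using assms by (auto simp: Vector_Spaces.linear_iff fs.vector_space_axioms)

lemma linD:
 assumes "Vector_Spaces.linear fscale fscale F"
 shows "F (f + g) = F f + F g" "F (fscale c f) = fscale c (F f)" "F 0 = 0" "F (- f) = - F f"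
  "F (f - g) = F f - F g" "F (\<Sum>i\<in>I. h i) = (\<Sum>i\<in>I. F (h i))"
proof -
 interpret vector_space_pair "fscale" "fscale" by unfold_locales
 show "F (f + g) = F f + F g" "F (fscale c f) = fscale c (F f)" "F 0 = 0" "F (- f) = - F f"
  "F (f - g) = F f - F g" "F (\<Sum>i\<in>I. h i) = (\<Sum>i\<in>I. F (h i))"
  using assms by (simp_all add: linear_add linear_scale linear_0 linear_neg linear_diff linear_sum)
qed

lemma poly_mapping_expand:
 "f = (\<Sum>x\<in>keys f. fscale (lookup f x) (single x 1))"
 by (rule poly_mapping_eqI)
  (auto simp: lookup_sum lookup_single when_def in_keys_iff sum.delta' if_distrib cong: if_cong)

lemma lin_eqI:
 assumes "Vector_Spaces.linear fscale fscale F" "Vector_Spaces.linear fscale fscale G"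
  "!!x. x \<in> keys f ==> F (single x 1) = G (single x 1)"
 shows "F f = G f"
 by (subst (1 2) poly_mapping_expand)
  (simp add: linD[OF assms(1)] linD[OF assms(2)] assms(3))

lemma lookup_lin_ext:
 "lookup (lin_ext h f) p =
  (\<Sum>x\<in>keys f. lookup f x * lookup (h x) p)"
 by (simp add: lin_ext_def lookup_sum)

lemma linear_comp:
 assumes "Vector_Spaces.linear fscale fscale F" "Vector_Spaces.linear fscale fscale G"
 shows "Vector_Spaces.linear fscale fscale (%x. G (F x))"
 by (rule linear_fscaleI) (simp_all add: linD[OF assms(1)] linD[OF assms(2)])

lemma linear_span_into:
 assumes "Vector_Spaces.linear fscale fscale F" "fs.subspace Z" "!!x. x \<in> X ==> F x \<in> Z"
  "x \<in> fs.span X"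
 shows "F x \<in> Z"
 using assms(4)
proof (rule fs.span_induct)
 show "fs.subspace {x. F x \<in> Z}"
  using assms(2) by (auto simp: fs.subspace_def linD[OF assms(1)])
qed (use assms(3) in blast)

lemma subspace_keys: "fs.subspace {f :: 'x \<Rightarrow>\<^sub>0 'k::field. keys f \<subseteq> X}"
proof -
 have "keys (fscale c f) \<subseteq> keys f" for c :: 'k and f :: "'x \<Rightarrow>\<^sub>0 'k"
  by (auto simp: in_keys_iff)
 then show ?thesis
  by (auto simp: fs.subspace_def dest: subsetD[OF keys_add] subset_trans)
qed

lemma keys_lin_ext:
 assumes "!!x. x \<in> keys f ==> keys (h x) \<subseteq> Y"
 shows "keys (lin_ext h f) \<subseteq> Y"
proof -
 have "lin_ext h f \<in> {f. keys f \<subseteq> Y}"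
  unfolding lin_ext_def
  by (intro fs.subspace_sum[OF subspace_keys] fs.subspace_scale[OF subspace_keys]) (use assms in auto)
 then show ?thesis by simp
qed

section \<open>Paths and slices\<close>

lemma path_target_conv:
 "path_target Q (u, p) = (if p = [] then u else head Q (last p))"
 by (simp add: path_target_def pre_digraph.awalk_verts_conv)

lemma path_target_append: "path_target Q (u, p @ r) = path_target Q (path_target Q (u, p), r)"
 by (simp add: path_target_conv)

locale quadratic_quiver = fin_digraph Q for Q :: "('v, 'a) pre_digraph" +
 fixes M :: "('v, 'a, 'k::field) path_elem set"
 assumes quad: "quadratic_relations Q M"
begin

abbreviation "ptarget \<equiv> path_target Q"
abbreviation "in_kQ f \<equiv> keys f \<subseteq> paths Q"

abbreviation kQ :: "('k, ('v, 'a, 'k) path_elem) module" where "kQ \<equiv> path_algebra Q"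

abbreviation pmul :: "('v, 'a, 'k) path_elem => ('v, 'a, 'k) path_elem => ('v, 'a, 'k) path_elem"
  (infixl \<open>\<cdot>\<close> 70) where
 "f \<cdot> g \<equiv> f \<otimes>\<^sub>kQ g"

abbreviation psingle :: "'v \<times> 'a list => ('v, 'a, 'k) path_elem" where
 "psingle p \<equiv> single p 1"

abbreviation vx :: "'v => ('v, 'a, 'k) path_elem" where "vx \<equiv> vertex_idem"

abbreviation V where "V l \<equiv> (path_part Q l :: ('v, 'a, 'k) path_elem set)"

abbreviation lin :: "(('x \<Rightarrow>\<^sub>0 'k) => ('y \<Rightarrow>\<^sub>0 'k)) => bool" where
 "lin \<equiv> Vector_Spaces.linear fscale fscale"

definition pcomp :: "'v \<times> 'a list => 'v \<times> 'a list => ('v, 'a, 'k) path_elem" where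
 "pcomp p q = (if ptarget q = fst p then psingle (fst q, snd q @ snd p) else 0)"

lemma pmul_conv: "f \<cdot> g = lin_ext (%p. lin_ext (pcomp p) g) f"
 by (simp add: path_algebra_def algebra_on_basis_def pcomp_def[abs_def])

lemma lin_pmul_left: "lin (%f. f \<cdot> g)"
 unfolding pmul_conv by (rule linear_lin_ext)

lemma lin_pmul_right: "lin (%g. f \<cdot> g)"
proof (rule linear_fscaleI)
 show "f \<cdot> (g + h) = f \<cdot> g + f \<cdot> h" for g h
  by (simp add: pmul_conv lin_ext_add) (simp add: lin_ext_def fs.scale_right_distrib sum.distrib)
 show "f \<cdot> fscale c g = fscale c (f \<cdot> g)" for g c
  by (simp add: pmul_conv lin_ext_scale)
   (simp add: lin_ext_def fs.scale_sum_right mult.left_commute)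
qed

lemmas pmul_left = linD[OF lin_pmul_left]
lemmas pmul_right = linD[OF lin_pmul_right]

lemma pmul_psingle [simp]: "psingle p \<cdot> psingle q = pcomp p q"
 by (simp add: pmul_conv)

text \<open>There is no condition on supports: \<open>pcomp\<close> tests composability through
  \<open>path_target\<close>, which makes sense for arbitrary lists of arrows, so trilinearity
  leaves a case check on single pairs.\<close>

lemma pmul_assoc: "(f \<cdot> g) \<cdot> h = f \<cdot> (g \<cdot> h)"
proof (rule lin_eqI[of "%f. (f \<cdot> g) \<cdot> h"])
 show "lin (%f. (f \<cdot> g) \<cdot> h)" "lin (%f. f \<cdot> (g \<cdot> h))"
  by (rule linear_comp[OF lin_pmul_left lin_pmul_left] lin_pmul_left)+
 fix p
 show "(psingle p \<cdot> g) \<cdot> h = psingle p \<cdot> (g \<cdot> h)"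
 proof (rule lin_eqI[of "%g. (psingle p \<cdot> g) \<cdot> h"])
  show "lin (%g. (psingle p \<cdot> g) \<cdot> h)" "lin (%g. psingle p \<cdot> (g \<cdot> h))"
   by (rule linear_comp[OF lin_pmul_right lin_pmul_left] linear_comp[OF lin_pmul_left lin_pmul_right])+
  fix q
  show "(psingle p \<cdot> psingle q) \<cdot> h = psingle p \<cdot> (psingle q \<cdot> h)"
  proof (rule lin_eqI[of "%h. (psingle p \<cdot> psingle q) \<cdot> h"])
   show "lin (%h. (psingle p \<cdot> psingle q) \<cdot> h)" "lin (%h. psingle p \<cdot> (psingle q \<cdot> h))"
    by (rule lin_pmul_right linear_comp[OF lin_pmul_right lin_pmul_right])+
   fix r :: "'v \<times> 'a list"
   show "(psingle p \<cdot> psingle q) \<cdot> psingle r = psingle p \<cdot> (psingle q \<cdot> psingle r)"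
    by (cases p; cases q; cases r)
     (auto simp: pcomp_def path_target_append pmul_left pmul_right path_target_conv)
  qed
 qed
qed

lemma paths_Nil: "(u, []) \<in> paths Q \<longleftrightarrow> u \<in> verts Q"
 by (auto simp: paths_def awalk_def)

lemma paths_append:
 "(u, p @ r) \<in> paths Q \<longleftrightarrow> (u, p) \<in> paths Q \<and> (ptarget (u, p), r) \<in> paths Q"
proof -
 have "(u, p) \<in> paths Q \<longleftrightarrow> awalk u p (ptarget (u, p))" for u p
  unfolding paths_def path_target_def by auto
 then show ?thesis by (simp add: path_target_append awalk_append_iff) (auto simp: path_target_def)
qed

lemma path_target_verts: "p \<in> paths Q ==> ptarget p \<in> verts Q"
 unfolding paths_def path_target_def by auto

lemma path_source_verts: "p \<in> paths Q ==> fst p \<in> verts Q"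
 by (auto simp: paths_def awalk_def)

lemma path_arcs: "(u, p) \<in> paths Q ==> set p \<subseteq> arcs Q"
 by (auto simp: paths_def awalk_def)

lemma paths_single: "(u, [a]) \<in> paths Q \<longleftrightarrow> a \<in> arcs Q \<and> u = tail Q a"
 by (auto simp: paths_def awalk_def)

lemma finite_paths: "finite {p \<in> paths Q. plen p = l}"
proof (rule finite_subset)
 show "{p \<in> paths Q. plen p = l} \<subseteq> verts Q \<times> {w. set w \<subseteq> arcs Q \<and> length w = l}"
  using path_source_verts path_arcs by fastforce
 show "finite (verts Q \<times> {w. set w \<subseteq> arcs Q \<and> length w = l})"
  by (simp add: finite_lists_length_eq)
qed

lemma subspace_V: "fs.subspace (V l)"
 unfolding path_part_def by (rule subspace_keys)

lemmas V_scale = fs.subspace_scale[OF subspace_V]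

lemma V_span: "V l = fs.span (psingle ` {p \<in> paths Q. plen p = l})"
proof
 show "V l \<subseteq> fs.span (psingle ` {p \<in> paths Q. plen p = l})"
 proof
  fix f assume "f \<in> V l"
  then show "f \<in> fs.span (psingle ` {p \<in> paths Q. plen p = l})"
   by (subst poly_mapping_expand)
    (rule fs.span_sum, rule fs.span_scale, rule fs.span_base, auto simp: path_part_def)
 qed
 show "fs.span (psingle ` {p \<in> paths Q. plen p = l}) \<subseteq> V l"
  by (rule fs.span_minimal[OF _ subspace_V]) (auto simp: path_part_def)
qed

lemma V_keys: "f \<in> V l ==> p \<in> keys f ==> p \<in> paths Q \<and> plen p = l"
 by (auto simp: path_part_def)

lemma pmul_closed:
 assumes "in_kQ f" "in_kQ g"
 shows "keys (f \<cdot> g) \<subseteq> {r \<in> paths Q. \<exists>p\<in>keys f. \<exists>q\<in>keys g.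
   plen r = plen p + plen q}"
 unfolding pmul_conv
proof (intro keys_lin_ext)
 fix p q assume pq: "p \<in> keys f" "q \<in> keys g"
 then have "(fst p, snd p) \<in> paths Q" "(fst q, snd q) \<in> paths Q" using assms by auto
 then show "keys (pcomp p q) \<subseteq> {r \<in> paths Q. \<exists>p\<in>keys f. \<exists>q\<in>keys g.
   plen r = plen p + plen q}"
 proof (cases "ptarget q = fst p")
  case True
  with pq assms have "(fst q, snd q @ snd p) \<in> paths Q" by (auto simp: paths_append)
  moreover have "length (snd q @ snd p) = plen p + plen q" by simp
  ultimately show ?thesis using True pq by (auto simp: pcomp_def simp del: length_append)
 qed (simp add: pcomp_def)
qed

lemma V_mult: "f \<in> V k ==> g \<in> V l ==> f \<cdot> g \<in> V (k + l)"
 using pmul_closed[of f g] by (fastforce simp: path_part_def)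

lemma V_sum: "(!!i. i \<in> I ==> f i \<in> V l) ==> (\<Sum>i\<in>I. f i) \<in> V l"
 by (rule fs.subspace_sum[OF subspace_V])

lemma vx_V: "i \<in> verts Q ==> vx i \<in> V 0"
 by (simp add: path_part_def vertex_idem_def paths_Nil)

definition arrow :: "'a => ('v, 'a, 'k) path_elem" where "arrow a = psingle (tail Q a, [a])"

lemma arrow_V: "a \<in> arcs Q ==> arrow a \<in> V 1"
 by (simp add: path_part_def arrow_def paths_single)

lemma vx_psingle: "vx j \<cdot> psingle p = (if ptarget p = j then psingle p else 0)"
 by (cases p) (auto simp: vertex_idem_def pcomp_def)

lemma psingle_vx: "psingle p \<cdot> vx i = (if fst p = i then psingle p else 0)"
 by (cases p) (auto simp: vertex_idem_def pcomp_def path_target_conv)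

lemma vx_vx: "vx i \<cdot> vx j = (if i = j then vx i else 0)"
 by (simp add: vertex_idem_def pcomp_def path_target_conv)

lemma lookup_vx_left: "lookup (vx j \<cdot> f) p = (if ptarget p = j then lookup f p else 0)"
proof -
 have "vx j \<cdot> f = lin_ext (%p. if ptarget p = j then psingle p else 0) f"
  by (rule lin_eqI[OF lin_pmul_right linear_lin_ext]) (simp add: vx_psingle)
 also have "lookup \<dots> p =
   (\<Sum>x\<in>keys f. if x = p then if ptarget p = j then lookup f p else 0 else 0)"
  unfolding lookup_lin_ext by (rule sum.cong) (auto simp: lookup_single when_def)
 also have "\<dots> = (if ptarget p = j then lookup f p else 0)" by (simp add: in_keys_iff)
 finally show ?thesis .
qed

lemma lookup_vx_right: "lookup (f \<cdot> vx i) p = (if fst p = i then lookup f p else 0)"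
proof -
 have "f \<cdot> vx i = lin_ext (%p. if fst p = i then psingle p else 0) f"
  by (rule lin_eqI[OF lin_pmul_left linear_lin_ext]) (simp add: psingle_vx)
 also have "lookup \<dots> p =
   (\<Sum>x\<in>keys f. if x = p then if fst p = i then lookup f p else 0 else 0)"
  unfolding lookup_lin_ext by (rule sum.cong) (auto simp: lookup_single when_def)
 also have "\<dots> = (if fst p = i then lookup f p else 0)" by (simp add: in_keys_iff)
 finally show ?thesis .
qed

lemma sum_vx_left: "in_kQ f ==> (\<Sum>j\<in>verts Q. vx j \<cdot> f) = f"
 by (rule poly_mapping_eqI)
  (auto simp: lookup_sum lookup_vx_left in_keys_iff sum.delta dest: path_target_verts subsetD)

lemma sum_vx_right: "in_kQ f ==> (\<Sum>i\<in>verts Q. f \<cdot> vx i) = f"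
 by (rule poly_mapping_eqI)
  (auto simp: lookup_sum lookup_vx_right in_keys_iff sum.delta dest: path_source_verts subsetD)

text \<open>
 Contraction of a factor of length \<open>b\<close> on the left or on the right with the functional taking the
 value \<open>\<phi> p\<close> on the path \<open>p\<close>.
\<close>

definition lslice :: "nat => ('v \<times> 'a list => 'k) => ('v, 'a, 'k) path_elem => ('v, 'a, 'k) path_elem" where
 "lslice b \<phi> = lin_ext (%(u, w). fscale
   (\<phi> (ptarget (u, take (length w - b) w), drop (length w - b) w))
   (psingle (u, take (length w - b) w)))"

definition rslice :: "nat => ('v \<times> 'a list => 'k) => ('v, 'a, 'k) path_elem => ('v, 'a, 'k) path_elem" where
 "rslice b \<phi> = lin_ext (%(u, w). fscale (\<phi> (u, take b w))
   (psingle (ptarget (u, take b w), drop b w)))"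

text \<open>Contraction of an element as a whole. A path p leaves behind its start vertex, the
  vertex at which a factor to the right of p is attached; \<open>rcontr\<close> keeps the end vertex
  for the same reason.\<close>

definition lcontr :: "('v \<times> 'a list => 'k) => ('v, 'a, 'k) path_elem => ('v, 'a, 'k) path_elem" where
 "lcontr \<phi> = lin_ext (%p. fscale (\<phi> p) (vx (fst p)))"

definition rcontr :: "('v \<times> 'a list => 'k) => ('v, 'a, 'k) path_elem => ('v, 'a, 'k) path_elem" where
 "rcontr \<phi> = lin_ext (%p. fscale (\<phi> p) (vx (ptarget p)))"

definition pairing :: "('v \<times> 'a list => 'k) => ('v, 'a, 'k) path_elem => 'k" where
 "pairing \<phi> f = (\<Sum>p\<in>keys f. lookup f p * \<phi> p)"

lemma lin_lslice: "lin (lslice b \<phi>)" and lin_rslice: "lin (rslice b \<phi>)"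
 and lin_lcontr: "lin (lcontr \<phi>)" and lin_rcontr: "lin (rcontr \<phi>)"
 unfolding lslice_def rslice_def lcontr_def rcontr_def by (rule linear_lin_ext)+

lemma lcontr_pairing: "f \<cdot> vx i = f ==> lcontr \<phi> f = fscale (pairing \<phi> f) (vx i)"
proof -
 assume f: "f \<cdot> vx i = f"
 have "fst p = i" if "p \<in> keys f" for p
  using lookup_vx_right[of f i p] that unfolding f by (auto simp: in_keys_iff split: if_splits)
 then show ?thesis
  by (simp add: lcontr_def lin_ext_def pairing_def fs.scale_sum_left)
qed

lemma rcontr_pairing: "vx j \<cdot> f = f ==> rcontr \<phi> f = fscale (pairing \<phi> f) (vx j)"
proof -
 assume f: "vx j \<cdot> f = f"
 have "ptarget p = j" if "p \<in> keys f" for p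
  using lookup_vx_left[of j f p] that unfolding f by (auto simp: in_keys_iff split: if_splits)
 then show ?thesis
  by (simp add: rcontr_def lin_ext_def pairing_def fs.scale_sum_left)
qed

text \<open>The left factor of a product is travelled last, hence sits at the end of the list of
  arrows, and that is the segment removed by \<open>lslice\<close>. The vertex left behind by
  \<open>lcontr\<close> kills whatever was not composable.\<close>

lemma lslice_mult: "x \<in> V b ==> lslice b \<phi> (x \<cdot> y) = lcontr \<phi> x \<cdot> y"
proof (rule lin_eqI[of "%x. lslice b \<phi> (x \<cdot> y)"])
 show "lin (%x. lslice b \<phi> (x \<cdot> y))" by (rule linear_comp[OF lin_pmul_left lin_lslice])
 show "lin (%x. lcontr \<phi> x \<cdot> y)" by (rule linear_comp[OF lin_lcontr lin_pmul_left])
 fix p assume "x \<in> V b" "p \<in> keys x"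
 then have p: "plen p = b" by (auto dest: V_keys)
 show "lslice b \<phi> (psingle p \<cdot> y) = lcontr \<phi> (psingle p) \<cdot> y"
 proof (rule lin_eqI[of "%y. lslice b \<phi> (psingle p \<cdot> y)"])
  show "lin (%y. lslice b \<phi> (psingle p \<cdot> y))" by (rule linear_comp[OF lin_pmul_right lin_lslice])
  show "lin (%y. lcontr \<phi> (psingle p) \<cdot> y)" by (rule lin_pmul_right)
  fix q :: "'v \<times> 'a list"
  show "lslice b \<phi> (psingle p \<cdot> psingle q) = lcontr \<phi> (psingle p) \<cdot> psingle q"
   using p by (cases p; cases q)
    (auto simp: pcomp_def lslice_def lcontr_def vx_psingle pmul_left linD[OF linear_lin_ext])
 qed
qed

lemma rslice_mult: "y \<in> V b ==> rslice b \<phi> (x \<cdot> y) = x \<cdot> rcontr \<phi> y"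
proof (rule lin_eqI[of "%y. rslice b \<phi> (x \<cdot> y)"])
 show "lin (%y. rslice b \<phi> (x \<cdot> y))" by (rule linear_comp[OF lin_pmul_right lin_rslice])
 show "lin (%y. x \<cdot> rcontr \<phi> y)" by (rule linear_comp[OF lin_rcontr lin_pmul_right])
 fix q assume "y \<in> V b" "q \<in> keys y"
 then have q: "plen q = b" by (auto dest: V_keys)
 show "rslice b \<phi> (x \<cdot> psingle q) = x \<cdot> rcontr \<phi> (psingle q)"
 proof (rule lin_eqI[of "%x. rslice b \<phi> (x \<cdot> psingle q)"])
  show "lin (%x. rslice b \<phi> (x \<cdot> psingle q))" by (rule linear_comp[OF lin_pmul_left lin_rslice])
  show "lin (%x. x \<cdot> rcontr \<phi> (psingle q))" by (rule lin_pmul_left)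
  fix p :: "'v \<times> 'a list"
  show "rslice b \<phi> (psingle p \<cdot> psingle q) = psingle p \<cdot> rcontr \<phi> (psingle q)"
   using q by (cases p; cases q)
    (auto simp: pcomp_def rslice_def rcontr_def psingle_vx pmul_right linD[OF linear_lin_ext])
 qed
qed

lemma lslice_pmul:
 assumes "x \<in> V m" "b \<le> m" shows "lslice b \<phi> (x \<cdot> y) = lslice b \<phi> x \<cdot> y"
proof (rule lin_eqI[of "%x. lslice b \<phi> (x \<cdot> y)"])
 show "lin (%x. lslice b \<phi> (x \<cdot> y))" by (rule linear_comp[OF lin_pmul_left lin_lslice])
 show "lin (%x. lslice b \<phi> x \<cdot> y)" by (rule linear_comp[OF lin_lslice lin_pmul_left])
 fix p assume "p \<in> keys x"
 then have p: "b \<le> plen p" using assms by (auto dest: V_keys)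
 show "lslice b \<phi> (psingle p \<cdot> y) = lslice b \<phi> (psingle p) \<cdot> y"
 proof (rule lin_eqI[of "%y. lslice b \<phi> (psingle p \<cdot> y)"])
  show "lin (%y. lslice b \<phi> (psingle p \<cdot> y))" by (rule linear_comp[OF lin_pmul_right lin_lslice])
  show "lin (%y. lslice b \<phi> (psingle p) \<cdot> y)" by (rule lin_pmul_right)
  fix q :: "'v \<times> 'a list"
  show "lslice b \<phi> (psingle p \<cdot> psingle q) = lslice b \<phi> (psingle p) \<cdot> psingle q"
   using p by (cases p; cases q)
    (auto simp: pcomp_def lslice_def pmul_left linD[OF linear_lin_ext] path_target_append)
 qed
qed

lemma rslice_pmul:
 assumes "y \<in> V m" "b \<le> m" shows "rslice b \<phi> (x \<cdot> y) = x \<cdot> rslice b \<phi> y"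
proof (rule lin_eqI[of "%y. rslice b \<phi> (x \<cdot> y)"])
 show "lin (%y. rslice b \<phi> (x \<cdot> y))" by (rule linear_comp[OF lin_pmul_right lin_rslice])
 show "lin (%y. x \<cdot> rslice b \<phi> y)" by (rule linear_comp[OF lin_rslice lin_pmul_right])
 fix q assume "q \<in> keys y"
 then have q: "b \<le> plen q" using assms by (auto dest: V_keys)
 show "rslice b \<phi> (x \<cdot> psingle q) = x \<cdot> rslice b \<phi> (psingle q)"
 proof (rule lin_eqI[of "%x. rslice b \<phi> (x \<cdot> psingle q)"])
  show "lin (%x. rslice b \<phi> (x \<cdot> psingle q))" by (rule linear_comp[OF lin_pmul_left lin_rslice])
  show "lin (%x. x \<cdot> rslice b \<phi> (psingle q))" by (rule lin_pmul_left)
  fix p :: "'v \<times> 'a list"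
  have t: "ptarget (ptarget (u, take b w), drop b w) = ptarget (u, w)" for u and w :: "'a list"
   by (metis append_take_drop_id path_target_append)
  show "rslice b \<phi> (psingle p \<cdot> psingle q) = psingle p \<cdot> rslice b \<phi> (psingle q)"
   using q by (cases p; cases q)
    (auto simp: pcomp_def rslice_def pmul_right linD[OF linear_lin_ext] t)
 qed
qed

lemma lslice_V: "x \<in> V (m + b) ==> lslice b \<phi> x \<in> V m"
proof -
 assume x: "x \<in> V (m + b)"
 have "(u, take m w) \<in> paths Q" if "(u, w) \<in> paths Q" for u w
  using that paths_append[of u "take m w" "drop m w"] by simp
 then have "keys (lslice b \<phi> x) \<subseteq> {p \<in> paths Q. plen p = m}"
  unfolding lslice_def using V_keys[OF x]
  by (intro keys_lin_ext) (auto simp: in_keys_iff lookup_single when_def split: if_splits)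
 then show ?thesis by (simp add: path_part_def)
qed

lemma rslice_V: "x \<in> V (b + m) ==> rslice b \<phi> x \<in> V m"
proof -
 assume x: "x \<in> V (b + m)"
 have "(ptarget (u, take b w), drop b w) \<in> paths Q" if "(u, w) \<in> paths Q" for u w
  using that paths_append[of u "take b w" "drop b w"] by simp
 then have "keys (rslice b \<phi> x) \<subseteq> {p \<in> paths Q. plen p = m}"
  unfolding rslice_def using V_keys[OF x]
  by (intro keys_lin_ext) (auto simp: in_keys_iff lookup_single when_def split: if_splits)
 then show ?thesis by (simp add: path_part_def)
qed

text \<open>By \<open>a + b \<le> m\<close> the two contractions consume disjoint segments of each
  path. The cancellation of the mixed terms in the bimodule differential rests on this
  commutation.\<close>

lemma lslice_rslice:
 assumes "x \<in> V m" "a + b \<le> m" shows "lslice a \<phi> (rslice b \<psi> x) = rslice b \<psi> (lslice a \<phi> x)"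
proof (rule lin_eqI[OF linear_comp[OF lin_rslice lin_lslice] linear_comp[OF lin_lslice lin_rslice]])
 fix p assume "p \<in> keys x"
 then have p: "a + b \<le> plen p" using assms by (auto dest: V_keys)
 define w1 where "w1 = take b (snd p)"
 define w2 where "w2 = take (plen p - b - a) (drop b (snd p))"
 define w3 where "w3 = drop (plen p - b - a) (drop b (snd p))"
 have w: "snd p = w1 @ w2 @ w3" "length w1 = b" "length w3 = a"
  using p by (simp add: w1_def w2_def w3_def del: drop_drop) (use p in \<open>auto simp: w1_def w3_def\<close>)
 then have pw: "p = (fst p, w1 @ w2 @ w3)" by (cases p) simp
 show "lslice a \<phi> (rslice b \<psi> (psingle p)) = rslice b \<psi> (lslice a \<phi> (psingle p))"
  using w(2,3) by (subst (1 2) pw)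
   (simp add: lslice_def rslice_def linD[OF linear_lin_ext] path_target_append mult.commute)
qed

text \<open>On \<open>V 1\<close> this is the functional dual to the arrow \<open>a\<close>, since
  the start vertex of a path with one arrow is determined by the arrow.\<close>

definition arrow_coeff :: "'a => 'v \<times> 'a list => 'k" where
 "arrow_coeff a p = (if snd p = [a] then 1 else 0)"

abbreviation Ls :: "'a => ('v, 'a, 'k) path_elem => ('v, 'a, 'k) path_elem" where
 "Ls a \<equiv> lslice 1 (arrow_coeff a)"

abbreviation Rs :: "'a => ('v, 'a, 'k) path_elem => ('v, 'a, 'k) path_elem" where
 "Rs a \<equiv> rslice 1 (arrow_coeff a)"

abbreviation coeff :: "('v, 'a, 'k) path_elem => 'a => 'k" where
 "coeff f a \<equiv> lookup f (tail Q a, [a])"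

lemma pairing_arrow: "f \<in> V 1 ==> pairing (arrow_coeff a) f = coeff f a"
proof -
 assume f: "f \<in> V 1"
 have "pairing (arrow_coeff a) f = (\<Sum>p\<in>keys f. if p = (tail Q a, [a]) then lookup f p else 0)"
  unfolding pairing_def
 proof (rule sum.cong)
  fix p assume "p \<in> keys f"
  then have "p \<in> paths Q" using V_keys[OF f] by blast
  then show "lookup f p * arrow_coeff a p = (if p = (tail Q a, [a]) then lookup f p else 0)"
   by (cases p) (auto simp: arrow_coeff_def paths_single)
 qed simp
 then show ?thesis by (simp add: in_keys_iff)
qed

lemma V1_eqI:
 assumes "f \<in> V 1" "g \<in> V 1" "!!a. a \<in> arcs Q ==> coeff f a = coeff g a"
 shows "f = g"
proof (rule poly_mapping_eqI)
 fix p
 show "lookup f p = lookup g p"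
 proof (cases "p \<in> paths Q \<and> plen p = 1")
  case True
  then obtain u a where "p = (u, [a])" by (cases p) (auto simp: length_Suc_conv)
  then show ?thesis using True assms(3) by (auto simp: paths_single)
 next
  case False
  then have "p \<notin> keys f" "p \<notin> keys g" using V_keys assms by blast+
  then show ?thesis by (simp add: in_keys_iff)
 qed
qed

text \<open>The tensor power of degree l + 1 is the direct sum, over the arrows that can stand
  leftmost, of what follows them; \<open>Ls a\<close> extracts the part belonging to
  \<open>a\<close>.\<close>

lemma Ls_expand: "x \<in> V (Suc l) ==> x = (\<Sum>a\<in>arcs Q. arrow a \<cdot> Ls a x)"
proof (rule lin_eqI[of "%x. x"])
 show "lin (%x. \<Sum>a\<in>arcs Q. arrow a \<cdot> Ls a x)"
  by (rule linear_fscaleI)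
   (simp_all add: linD[OF lin_lslice] pmul_right sum.distrib fs.scale_sum_right)
 show "lin (%x :: ('v, 'a, 'k) path_elem. x)" by (rule linear_fscaleI) simp_all
 fix p assume "x \<in> V (Suc l)" "p \<in> keys x"
 then have "p \<in> paths Q" "plen p = Suc l" by (auto dest: V_keys)
 then obtain u w c where p: "p = (u, w @ [c])" "(u, w @ [c]) \<in> paths Q"
  by (cases p) (auto simp: length_Suc_conv_rev)
 then have c: "c \<in> arcs Q" "ptarget (u, w) = tail Q c" by (auto simp: paths_append paths_single)
 have "(\<Sum>a\<in>arcs Q. arrow a \<cdot> Ls a (psingle p)) = (\<Sum>a\<in>arcs Q. if a = c then psingle p else 0)"
  by (rule sum.cong) (auto simp: p(1) lslice_def arrow_coeff_def arrow_def pcomp_def c pmul_right)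
 then show "psingle p = (\<Sum>a\<in>arcs Q. arrow a \<cdot> Ls a (psingle p))" using c by simp
qed

lemma Rs_expand: "x \<in> V (Suc l) ==> x = (\<Sum>a\<in>arcs Q. Rs a x \<cdot> arrow a)"
proof (rule lin_eqI[of "%x. x"])
 show "lin (%x. \<Sum>a\<in>arcs Q. Rs a x \<cdot> arrow a)"
  by (rule linear_fscaleI)
   (simp_all add: linD[OF lin_rslice] pmul_left sum.distrib fs.scale_sum_right)
 show "lin (%x :: ('v, 'a, 'k) path_elem. x)" by (rule linear_fscaleI) simp_all
 fix p assume "x \<in> V (Suc l)" "p \<in> keys x"
 then have "p \<in> paths Q" "plen p = Suc l" by (auto dest: V_keys)
 then obtain u w c where p: "p = (u, c # w)" "(u, [c] @ w) \<in> paths Q"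
  by (cases p) (auto simp: length_Suc_conv)
 then have c: "c \<in> arcs Q" "u = tail Q c" unfolding paths_append paths_single by auto
 have "(\<Sum>a\<in>arcs Q. Rs a (psingle p) \<cdot> arrow a) = (\<Sum>a\<in>arcs Q. if a = c then psingle p else 0)"
  by (rule sum.cong) (auto simp: p(1) rslice_def arrow_coeff_def arrow_def pcomp_def c pmul_left path_target_conv)
 then show "psingle p = (\<Sum>a\<in>arcs Q. Rs a (psingle p) \<cdot> arrow a)" using c by simp
qed

end

section \<open>Koszul spaces\<close>

context quadratic_quiver
begin

lemma M_sub: "fs.subspace M" "M \<subseteq> V 2" "s \<in> V 0 ==> m \<in> M ==> s \<cdot> m \<in> M"
 "s \<in> V 0 ==> m \<in> M ==> m \<cdot> s \<in> M"
 using quad by (auto simp: quadratic_relations_def)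

text \<open>The tensors whose window of length two after \<mu> factors, counted from the left,
  satisfies the relations.\<close>

definition W :: "nat => nat => ('v, 'a, 'k) path_elem set" where
 "W \<mu> c = prod_space Q (prod_space Q (V \<mu>) M) (V c)"

abbreviation K where "K \<equiv> koszul_space Q M"

lemma subspace_prod: "fs.subspace (prod_space Q X Y)"
 by (simp add: prod_space_def)

lemma prod_spaceI: "x \<in> X ==> y \<in> Y ==> x \<cdot> y \<in> prod_space Q X Y"
 unfolding prod_space_def by (rule fs.span_base) blast

lemma linear_prod_into:
 assumes "lin F" "fs.subspace Z" "!!x y. x \<in> X ==> y \<in> Y ==> F (x \<cdot> y) \<in> Z"
  "z \<in> prod_space Q X Y"
 shows "F z \<in> Z"
 by (rule linear_span_into[OF assms(1,2) _ assms(4)[unfolded prod_space_def]]) (use assms(3) in blast)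

lemma W_I: "v \<in> V \<mu> ==> m \<in> M ==> w \<in> V c ==> v \<cdot> m \<cdot> w \<in> W \<mu> c"
 unfolding W_def by (intro prod_spaceI)

lemma linear_W_into:
 assumes "lin F" "fs.subspace Z" "!!v m w. v \<in> V \<mu> ==> m \<in> M ==> w \<in> V c ==> F (v \<cdot> m \<cdot> w) \<in> Z"
  "z \<in> W \<mu> c"
 shows "F z \<in> Z"
proof (rule linear_prod_into[OF assms(1,2) _ assms(4)[unfolded W_def]])
 fix x w assume x: "x \<in> prod_space Q (V \<mu>) M" and w: "w \<in> V c"
 show "F (x \<cdot> w) \<in> Z"
  by (rule linear_prod_into[OF linear_comp[OF lin_pmul_left assms(1)] assms(2) _ x])
   (rule assms(3)[OF _ _ w])
qed

lemma lin_id: "lin (%x. x)"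
 by (rule linear_fscaleI) simp_all

lemma subspace_W: "fs.subspace (W \<mu> c)"
 unfolding W_def by (rule subspace_prod)

lemma W_V: "W \<mu> c \<subseteq> V (\<mu> + 2 + c)"
proof
 fix x assume "x \<in> W \<mu> c"
 then show "x \<in> V (\<mu> + 2 + c)"
  by (rule linear_W_into[where F="%x. x", OF lin_id subspace_V, rotated]) (intro V_mult, use M_sub(2) in auto)
qed

lemma K_low: "l \<le> 1 ==> K l = V l"
 by (simp add: koszul_space_def)

lemma K_Suc2: "K (Suc (Suc l)) = (\<Inter>\<mu>\<in>{..l}. W \<mu> (l - \<mu>))"
 by (auto simp: koszul_space_def W_def atLeast0AtMost)

lemma K_V: "K l \<subseteq> V l"
proof (cases "l \<le> 1")
 case False
 then obtain m where m: "l = Suc (Suc m)" by (metis Suc_leI le_Suc_eq not_less_eq_eq One_nat_def old.nat.exhaust le0)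
 have "K l \<subseteq> W 0 m" unfolding m K_Suc2 by auto
 then show ?thesis using W_V[of 0 m] m by simp
qed (simp add: K_low)

lemma subspace_K: "fs.subspace (K l)"
proof (cases "l \<le> 1")
 case False
 then obtain m where m: "l = Suc (Suc m)" by (metis Suc_leI le_Suc_eq not_less_eq_eq One_nat_def old.nat.exhaust le0)
 show ?thesis unfolding m K_Suc2 using subspace_W by (intro fs.subspace_Inter) auto
qed (simp add: K_low subspace_V)

lemma K_vertex:
 assumes "x \<in> K l" "s \<in> V 0" shows "s \<cdot> x \<in> K l" "x \<cdot> s \<in> K l"
proof -
 have "s \<cdot> x \<in> K l \<and> x \<cdot> s \<in> K l"
 proof (cases "l \<le> 1")
  case True then show ?thesis using assms V_mult[of s 0 x l] V_mult[of x l s 0] by (simp add: K_low)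
 next
  case False
  then obtain m where m: "l = Suc (Suc m)" by (metis Suc_leI le_Suc_eq not_less_eq_eq One_nat_def old.nat.exhaust le0)
  have "s \<cdot> x \<in> W \<mu> c" if "x \<in> W \<mu> c" for \<mu> c
   by (rule linear_W_into[OF lin_pmul_right subspace_W _ that])
    (use V_mult[OF assms(2)] in \<open>auto simp flip: pmul_assoc intro!: W_I\<close>)
  moreover have "x \<cdot> s \<in> W \<mu> c" if "x \<in> W \<mu> c" for \<mu> c
   by (rule linear_W_into[OF lin_pmul_left subspace_W _ that])
    (use V_mult[OF _ assms(2)] in \<open>auto simp: pmul_assoc[of _ _ s] intro!: W_I\<close>)
  ultimately show ?thesis using assms(1) unfolding m K_Suc2 by blast
 qed
 then show "s \<cdot> x \<in> K l" "x \<cdot> s \<in> K l" by auto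
qed

lemma lcontr_V0: "x \<in> V l ==> lcontr \<phi> x \<in> V 0"
 unfolding lcontr_def lin_ext_def
 by (intro V_sum V_scale vx_V path_source_verts) (auto dest: V_keys)

lemma rcontr_V0: "x \<in> V l ==> rcontr \<phi> x \<in> V 0"
 unfolding rcontr_def lin_ext_def
 by (intro V_sum V_scale vx_V path_target_verts) (auto dest: V_keys)

text \<open>Removing the leftmost arrow shifts all windows by one: the condition at \<mu> for the
  result is the condition at \<mu> + 1 for \<open>x\<close>. For l at most 1 there is no window to
  check.\<close>

lemma lslice_K: "x \<in> K (Suc l) ==> lslice 1 \<phi> x \<in> K l"
proof (cases "l \<le> 1")
 case True
 assume "x \<in> K (Suc l)"
 then have "x \<in> V (l + 1)" using K_V by auto
 then show ?thesis using True lslice_V[of x l 1] by (simp add: K_low)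
next
 case False
 assume x: "x \<in> K (Suc l)"
 obtain m where m: "l = Suc (Suc m)" using False by (metis Suc_leI le_Suc_eq not_less_eq_eq One_nat_def old.nat.exhaust le0)
 have "lslice 1 \<phi> x \<in> W \<mu> (m - \<mu>)" if "\<mu> \<le> m" for \<mu>
 proof (rule linear_W_into[OF lin_lslice subspace_W])
  show "x \<in> W (Suc \<mu>) (m - \<mu>)"
   using x that unfolding m K_Suc2 by (metis INT_E Suc_le_mono atMost_iff diff_Suc_Suc)
  fix v n w assume v: "v \<in> V (Suc \<mu>)" and n: "n \<in> M" and w: "w \<in> V (m - \<mu>)"
  have "lslice 1 \<phi> (v \<cdot> (n \<cdot> w)) = lslice 1 \<phi> v \<cdot> (n \<cdot> w)" by (rule lslice_pmul[OF v]) simp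
  then show "lslice 1 \<phi> (v \<cdot> n \<cdot> w) \<in> W \<mu> (m - \<mu>)"
   using lslice_V[of v \<mu> 1] v W_I[OF _ n w] by (simp add: pmul_assoc)
 qed
 then show ?thesis unfolding m K_Suc2 by blast
qed

lemma rslice_K: "x \<in> K (Suc l) ==> rslice 1 \<phi> x \<in> K l"
proof (cases "l \<le> 1")
 case True
 assume "x \<in> K (Suc l)"
 then have "x \<in> V (1 + l)" using K_V by auto
 then show ?thesis using True rslice_V[of x 1 l] by (simp add: K_low)
next
 case False
 assume x: "x \<in> K (Suc l)"
 obtain m where m: "l = Suc (Suc m)" using False by (metis Suc_leI le_Suc_eq not_less_eq_eq One_nat_def old.nat.exhaust le0)
 have "rslice 1 \<phi> x \<in> W \<mu> (m - \<mu>)" if "\<mu> \<le> m" for \<mu>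
 proof (rule linear_W_into[OF lin_rslice subspace_W])
  show "x \<in> W \<mu> (Suc (m - \<mu>))"
   using x that unfolding m K_Suc2 by (metis INT_E Suc_diff_le atMost_iff le_SucI)
  fix v n w assume v: "v \<in> V \<mu>" and n: "n \<in> M" and w: "w \<in> V (Suc (m - \<mu>))"
  have "rslice 1 \<phi> ((v \<cdot> n) \<cdot> w) = (v \<cdot> n) \<cdot> rslice 1 \<phi> w" by (rule rslice_pmul[OF w]) simp
  then show "rslice 1 \<phi> (v \<cdot> n \<cdot> w) \<in> W \<mu> (m - \<mu>)"
   using rslice_V[of w 1 "m - \<mu>"] w W_I[OF v n] by simp
 qed
 then show ?thesis unfolding m K_Suc2 by blast
qed

text \<open>K_(l+2) is contained in M \<otimes> V_l. Contracting all of the right factor leaves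
  elements of M times vertices, and M is stable under vertices.\<close>

lemma rslice_K_M: "x \<in> K (Suc (Suc l)) ==> rslice l \<phi> x \<in> M"
proof (rule linear_W_into[OF lin_rslice M_sub(1)])
 assume "x \<in> K (Suc (Suc l))" then show "x \<in> W 0 l" unfolding K_Suc2 by force
 fix v n w assume "v \<in> V 0" and n: "n \<in> M" and w: "w \<in> V l"
 then show "rslice l \<phi> (v \<cdot> n \<cdot> w) \<in> M"
  by (simp add: rslice_mult M_sub rcontr_V0)
qed

lemma lslice_K_M: "x \<in> K (Suc (Suc l)) ==> lslice l \<phi> x \<in> M"
proof (rule linear_W_into[OF lin_lslice M_sub(1)])
 assume "x \<in> K (Suc (Suc l))" then show "x \<in> W l 0" unfolding K_Suc2 by force
 fix v n w assume "v \<in> V l" and n: "n \<in> M" and w: "w \<in> V 0"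
 then show "lslice l \<phi> (v \<cdot> n \<cdot> w) \<in> M"
  by (simp add: pmul_assoc lslice_mult M_sub lcontr_V0)
qed

text \<open>K_(l+2) contains the intersection of V \<otimes> K_(l+1) and M \<otimes> V_l: the
  leftmost window is taken care of by the second presentation of \<open>x\<close>, and every other
  window of \<open>x\<close> is a window of the factors in K_(l+1).\<close>

lemma K_SucI:
 assumes "!!i. i \<in> I ==> v i \<in> V 1 \<and> q i \<in> K (Suc l)" "x = (\<Sum>i\<in>I. v i \<cdot> q i)"
  "!!j. j \<in> J ==> m j \<in> M \<and> p j \<in> V l" "x = (\<Sum>j\<in>J. m j \<cdot> p j)"
 shows "x \<in> K (Suc (Suc l))"
 unfolding K_Suc2
proof
 fix \<mu> assume mu: "\<mu> \<in> {..l}"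
 show "x \<in> W \<mu> (l - \<mu>)"
 proof (cases \<mu>)
  case 0
  have "m j \<cdot> p j \<in> W 0 l" if "j \<in> J" for j
  proof -
   \<comment> \<open>\<open>W 0 l\<close> asks for a left factor of degree zero, which the
     decomposition of the unit into vertices supplies.\<close>
   have "(\<Sum>i\<in>verts Q. vx i \<cdot> m j) = m j"
    by (rule sum_vx_left) (use M_sub(2) assms(3)[OF that] in \<open>auto simp: path_part_def\<close>)
   then have "m j \<cdot> p j = (\<Sum>i\<in>verts Q. vx i \<cdot> m j \<cdot> p j)" by (metis pmul_left(6))
   then show ?thesis using assms(3)[OF that]
    by (auto intro!: fs.subspace_sum[OF subspace_W] W_I vx_V)
  qed
  then show ?thesis unfolding assms(4) 0 by (auto intro!: fs.subspace_sum[OF subspace_W])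
 next
  case (Suc \<nu>)
  have "v i \<cdot> q i \<in> W (Suc \<nu>) (l - Suc \<nu>)" if "i \<in> I" for i
  proof (rule linear_W_into[OF lin_pmul_right subspace_W])
   obtain l' where l': "l = Suc l'" using mu Suc by (cases l) auto
   show "q i \<in> W \<nu> (l - Suc \<nu>)"
    using assms(1)[OF that] mu Suc unfolding l' K_Suc2 by auto
   fix a n b assume a: "a \<in> V \<nu>" and n: "n \<in> M" and b: "b \<in> V (l - Suc \<nu>)"
   have "v i \<cdot> a \<in> V (1 + \<nu>)" by (rule V_mult) (use assms(1)[OF that] a in auto)
   then show "v i \<cdot> (a \<cdot> n \<cdot> b) \<in> W (Suc \<nu>) (l - Suc \<nu>)"
    using W_I[OF _ n b, of "v i \<cdot> a"] by (simp add: pmul_assoc)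
  qed
  then show ?thesis unfolding assms(2) Suc by (auto intro!: fs.subspace_sum[OF subspace_W])
 qed
qed

section \<open>Compatible bases and structure constants\<close>

lemma compatible_basisD:
 assumes "compatible_basis Q (K l) B"
 shows "B \<subseteq> K l" "fs.independent B" "fs.span B = K l" "B \<subseteq> V l" "finite B"
proof -
 show a: "B \<subseteq> K l" "fs.independent B" "fs.span B = K l" using assms by (auto simp: compatible_basis_def)
 then show b: "B \<subseteq> V l" using K_V by blast
 have "finite (psingle ` {p \<in> paths Q. plen p = l})" using finite_paths by simp
 then show "finite B" using fs.independent_span_bound[OF _ a(2)] b unfolding V_span by blast
qed

text \<open>The elements with one source and one target span K_l, because q is the sum of the e_j q
  e_i; a maximal independent set is chosen among them.\<close>

lemma compatible_basis_exists: "\<exists>B. compatible_basis Q (K l) B"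
proof -
 define H where "H = {q \<in> K l. \<exists>i\<in>verts Q. \<exists>j\<in>verts Q. vx j \<cdot> q \<cdot> vx i = q}"
 obtain B where B: "B \<subseteq> H" "fs.independent B" "H \<subseteq> fs.span B"
  by (rule fs.maximal_independent_subset)
 have "K l \<subseteq> fs.span H"
 proof
  fix q assume q: "q \<in> K l"
  have k: "in_kQ q" using q K_V by (auto simp: path_part_def)
  have "vx j \<cdot> q \<cdot> vx i \<in> H" if "i \<in> verts Q" "j \<in> verts Q" for i j
  proof -
   have "vx j \<cdot> (vx j \<cdot> q \<cdot> vx i) \<cdot> vx i = (vx j \<cdot> vx j) \<cdot> q \<cdot> (vx i \<cdot> vx i)"
    by (simp only: pmul_assoc)
   then show ?thesis
    unfolding H_def using that K_vertex q vx_V by (auto simp: vx_vx)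
  qed
  moreover have "q = (\<Sum>i\<in>verts Q. \<Sum>j\<in>verts Q. vx j \<cdot> q \<cdot> vx i)"
  proof -
   have "(\<Sum>j\<in>verts Q. vx j \<cdot> q \<cdot> vx i) = q \<cdot> vx i" for i
   proof -
    have "(\<Sum>j\<in>verts Q. vx j \<cdot> q \<cdot> vx i) = (\<Sum>j\<in>verts Q. vx j \<cdot> q) \<cdot> vx i"
     by (simp only: pmul_left(6))
    then show ?thesis by (simp only: sum_vx_left[OF k])
   qed
   then show ?thesis by (simp add: sum_vx_right[OF k])
  qed
  ultimately show "q \<in> fs.span H" by (metis (no_types, lifting) fs.span_sum fs.span_base)
 qed
 also have "\<dots> \<subseteq> fs.span B" using B(3) by (simp add: fs.span_minimal)
 finally have "K l \<subseteq> fs.span B" .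
 moreover have "fs.span B \<subseteq> K l"
  by (rule fs.span_minimal[OF _ subspace_K]) (use B(1) in \<open>auto simp: H_def\<close>)
 ultimately have "compatible_basis Q (K l) B"
  using B by (auto simp: compatible_basis_def H_def)
 then show ?thesis by blast
qed

lemma basis_vertices:
 assumes "compatible_basis Q (K l) B" "q \<in> B"
 shows "source Q q \<in> verts Q" "q \<cdot> vx (source Q q) = q" "target Q q \<in> verts Q" "vx (target Q q) \<cdot> q = q"
  "q \<noteq> 0"
proof -
 obtain i j where ij: "i \<in> verts Q" "j \<in> verts Q" "vx j \<cdot> q \<cdot> vx i = q"
  using assms by (auto simp: compatible_basis_def)
 show q0: "q \<noteq> 0" using compatible_basisD(2)[OF assms(1)] assms(2) fs.dependent_zero by blast
 have qi: "q \<cdot> vx i = q"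
 proof -
  have "q \<cdot> vx i = vx j \<cdot> q \<cdot> vx i \<cdot> vx i" by (simp only: ij(3))
  also have "\<dots> = vx j \<cdot> q \<cdot> vx i" by (simp add: pmul_assoc vx_vx)
  finally show ?thesis using ij(3) by simp
 qed
 have jq: "vx j \<cdot> q = q"
 proof -
  have "vx j \<cdot> q = vx j \<cdot> (vx j \<cdot> q \<cdot> vx i)" by (simp only: ij(3))
  also have "\<dots> = (vx j \<cdot> vx j) \<cdot> q \<cdot> vx i" by (simp only: pmul_assoc)
  finally show ?thesis using ij(3) by (simp add: vx_vx)
 qed
 have "source Q q = i" unfolding source_def
 proof (rule the_equality)
  fix i' assume i': "i' \<in> verts Q \<and> q \<cdot> vx i' = q"
  then have "q = q \<cdot> (vx i \<cdot> vx i')" using qi by (simp flip: pmul_assoc)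
  then show "i' = i" using q0 by (auto simp: vx_vx pmul_right split: if_splits)
 qed (use qi ij in simp)
 then show "source Q q \<in> verts Q" "q \<cdot> vx (source Q q) = q" using ij qi by auto
 have "target Q q = j" unfolding target_def
 proof (rule the_equality)
  fix j' assume j': "j' \<in> verts Q \<and> vx j' \<cdot> q = q"
  then have "q = (vx j' \<cdot> vx j) \<cdot> q" using jq by (simp add: pmul_assoc)
  then show "j' = j" using q0 by (auto simp: vx_vx pmul_left split: if_splits)
 qed (use jq ij in simp)
 then show "target Q q \<in> verts Q" "vx (target Q q) \<cdot> q = q" using ij jq by auto
qed

section \<open>Coefficients with respect to a basis of the next lower Koszul space\<close>

lemma independent_coeffs_eq:
 assumes "fs.independent B" "finite B" "(\<Sum>p\<in>B. fscale (c p) p) = (\<Sum>p\<in>B. fscale (c' p) p)" "p \<in> B"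
 shows "c p = (c' p :: 'k)"
proof -
 have "(\<Sum>p\<in>B. fscale (c p - c' p) p) = 0" using assms(3) by (simp add: fs.scale_left_diff_distrib sum_subtractf)
 then have "c p - c' p = 0" using assms(1,2,4) fs.independentD[of B B "%p. c p - c' p" p] by auto
 then show ?thesis by simp
qed

lemma Ls_mult_basis:
 assumes "c \<in> V 1" "c \<cdot> vx j = c" "vx j \<cdot> p = p"
 shows "Ls a (c \<cdot> p) = fscale (coeff c a) p"
 using assms lslice_mult[OF assms(1), of "arrow_coeff a" p] pairing_arrow[OF assms(1), of a]
 by (simp add: lcontr_pairing pmul_left)

lemma Rs_mult_basis:
 assumes "c \<in> V 1" "vx i \<cdot> c = c" "p \<cdot> vx i = p"
 shows "Rs a (p \<cdot> c) = fscale (coeff c a) p"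
 using assms rslice_mult[OF assms(1), of "arrow_coeff a" p] pairing_arrow[OF assms(1), of a]
 by (simp add: rcontr_pairing pmul_right)

text \<open>The condition under the definite description in \<open>delta_R\<close>, with its
  equation reversed.\<close>

definition is_coeff_R where
 "is_coeff_R B q c \<longleftrightarrow> (\<forall>p. p \<notin> B --> c p = 0) \<and>
   (\<forall>p\<in>B. c p \<in> V 1 \<and> c p \<cdot> vx (target Q p) = c p) \<and> (\<Sum>p\<in>B. c p \<cdot> p) = q"

definition is_coeff_L where
 "is_coeff_L B q c \<longleftrightarrow> (\<forall>p. p \<notin> B --> c p = 0) \<and>
   (\<forall>p\<in>B. c p \<in> V 1 \<and> vx (source Q p) \<cdot> c p = c p) \<and> (\<Sum>p\<in>B. p \<cdot> c p) = q"

text \<open>Contraction with the functional of an arrow turns the V-valued coefficients of q into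
  the coordinates of \<open>Ls a q\<close> in the basis \<open>B\<close>. Uniqueness of the
  coefficients is uniqueness of these coordinates, and their existence is the fact that
  \<open>Ls a q\<close> lies in the span of \<open>B\<close>.\<close>

lemma coeff_R_slice:
 assumes "compatible_basis Q (K l) B" "is_coeff_R B q c"
 shows "Ls a q = (\<Sum>p\<in>B. fscale (coeff (c p) a) p)"
proof -
 have "Ls a q = (\<Sum>p\<in>B. Ls a (c p \<cdot> p))"
  using assms(2) by (simp add: is_coeff_R_def linD(6)[OF lin_lslice, symmetric])
 also have "\<dots> = (\<Sum>p\<in>B. fscale (coeff (c p) a) p)"
  by (rule sum.cong)
   (use assms basis_vertices[OF assms(1)] Ls_mult_basis in \<open>auto simp: is_coeff_R_def\<close>)
 finally show ?thesis .
qed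

lemma coeff_L_slice:
 assumes "compatible_basis Q (K l) B" "is_coeff_L B q c"
 shows "Rs a q = (\<Sum>p\<in>B. fscale (coeff (c p) a) p)"
proof -
 have "Rs a q = (\<Sum>p\<in>B. Rs a (p \<cdot> c p))"
  using assms(2) by (simp add: is_coeff_L_def linD(6)[OF lin_rslice, symmetric])
 also have "\<dots> = (\<Sum>p\<in>B. fscale (coeff (c p) a) p)"
  by (rule sum.cong)
   (use assms basis_vertices[OF assms(1)] Rs_mult_basis in \<open>auto simp: is_coeff_L_def\<close>)
 finally show ?thesis .
qed

lemma coeff_R_unique:
 assumes B: "compatible_basis Q (K l) B" and c: "is_coeff_R B q c" "is_coeff_R B q c'"
 shows "c = c'"
proof
 fix p show "c p = c' p"
 proof (cases "p \<in> B")
  case True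
  have "coeff (c p) a = coeff (c' p) a" for a
   by (rule independent_coeffs_eq[OF compatible_basisD(2,5)[OF B] _ True,
      of "%p. coeff (c p) a" "%p. coeff (c' p) a"])
    (rule coeff_R_slice[OF B c(1), symmetric, THEN trans, OF coeff_R_slice[OF B c(2)]])
  moreover have "c p \<in> V 1" "c' p \<in> V 1" using c True unfolding is_coeff_R_def by blast+
  ultimately show ?thesis by (intro V1_eqI)
 next
  case False
  then have "c p = 0" "c' p = 0" using c unfolding is_coeff_R_def by blast+
  then show ?thesis by simp
 qed
qed

lemma coeff_L_unique:
 assumes B: "compatible_basis Q (K l) B" and c: "is_coeff_L B q c" "is_coeff_L B q c'"
 shows "c = c'"
proof
 fix p show "c p = c' p"
 proof (cases "p \<in> B")
  case True
  have "coeff (c p) a = coeff (c' p) a" for a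
   by (rule independent_coeffs_eq[OF compatible_basisD(2,5)[OF B] _ True,
      of "%p. coeff (c p) a" "%p. coeff (c' p) a"])
    (rule coeff_L_slice[OF B c(1), symmetric, THEN trans, OF coeff_L_slice[OF B c(2)]])
  moreover have "c p \<in> V 1" "c' p \<in> V 1" using c True unfolding is_coeff_L_def by blast+
  ultimately show ?thesis by (intro V1_eqI)
 next
  case False
  then have "c p = 0" "c' p = 0" using c unfolding is_coeff_L_def by blast+
  then show ?thesis by simp
 qed
qed

lemma coeff_R_exists:
 assumes B: "compatible_basis Q (K l) B" and q: "q \<in> K (Suc l)"
 shows "\<exists>c. is_coeff_R B q c"
proof -
 note b = compatible_basisD[OF B] and v = basis_vertices[OF B]
 define r where "r a p = fs.representation B (Ls a q) p" for a p
 \<comment> \<open>The arrows are cut down at the target of p to meet the normalization; the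
   products c_p p do not change, since p absorbs that vertex.\<close>
 define c where "c p = (if p \<in> B then \<Sum>a\<in>arcs Q. fscale (r a p) (arrow a \<cdot> vx (target Q p)) else 0)" for p
 have "Ls a q = (\<Sum>p\<in>B. fscale (r a p) p)" for a
  unfolding r_def using fs.sum_representation_eq[OF b(2) _ b(5) subset_refl] lslice_K[OF q] b(3) by auto
 then have "q = (\<Sum>a\<in>arcs Q. \<Sum>p\<in>B. fscale (r a p) (arrow a \<cdot> p))"
  using Ls_expand[of q l] q K_V by (auto simp: pmul_right)
 also have "\<dots> = (\<Sum>p\<in>B. \<Sum>a\<in>arcs Q. fscale (r a p) (arrow a \<cdot> p))" by (rule sum.swap)
 also have "\<dots> = (\<Sum>p\<in>B. c p \<cdot> p)"
  by (rule sum.cong) (auto simp: c_def pmul_left pmul_assoc v)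
 finally have "q = (\<Sum>p\<in>B. c p \<cdot> p)" .
 moreover have "c p \<in> V 1 \<and> c p \<cdot> vx (target Q p) = c p" if "p \<in> B" for p
 proof
  have "arrow a \<cdot> vx (target Q p) \<in> V (1 + 0)" if "a \<in> arcs Q" for a
   by (rule V_mult[OF arrow_V[OF that] vx_V]) (rule v(3)[OF \<open>p \<in> B\<close>])
  then show "c p \<in> V 1" using that by (auto simp: c_def intro!: V_sum V_scale)
  show "c p \<cdot> vx (target Q p) = c p" using that by (simp add: c_def pmul_left pmul_assoc vx_vx)
 qed
 moreover have "c p = 0" if "p \<notin> B" for p using that by (simp add: c_def)
 ultimately have "is_coeff_R B q c" unfolding is_coeff_R_def by metis
 then show ?thesis by blast
qed

lemma coeff_L_exists:
 assumes B: "compatible_basis Q (K l) B" and q: "q \<in> K (Suc l)"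
 shows "\<exists>c. is_coeff_L B q c"
proof -
 note b = compatible_basisD[OF B] and v = basis_vertices[OF B]
 define r where "r a p = fs.representation B (Rs a q) p" for a p
 define c where "c p = (if p \<in> B then \<Sum>a\<in>arcs Q. fscale (r a p) (vx (source Q p) \<cdot> arrow a) else 0)" for p
 have "Rs a q = (\<Sum>p\<in>B. fscale (r a p) p)" for a
  unfolding r_def using fs.sum_representation_eq[OF b(2) _ b(5) subset_refl] rslice_K[OF q] b(3) by auto
 then have "q = (\<Sum>a\<in>arcs Q. \<Sum>p\<in>B. fscale (r a p) (p \<cdot> arrow a))"
  using Rs_expand[of q l] q K_V by (auto simp: pmul_left)
 also have "\<dots> = (\<Sum>p\<in>B. \<Sum>a\<in>arcs Q. fscale (r a p) (p \<cdot> arrow a))" by (rule sum.swap)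
 also have "\<dots> = (\<Sum>p\<in>B. p \<cdot> c p)"
  by (rule sum.cong) (auto simp: c_def pmul_right v simp flip: pmul_assoc)
 finally have "q = (\<Sum>p\<in>B. p \<cdot> c p)" .
 moreover have "c p \<in> V 1 \<and> vx (source Q p) \<cdot> c p = c p" if "p \<in> B" for p
 proof
  have "vx (source Q p) \<cdot> arrow a \<in> V (0 + 1)" if "a \<in> arcs Q" for a
   by (rule V_mult[OF vx_V arrow_V[OF that]]) (rule v(1)[OF \<open>p \<in> B\<close>])
  then show "c p \<in> V 1" using that by (auto simp: c_def intro!: V_sum V_scale)
  show "vx (source Q p) \<cdot> c p = c p" using that by (simp add: c_def pmul_right vx_vx flip: pmul_assoc)
 qed
 moreover have "c p = 0" if "p \<notin> B" for p using that by (simp add: c_def)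
 ultimately have "is_coeff_L B q c" unfolding is_coeff_L_def by metis
 then show ?thesis by blast
qed

lemma delta_R_eqI:
 assumes "compatible_basis Q (K l) B" "is_coeff_R B q c" shows "delta_R Q B p q = c p"
proof -
 have "delta_R Q B p q = (THE c. is_coeff_R B q c) p" unfolding delta_R_def is_coeff_R_def by (simp only: eq_commute[of q])
 also have "(THE c. is_coeff_R B q c) = c"
  using assms coeff_R_unique by (intro the_equality) auto
 finally show ?thesis .
qed

lemma delta_L_eqI:
 assumes "compatible_basis Q (K l) B" "is_coeff_L B q c" shows "delta_L Q B p q = c p"
proof -
 have "delta_L Q B p q = (THE c. is_coeff_L B q c) p" unfolding delta_L_def is_coeff_L_def by (simp only: eq_commute[of q])
 also have "(THE c. is_coeff_L B q c) = c"
  using assms coeff_L_unique by (intro the_equality) auto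
 finally show ?thesis .
qed

lemma delta_R_coeff:
 assumes "compatible_basis Q (K l) B" "q \<in> K (Suc l)"
 shows "is_coeff_R B q (%p. delta_R Q B p q)"
proof -
 obtain c where c: "is_coeff_R B q c" using coeff_R_exists[OF assms] by blast
 have "(%p. delta_R Q B p q) = c" using delta_R_eqI[OF assms(1) c] by (rule ext)
 then show ?thesis using c by simp
qed

lemma delta_L_coeff:
 assumes "compatible_basis Q (K l) B" "q \<in> K (Suc l)"
 shows "is_coeff_L B q (%p. delta_L Q B p q)"
proof -
 obtain c where c: "is_coeff_L B q c" using coeff_L_exists[OF assms] by blast
 have "(%p. delta_L Q B p q) = c" using delta_L_eqI[OF assms(1) c] by (rule ext)
 then show ?thesis using c by simp
qed

lemma delta_R_sum:
 "compatible_basis Q (K l) B ==> q \<in> K (Suc l) ==> (\<Sum>p\<in>B. delta_R Q B p q \<cdot> p) = q"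
 using delta_R_coeff by (auto simp: is_coeff_R_def)

lemma delta_L_sum:
 "compatible_basis Q (K l) B ==> q \<in> K (Suc l) ==> (\<Sum>p\<in>B. p \<cdot> delta_L Q B p q) = q"
 using delta_L_coeff by (auto simp: is_coeff_L_def)

text \<open>The conditions at the ends follow from uniqueness: multiplying the expansion of q by a
  vertex which q absorbs on that side gives another admissible expansion of q.\<close>

lemma delta_R_props:
 assumes B: "compatible_basis Q (K l) B" and q: "q \<in> K (Suc l)" and p: "p \<in> B"
 shows "delta_R Q B p q \<in> V 1" "delta_R Q B p q \<cdot> vx (target Q p) = delta_R Q B p q"
  and "vx j \<cdot> q = q ==> j \<in> verts Q ==> vx j \<cdot> delta_R Q B p q = delta_R Q B p q"
  and "q \<cdot> vx i = q ==> source Q p \<noteq> i ==> delta_R Q B p q = 0"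
proof -
 note d = delta_R_coeff[OF B q, unfolded is_coeff_R_def] and dsum = delta_R_sum[OF B q] and v = basis_vertices[OF B]
 show "delta_R Q B p q \<in> V 1" "delta_R Q B p q \<cdot> vx (target Q p) = delta_R Q B p q" using d p by auto
 show "vx j \<cdot> delta_R Q B p q = delta_R Q B p q" if j: "vx j \<cdot> q = q" "j \<in> verts Q"
 proof -
  have "vx j \<cdot> delta_R Q B p q \<in> V (0 + 1)" if "p \<in> B" for p
   by (rule V_mult[OF vx_V[OF j(2)]]) (use d that in auto)
  moreover have "(\<Sum>p\<in>B. (vx j \<cdot> delta_R Q B p q) \<cdot> p) = q"
   unfolding pmul_assoc pmul_right(6)[symmetric] dsum by (rule j(1))
  ultimately have "is_coeff_R B q (%p. vx j \<cdot> delta_R Q B p q)"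
   using d unfolding is_coeff_R_def by (simp add: pmul_right pmul_assoc)
  from delta_R_eqI[OF B this, of p] show ?thesis by simp
 qed
 show "delta_R Q B p q = 0" if i: "q \<cdot> vx i = q" "source Q p \<noteq> i"
 proof -
  have "p \<cdot> vx i = (if source Q p = i then p else 0)" if "p \<in> B" for p
  proof -
   have "p \<cdot> vx i = p \<cdot> (vx (source Q p) \<cdot> vx i)" using v(2)[OF that] by (simp flip: pmul_assoc)
   also have "\<dots> = (if source Q p = i then p else 0)" using v(2)[OF that] by (auto simp: vx_vx pmul_right)
   finally show ?thesis .
  qed
  then have "(\<Sum>p\<in>B. (if source Q p = i then delta_R Q B p q else 0) \<cdot> p) = (\<Sum>p\<in>B. delta_R Q B p q \<cdot> p) \<cdot> vx i"
   by (simp add: pmul_left pmul_assoc) (auto intro!: sum.cong simp: pmul_left pmul_right)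
  also have "\<dots> = q" unfolding dsum by (rule i(1))
  finally have "is_coeff_R B q (%p. if source Q p = i then delta_R Q B p q else 0)"
   using d unfolding is_coeff_R_def by (auto simp: pmul_left fs.subspace_0[OF subspace_V])
  from delta_R_eqI[OF B this, of p] show ?thesis using i by simp
 qed
qed

lemma delta_L_props:
 assumes B: "compatible_basis Q (K l) B" and q: "q \<in> K (Suc l)" and p: "p \<in> B"
 shows "delta_L Q B p q \<in> V 1" "vx (source Q p) \<cdot> delta_L Q B p q = delta_L Q B p q"
  and "q \<cdot> vx i = q ==> i \<in> verts Q ==> delta_L Q B p q \<cdot> vx i = delta_L Q B p q"
  and "vx j \<cdot> q = q ==> target Q p \<noteq> j ==> delta_L Q B p q = 0"
proof -
 note d = delta_L_coeff[OF B q, unfolded is_coeff_L_def] and dsum = delta_L_sum[OF B q] and v = basis_vertices[OF B]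
 show "delta_L Q B p q \<in> V 1" "vx (source Q p) \<cdot> delta_L Q B p q = delta_L Q B p q" using d p by auto
 show "delta_L Q B p q \<cdot> vx i = delta_L Q B p q" if j: "q \<cdot> vx i = q" "i \<in> verts Q"
 proof -
  have "delta_L Q B p q \<cdot> vx i \<in> V (1 + 0)" if "p \<in> B" for p
   by (rule V_mult[OF _ vx_V[OF j(2)]]) (use d that in auto)
  moreover have "(\<Sum>p\<in>B. p \<cdot> (delta_L Q B p q \<cdot> vx i)) = q"
   unfolding pmul_assoc[symmetric] pmul_left(6)[symmetric] dsum by (rule j(1))
  ultimately have "is_coeff_L B q (%p. delta_L Q B p q \<cdot> vx i)"
   using d unfolding is_coeff_L_def by (simp add: pmul_left flip: pmul_assoc)
  from delta_L_eqI[OF B this, of p] show ?thesis by simp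
 qed
 show "delta_L Q B p q = 0" if i: "vx j \<cdot> q = q" "target Q p \<noteq> j"
 proof -
  have "vx j \<cdot> p = (if target Q p = j then p else 0)" if "p \<in> B" for p
  proof -
   have "vx j \<cdot> p = (vx j \<cdot> vx (target Q p)) \<cdot> p" using v(4)[OF that] by (simp add: pmul_assoc)
   also have "\<dots> = (if target Q p = j then p else 0)" using v(4)[OF that] by (auto simp: vx_vx pmul_left)
   finally show ?thesis .
  qed
  then have "(\<Sum>p\<in>B. p \<cdot> (if target Q p = j then delta_L Q B p q else 0)) = vx j \<cdot> (\<Sum>p\<in>B. p \<cdot> delta_L Q B p q)"
   by (simp add: pmul_right flip: pmul_assoc) (auto intro!: sum.cong simp: pmul_left pmul_right)
  also have "\<dots> = q" unfolding dsum by (rule i(1))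
  finally have "is_coeff_L B q (%p. if target Q p = j then delta_L Q B p q else 0)"
   using d unfolding is_coeff_L_def by (auto simp: pmul_right fs.subspace_0[OF subspace_V])
  from delta_L_eqI[OF B this, of p] show ?thesis using i by simp
 qed
qed

text \<open>The values on paths of the functional dual to r in a basis of the whole space that
  extends \<open>B\<close>.\<close>

definition dual_coeff :: "('v, 'a, 'k) path_elem set => ('v, 'a, 'k) path_elem => 'v \<times> 'a list => 'k" where
 "dual_coeff B r p = fs.representation (fs.extend_basis B) (psingle p) r"

lemma pairing_dual:
 assumes "fs.independent B" "r \<in> B" "r' \<in> B"
 shows "pairing (dual_coeff B r) r' = (if r' = r then 1 else 0)"
proof -
 let ?E = "fs.extend_basis B"
 have E: "fs.independent ?E" "fs.span ?E = UNIV" "B \<subseteq> ?E"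
  using fs.independent_extend_basis[OF assms(1)] fs.span_extend_basis[OF assms(1)]
   fs.extend_basis_superset[OF assms(1)] by auto
 have "pairing (dual_coeff B r) f = fs.representation ?E f r" for f
 proof -
  have "fs.representation ?E f r = fs.representation ?E (\<Sum>x\<in>keys f. fscale (lookup f x) (psingle x)) r"
   by (subst poly_mapping_expand) simp
  also have "\<dots> = pairing (dual_coeff B r) f"
   by (simp add: fs.representation_sum[OF E(1)] E(2) fs.representation_scale[OF E(1)] pairing_def dual_coeff_def)
  finally show ?thesis ..
 qed
 then show ?thesis using E assms by (auto simp: fs.representation_basis)
qed

text \<open>Inserting the expansions of the p into that of q gives q as the sum of the m_r r, where
  m_r is the sum in question. Applied to the right factors, the functional dual to r isolates m_r;
  and contractions of this kind map K_(l+2) into M.\<close>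

lemma delta_R_delta_R:
 assumes B1: "compatible_basis Q (K (Suc l)) B1" and B0: "compatible_basis Q (K l) B0"
  and q: "q \<in> K (Suc (Suc l))" and r: "r \<in> B0"
 shows "(\<Sum>p\<in>B1. delta_R Q B1 p q \<cdot> delta_R Q B0 r p) \<in> M"
proof -
 note b1 = compatible_basisD[OF B1] and b0 = compatible_basisD[OF B0]
 define m where "m r = (\<Sum>p\<in>B1. delta_R Q B1 p q \<cdot> delta_R Q B0 r p)" for r
 have d0: "(\<Sum>r\<in>B0. delta_R Q B0 r p \<cdot> r) = p" if "p \<in> B1" for p
  by (rule delta_R_sum[OF B0]) (use b1(1) that in blast)
 have "(\<Sum>r\<in>B0. m r \<cdot> r) = (\<Sum>p\<in>B1. delta_R Q B1 p q \<cdot> (\<Sum>r\<in>B0. delta_R Q B0 r p \<cdot> r))"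
  unfolding m_def pmul_right(6) pmul_left(6) pmul_assoc by (rule sum.swap)
 also have "\<dots> = q" by (simp add: d0 delta_R_sum[OF B1 q])
 finally have qm: "q = (\<Sum>r\<in>B0. m r \<cdot> r)" by simp
 have mv: "m r \<cdot> vx (target Q r) = m r" if "r \<in> B0" for r
  unfolding m_def pmul_left(6)
  by (rule sum.cong) (use delta_R_props(2)[OF B0 _ that] b1(1) in \<open>auto simp: pmul_assoc\<close>)
 have "rslice l (dual_coeff B0 r) q = (\<Sum>r'\<in>B0. m r' \<cdot> rcontr (dual_coeff B0 r) r')"
  by (subst qm) (use b0(4) rslice_mult in \<open>auto simp: linD(6)[OF lin_rslice] intro!: sum.cong\<close>)
 also have "\<dots> = (\<Sum>r'\<in>B0. if r' = r then m r else 0)"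
 proof (rule sum.cong)
  fix r' assume r': "r' \<in> B0"
  show "m r' \<cdot> rcontr (dual_coeff B0 r) r' = (if r' = r then m r else 0)"
   using rcontr_pairing[OF basis_vertices(4)[OF B0 r']] pairing_dual[OF b0(2) r r'] mv[OF r']
   by (simp add: pmul_right)
 qed simp
 also have "\<dots> = m r" using r b0(5) by simp
 finally show ?thesis using rslice_K_M[OF q, of "dual_coeff B0 r"] by (simp add: m_def)
qed

lemma delta_L_delta_L:
 assumes B1: "compatible_basis Q (K (Suc l)) B1" and B0: "compatible_basis Q (K l) B0"
  and q: "q \<in> K (Suc (Suc l))" and r: "r \<in> B0"
 shows "(\<Sum>p\<in>B1. delta_L Q B0 r p \<cdot> delta_L Q B1 p q) \<in> M"
proof -
 note b1 = compatible_basisD[OF B1] and b0 = compatible_basisD[OF B0]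
 define m where "m r = (\<Sum>p\<in>B1. delta_L Q B0 r p \<cdot> delta_L Q B1 p q)" for r
 have d0: "(\<Sum>r\<in>B0. r \<cdot> delta_L Q B0 r p) = p" if "p \<in> B1" for p
  by (rule delta_L_sum[OF B0]) (use b1(1) that in blast)
 have "(\<Sum>r\<in>B0. r \<cdot> m r) = (\<Sum>p\<in>B1. (\<Sum>r\<in>B0. r \<cdot> delta_L Q B0 r p) \<cdot> delta_L Q B1 p q)"
  unfolding m_def pmul_right(6) pmul_left(6) pmul_assoc by (rule sum.swap)
 also have "\<dots> = q" by (simp add: d0 delta_L_sum[OF B1 q])
 finally have qm: "q = (\<Sum>r\<in>B0. r \<cdot> m r)" by simp
 have mv: "vx (source Q r) \<cdot> m r = m r" if "r \<in> B0" for r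
  unfolding m_def pmul_right(6)
  by (rule sum.cong) (use delta_L_props(2)[OF B0 _ that] b1(1) in \<open>auto simp flip: pmul_assoc\<close>)
 have "lslice l (dual_coeff B0 r) q = (\<Sum>r'\<in>B0. lcontr (dual_coeff B0 r) r' \<cdot> m r')"
  by (subst qm) (use b0(4) lslice_mult in \<open>auto simp: linD(6)[OF lin_lslice] intro!: sum.cong\<close>)
 also have "\<dots> = (\<Sum>r'\<in>B0. if r' = r then m r else 0)"
 proof (rule sum.cong)
  fix r' assume r': "r' \<in> B0"
  show "lcontr (dual_coeff B0 r) r' \<cdot> m r' = (if r' = r then m r else 0)"
   using lcontr_pairing[OF basis_vertices(2)[OF B0 r']] pairing_dual[OF b0(2) r r'] mv[OF r']
   by (simp add: pmul_left)
 qed simp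
 also have "\<dots> = m r" using r b0(5) by simp
 finally show ?thesis using lslice_K_M[OF q, of "dual_coeff B0 r"] by (simp add: m_def)
qed

text \<open>Both sides are the coordinate at r of one element, obtained from q by contracting the
  leftmost factor with \<open>a\<close> and the rightmost one with \<open>b\<close>, in either
  order.\<close>

lemma delta_R_delta_L:
 assumes B1: "compatible_basis Q (K (Suc l)) B1" and B0: "compatible_basis Q (K l) B0"
  and q: "q \<in> K (Suc (Suc l))" and r: "r \<in> B0"
 shows "(\<Sum>p\<in>B1. coeff (delta_R Q B1 p q) a * coeff (delta_L Q B0 r p) b) =
  (\<Sum>p\<in>B1. coeff (delta_R Q B0 r p) a * coeff (delta_L Q B1 p q) b)"
proof -
 note b1 = compatible_basisD[OF B1] and b0 = compatible_basisD[OF B0]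
 have "Rs b (Ls a q) = (\<Sum>p\<in>B1. fscale (coeff (delta_R Q B1 p q) a) (Rs b p))"
  unfolding coeff_R_slice[OF B1 delta_R_coeff[OF B1 q]] by (simp only: linD[OF lin_rslice])
 also have "\<dots> = (\<Sum>p\<in>B1. fscale (coeff (delta_R Q B1 p q) a) (\<Sum>r\<in>B0. fscale (coeff (delta_L Q B0 r p) b) r))"
 proof (rule sum.cong[OF refl])
  fix p assume "p \<in> B1"
  then have "p \<in> K (Suc l)" using b1(1) by blast
  from coeff_L_slice[OF B0 delta_L_coeff[OF B0 this], of b]
  show "fscale (coeff (delta_R Q B1 p q) a) (Rs b p) =
   fscale (coeff (delta_R Q B1 p q) a) (\<Sum>r\<in>B0. fscale (coeff (delta_L Q B0 r p) b) r)"
   by (rule arg_cong)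
 qed
 also have "\<dots> = (\<Sum>r\<in>B0. fscale (\<Sum>p\<in>B1. coeff (delta_R Q B1 p q) a * coeff (delta_L Q B0 r p) b) r)"
  by (simp add: fs.scale_sum_right fs.scale_sum_left) (rule sum.swap)
 finally have 1: "Rs b (Ls a q) = \<dots>" .
 have "Ls a (Rs b q) = (\<Sum>p\<in>B1. fscale (coeff (delta_L Q B1 p q) b) (Ls a p))"
  unfolding coeff_L_slice[OF B1 delta_L_coeff[OF B1 q]] by (simp only: linD[OF lin_lslice])
 also have "\<dots> = (\<Sum>p\<in>B1. fscale (coeff (delta_L Q B1 p q) b) (\<Sum>r\<in>B0. fscale (coeff (delta_R Q B0 r p) a) r))"
 proof (rule sum.cong[OF refl])
  fix p assume "p \<in> B1"
  then have "p \<in> K (Suc l)" using b1(1) by blast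
  from coeff_R_slice[OF B0 delta_R_coeff[OF B0 this], of a]
  show "fscale (coeff (delta_L Q B1 p q) b) (Ls a p) =
   fscale (coeff (delta_L Q B1 p q) b) (\<Sum>r\<in>B0. fscale (coeff (delta_R Q B0 r p) a) r)"
   by (rule arg_cong)
 qed
 also have "\<dots> = (\<Sum>r\<in>B0. fscale (\<Sum>p\<in>B1. coeff (delta_R Q B0 r p) a * coeff (delta_L Q B1 p q) b) r)"
  by (simp add: fs.scale_sum_right fs.scale_sum_left mult.commute) (rule sum.swap)
 finally have 2: "Ls a (Rs b q) = \<dots>" .
 have "Ls a (Rs b q) = Rs b (Ls a q)"
  by (rule lslice_rslice[of _ "Suc (Suc l)"]) (use q K_V in auto)
 from 1[symmetric, THEN trans, OF this[symmetric, THEN trans, OF 2]] show ?thesis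
  by (rule independent_coeffs_eq[OF b0(2,5) _ r,
     of "%r. \<Sum>p\<in>B1. coeff (delta_R Q B1 p q) a * coeff (delta_L Q B0 r p) b"
       "%r. \<Sum>p\<in>B1. coeff (delta_R Q B0 r p) a * coeff (delta_L Q B1 p q) b"])
qed

text \<open>
 Exactness of the left Koszul complex in the lowest degree: \<open>V \<otimes> K\<^sub>l\<^sub>+\<^sub>1 \<inter> M \<otimes> K\<^sub>l = K\<^sub>l\<^sub>+\<^sub>2\<close>.
\<close>

lemma koszul_lowest_exact:
 assumes B: "compatible_basis Q (K l) B" and v: "!!p. p \<in> B ==> v p \<in> V 1 \<and> v p \<cdot> vx (target Q p) = v p"
  "!!p. p \<notin> B ==> v p = 0"
  and M: "!!l' B'. l = Suc l' ==> \<exists>B'. compatible_basis Q (K l') B' \<and> (\<forall>r\<in>B'. (\<Sum>p\<in>B. v p \<cdot> delta_R Q B' r p) \<in> M)"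
 shows "(\<Sum>p\<in>B. v p \<cdot> p) \<in> K (Suc l)" "delta_R Q B p (\<Sum>p\<in>B. v p \<cdot> p) = v p"
proof -
 note b = compatible_basisD[OF B]
 show "(\<Sum>p\<in>B. v p \<cdot> p) \<in> K (Suc l)"
 proof (cases l)
  case 0
  have "v p \<cdot> p \<in> V (1 + 0)" if "p \<in> B" for p
   by (rule V_mult) (use v(1)[OF that] b(4) that 0 in auto)
  then show ?thesis using 0 by (auto simp: K_low intro!: V_sum)
 next
  case (Suc l')
  then obtain B' where B': "compatible_basis Q (K l') B'"
   "!!r. r \<in> B' ==> (\<Sum>p\<in>B. v p \<cdot> delta_R Q B' r p) \<in> M" using M by blast
  have d: "(\<Sum>r\<in>B'. delta_R Q B' r p \<cdot> r) = p" if "p \<in> B" for p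
   by (rule delta_R_sum[OF B'(1)]) (use b(1) that Suc in auto)
  have "(\<Sum>p\<in>B. v p \<cdot> p) = (\<Sum>p\<in>B. v p \<cdot> (\<Sum>r\<in>B'. delta_R Q B' r p \<cdot> r))"
   by (simp add: d)
  also have "\<dots> = (\<Sum>r\<in>B'. (\<Sum>p\<in>B. v p \<cdot> delta_R Q B' r p) \<cdot> r)"
   unfolding pmul_right(6) pmul_left(6) pmul_assoc by (rule sum.swap)
  finally have "(\<Sum>p\<in>B. v p \<cdot> p) = \<dots>" .
  then show ?thesis
   unfolding Suc by (intro K_SucI[of B v "%p. p" l' _ B' "%r. \<Sum>p\<in>B. v p \<cdot> delta_R Q B' r p" "%r. r"])
    (use v b(1) B' compatible_basisD(4)[OF B'(1)] Suc in auto)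
 qed
 show "delta_R Q B p (\<Sum>p\<in>B. v p \<cdot> p) = v p"
  by (rule delta_R_eqI[OF B]) (use v in \<open>auto simp: is_coeff_R_def\<close>)
qed

end

section \<open>Quotients of algebras given by a basis\<close>

lemma ring_cong:
 assumes "ring R" "carrier S = carrier R" "monoid.mult S = monoid.mult R" "monoid.one S = monoid.one R"
  "ring.zero S = ring.zero R" "ring.add S = ring.add R"
 shows "ring S"
proof -
 interpret R: ring R by fact
 have inv: "\<exists>y\<in>carrier R. y \<oplus>\<^sub>R x = \<zero>\<^sub>R" if "x \<in> carrier R" for x
  using that by (intro bexI[of _ "\<ominus>\<^sub>R x"]) (auto simp: R.l_neg)
 have "abelian_group S"
  by (rule abelian_groupI) (simp_all add: assms(2-6) R.a_ac inv)
 moreover have "Group.monoid S"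
  by (rule monoidI) (simp_all add: assms(2-6) R.m_assoc)
 ultimately show ?thesis
  by (rule ringI) (simp_all add: assms(2-6) R.l_distr R.r_distr)
qed

definition amul :: "('x => 'x => ('x \<Rightarrow>\<^sub>0 'k::field)) => ('x \<Rightarrow>\<^sub>0 'k) => ('x \<Rightarrow>\<^sub>0 'k) => ('x \<Rightarrow>\<^sub>0 'k)" where
 "amul m f g = lin_ext (%x. lin_ext (m x) g) f"

lemma algebra_on_basis_simps [simp]:
 "carrier (algebra_on_basis X m u) = {f. keys f \<subseteq> X}"
 "monoid.mult (algebra_on_basis X m u) = amul m" "monoid.one (algebra_on_basis X m u) = u"
 "ring.zero (algebra_on_basis X m u) = 0" "ring.add (algebra_on_basis X m u) = (+)"
 "module.smult (algebra_on_basis X m u) = fscale"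
 by (auto simp: algebra_on_basis_def amul_def[abs_def])

lemma lin_amul_left: "Vector_Spaces.linear fscale fscale (%f. amul m f g)"
 unfolding amul_def by (rule linear_lin_ext)

lemma lin_amul_right: "Vector_Spaces.linear fscale fscale (%g. amul m f g)"
proof (rule linear_fscaleI)
 show "amul m f (g + h) = amul m f g + amul m f h" for g h
  by (simp add: amul_def lin_ext_add) (simp add: lin_ext_def fs.scale_right_distrib sum.distrib)
 show "amul m f (fscale c g) = fscale c (amul m f g)" for g c
  by (simp add: amul_def lin_ext_scale)
   (simp add: lin_ext_def fs.scale_sum_right mult.left_commute)
qed

lemmas amul_left = linD[OF lin_amul_left]
lemmas amul_right = linD[OF lin_amul_right]

lemma amul_single [simp]: "amul m (single x 1) (single y 1) = m x y"
 by (simp add: amul_def)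

text \<open>Associativity and the unit laws are multilinear, so they are checked on basis
  elements.\<close>

lemma ring_algebra_on_basis:
 fixes m :: "'x => 'x => ('x \<Rightarrow>\<^sub>0 'k::field)"
 assumes closed: "!!x y. x \<in> X ==> y \<in> X ==> keys (m x y) \<subseteq> X"
  and assoc: "!!x y z. x \<in> X ==> y \<in> X ==> z \<in> X ==>
   amul m (m x y) (single z 1) = amul m (single x 1) (m y z)"
  and u: "keys u \<subseteq> X"
   "!!x. x \<in> X ==> amul m u (single x 1) = single x 1"
   "!!x. x \<in> X ==> amul m (single x 1) u = single x 1"
 shows "ring (algebra_on_basis X m u)"
proof -
 have lid: "Vector_Spaces.linear fscale fscale (%x :: 'x \<Rightarrow>\<^sub>0 'k. x)" by (rule linear_fscaleI) simp_all
 have neg: "keys (- f) \<subseteq> X" if "keys f \<subseteq> X" for f :: "'x \<Rightarrow>\<^sub>0 'k"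
  using fs.subspace_neg[OF subspace_keys, of f X] that by simp
 have plus: "keys (f + g) \<subseteq> X" if "keys f \<subseteq> X" "keys g \<subseteq> X"
  for f g :: "'x \<Rightarrow>\<^sub>0 'k"
  using fs.subspace_add[OF subspace_keys, of f X g] that by simp
 have ab: "abelian_group (algebra_on_basis X m u)"
 proof (rule abelian_groupI, goal_cases)
  case (6 x) then show ?case by (intro bexI[of _ "- x"]) (auto simp: neg)
 qed (auto simp: plus ac_simps)
 have as: "amul m (amul m f g) h = amul m f (amul m g h)"
  if "keys f \<subseteq> X" "keys g \<subseteq> X" "keys h \<subseteq> X" for f g h
 proof (rule lin_eqI[OF linear_comp[OF lin_amul_left lin_amul_left] lin_amul_left])
  fix x assume x: "x \<in> keys f"
  show "amul m (amul m (single x 1) g) h = amul m (single x 1) (amul m g h)"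
  proof (rule lin_eqI[OF linear_comp[OF lin_amul_right lin_amul_left] linear_comp[OF lin_amul_left lin_amul_right]])
   fix y assume y: "y \<in> keys g"
   show "amul m (amul m (single x 1) (single y 1)) h =
    amul m (single x 1) (amul m (single y 1) h)"
   proof (rule lin_eqI[OF lin_amul_right linear_comp[OF lin_amul_right lin_amul_right]])
    fix z assume z: "z \<in> keys h"
    show "amul m (amul m (single x 1) (single y 1)) (single z 1) =
     amul m (single x 1) (amul m (single y 1) (single z 1))"
     using assoc[of x y z] x y z that by (simp add: subset_iff)
   qed
  qed
 qed
 have mon: "Group.monoid (algebra_on_basis X m u)"
 proof (rule monoidI, goal_cases)
  case (1 f g)
  then have "keys (amul m f g) \<subseteq> X"
   unfolding amul_def by (intro keys_lin_ext closed) auto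
  then show ?case by simp
 next
  case 2 then show ?case using u by simp
 next
  case (3 f g h) then show ?case using as by simp
 next
  case (4 f)
  have "amul m u f = f"
   by (rule lin_eqI[OF lin_amul_right lid]) (use 4 u(2) in auto)
  then show ?case by simp
 next
  case (5 f)
  have "amul m f u = f"
   by (rule lin_eqI[OF lin_amul_left lid]) (use 5 u(3) in auto)
  then show ?case by simp
 qed
 show ?thesis by (rule ringI[OF ab mon]) (auto simp: amul_left amul_right)
qed

lemma quot_simps:
 "carrier (quot A N) = a_rcosets\<^bsub>A\<^esub> N" "monoid.mult (quot A N) = rcoset_mult A N"
 "monoid.one (quot A N) = N +>\<^sub>A \<one>\<^sub>A" "ring.zero (quot A N) = N" "ring.add (quot A N) = set_add A"
 "module.smult (quot A N) = (%a X. \<Union>x\<in>X. N +>\<^sub>A (a \<odot>\<^sub>A x))"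
 by (simp_all add: quot_def ring.defs module.defs FactRing_def)

text \<open>What is factored out is a subspace, so that the locale covers the quadratic algebra as
  well as tensor products of spaces; \<open>algebra_ideal_quotient\<close> adds the products of
  cosets.\<close>

locale algebra_quotient =
 fixes A :: "('k::field, 'x \<Rightarrow>\<^sub>0 'k) module" and X m u and T :: "('x \<Rightarrow>\<^sub>0 'k) set"
 assumes A_def: "A = algebra_on_basis X m u" and subspace_T: "fs.subspace T"
begin

abbreviation cls where "cls f \<equiv> T +>\<^sub>A f"

lemma cls_conv: "cls f = (%t. t + f) ` T"
 by (auto simp: a_r_coset_def' A_def)

lemma cls_eq: "cls f = cls g \<longleftrightarrow> f - g \<in> T"
proof
 assume "cls f = cls g"
 then have "f \<in> cls g" unfolding cls_conv using fs.subspace_0[OF subspace_T] by force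
 then show "f - g \<in> T" by (auto simp: cls_conv)
next
 assume fg: "f - g \<in> T"
 have "t + f \<in> cls g" if "t \<in> T" for t
  unfolding cls_conv using fs.subspace_add[OF subspace_T that fg] by (intro image_eqI) auto
 moreover have "t + g \<in> cls f" if "t \<in> T" for t
  unfolding cls_conv using fs.subspace_diff[OF subspace_T that fg] by (intro image_eqI) auto
 ultimately show "cls f = cls g" unfolding cls_conv[of f] cls_conv[of g] cls_conv by (auto simp: cls_conv)
qed

lemma mem_cls: "f \<in> cls g \<longleftrightarrow> f - g \<in> T"
proof
 assume "f - g \<in> T"
 then have "(f - g) + g \<in> (%t. t + g) ` T" by (rule imageI)
 then show "f \<in> cls g" by (simp add: cls_conv)
qed (auto simp: cls_conv)

lemma cls_zero: "\<zero>\<^bsub>quot A T\<^esub> = cls 0"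
 by (auto simp: quot_simps cls_conv)

lemma cls_eq_zero: "cls f = \<zero>\<^bsub>quot A T\<^esub> \<longleftrightarrow> f \<in> T"
 by (simp add: cls_zero cls_eq)

lemma cls_add: "cls f \<oplus>\<^bsub>quot A T\<^esub> cls g = cls (f + g)"
proof
 show "cls f \<oplus>\<^bsub>quot A T\<^esub> cls g \<subseteq> cls (f + g)"
 proof
  fix x assume "x \<in> cls f \<oplus>\<^bsub>quot A T\<^esub> cls g"
  then obtain a b where "a \<in> cls f" "b \<in> cls g" "x = a + b"
   by (auto simp: quot_simps set_add_def' A_def)
  then have e: "x - (f + g) = (a - f) + (b - g)" and "a - f \<in> T" "b - g \<in> T" by (auto simp: mem_cls)
  then have "(a - f) + (b - g) \<in> T" using fs.subspace_add[OF subspace_T] by blast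
  then show "x \<in> cls (f + g)" unfolding mem_cls e .
 qed
 show "cls (f + g) \<subseteq> cls f \<oplus>\<^bsub>quot A T\<^esub> cls g"
 proof
  fix x assume x: "x \<in> cls (f + g)"
  then have "x - g \<in> cls f" by (simp add: mem_cls algebra_simps)
  moreover have "g \<in> cls g" using fs.subspace_0[OF subspace_T] by (simp add: mem_cls)
  moreover have "x = (x - g) \<oplus>\<^sub>A g" by (simp add: A_def)
  ultimately show "x \<in> cls f \<oplus>\<^bsub>quot A T\<^esub> cls g"
   unfolding quot_simps set_add_def' by blast
 qed
qed

lemma cls_smult: "c \<odot>\<^bsub>quot A T\<^esub> cls f = cls (fscale c f)"
proof -
 have c: "cls (fscale c x) = cls (fscale c f)" if "x \<in> cls f" for x
 proof -
  have "fscale c x - fscale c f = fscale c (x - f)" by (simp add: fs.scale_right_diff_distrib)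
  then show ?thesis using that fs.subspace_scale[OF subspace_T] by (simp add: cls_eq mem_cls)
 qed
 have "f \<in> cls f" using fs.subspace_0[OF subspace_T] by (simp add: mem_cls)
 then have ne: "cls f \<noteq> {}" by blast
 have "(\<Union>x\<in>cls f. cls (fscale c x)) = cls (fscale c f)"
  by (rule SUP_eq_const[OF ne c])
 moreover have "module.smult A = fscale" by (simp add: A_def)
 ultimately show ?thesis by (simp only: quot_simps)
qed

lemma cls_carrier: "carrier (quot A T) = cls ` {f. keys f \<subseteq> X}"
 by (auto simp: quot_simps A_RCOSETS_def' A_def)

lemma cls_one: "\<one>\<^bsub>quot A T\<^esub> = cls u"
 by (simp add: quot_simps A_def)

lemma carrierE:
 assumes "x \<in> carrier (quot A T)" obtains f where "x = cls f" "keys f \<subseteq> X"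
 using assms by (auto simp: cls_carrier)

lemma carrierI: "keys f \<subseteq> X ==> cls f \<in> carrier (quot A T)"
 by (auto simp: cls_carrier)

lemma abelian_group_quot: "abelian_group (quot A T)"
proof (rule abelian_groupI, goal_cases)
 case (1 x y)
 then show ?case
  by (elim carrierE) (simp add: cls_add carrierI fs.subspace_add[OF subspace_keys, simplified])
next
 case 2 then show ?case by (simp add: cls_zero carrierI)
next
 case (3 x y z) then show ?case by (elim carrierE) (simp add: cls_add ac_simps)
next
 case (4 x y) then show ?case by (elim carrierE) (simp add: cls_add ac_simps)
next
 case (5 x) then show ?case by (elim carrierE) (simp add: cls_add cls_zero)
next
 case (6 x)
 then obtain f where f: "x = cls f" "keys f \<subseteq> X" by (rule carrierE)
 then have "cls (- f) \<in> carrier (quot A T)" using fs.subspace_neg[OF subspace_keys, of f X] carrierI by simp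
 moreover have "cls (- f) \<oplus>\<^bsub>quot A T\<^esub> x = \<zero>\<^bsub>quot A T\<^esub>" by (simp add: f cls_add cls_zero)
 ultimately show ?case by blast
qed

lemma cls_finsum:
 assumes "finite I" "!!i. i \<in> I ==> keys (f i) \<subseteq> X"
 shows "finsum (quot A T) (%i. cls (f i)) I = cls (\<Sum>i\<in>I. f i)"
 using assms
proof (induction I rule: finite_induct)
 interpret abelian_group "quot A T" by (rule abelian_group_quot)
 case empty show ?case by (simp add: cls_zero)
next
 interpret abelian_group "quot A T" by (rule abelian_group_quot)
 case (insert i I)
 then have "(%i. cls (f i)) \<in> I \<rightarrow> carrier (quot A T)" "cls (f i) \<in> carrier (quot A T)"
  using carrierI by auto
 then show ?case using insert by (simp add: finsum_insert cls_add)
qed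

end

locale algebra_ideal_quotient = algebra_quotient +
 assumes ideal_T: "ideal T A"
begin

lemma cls_mult:
 assumes "keys f \<subseteq> X" "keys g \<subseteq> X"
 shows "cls f \<otimes>\<^bsub>quot A T\<^esub> cls g = cls (f \<otimes>\<^sub>A g)"
 unfolding quot_simps by (rule ideal.rcoset_mult_add[OF ideal_T]) (use assms in \<open>auto simp: A_def\<close>)

lemma ring_quot: "ring (quot A T)"
 by (rule ring_cong[OF ideal.quotient_is_ring[OF ideal_T]]) (simp_all add: quot_simps FactRing_def)

end

section \<open>The quadratic algebra and its grading\<close>

context quadratic_quiver
begin

lemma path_algebra_conv: "kQ = algebra_on_basis (paths Q) pcomp (\<Sum>v\<in>verts Q. vx v)"
 by (simp add: path_algebra_def pcomp_def[abs_def])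

lemma keys_sum:
 fixes f :: "'i => 'x \<Rightarrow>\<^sub>0 'k"
 shows "(!!i. i \<in> I ==> keys (f i) \<subseteq> X) ==> keys (\<Sum>i\<in>I. f i) \<subseteq> X"
 using fs.subspace_sum[OF subspace_keys, of I f X] by simp

lemma keys_scale: "keys f \<subseteq> X ==> keys (fscale (c :: 'k) f) \<subseteq> X"
 using fs.subspace_scale[OF subspace_keys, of f X c] by simp

lemma pmul_paths:
 assumes "in_kQ f" "in_kQ g"
 shows "in_kQ (f \<cdot> g)"
 using pmul_closed[OF assms] by blast

lemma V_paths: "f \<in> V l ==> in_kQ f"
 by (auto simp: path_part_def)

lemma vx_paths: "i \<in> verts Q ==> in_kQ (vx i)"
 by (rule V_paths[OF vx_V])

lemma amul_pcomp: "amul pcomp = (\<cdot>)"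
 by (simp add: amul_def[abs_def] pmul_conv[abs_def])

lemma ring_kQ: "ring kQ"
 unfolding path_algebra_conv
proof (rule ring_algebra_on_basis)
 fix p q assume pq: "p \<in> paths Q" "q \<in> paths Q"
 show "in_kQ (pcomp p q)"
  using pmul_paths[of "psingle p" "psingle q"] pq by simp
next
 fix p q r :: "'v \<times> 'a list"
 show "amul pcomp (pcomp p q) (psingle r) = amul pcomp (psingle p) (pcomp q r)"
  using pmul_assoc[of "psingle p" "psingle q" "psingle r"] by (simp add: amul_pcomp)
next
 show "in_kQ (\<Sum>v\<in>verts Q. vx v)" by (rule keys_sum) (rule vx_paths)
next
 fix p assume p: "p \<in> paths Q"
 show "amul pcomp (\<Sum>v\<in>verts Q. vx v) (psingle p) = psingle p"
  using sum_vx_left[of "psingle p"] p by (simp add: amul_pcomp pmul_left)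
 show "amul pcomp (psingle p) (\<Sum>v\<in>verts Q. vx v) = psingle p"
  using sum_vx_right[of "psingle p"] p by (simp add: amul_pcomp pmul_right)
qed

lemma kQ_simps: "carrier kQ = {f. in_kQ f}" "ring.zero kQ = 0" "ring.add kQ = (+)"
 "monoid.one kQ = (\<Sum>v\<in>verts Q. vx v)"
 by (simp_all add: path_algebra_conv)

lemma ideal_kQ_I:
 assumes "fs.subspace J" "!!x. x \<in> J ==> in_kQ x"
  "!!x y. x \<in> J ==> in_kQ y ==> y \<cdot> x \<in> J \<and> x \<cdot> y \<in> J"
 shows "ideal J kQ"
proof (rule idealI[OF ring_kQ])
 interpret kQ: ring kQ by (rule ring_kQ)
 have inv: "\<ominus>\<^sub>kQ a \<in> J" if a: "a \<in> J" for a
 proof -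
  have "\<ominus>\<^sub>kQ a = - a"
   by (rule kQ.minus_equality)
    (use assms(2)[OF a] fs.subspace_neg[OF subspace_keys, of a "paths Q"] in \<open>simp_all add: kQ_simps\<close>)
  then show ?thesis using fs.subspace_neg[OF assms(1) a] by simp
 qed
 show "subgroup J (add_monoid kQ)"
  by (rule kQ.add.subgroupI)
   (use assms(2) inv fs.subspace_0[OF assms(1)] fs.subspace_add[OF assms(1)] in \<open>auto simp: kQ_simps\<close>)
qed (use assms(3) in \<open>auto simp: kQ_simps\<close>)

abbreviation I where "I \<equiv> qideal Q M"
abbreviation \<A> where "\<A> \<equiv> qalg Q M"
abbreviation cl where "cl \<equiv> qcls Q M"

lemma M_carrier: "M \<subseteq> carrier kQ"
 using M_sub(2) V_paths by (auto simp: kQ_simps)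

lemma ideal_I: "ideal I kQ"
 unfolding qideal_def by (rule ring.genideal_ideal[OF ring_kQ M_carrier])

lemma I_minimal: "ideal J kQ ==> M \<subseteq> J ==> I \<subseteq> J"
 unfolding qideal_def by (rule ring.genideal_minimal[OF ring_kQ])

lemma M_I: "M \<subseteq> I"
 unfolding qideal_def by (rule ring.genideal_self[OF ring_kQ M_carrier])

lemma I_paths: "x \<in> I ==> in_kQ x"
 using additive_subgroup.a_subset[OF ideal.axioms(1)[OF ideal_I]] by (auto simp: kQ_simps)

lemma I_mult:
 assumes "x \<in> I" "in_kQ y" shows "y \<cdot> x \<in> I" "x \<cdot> y \<in> I"
 using ideal.I_l_closed[OF ideal_I assms(1)] ideal.I_r_closed[OF ideal_I assms(1)] assms(2)
 by (auto simp: kQ_simps)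

text \<open>\<open>I\<close> is generated as an ideal of a ring. It is closed under a scalar c
  because c acts as multiplication by c times the unit, an element of kQ.\<close>

lemma subspace_I: "fs.subspace I"
proof -
 interpret ideal I kQ by (rule ideal_I)
 have "fscale c x \<in> I" if x: "x \<in> I" for c x
 proof -
  have "(\<Sum>v\<in>verts Q. vx v) \<cdot> x = x" using sum_vx_left[OF I_paths[OF x]] by (simp only: pmul_left)
  then have e: "fscale c (\<Sum>v\<in>verts Q. vx v) \<cdot> x = fscale c x" by (simp only: pmul_left(2))
  have "in_kQ (fscale c (\<Sum>v\<in>verts Q. vx v))"
   by (rule keys_scale[OF keys_sum[OF vx_paths]])
  from I_mult(1)[OF x this] show ?thesis unfolding e .
 qed
 moreover have "0 \<in> I" using additive_subgroup.zero_closed[OF ideal.axioms(1)[OF ideal_I]] by (simp add: kQ_simps)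
 moreover have "x + y \<in> I" if "x \<in> I" "y \<in> I" for x y
  using additive_subgroup.a_closed[OF ideal.axioms(1)[OF ideal_I] that] by (simp add: kQ_simps)
 ultimately show ?thesis by (auto simp: fs.subspace_def)
qed

sublocale qa: algebra_ideal_quotient kQ "paths Q" pcomp "\<Sum>v\<in>verts Q. vx v" I
 by (intro algebra_ideal_quotient.intro algebra_quotient.intro algebra_ideal_quotient_axioms.intro)
  (rule path_algebra_conv subspace_I ideal_I)+

lemma qa_conv: "quot kQ I = \<A>" "I +>\<^sub>kQ f = cl f"
 by (simp_all add: qalg_def qcls_def)

lemmas cl_eq = qa.cls_eq[unfolded qa_conv]
 and cl_zero = qa.cls_zero[unfolded qa_conv]
 and cl_eq_zero = qa.cls_eq_zero[unfolded qa_conv]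
 and cl_add = qa.cls_add[unfolded qa_conv]
 and cl_smult = qa.cls_smult[unfolded qa_conv]
 and cl_carrier = qa.cls_carrier[unfolded qa_conv]
 and cl_one = qa.cls_one[unfolded qa_conv]
 and clI = qa.carrierI[unfolded qa_conv]
 and clE = qa.carrierE[unfolded qa_conv]
 and cl_finsum = qa.cls_finsum[unfolded qa_conv]
 and cl_mult = qa.cls_mult[unfolded qa_conv]
 and ring_\<A> = qa.ring_quot[unfolded qa_conv]

sublocale L: ring \<A> by (rule ring_\<A>)

section \<open>Homogeneous components, and the degrees in which relations live\<close>

definition dcomp :: "nat => ('v, 'a, 'k) path_elem => ('v, 'a, 'k) path_elem" where
 "dcomp m = lin_ext (%p. if plen p = m then psingle p else 0)"

lemma lookup_dcomp: "lookup (dcomp m f) p = (if plen p = m then lookup f p else 0)"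
proof -
 have "lookup (dcomp m f) p =
   (\<Sum>x\<in>keys f. if x = p then if plen p = m then lookup f p else 0 else 0)"
  unfolding dcomp_def lookup_lin_ext by (rule sum.cong) (auto simp: lookup_single when_def)
 then show ?thesis by (simp add: in_keys_iff)
qed

lemma lin_dcomp: "lin (dcomp m)"
 unfolding dcomp_def by (rule linear_lin_ext)

lemma dcomp_V: "in_kQ f ==> dcomp m f \<in> V m"
 by (auto simp: path_part_def in_keys_iff lookup_dcomp split: if_splits)

lemma dcomp_of_V: "f \<in> V l ==> dcomp m f = (if m = l then f else 0)"
 by (rule poly_mapping_eqI) (use V_keys[of f l] in \<open>force simp: lookup_dcomp in_keys_iff\<close>)

lemma dcomp_mult: "dcomp m (f \<cdot> g) = (\<Sum>a\<le>m. dcomp a f \<cdot> dcomp (m - a) g)"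
proof (rule lin_eqI[of "%f. dcomp m (f \<cdot> g)"])
 show "lin (%f. dcomp m (f \<cdot> g))" by (rule linear_comp[OF lin_pmul_left lin_dcomp])
 show "lin (%f. \<Sum>a\<le>m. dcomp a f \<cdot> dcomp (m - a) g)"
  by (rule linear_fscaleI)
   (simp_all add: linD[OF lin_dcomp] pmul_left sum.distrib fs.scale_sum_right)
 fix p
 show "dcomp m (psingle p \<cdot> g) = (\<Sum>a\<le>m. dcomp a (psingle p) \<cdot> dcomp (m - a) g)"
 proof (rule lin_eqI[of "%g. dcomp m (psingle p \<cdot> g)"])
  show "lin (%g. dcomp m (psingle p \<cdot> g))" by (rule linear_comp[OF lin_pmul_right lin_dcomp])
  show "lin (%g. \<Sum>a\<le>m. dcomp a (psingle p) \<cdot> dcomp (m - a) g)"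
   by (rule linear_fscaleI)
    (simp_all add: linD[OF lin_dcomp] pmul_right sum.distrib fs.scale_sum_right)
  fix q :: "'v \<times> 'a list"
  have "(\<Sum>a\<le>m. dcomp a (psingle p) \<cdot> dcomp (m - a) (psingle q)) =
   (\<Sum>a\<le>m. if a = plen p then if plen p + plen q = m then pcomp p q else 0 else 0)"
   by (rule sum.cong) (auto simp: dcomp_def pmul_left pmul_right)
  then show "dcomp m (psingle p \<cdot> psingle q) = (\<Sum>a\<le>m. dcomp a (psingle p) \<cdot> dcomp (m - a) (psingle q))"
   by (auto simp: dcomp_def pcomp_def linD[OF linear_lin_ext])
 qed
qed

text \<open>The elements of \<open>I\<close> all of whose components lie in \<open>I\<close> form an
  ideal that contains the homogeneous set M, so minimality of the generated ideal applies.\<close>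

lemma I_dcomp: "x \<in> I ==> dcomp m x \<in> I"
proof -
 have "I \<subseteq> {x \<in> I. \<forall>m. dcomp m x \<in> I}"
 proof (rule I_minimal[OF ideal_kQ_I])
  show "fs.subspace {x \<in> I. \<forall>m. dcomp m x \<in> I}"
   using subspace_I by (auto simp: fs.subspace_def linD[OF lin_dcomp])
  fix x y :: "('v, 'a, 'k) path_elem" assume x: "x \<in> {x \<in> I. \<forall>m. dcomp m x \<in> I}" and y: "in_kQ y"
  have "dcomp m (y \<cdot> x) \<in> I" for m
   unfolding dcomp_mult
   by (rule fs.subspace_sum[OF subspace_I], rule I_mult(1)[OF _ V_paths[OF dcomp_V[OF y]]]) (use x in blast)
  moreover have "dcomp m (x \<cdot> y) \<in> I" for m
   unfolding dcomp_mult
   by (rule fs.subspace_sum[OF subspace_I], rule I_mult(2)[OF _ V_paths[OF dcomp_V[OF y]]]) (use x in blast)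
  ultimately show "y \<cdot> x \<in> {x \<in> I. \<forall>m. dcomp m x \<in> I} \<and> x \<cdot> y \<in> {x \<in> I. \<forall>m. dcomp m x \<in> I}"
   using I_mult[OF _ y] x by blast
 next
  show "M \<subseteq> {x \<in> I. \<forall>m. dcomp m x \<in> I}"
  proof
   fix x assume x: "x \<in> M"
   then have "x \<in> V 2" "x \<in> I" using M_sub(2) M_I by blast+
   then show "x \<in> {x \<in> I. \<forall>m. dcomp m x \<in> I}" using fs.subspace_0[OF subspace_I] by (simp add: dcomp_of_V)
  qed
 qed (use I_paths in blast)
 then show "x \<in> I ==> dcomp m x \<in> I" by blast
qed

text \<open>Again by minimality: \<open>J\<close> is an ideal because the component of degree 2 of a
  product with an element of \<open>J\<close> only involves the degree-0 part of the other factor,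
  and M is stable under vertices.\<close>

lemma I_low: "x \<in> I ==> dcomp 0 x = 0" "x \<in> I ==> dcomp 1 x = 0" "x \<in> I ==> dcomp 2 x \<in> M"
proof -
 define J where "J = {x. in_kQ x \<and> dcomp 0 x = 0 \<and> dcomp 1 x = 0 \<and> dcomp 2 x \<in> M}"
 have "I \<subseteq> J"
 proof (rule I_minimal[OF ideal_kQ_I])
  show "fs.subspace J" unfolding fs.subspace_def
  proof (intro conjI ballI allI)
   show "0 \<in> J" by (simp add: J_def linD[OF lin_dcomp] fs.subspace_0[OF M_sub(1)])
   fix x y assume x: "x \<in> J" and y: "y \<in> J"
   then have "in_kQ (x + y)" using keys_add[of x y] unfolding J_def by blast
   then show "x + y \<in> J"
    using x y by (simp add: J_def linD[OF lin_dcomp] fs.subspace_add[OF M_sub(1)])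
  next
   fix c x assume x: "x \<in> J"
   then have "in_kQ (fscale c x)" using keys_scale[of x] unfolding J_def by blast
   then show "fscale c x \<in> J"
    using x by (simp add: J_def linD[OF lin_dcomp] fs.subspace_scale[OF M_sub(1)])
  qed
  fix x y :: "('v, 'a, 'k) path_elem" assume x: "x \<in> J" and y: "in_kQ y"
  have *: "{..1::nat} = {0, 1}" "{..2::nat} = {0, 1, 2}" by auto
  have x': "in_kQ x" "dcomp 0 x = 0" "dcomp 1 x = 0" "dcomp 2 x \<in> M"
   using x unfolding J_def by blast+
  have "dcomp 2 (y \<cdot> x) = dcomp 0 y \<cdot> dcomp 2 x" "dcomp 2 (x \<cdot> y) = dcomp 2 x \<cdot> dcomp 0 y"
   using x'(2,3) by (simp_all add: dcomp_mult * pmul_left(3) pmul_right(3))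
  moreover have "dcomp 1 (y \<cdot> x) = 0" "dcomp 1 (x \<cdot> y) = 0" "dcomp 0 (y \<cdot> x) = 0" "dcomp 0 (x \<cdot> y) = 0"
   using x'(2,3) by (simp_all add: dcomp_mult * pmul_left(3) pmul_right(3))
  ultimately show "y \<cdot> x \<in> J \<and> x \<cdot> y \<in> J"
   unfolding J_def using pmul_paths[OF y x'(1)] pmul_paths[OF x'(1) y] M_sub(3,4)[OF dcomp_V[OF y] x'(4)]
   by simp
 next
  show "M \<subseteq> J"
  proof
   fix x assume x: "x \<in> M"
   then have "x \<in> V 2" using M_sub(2) by blast
   then show "x \<in> J" using x V_paths unfolding J_def by (simp add: dcomp_of_V)
  qed
 qed (auto simp: J_def)
 then show "x \<in> I ==> dcomp 0 x = 0" "x \<in> I ==> dcomp 1 x = 0" "x \<in> I ==> dcomp 2 x \<in> M"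
  unfolding J_def by blast+
qed

lemma cl_inj_low: "f \<in> V l ==> g \<in> V l ==> l \<le> 1 ==> cl f = cl g ==> f = g"
proof -
 assume a: "f \<in> V l" "g \<in> V l" "l \<le> 1" "cl f = cl g"
 then have "dcomp l (f - g) = 0" using I_low(1,2)[of "f - g"] by (cases l) (auto simp: cl_eq)
 then show ?thesis using a by (simp add: linD[OF lin_dcomp] dcomp_of_V)
qed

lemma cl_V2_zero: "f \<in> V 2 ==> cl f = \<zero>\<^sub>\<A> \<longleftrightarrow> f \<in> M"
 using I_low(3)[of f] M_I by (auto simp: cl_eq_zero dcomp_of_V)

lemma cl_mult_V: "f \<in> V k ==> g \<in> V l ==> cl f \<otimes>\<^sub>\<A> cl g = cl (f \<cdot> g)"
 by (rule cl_mult) (auto dest: V_paths)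

text \<open>The k-th power of the ideal generated by the arrows, described through
  representatives.\<close>

definition rad :: "nat => ('v, 'a, 'k) path_elem set set" where
 "rad k = cl ` {f. keys f \<subseteq> {p \<in> paths Q. plen p \<ge> k}}"

lemma rad_carrier: "rad k \<subseteq> carrier \<A>"
 unfolding rad_def cl_carrier by auto

lemma rad_add: "x \<in> rad k ==> y \<in> rad k ==> x \<oplus>\<^sub>\<A> y \<in> rad k"
proof -
 assume "x \<in> rad k" "y \<in> rad k"
 then obtain f g where "x = cl f" "y = cl g" "f \<in> {f. keys f \<subseteq> {p \<in> paths Q. plen p \<ge> k}}"
  "g \<in> {f. keys f \<subseteq> {p \<in> paths Q. plen p \<ge> k}}" unfolding rad_def by blast
 moreover from this have "f + g \<in> {f. keys f \<subseteq> {p \<in> paths Q. plen p \<ge> k}}"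
  by (intro fs.subspace_add[OF subspace_keys])
 ultimately show ?thesis unfolding rad_def by (simp only: cl_add imageI)
qed

lemma rad_zero: "\<zero>\<^sub>\<A> \<in> rad k"
 unfolding rad_def cl_zero by (rule imageI) simp

lemma rad_mult: "x \<in> rad k ==> y \<in> rad l ==> x \<otimes>\<^sub>\<A> y \<in> rad (k + l)"
proof -
 assume "x \<in> rad k" "y \<in> rad l"
 then obtain f g where f: "x = cl f" "keys f \<subseteq> {p \<in> paths Q. plen p \<ge> k}"
  and g: "y = cl g" "keys g \<subseteq> {p \<in> paths Q. plen p \<ge> l}" by (auto simp: rad_def)
 have fg: "in_kQ f" "in_kQ g" using f g by auto
 have "keys (f \<cdot> g) \<subseteq> {p \<in> paths Q. plen p \<ge> k + l}"
 proof
  fix r assume "r \<in> keys (f \<cdot> g)"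
  then obtain p q where "r \<in> paths Q" "p \<in> keys f" "q \<in> keys g"
   "plen r = plen p + plen q" using pmul_closed[OF fg] by blast
  moreover have "k \<le> plen p" "l \<le> plen q" using calculation f(2) g(2) by auto
  ultimately show "r \<in> {p \<in> paths Q. plen p \<ge> k + l}" by simp
 qed
 then show ?thesis unfolding rad_def f(1) g(1) cl_mult[OF fg] by (rule imageI[OF CollectI])
qed

lemma rad_all: "rad 0 = carrier \<A>"
 by (simp add: rad_def cl_carrier)

lemma rad_vx: "i \<in> verts Q ==> cl (vx i) \<notin> rad 1"
proof
 assume i: "i \<in> verts Q" and "cl (vx i) \<in> rad 1"
 then obtain f where f: "cl (vx i) = cl f" "keys f \<subseteq> {p \<in> paths Q. plen p \<ge> 1}"
  by (auto simp: rad_def)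
 then have "dcomp 0 (vx i - f) = 0" using I_low(1) by (simp add: cl_eq)
 moreover have "dcomp 0 f = 0"
 proof (rule poly_mapping_eqI)
  fix p
  have "plen p = 0 ==> p \<notin> keys f" using f(2) by auto
  then show "lookup (dcomp 0 f) p = lookup 0 p" by (simp add: lookup_dcomp in_keys_iff)
 qed
 ultimately have "vx i = 0" using vx_V[OF i] by (simp add: linD[OF lin_dcomp] dcomp_of_V)
 then have "lookup (vx i) (i, []) = 0" by simp
 then show False by (simp add: vertex_idem_def)
qed

end

section \<open>Finite-dimensional quadratic algebras\<close>

locale fd_quadratic_quiver = quadratic_quiver Q M
 for Q :: "('v, 'a) pre_digraph" and M :: "('v, 'a, 'k::field) path_elem set" +
 assumes fd: "fin_dim (qalg Q M)"
begin

text \<open>The representatives of a finite spanning set have bounded length. A longer path is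
  congruent to a combination of them, and the component of this congruence in the degree of the path
  is the path itself, so the path lies in \<open>I\<close>.\<close>

lemma high_degree_vanishes: "\<exists>N. \<forall>f. keys f \<subseteq> {p \<in> paths Q. plen p \<ge> N} --> f \<in> I"
proof -
 obtain X where X: "finite X" "X \<subseteq> carrier \<A>"
  "!!a. a \<in> carrier \<A> ==> \<exists>c. a = finsum \<A> (%x. c x \<odot>\<^sub>\<A> x) X"
  using fd by (auto simp: fin_dim_def)
 have "\<forall>x\<in>X. \<exists>f. x = cl f \<and> in_kQ f" using X(2) clE by blast
 then obtain r where r: "!!x. x \<in> X ==> x = cl (r x)" "!!x. x \<in> X ==> in_kQ (r x)"
  by metis
 \<comment> \<open>One more than the largest length that occurs in a representative; the 0 keeps the
   maximum defined when there are no paths at all.\<close>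
 define N where "N = Suc (Max ({0} \<union> (%p. plen p) ` (\<Union>x\<in>X. keys (r x))))"
 have len: "plen p < N" if "x \<in> X" "p \<in> keys (r x)" for x p
  unfolding N_def using X(1) that by (auto simp: less_Suc_eq_le intro!: Max_ge)
 have single: "psingle p \<in> I" if p: "p \<in> paths Q" "plen p \<ge> N" for p
 proof -
  obtain c where "cl (psingle p) = finsum \<A> (%x. c x \<odot>\<^sub>\<A> x) X"
   using X(3)[OF clI[of "psingle p"]] p by auto
  also have "\<dots> = finsum \<A> (%x. cl (fscale (c x) (r x))) X"
  proof (rule L.finsum_cong')
   show "(%x. cl (fscale (c x) (r x))) \<in> X \<rightarrow> carrier \<A>" using r(2) by (auto intro!: clI keys_scale)
   show "c x \<odot>\<^sub>\<A> x = cl (fscale (c x) (r x))" if "x \<in> X" for x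
    using cl_smult[of "c x" "r x"] r(1)[OF that] by simp
  qed simp
  also have "\<dots> = cl (\<Sum>x\<in>X. fscale (c x) (r x))"
   by (rule cl_finsum[OF X(1)]) (rule keys_scale[OF r(2)])
  finally have "psingle p - (\<Sum>x\<in>X. fscale (c x) (r x)) \<in> I" by (simp add: cl_eq)
  then have "dcomp (plen p) (psingle p - (\<Sum>x\<in>X. fscale (c x) (r x))) \<in> I" by (rule I_dcomp)
  moreover have "dcomp (plen p) (r x) = 0" if "x \<in> X" for x
   by (rule poly_mapping_eqI) (use len[OF that] p(2) in \<open>force simp: lookup_dcomp in_keys_iff\<close>)
  moreover have "dcomp (plen p) (psingle p) = psingle p"
   by (rule dcomp_of_V[THEN trans]) (use p in \<open>auto simp: path_part_def\<close>)
  ultimately show ?thesis by (simp add: linD[OF lin_dcomp])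
 qed
 have "f \<in> I" if f: "keys f \<subseteq> {p \<in> paths Q. plen p \<ge> N}" for f :: "('v, 'a, 'k) path_elem"
  by (subst poly_mapping_expand, rule fs.subspace_sum[OF subspace_I], rule fs.subspace_scale[OF subspace_I], rule single)
   (use f in auto)
 then show ?thesis by blast
qed

definition ht :: nat where
 "ht = (SOME N. \<forall>f. keys f \<subseteq> {p \<in> paths Q. plen p \<ge> N} --> f \<in> I)"

lemma ht: "keys f \<subseteq> {p \<in> paths Q. plen p \<ge> ht} ==> f \<in> I"
 using someI_ex[OF high_degree_vanishes] unfolding ht_def by blast

lemma rad_ht: "rad ht = {\<zero>\<^sub>\<A>}"
proof -
 have "x = \<zero>\<^sub>\<A>" if x: "x \<in> rad ht" for x
 proof -
  obtain f where f: "x = cl f" "keys f \<subseteq> {p \<in> paths Q. plen p \<ge> ht}"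
   using x unfolding rad_def by blast
  show ?thesis unfolding f(1) cl_eq_zero by (rule ht[OF f(2)])
 qed
 then show ?thesis using rad_zero by blast
qed

text \<open>The homogeneous component of a residue class, computed from an arbitrary representative.
  Homogeneity of \<open>I\<close> makes the choice irrelevant.\<close>

definition lcomp :: "nat => ('v, 'a, 'k) path_elem set => ('v, 'a, 'k) path_elem set" where
 "lcomp m X = cl (dcomp m (SOME f. f \<in> X))"

lemma lcomp_cl: "lcomp m (cl f) = cl (dcomp m f)"
proof -
 have "f \<in> cl f" using qa.mem_cls[of f f] fs.subspace_0[OF subspace_I] by (simp add: qa_conv)
 then have "(SOME g. g \<in> cl f) \<in> cl f" by (rule someI[of "%g. g \<in> cl f"])
 then have "(SOME g. g \<in> cl f) - f \<in> I" using qa.mem_cls[of _ f] by (simp add: qa_conv)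
 from I_dcomp[OF this] show ?thesis by (simp add: lcomp_def cl_eq linD[OF lin_dcomp])
qed

lemma lcomp_V: "a \<in> carrier \<A> ==> lcomp m a \<in> cl ` V m"
 by (auto elim!: clE simp: lcomp_cl dcomp_V)

lemma lcomp_closed: "a \<in> carrier \<A> ==> lcomp m a \<in> carrier \<A>"
 by (auto elim!: clE simp: lcomp_cl intro!: clI V_paths[OF dcomp_V])

lemma clV_carrier: "cl ` V m \<subseteq> carrier \<A>"
 using V_paths by (auto intro!: clI)

lemma lcomp_vertex:
 assumes "a \<in> carrier \<A>" "i \<in> verts Q" "a \<otimes>\<^sub>\<A> cl (vx i) = a"
 shows "lcomp m a \<otimes>\<^sub>\<A> cl (vx i) = lcomp m a"
proof -
 obtain f where f: "a = cl f" "in_kQ f" using assms(1) by (rule clE)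
 have d: "dcomp m (f \<cdot> vx i) = dcomp m f \<cdot> vx i"
  by (rule poly_mapping_eqI) (simp add: lookup_dcomp lookup_vx_right)
 have "lcomp m a \<otimes>\<^sub>\<A> cl (vx i) = cl (dcomp m f \<cdot> vx i)"
  unfolding f lcomp_cl by (rule cl_mult_V[OF dcomp_V[OF f(2)] vx_V[OF assms(2)]])
 also have "\<dots> = lcomp m (cl f \<otimes>\<^sub>\<A> cl (vx i))"
  by (simp add: cl_mult[OF f(2) vx_paths[OF assms(2)]] lcomp_cl d)
 finally show ?thesis using assms(3) f by simp
qed

lemma lcomp_zero_rad: "a \<in> carrier \<A> ==> lcomp 0 a = \<zero>\<^sub>\<A> ==> a \<in> rad 1"
proof -
 assume a: "a \<in> carrier \<A>" "lcomp 0 a = \<zero>\<^sub>\<A>"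
 obtain f where f: "a = cl f" "in_kQ f" using a(1) by (rule clE)
 then have "dcomp 0 f \<in> I" using a(2) by (simp add: lcomp_cl cl_eq_zero)
 then have "a = cl (f - dcomp 0 f)" by (simp add: f cl_eq)
 moreover have "keys (f - dcomp 0 f) \<subseteq> {p \<in> paths Q. plen p \<ge> 1}"
 proof
  fix p assume "p \<in> keys (f - dcomp 0 f)"
  then have "p \<in> keys f \<and> snd p \<noteq> []"
   by (auto simp: in_keys_iff lookup_minus lookup_dcomp split: if_splits)
  then show "p \<in> {p \<in> paths Q. plen p \<ge> 1}" using f(2) by (cases "snd p") auto
 qed
 ultimately show ?thesis unfolding rad_def by blast
qed

text \<open>The summation index is an internal degree: a coefficient of degree m in front of an
  element of K_l has internal degree l + m. Nothing is lost by stopping before l +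
  \<open>ht\<close>.\<close>

lemma lcomp_sum:
 assumes "a \<in> carrier \<A>"
 shows "a = finsum \<A> (%i. lcomp (nat (i - int l)) a) {int l..<int l + int ht}"
proof -
 obtain f where f: "a = cl f" "in_kQ f" using assms by (rule clE)
 let ?A = "{int l..<int l + int ht}"
 let ?s = "\<Sum>i\<in>?A. dcomp (nat (i - int l)) f"
 have s: "lookup ?s p = (if plen p < ht then lookup f p else 0)" for p
 proof -
  have "lookup ?s p = (\<Sum>i\<in>?A. if i = int l + int (plen p) then lookup f p else 0)"
   unfolding lookup_sum by (rule sum.cong) (auto simp: lookup_dcomp)
  also have "\<dots> = (if plen p < ht then lookup f p else 0)" by simp
  finally show ?thesis .
 qed
 have "keys (f - ?s) \<subseteq> {p \<in> paths Q. plen p \<ge> ht}"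
 proof
  fix p assume "p \<in> keys (f - ?s)"
  then have "p \<in> keys f \<and> \<not> plen p < ht"
   by (auto simp: in_keys_iff lookup_minus s split: if_splits)
  then show "p \<in> {p \<in> paths Q. plen p \<ge> ht}" using f(2) by auto
 qed
 then have "cl f = cl ?s" using ht by (simp add: cl_eq)
 also have "\<dots> = finsum \<A> (%i. cl (dcomp (nat (i - int l)) f)) ?A"
  by (rule cl_finsum[symmetric]) (auto intro!: V_paths[OF dcomp_V[OF f(2)]] simp del: subset_iff)
 finally show ?thesis unfolding f(1) lcomp_cl .
qed

text \<open>A basis C of \<open>I\<close> is extended by paths to a basis of kQ; the added paths
  form a basis modulo \<open>I\<close>. Because the basis consists of paths, each of its elements
  has a length and an end vertex, on which the filtration argument depends.\<close>

lemma path_basis_exists: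
 "\<exists>N \<subseteq> paths Q. (\<forall>f. in_kQ f --> (\<exists>g. keys g \<subseteq> N \<and> f - g \<in> I)) \<and>
   (\<forall>g. keys g \<subseteq> N --> g \<in> I --> g = 0)"
proof -
 obtain C where C: "C \<subseteq> I" "fs.independent C" "I \<subseteq> fs.span C"
  by (rule fs.maximal_independent_subset)
 let ?S = "C \<union> psingle ` paths Q"
 obtain D where D: "C \<subseteq> D" "D \<subseteq> ?S" "fs.independent D" "?S \<subseteq> fs.span D"
  using fs.maximal_independent_subset_extend[OF _ C(2), of ?S] by blast
 define N where "N = {p \<in> paths Q. psingle p \<in> D - C}"
 have sC: "fs.span C \<subseteq> I" by (rule fs.span_minimal[OF C(1) subspace_I])
 have DN: "D = C \<union> psingle ` N" using D(1,2) unfolding N_def by blast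
 have "\<exists>g. keys g \<subseteq> N \<and> f - g \<in> I" if f: "in_kQ f" for f
 proof -
  have "f \<in> fs.span ?S"
   by (subst poly_mapping_expand, rule fs.span_sum, rule fs.span_scale, rule fs.span_base) (use f in auto)
  also have "fs.span ?S \<subseteq> fs.span D" using D(4) by (simp add: fs.span_minimal)
  finally have "f \<in> fs.span (C \<union> psingle ` N)" unfolding DN .
  then obtain x g where xg: "f = x + g" "x \<in> fs.span C" "g \<in> fs.span (psingle ` N)"
   unfolding fs.span_Un by blast
  have "fs.span (psingle ` N) \<subseteq> {g. keys g \<subseteq> N}"
   by (rule fs.span_minimal[OF _ subspace_keys]) auto
  then show ?thesis using xg sC by (intro exI[of _ g]) auto
 qed
 moreover have "g = 0" if g: "keys g \<subseteq> N" "g \<in> I" for g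
 proof (rule poly_mapping_eqI)
  fix p
  have gC: "g \<in> fs.span C" using C(3) g(2) by blast
  show "lookup g p = lookup 0 p"
  proof (cases "p \<in> N")
   case True
   have inj: "inj psingle"
    by (rule injI) (metis keys_single singletonD singletonI zero_neq_one)
   have "fs.representation D g (psingle p) = (\<Sum>x\<in>keys g. lookup g x * fs.representation D (psingle x) (psingle p))"
   proof -
    have "psingle x \<in> fs.span D" if "x \<in> keys g" for x
     by (rule fs.span_base) (use that g(1) DN in auto)
    then show ?thesis
     by (subst poly_mapping_expand)
      (simp add: fs.representation_sum[OF D(3)] fs.representation_scale[OF D(3)] fs.span_scale)
   qed
   also have "\<dots> = (\<Sum>x\<in>keys g. if x = p then lookup g p else 0)"
   proof (rule sum.cong)
    fix x assume "x \<in> keys g"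
    then have "psingle x \<in> D" using g(1) DN by auto
    then show "lookup g x * fs.representation D (psingle x) (psingle p) = (if x = p then lookup g p else 0)"
     by (auto simp: fs.representation_basis[OF D(3)] dest: injD[OF inj])
   qed simp
   also have "\<dots> = lookup g p" by (simp add: in_keys_iff)
   finally have 1: "fs.representation D g (psingle p) = lookup g p" .
   \<comment> \<open>As g lies in the span of C, its coordinates at the added paths vanish; by the
     computation above these coordinates are its coefficients.\<close>
   have "fs.representation D g = fs.representation C g"
    by (rule fs.representation_extend[OF D(3) gC D(1)])
   moreover have "fs.representation C g (psingle p) = 0"
   proof (rule ccontr)
    assume "fs.representation C g (psingle p) \<noteq> 0"
    then have "psingle p \<in> C" by (rule fs.representation_ne_zero)
    then show False using True unfolding N_def by blast
   qed
   ultimately show ?thesis using 1 by simp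
  qed (use g(1) in \<open>auto simp: in_keys_iff\<close>)
 qed
 moreover have "N \<subseteq> paths Q" unfolding N_def by blast
 ultimately show ?thesis by blast
qed

section \<open>Normal forms and coordinates in a basis of paths\<close>

definition NB :: "('v \<times> 'a list) set" where
 "NB = (SOME N. N \<subseteq> paths Q \<and> (\<forall>f :: ('v, 'a, 'k) path_elem. in_kQ f -->
    (\<exists>g. keys g \<subseteq> N \<and> f - g \<in> I)) \<and>
   (\<forall>g :: ('v, 'a, 'k) path_elem. keys g \<subseteq> N --> g \<in> I --> g = 0))"

lemma NB: "NB \<subseteq> paths Q" "in_kQ f ==> \<exists>g. keys g \<subseteq> NB \<and> f - g \<in> I"
 "keys g \<subseteq> NB ==> g \<in> I ==> g = 0"
proof -
 note nb = someI_ex[OF path_basis_exists, folded NB_def]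
 show "NB \<subseteq> paths Q" by (rule nb[THEN conjunct1])
 show "in_kQ f ==> \<exists>g. keys g \<subseteq> NB \<and> f - g \<in> I"
  by (rule nb[THEN conjunct2, THEN conjunct1, rule_format])
 show "keys g \<subseteq> NB ==> g \<in> I ==> g = 0"
  by (rule nb[THEN conjunct2, THEN conjunct2, rule_format])
qed

lemma NB_length: "p \<in> NB ==> plen p < ht"
proof (rule ccontr)
 assume p: "p \<in> NB" "\<not> plen p < ht"
 then have "psingle p \<in> I" using NB(1) by (intro ht) auto
 then have "psingle p = 0" using p NB(3)[of "psingle p"] by simp
 then have "lookup (psingle p) p = 0" by simp
 then show False by simp
qed

lemma finite_NB: "finite NB"
proof (rule finite_subset)
 show "NB \<subseteq> (\<Union>l<ht. {p \<in> paths Q. plen p = l})" using NB(1) NB_length by auto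
qed (simp add: finite_paths)

definition nf :: "('v, 'a, 'k) path_elem => ('v, 'a, 'k) path_elem" where
 "nf f = (SOME g. keys g \<subseteq> NB \<and> f - g \<in> I)"

lemma nf: "in_kQ f ==> keys (nf f) \<subseteq> NB"
 "in_kQ f ==> f - nf f \<in> I"
 using someI_ex[OF NB(2), of f] unfolding nf_def by blast+

lemma nf_unique:
 assumes "in_kQ f" "keys g \<subseteq> NB" "f - g \<in> I"
 shows "nf f = g"
proof -
 have "(f - g) - (f - nf f) \<in> I" by (rule fs.subspace_diff[OF subspace_I assms(3) nf(2)[OF assms(1)]])
 then have "nf f - g \<in> I" by simp
 moreover have "keys (nf f - g) \<subseteq> NB"
  using fs.subspace_diff[OF subspace_keys, of "nf f" NB g] nf(1)[OF assms(1)] assms(2) by simp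
 ultimately show ?thesis using NB(3) by fastforce
qed

lemma cl_nf: "in_kQ f ==> cl (nf f) = cl f"
 using fs.subspace_neg[OF subspace_I nf(2)[of f]] by (simp add: cl_eq)

lemma nf_add:
 assumes "in_kQ f" "in_kQ g" shows "nf (f + g) = nf f + nf g"
proof (rule nf_unique)
 show "in_kQ (f + g)" using keys_add[of f g] assms by blast
 show "keys (nf f + nf g) \<subseteq> NB" using keys_add[of "nf f" "nf g"] nf(1) assms by blast
 have "(f - nf f) + (g - nf g) \<in> I" by (intro fs.subspace_add[OF subspace_I] nf(2) assms)
 then show "f + g - (nf f + nf g) \<in> I" by (simp add: algebra_simps)
qed

lemma nf_scale: "in_kQ f ==> nf (fscale c f) = fscale c (nf f)"
proof (rule nf_unique)
 assume f: "in_kQ f"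
 show "in_kQ (fscale c f)" "keys (fscale c (nf f)) \<subseteq> NB"
  by (rule keys_scale f nf(1)[OF f])+
 show "fscale c f - fscale c (nf f) \<in> I"
  using fs.subspace_scale[OF subspace_I nf(2)[OF f], of c] by (simp add: fs.scale_right_diff_distrib)
qed

text \<open>The degree-m part of the normal form is again supported on \<open>NB\<close> and, by
  homogeneity of \<open>I\<close>, again congruent to f. By uniqueness it is the whole normal
  form.\<close>

lemma nf_V: "f \<in> V m ==> nf f \<in> V m"
proof -
 assume f: "f \<in> V m"
 note k = V_paths[OF f]
 have kn: "in_kQ (nf f)" using nf(1)[OF k] NB(1) by blast
 have "nf f = dcomp m (nf f)"
 proof (rule nf_unique[OF k])
  show "keys (dcomp m (nf f)) \<subseteq> NB"
   using nf(1)[OF k] by (auto simp: in_keys_iff lookup_dcomp split: if_splits)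
  have "dcomp m (f - nf f) \<in> I" by (rule I_dcomp[OF nf(2)[OF k]])
  then show "f - dcomp m (nf f) \<in> I" using f by (simp add: linD[OF lin_dcomp] dcomp_of_V)
 qed
 then show ?thesis using dcomp_V[OF kn] by metis
qed

definition coord :: "'v \<times> 'a list => ('v, 'a, 'k) path_elem set => 'k" where
 "coord \<beta> X = lookup (nf (SOME f. in_kQ f \<and> X = cl f)) \<beta>"

lemma coord_cl: "in_kQ f ==> coord \<beta> (cl f) = lookup (nf f) \<beta>"
proof -
 assume f: "in_kQ f"
 define g where "g = (SOME g. in_kQ g \<and> cl f = cl g)"
 have g: "in_kQ g" "cl f = cl g"
  using someI[of "%g. in_kQ g \<and> cl f = cl g" f] f unfolding g_def by auto
 have "nf g = nf f"
 proof (rule nf_unique[OF g(1) nf(1)[OF f]])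
  have "g - f \<in> I" using g(2) cl_eq by metis
  from fs.subspace_add[OF subspace_I this nf(2)[OF f]] show "g - nf f \<in> I" by simp
 qed
 then show ?thesis by (simp add: coord_def g_def)
qed

lemma coord_add: "x \<in> carrier \<A> ==> y \<in> carrier \<A> ==> coord \<beta> (x \<oplus>\<^sub>\<A> y) = coord \<beta> x + coord \<beta> y"
proof -
 assume "x \<in> carrier \<A>" "y \<in> carrier \<A>"
 then obtain f g where f: "x = cl f" "in_kQ f" and g: "y = cl g" "in_kQ g"
  by (elim clE)
 have "in_kQ (f + g)" using keys_add[of f g] f g by blast
 then show ?thesis using f g by (simp add: cl_add coord_cl nf_add lookup_add)
qed

lemma coord_smult: "x \<in> carrier \<A> ==> coord \<beta> (c \<odot>\<^sub>\<A> x) = c * coord \<beta> x"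
proof -
 assume "x \<in> carrier \<A>"
 then obtain f where f: "x = cl f" "in_kQ f" by (elim clE)
 have "in_kQ (fscale c f)" by (rule keys_scale[OF f(2)])
 then show ?thesis using f by (simp add: cl_smult coord_cl nf_scale)
qed

lemma coord_basis: "\<beta> \<in> NB ==> \<gamma> \<in> NB ==> coord \<beta> (cl (psingle \<gamma>)) = (if \<beta> = \<gamma> then 1 else 0)"
proof -
 assume "\<beta> \<in> NB" "\<gamma> \<in> NB"
 then have "nf (psingle \<gamma>) = psingle \<gamma>"
  using NB(1) fs.subspace_0[OF subspace_I] by (intro nf_unique) auto
 then show ?thesis using \<open>\<gamma> \<in> NB\<close> NB(1) by (subst coord_cl) (auto simp: lookup_single)
qed

lemma coord_V: "f \<in> V m ==> plen \<beta> \<noteq> m ==> coord \<beta> (cl f) = 0"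
 using V_keys[OF nf_V[of f m], of \<beta>] by (auto simp: coord_cl[OF V_paths] in_keys_iff)

lemma coord_expand:
 assumes "x \<in> carrier \<A>"
 shows "x = finsum \<A> (%\<beta>. coord \<beta> x \<odot>\<^sub>\<A> cl (psingle \<beta>)) NB"
proof -
 obtain f where f: "x = cl f" "in_kQ f" using assms by (rule clE)
 have k: "in_kQ (psingle \<beta>)" if "\<beta> \<in> NB" for \<beta> using that NB(1) by auto
 have "nf f = (\<Sum>\<beta>\<in>NB. fscale (lookup (nf f) \<beta>) (psingle \<beta>))"
  by (subst poly_mapping_expand, rule sum.mono_neutral_left)
   (use nf(1)[OF f(2)] finite_NB in \<open>auto simp: in_keys_iff\<close>)
 then have "x = cl (\<Sum>\<beta>\<in>NB. fscale (lookup (nf f) \<beta>) (psingle \<beta>))"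
  using cl_nf[OF f(2)] f(1) by simp
 also have "\<dots> = finsum \<A> (%\<beta>. cl (fscale (lookup (nf f) \<beta>) (psingle \<beta>))) NB"
  by (rule cl_finsum[OF finite_NB, symmetric]) (rule keys_scale[OF k])
 finally have *: "x = finsum \<A> (%\<beta>. cl (fscale (lookup (nf f) \<beta>) (psingle \<beta>))) NB" .
 have "coord \<beta> x = lookup (nf f) \<beta>" for \<beta> by (simp only: f(1) coord_cl[OF f(2)])
 then show ?thesis using * by (simp only: cl_smult)
qed

end

section \<open>Graded modules\<close>

locale graded_mod =
 fixes R :: "('r, 's) ring_scheme" and RG :: "int => 'r set" and M :: "('r, 'm, 't) module_scheme"
  and MG :: "int => 'm set"
 assumes graded: "graded_module R RG M MG"
begin

sublocale left_module R M using graded by (simp add: graded_module_def)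

definition is_decomp :: "'m => (int => 'm) => bool" where
 "is_decomp x c \<longleftrightarrow> (\<forall>i. c i \<in> MG i) \<and> finite {i. c i \<noteq> \<zero>\<^sub>M} \<and> x = finsum M c {i. c i \<noteq> \<zero>\<^sub>M}"

definition gc :: "'m => int => 'm" where "gc x = (THE c. is_decomp x c)"

lemma subgroup_MG: "subgroup (MG i) (add_monoid M)"
 and smult_MG: "a \<in> RG i ==> x \<in> MG j ==> a \<odot>\<^sub>M x \<in> MG (i + j)"
 and decomp_ex1: "x \<in> carrier M ==> \<exists>!c. is_decomp x c"
proof -
 note g = graded[unfolded graded_module_def, THEN conjunct2]
 show "subgroup (MG i) (add_monoid M)" by (rule g[THEN conjunct1, rule_format])
 show "a \<in> RG i ==> x \<in> MG j ==> a \<odot>\<^sub>M x \<in> MG (i + j)"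
  by (rule g[THEN conjunct2, THEN conjunct2, rule_format])
 show "x \<in> carrier M ==> \<exists>!c. is_decomp x c"
  unfolding is_decomp_def by (rule g[THEN conjunct2, THEN conjunct1, rule_format])
qed

lemma MG_closed: "x \<in> MG i ==> x \<in> carrier M" "\<zero>\<^sub>M \<in> MG i"
 "x \<in> MG i ==> y \<in> MG i ==> x \<oplus>\<^sub>M y \<in> MG i" "x \<in> MG i ==> \<ominus>\<^sub>M x \<in> MG i"
 using subgroup.subset[OF subgroup_MG] subgroup.one_closed[OF subgroup_MG]
  subgroup.m_closed[OF subgroup_MG] subgroup.m_inv_closed[OF subgroup_MG]
 by (auto simp: a_inv_def)

lemma gc_decomp: "x \<in> carrier M ==> is_decomp x (gc x)"
 unfolding gc_def by (rule theI'[OF decomp_ex1])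

lemma gc_eqI:
 assumes "finite A" "!!i. c i \<in> MG i" "!!i. i \<notin> A ==> c i = \<zero>\<^sub>M"
 shows "gc (finsum M c A) = c"
proof -
 have c: "c i \<in> carrier M" for i using assms(2) MG_closed(1) by blast
 have fin: "finite {i. c i \<noteq> \<zero>\<^sub>M}" by (rule finite_subset[OF _ assms(1)]) (use assms(3) in blast)
 have "finsum M c {i. c i \<noteq> \<zero>\<^sub>M} = finsum M c A"
  by (rule M.add.finprod_mono_neutral_cong_left) (use assms c in auto)
 then have "is_decomp (finsum M c A) c" unfolding is_decomp_def using assms(2) fin by simp
 moreover have "finsum M c A \<in> carrier M" using c by (simp add: Pi_def)
 ultimately show ?thesis unfolding gc_def using decomp_ex1 by (metis the1_equality)
qed

lemma gc_MG: "x \<in> carrier M ==> gc x i \<in> MG i"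
 and gc_finite: "x \<in> carrier M ==> finite {i. gc x i \<noteq> \<zero>\<^sub>M}"
 and gc_sum: "x \<in> carrier M ==> finsum M (gc x) {i. gc x i \<noteq> \<zero>\<^sub>M} = x"
 using gc_decomp[of x] unfolding is_decomp_def by simp_all

lemma gc_carrier: "x \<in> carrier M ==> gc x i \<in> carrier M"
 using gc_MG MG_closed(1) by blast

lemma gc_homogeneous: "x \<in> MG j ==> gc x = (%i. if i = j then x else \<zero>\<^sub>M)"
proof -
 assume x: "x \<in> MG j"
 have "gc (finsum M (%i. if i = j then x else \<zero>\<^sub>M) {j}) = (%i. if i = j then x else \<zero>\<^sub>M)"
  by (rule gc_eqI) (use x MG_closed(2) in auto)
 moreover have "finsum M (%i. if i = j then x else \<zero>\<^sub>M) {j} = x"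
  using MG_closed(1)[OF x] by simp
 ultimately show ?thesis by simp
qed

lemma gc_add: "x \<in> carrier M ==> y \<in> carrier M ==> gc (x \<oplus>\<^sub>M y) = (%i. gc x i \<oplus>\<^sub>M gc y i)"
proof -
 assume x: "x \<in> carrier M" and y: "y \<in> carrier M"
 let ?A = "{i. gc x i \<noteq> \<zero>\<^sub>M} \<union> {i. gc y i \<noteq> \<zero>\<^sub>M}"
 have A: "finite ?A" using gc_finite x y by blast
 have x': "finsum M (gc x) ?A = x"
  by (subst gc_sum[OF x, symmetric], rule M.add.finprod_mono_neutral_cong_left[symmetric])
   (use A gc_carrier[OF x] in auto)
 have y': "finsum M (gc y) ?A = y"
  by (subst gc_sum[OF y, symmetric], rule M.add.finprod_mono_neutral_cong_left[symmetric])
   (use A gc_carrier[OF y] in auto)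
 have "finsum M (%i. gc x i \<oplus>\<^sub>M gc y i) ?A = finsum M (gc x) ?A \<oplus>\<^sub>M finsum M (gc y) ?A"
  by (rule M.finsum_addf) (use gc_carrier[OF x] gc_carrier[OF y] in auto)
 then have "x \<oplus>\<^sub>M y = finsum M (%i. gc x i \<oplus>\<^sub>M gc y i) ?A" unfolding x' y' ..
 also have "gc \<dots> = (%i. gc x i \<oplus>\<^sub>M gc y i)"
  by (rule gc_eqI[OF A]) (use gc_MG x y MG_closed(3) in auto)
 finally show ?thesis .
qed

lemma gc_zero: "gc \<zero>\<^sub>M i = \<zero>\<^sub>M"
 using gc_homogeneous[OF MG_closed(2), of i] by simp

lemma gc_finsum:
 assumes "finite A" "!!a. a \<in> A ==> F a \<in> carrier M"
 shows "gc (finsum M F A) i = finsum M (%a. gc (F a) i) A"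
 by (rule finsum_hom[where h="%x. gc x i"])
  (use assms gc_carrier gc_add gc_zero in \<open>auto simp: M.abelian_group_axioms\<close>)

lemma gc_finsum_homogeneous:
 assumes "finite A" "!!j. j \<in> A ==> F j \<in> MG j"
 shows "gc (finsum M F A) i = (if i \<in> A then F i else \<zero>\<^sub>M)"
proof -
 define c where "c j = (if j \<in> A then F j else \<zero>\<^sub>M)" for j
 have "finsum M F A = finsum M c A"
  by (rule M.finsum_cong') (use MG_closed(1)[OF assms(2)] in \<open>auto simp: c_def\<close>)
 then have "gc (finsum M F A) = c"
  using gc_eqI[OF assms(1), of c] assms(2) MG_closed(2) by (simp add: c_def)
 then show ?thesis by (simp add: c_def)
qed

end

lemma graded_hom_gc:
 assumes "graded_mod R RG M MG" "graded_mod R RG N NG" "f \<in> mod_hom R M N"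
  "!!i x. x \<in> MG i ==> f x \<in> NG i" "x \<in> carrier M"
 shows "f (graded_mod.gc M MG x i) = graded_mod.gc N NG (f x) i"
proof -
 interpret M: graded_mod R RG M MG by fact
 interpret N: graded_mod R RG N NG by fact
 let ?A = "insert i {i. M.gc x i \<noteq> \<zero>\<^sub>M}"
 have A: "finite ?A" using M.gc_finite[OF assms(5)] by simp
 have "x = finsum M (M.gc x) ?A"
  by (subst M.gc_sum[OF assms(5), symmetric], rule M.M.add.finprod_mono_neutral_cong_left)
   (use A M.gc_carrier[OF assms(5)] in auto)
 then have "f x = f (finsum M (M.gc x) ?A)" by simp
 also have "\<dots> = finsum N (%i. f (M.gc x i)) ?A"
  by (rule mod_hom_finsum[OF assms(3) M.left_module_axioms N.left_module_axioms A]) (rule M.gc_carrier[OF assms(5)])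
 finally have "N.gc (f x) i = N.gc (finsum N (%i. f (M.gc x i)) ?A) i" by simp
 also have "\<dots> = f (M.gc x i)"
  by (subst N.gc_finsum_homogeneous[OF A]) (use assms(4) M.gc_MG[OF assms(5)] in auto)
 finally show ?thesis ..
qed

context fd_quadratic_quiver
begin

text \<open>The algebra has no negative degrees, so the elements without components below t form a
  submodule, and this submodule contains the generators.\<close>

lemma graded_low_zero:
 assumes "graded_mod \<A> (qgrading Q M) P PG" "generated_by \<A> P (PG t)" "i < t" "x \<in> PG i"
 shows "x = \<zero>\<^sub>P"
proof -
 interpret P: graded_mod \<A> "qgrading Q M" P PG by fact
 define N where "N = {x \<in> carrier P. \<forall>j<t. P.gc x j = \<zero>\<^sub>P}"
 have add: "x \<oplus>\<^sub>P y \<in> N" if "x \<in> N" "y \<in> N" for x y using that by (auto simp: N_def P.gc_add)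
 have hom: "a \<odot>\<^sub>P x \<in> N" if a: "a \<in> cl ` V m" and x: "x \<in> N" for a m x
 proof -
  have ac: "a \<in> carrier \<A>" and ag: "a \<in> qgrading Q M (int m)" using a clV_carrier by (auto simp: qgrading_def)
  have xc: "x \<in> carrier P" using x by (simp add: N_def)
  let ?A = "{i. P.gc x i \<noteq> \<zero>\<^sub>P}"
  have c: "a \<odot>\<^sub>P P.gc x j \<in> carrier P" for j using ac P.gc_carrier[OF xc] P.smult_closed by blast
  have "a \<odot>\<^sub>P x = a \<odot>\<^sub>P finsum P (P.gc x) ?A" by (simp add: P.gc_sum[OF xc])
  also have "\<dots> = finsum P (%j. a \<odot>\<^sub>P P.gc x j) ?A"
   by (rule P.finsum_smult_right[OF P.gc_finite[OF xc] ac]) (rule P.gc_carrier[OF xc])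
  finally have ax: "a \<odot>\<^sub>P x = finsum P (%j. a \<odot>\<^sub>P P.gc x j) ?A" .
  have "P.gc (a \<odot>\<^sub>P x) j = \<zero>\<^sub>P" if j: "j < t" for j
  proof -
   have "P.gc (a \<odot>\<^sub>P P.gc x j') j = \<zero>\<^sub>P" for j'
   proof (cases "j' < t")
    case True
    then have "P.gc x j' = \<zero>\<^sub>P" using x by (simp add: N_def)
    then show ?thesis using ac by (simp add: P.gc_zero)
   next
    case False
    have "a \<odot>\<^sub>P P.gc x j' \<in> PG (int m + j')" by (rule P.smult_MG[OF ag P.gc_MG[OF xc]])
    then show ?thesis using False j by (simp add: P.gc_homogeneous)
   qed
   then show ?thesis unfolding ax
    by (subst P.gc_finsum[OF P.gc_finite[OF xc] c]) (simp add: P.M.finsum_zero)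
  qed
  then show ?thesis unfolding N_def using ac xc P.smult_closed by simp
 qed
 have zero: "\<zero>\<^sub>P \<in> N" by (simp add: N_def P.gc_zero)
 have smult: "a \<odot>\<^sub>P x \<in> N" if a: "a \<in> carrier \<A>" and x: "x \<in> N" for a x
 proof -
  have xc: "x \<in> carrier P" using x by (simp add: N_def)
  have "a \<odot>\<^sub>P x = finsum P (%i. lcomp (nat (i - int 0)) a \<odot>\<^sub>P x) {int 0..<int 0 + int ht}"
   by (subst lcomp_sum[OF a, of 0], rule P.finsum_smult_left[OF _ xc]) (auto intro!: lcomp_closed a)
  also have "\<dots> \<in> N"
   by (rule P.M.finsum_additive_closed[OF _ _ zero _ add])
    (use hom[OF lcomp_V[OF a] x] in \<open>auto simp: N_def\<close>)
  finally show ?thesis .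
 qed
 have "submodule N \<A> P"
 proof (intro submodule.intro submodule_axioms.intro)
  have "\<ominus>\<^sub>P x \<in> N" if "x \<in> N" for x
  proof -
   have xc: "x \<in> carrier P" using that by (simp add: N_def)
   have "(\<ominus>\<^sub>\<A> \<one>\<^sub>\<A>) \<odot>\<^sub>P x \<oplus>\<^sub>P \<one>\<^sub>\<A> \<odot>\<^sub>P x = \<zero>\<^sub>P"
    using xc by (simp flip: P.smult_l_distr add: L.l_neg)
   then have "\<ominus>\<^sub>P x = (\<ominus>\<^sub>\<A> \<one>\<^sub>\<A>) \<odot>\<^sub>P x"
    using xc by (intro P.M.minus_equality) (auto simp: P.smult_one P.smult_closed)
   then show ?thesis using smult that by simp
  qed
  then show "subgroup N (add_monoid P)"
   using zero add by (intro P.M.add.subgroupI) (auto simp: N_def a_inv_def)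
 qed (use smult in auto)
 moreover have "PG t \<subseteq> N" using P.MG_closed(1) by (auto simp: N_def P.gc_homogeneous)
 ultimately have "carrier P \<subseteq> N" using assms(2) unfolding generated_by_def by blast
 then have "P.gc x i = \<zero>\<^sub>P" using assms(3) P.MG_closed(1)[OF assms(4)] by (auto simp: N_def)
 then show ?thesis by (simp add: P.gc_homogeneous[OF assms(4)])
qed

end

section \<open>The left Koszul complex\<close>

lemma (in abelian_group) minus_zero_eq:
 assumes "x \<in> carrier G" "y \<in> carrier G" "x \<ominus> y = \<zero>" shows "x = y"
proof -
 have "x = (x \<ominus> y) \<oplus> y" using assms(1,2) by (simp add: a_minus_def a_assoc l_neg)
 then show ?thesis using assms by simp
qed

lemma regular_simps:
 "carrier (regular R) = carrier R" "monoid.mult (regular R) = monoid.mult R" "monoid.one (regular R) = monoid.one R"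
 "ring.zero (regular R) = ring.zero R" "ring.add (regular R) = ring.add R" "module.smult (regular R) = monoid.mult R"
 by (simp_all add: regular_def ring.defs module.defs)

lemma left_module_regular:
 assumes "ring R" shows "left_module R (regular R)"
proof -
 interpret ring R by fact
 have inv: "\<exists>y\<in>carrier R. y \<oplus>\<^sub>R x = \<zero>\<^sub>R" if "x \<in> carrier R" for x
  using that by (intro bexI[of _ "\<ominus>\<^sub>R x"]) (auto simp: l_neg)
 have "abelian_group (regular R)"
  by (rule abelian_groupI) (simp_all add: regular_simps a_ac inv)
 then show ?thesis
  by (intro left_moduleI[OF assms]) (simp_all add: regular_simps l_distr r_distr m_assoc)
qed

locale koszul_bases = fd_quadratic_quiver Q M
 for Q :: "('v, 'a) pre_digraph" and M :: "('v, 'a, 'k::field) path_elem set" +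
 fixes B :: "nat => ('v, 'a, 'k) path_elem set"
 assumes basis: "compatible_basis Q (koszul_space Q M l) (B l)"
begin

abbreviation tidem :: "('v, 'a, 'k) path_elem => ('v, 'a, 'k) path_elem set" where
 "tidem q \<equiv> cl (vx (target Q q))"

abbreviation KL where "KL l \<equiv> idem_module \<A> (B l) tidem"

abbreviation dR :: "nat => ('v, 'a, 'k) path_elem => ('v, 'a, 'k) path_elem => ('v, 'a, 'k) path_elem" where
 "dR l p q \<equiv> delta_R Q (B l) p q"

text \<open>The image of q under the left Koszul differential, as a row of coefficients. It is
  meaningful for every q in K_(l+1), not only for basis elements.\<close>

definition rowL :: "nat => ('v, 'a, 'k) path_elem => ('v, 'a, 'k) path_elem => ('v, 'a, 'k) path_elem set" where
 "rowL l q = (%p. cl (dR l p q))"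

definition dL where "dL l = lin_comb \<A> (KL l) (rowL l)"

lemmas bd = compatible_basisD[OF basis]
lemmas bv = basis_vertices[OF basis]

lemma B_K: "q \<in> B l ==> q \<in> K l" using bd(1) by blast
lemma B_V: "q \<in> B l ==> q \<in> V l" using bd(4) by blast

lemma vx_idem: "i \<in> verts Q ==> cl (vx i) \<in> carrier \<A>"
 "i \<in> verts Q ==> cl (vx i) \<otimes>\<^sub>\<A> cl (vx i) = cl (vx i)"
 by (auto simp: cl_mult_V[OF vx_V vx_V] vx_vx intro!: clI vx_paths)

lemma fam_KL: "idem_family \<A> (B l) tidem"
 by (intro idem_family.intro idem_family_axioms.intro ring_\<A>) (auto simp: bd(5) vx_idem bv(3))

lemma left_module_KL: "left_module \<A> (KL l)"
 by (rule idem_family.left_module_idem[OF fam_KL])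

lemmas KL_ops = idem_family.idem_ops[OF fam_KL]

lemma dR_props:
 assumes "q \<in> K (Suc l)" "p \<in> B l"
 shows "dR l p q \<in> V 1" "dR l p q \<cdot> vx (target Q p) = dR l p q"
 using delta_R_props(1,2)[OF basis assms] by auto

lemma dR_outside: "q \<in> K (Suc l) ==> p \<notin> B l ==> dR l p q = 0"
 using delta_R_coeff[OF basis, of q l] by (simp add: is_coeff_R_def)

lemma dR_target: "q \<in> B (Suc l) ==> p \<in> B l ==> vx (target Q q) \<cdot> dR l p q = dR l p q"
 by (rule delta_R_props(3)[OF basis B_K _ bv(4) bv(3)])

lemma KL_I:
 assumes "!!q. q \<in> B l ==> f q \<in> carrier \<A>" "!!q. q \<in> B l ==> f q \<otimes>\<^sub>\<A> tidem q = f q"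
  "!!q. q \<notin> B l ==> f q = \<zero>\<^sub>\<A>"
 shows "f \<in> carrier (KL l)"
 unfolding idem_family.idem_carrier[OF fam_KL] using assms by blast

lemma cl_mult_vx: "f \<in> V m ==> i \<in> verts Q ==> f \<cdot> vx i = f ==> cl f \<otimes>\<^sub>\<A> cl (vx i) = cl f"
 using cl_mult_V[OF _ vx_V] by metis

lemma rowL_carrier: "q \<in> K (Suc l) ==> rowL l q \<in> carrier (KL l)"
proof (rule KL_I, goal_cases)
 case (1 p) then show ?case unfolding rowL_def by (intro clI V_paths[OF dR_props(1)])
next
 case (2 p) then show ?case unfolding rowL_def by (intro cl_mult_vx[OF dR_props(1)] bv(3) dR_props(2))
next
 case (3 p) then show ?case by (simp add: rowL_def dR_outside cl_zero)
qed

lemma dL_hom: "dL l \<in> mod_hom \<A> (KL (Suc l)) (KL l)"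
 unfolding dL_def
 by (rule idem_family.lin_comb_idem_hom[OF fam_KL left_module_KL rowL_carrier[OF B_K]])

lemma dL_apply: "f \<in> carrier (KL (Suc l)) ==> dL l f p = finsum \<A> (%q. f q \<otimes>\<^sub>\<A> cl (dR l p q)) (B (Suc l))"
proof -
 assume f: "f \<in> carrier (KL (Suc l))"
 have "dL l f p = finsum \<A> (%q. f q \<otimes>\<^sub>\<A> rowL l q p) (B (Suc l))"
  unfolding dL_def by (rule idem_matrix_apply[OF fam_KL fam_KL rowL_carrier[OF B_K] f])
 then show ?thesis by (simp only: rowL_def)
qed

lemma unit_smult: "q \<in> B l ==> tidem q \<odot>\<^bsub>KL l\<^esub> idem_unit \<A> tidem q = idem_unit \<A> tidem q"
 by (rule ext) (auto simp: KL_ops idem_unit_def vx_idem bv(3))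

lemma unit_carrier: "q \<in> B l ==> idem_unit \<A> tidem q \<in> carrier (KL l)"
 by (rule idem_family.idem_unit_carrier[OF fam_KL])

lemma dL_unit: "q \<in> B (Suc l) ==> dL l (idem_unit \<A> tidem q) = rowL l q"
proof -
 assume q: "q \<in> B (Suc l)"
 have "dL l (idem_unit \<A> tidem q) = tidem q \<odot>\<^bsub>KL l\<^esub> rowL l q"
  unfolding dL_def by (rule idem_family.lin_comb_unit[OF fam_KL left_module_KL rowL_carrier[OF B_K] q])
 also have "\<dots> = rowL l q"
 proof
  fix p
  show "(tidem q \<odot>\<^bsub>KL l\<^esub> rowL l q) p = rowL l q p"
  proof (cases "p \<in> B l")
   case True
   then show ?thesis
    using dR_props(1)[OF B_K[OF q] True] dR_target[OF q True] bv(3)[OF q]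
    by (simp add: KL_ops rowL_def cl_mult_V[OF vx_V])
  next
   case False
   then show ?thesis using bv(3)[OF q]
    by (simp add: KL_ops rowL_def dR_outside[OF B_K[OF q]] vx_idem flip: cl_zero)
  qed
 qed
 finally show ?thesis .
qed

text \<open>The element of \<open>\<Lambda>\<^sub>0 \<otimes>\<^sub>S K\<^sub>l\<close> with coefficients \<open>c\<close>, and its counterpart in \<open>K\<^sub>l\<close>.\<close>

definition scal :: "nat => (('v, 'a, 'k) path_elem => 'k) => ('v, 'a, 'k) path_elem => ('v, 'a, 'k) path_elem set" where
 "scal l c = (%q. if q \<in> B l then cl (fscale (c q) (vx (target Q q))) else \<zero>\<^sub>\<A>)"

lemma scal_carrier: "scal l c \<in> carrier (KL l)"
proof (rule KL_I, goal_cases)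
 case (1 q) then show ?case by (auto simp: scal_def intro!: clI keys_scale vx_paths bv(3))
next
 case (2 q)
 have "cl (fscale (c q) (vx (target Q q))) \<otimes>\<^sub>\<A> tidem q = cl (fscale (c q) (vx (target Q q)))"
  by (rule cl_mult_vx[OF fs.subspace_scale[OF subspace_V vx_V[OF bv(3)[OF 2]]] bv(3)[OF 2]])
   (simp add: pmul_left vx_vx)
 then show ?case using 2 by (simp add: scal_def)
qed (simp add: scal_def)

section \<open>Lowest degrees of the left Koszul complex\<close>

definition KL0 where "KL0 l = {x \<in> carrier (KL l). \<forall>q. x q \<in> cl ` V 0}"

lemma KL_value: "f \<in> carrier (KL l) ==> f q \<in> carrier \<A>"
 by (rule idem_family.idem_value[OF fam_KL])

lemma KL_vertex: "f \<in> carrier (KL l) ==> q \<in> B l ==> f q \<otimes>\<^sub>\<A> tidem q = f q"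
 "f \<in> carrier (KL l) ==> q \<notin> B l ==> f q = \<zero>\<^sub>\<A>"
 by (auto simp: idem_family.idem_carrier[OF fam_KL])

lemma scal_V0: "scal l c q \<in> cl ` V 0"
 unfolding scal_def cl_zero
 by (auto intro!: imageI V_scale vx_V bv(3) fs.subspace_0[OF subspace_V])

text \<open>A coefficient of degree 0 that is fixed by a vertex idempotent is a scalar multiple of
  this idempotent.\<close>

lemma KL0_scal: "x \<in> KL0 l \<longleftrightarrow> (\<exists>c. x = scal l c)"
proof
 assume x: "x \<in> KL0 l"
 have "\<exists>c. x q = cl (fscale c (vx (target Q q)))" if q: "q \<in> B l" for q
 proof -
  obtain s where s: "x q = cl s" "s \<in> V 0" using x by (auto simp: KL0_def)
  let ?t = "target Q q"
  have "x q = x q \<otimes>\<^sub>\<A> tidem q" using x KL_vertex(1)[of x l q] q by (simp add: KL0_def)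
  also have "\<dots> = cl (s \<cdot> vx ?t)" using s bv(3)[OF q] by (simp add: cl_mult_V[OF _ vx_V])
  also have "s \<cdot> vx ?t = fscale (lookup s (?t, [])) (vx ?t)"
  proof (rule poly_mapping_eqI)
   fix p
   have "lookup s p = 0" if "snd p \<noteq> []" using V_keys[OF s(2), of p] that by (auto simp: in_keys_iff)
   moreover have "lookup (vx ?t :: ('v, 'a, 'k) path_elem) p = (if p = (?t, []) then 1 else 0)"
    by (auto simp: vertex_idem_def lookup_single when_def)
   ultimately show "lookup (s \<cdot> vx ?t) p = lookup (fscale (lookup s (?t, [])) (vx ?t)) p"
    by (cases p) (auto simp: lookup_vx_right)
  qed
  finally show ?thesis by blast
 qed
 then obtain c where "!!q. q \<in> B l ==> x q = cl (fscale (c q) (vx (target Q q)))" by metis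
 moreover have "x q = \<zero>\<^sub>\<A>" if "q \<notin> B l" for q
  using KL_vertex(2)[OF _ that] x by (simp add: KL0_def)
 ultimately have "x = scal l c" by (intro ext) (simp add: scal_def)
 then show "\<exists>c. x = scal l c" by (intro exI[of _ c])
next
 assume "\<exists>c. x = scal l c"
 then show "x \<in> KL0 l" using scal_carrier scal_V0 by (auto simp: KL0_def)
qed

lemma scal_zero: "(\<Sum>q\<in>B l. fscale (c q) q) = 0 ==> scal l c = (%q. \<zero>\<^sub>\<A>)"
proof -
 assume "(\<Sum>q\<in>B l. fscale (c q) q) = 0"
 then have "c q = 0" if "q \<in> B l" for q
  using fs.independentD[OF bd(2) bd(5) subset_refl _ that] by blast
 then show ?thesis by (intro ext) (simp add: scal_def flip: cl_zero)
qed

lemma scal_surj: "x \<in> K l ==> \<exists>c. (\<Sum>q\<in>B l. fscale (c q) q) = x"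
 using fs.sum_representation_eq[OF bd(2) _ bd(5) subset_refl, of x l] bd(3)[of l] by blast

lemma scal_K: "(\<Sum>q\<in>B l. fscale (c q) q) \<in> K l"
 by (intro fs.subspace_sum[OF subspace_K] fs.subspace_scale[OF subspace_K] B_K)

text \<open>On coefficients of degree 0 the differential is the inclusion of K_(l+1) into V
  \<otimes> K_l. Uniqueness of the coefficients gives the linearity of \<open>delta_R\<close> behind
  it.\<close>

lemma dL_scal:
 shows "dL l (scal (Suc l) c) = rowL l (\<Sum>q\<in>B (Suc l). fscale (c q) q)"
proof
 fix p
 have t: "vx (target Q q) \<cdot> dR l p q = dR l p q" if "q \<in> B (Suc l)" for q
  by (cases "p \<in> B l") (use dR_target dR_outside B_K that in \<open>auto simp: pmul_right\<close>)
 have V: "dR l p q \<in> V 1" if "q \<in> B (Suc l)" for q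
  by (cases "p \<in> B l") (use dR_props(1) dR_outside B_K that fs.subspace_0[OF subspace_V] in auto)
 have lin: "dR l p (\<Sum>q\<in>B (Suc l). fscale (c q) q) = (\<Sum>q\<in>B (Suc l). fscale (c q) (dR l p q))"
 proof (rule delta_R_eqI[OF basis])
  have "(\<Sum>p\<in>B l. (\<Sum>q\<in>B (Suc l). fscale (c q) (dR l p q)) \<cdot> p) = (\<Sum>q\<in>B (Suc l). fscale (c q) (\<Sum>p\<in>B l. dR l p q \<cdot> p))"
   unfolding pmul_left fs.scale_sum_right by (rule sum.swap)
  also have "\<dots> = (\<Sum>q\<in>B (Suc l). fscale (c q) q)"
   by (rule sum.cong) (simp_all add: delta_R_sum[OF basis B_K])
  finally show "is_coeff_R (B l) (\<Sum>q\<in>B (Suc l). fscale (c q) q) (%p. \<Sum>q\<in>B (Suc l). fscale (c q) (dR l p q))"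
   unfolding is_coeff_R_def
  proof (intro conjI allI impI ballI)
   fix p assume p: "p \<in> B l"
   show "(\<Sum>q\<in>B (Suc l). fscale (c q) (dR l p q)) \<in> V 1"
    by (intro V_sum V_scale dR_props(1)[OF B_K p])
   show "(\<Sum>q\<in>B (Suc l). fscale (c q) (dR l p q)) \<cdot> vx (target Q p) = (\<Sum>q\<in>B (Suc l). fscale (c q) (dR l p q))"
    unfolding pmul_left by (rule sum.cong) (simp_all add: dR_props(2)[OF B_K p])
  qed (simp add: dR_outside B_K)
 qed
 have "dL l (scal (Suc l) c) p = finsum \<A> (%q. scal (Suc l) c q \<otimes>\<^sub>\<A> cl (dR l p q)) (B (Suc l))"
  by (rule dL_apply[OF scal_carrier])
 also have "\<dots> = finsum \<A> (%q. cl (fscale (c q) (dR l p q))) (B (Suc l))"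
 proof (rule L.finsum_cong')
  show "scal (Suc l) c q \<otimes>\<^sub>\<A> cl (dR l p q) = cl (fscale (c q) (dR l p q))" if q: "q \<in> B (Suc l)" for q
   using q by (simp add: scal_def cl_mult_V[OF fs.subspace_scale[OF subspace_V vx_V[OF bv(3)]] V] pmul_left t)
  show "(%q. cl (fscale (c q) (dR l p q))) \<in> B (Suc l) \<rightarrow> carrier \<A>"
   by (auto intro!: clI keys_scale V_paths[OF V])
 qed simp
 also have "\<dots> = cl (\<Sum>q\<in>B (Suc l). fscale (c q) (dR l p q))"
  by (rule cl_finsum[OF bd(5)]) (rule keys_scale[OF V_paths[OF V]])
 finally show "dL l (scal (Suc l) c) p = rowL l (\<Sum>q\<in>B (Suc l). fscale (c q) q) p"
  by (simp add: rowL_def lin)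
qed

text \<open>The relations begin in degree 2, so V embeds into \<Lambda> and no coefficient of
  \<open>x\<close> is lost.\<close>

lemma rowL_zero: "x \<in> K (Suc l) ==> rowL l x = (%q. \<zero>\<^sub>\<A>) ==> x = 0"
proof -
 assume x: "x \<in> K (Suc l)" and z: "rowL l x = (%q. \<zero>\<^sub>\<A>)"
 have "dR l p x = 0" if p: "p \<in> B l" for p
 proof (rule cl_inj_low[OF dR_props(1)[OF x p]])
  show "cl (dR l p x) = cl 0" using fun_cong[OF z, of p] by (simp add: rowL_def cl_zero)
 qed (auto simp: fs.subspace_0[OF subspace_V])
 then have "(\<Sum>p\<in>B l. dR l p x \<cdot> p) = 0" by (simp add: pmul_left)
 then show "x = 0" by (simp add: delta_R_sum[OF basis x])
qed

lemma dL_rowL: "q \<in> K (Suc (Suc l)) ==> dL l (rowL (Suc l) q) = (%r. \<zero>\<^sub>\<A>)"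
proof
 fix r assume q: "q \<in> K (Suc (Suc l))"
 have V: "dR l r p \<in> V 1" if "p \<in> B (Suc l)" for p
  by (cases "r \<in> B l") (use dR_props(1) dR_outside B_K that fs.subspace_0[OF subspace_V] in auto)
 have "dL l (rowL (Suc l) q) r = finsum \<A> (%p. cl (dR (Suc l) p q \<cdot> dR l r p)) (B (Suc l))"
  unfolding dL_apply[OF rowL_carrier[OF q]]
 proof (rule L.finsum_cong')
  show "rowL (Suc l) q p \<otimes>\<^sub>\<A> cl (dR l r p) = cl (dR (Suc l) p q \<cdot> dR l r p)" if "p \<in> B (Suc l)" for p
   unfolding rowL_def by (rule cl_mult_V[OF dR_props(1)[OF q that] V[OF that]])
  show "(%p. cl (dR (Suc l) p q \<cdot> dR l r p)) \<in> B (Suc l) \<rightarrow> carrier \<A>"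
  proof
   fix p assume p: "p \<in> B (Suc l)"
   show "cl (dR (Suc l) p q \<cdot> dR l r p) \<in> carrier \<A>"
    by (rule clI[OF V_paths[OF V_mult[OF dR_props(1)[OF q p] V[OF p]]]])
  qed
 qed simp
 also have "\<dots> = cl (\<Sum>p\<in>B (Suc l). dR (Suc l) p q \<cdot> dR l r p)"
  by (rule cl_finsum[OF bd(5)]) (rule V_paths[OF V_mult[OF dR_props(1)[OF q] V]])
 also have "\<dots> = \<zero>\<^sub>\<A>"
 proof (cases "r \<in> B l")
  case True
  then show ?thesis using delta_R_delta_R[OF basis basis q True] M_I by (auto simp: cl_eq_zero)
 next
  case False
  then have "(\<Sum>p\<in>B (Suc l). dR (Suc l) p q \<cdot> dR l r p) = 0"
   using dR_outside B_K by (intro sum.neutral) (auto simp: pmul_right)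
  then show ?thesis by (simp add: cl_zero)
 qed
 finally show "dL l (rowL (Suc l) q) r = \<zero>\<^sub>\<A>" .
qed

text \<open>Exactness in coefficient degree one. The cycle condition puts the products of the
  coefficients with the \<open>dR\<close> into M, and then \<open>koszul_lowest_exact\<close>
  produces an element of K_(l+1). For l = 0 the condition is empty, in accordance with K_1 =
  V.\<close>

lemma degree_one_cycle:
 assumes x: "x \<in> carrier (KL l)" "!!q. x q \<in> cl ` V 1" and "!!l'. l = Suc l' ==> dL l' x = (%q. \<zero>\<^sub>\<A>)"
 shows "\<exists>y\<in>KL0 (Suc l). dL l y = x"
proof -
 have "\<exists>v. v \<in> V 1 \<and> v \<cdot> vx (target Q p) = v \<and> x p = cl v" if p: "p \<in> B l" for p
 proof -
  obtain v where v: "x p = cl v" "v \<in> V 1" using x(2) by (metis imageE)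
  have vt: "v \<cdot> vx (target Q p) \<in> V 1" using V_mult[OF v(2) vx_V[OF bv(3)[OF p]]] by simp
  have "cl (v \<cdot> vx (target Q p)) = cl v"
   using KL_vertex(1)[OF x(1) p] cl_mult_V[OF v(2) vx_V[OF bv(3)[OF p]]] v(1) by simp
  then have "v \<cdot> vx (target Q p) = v" using cl_inj_low[OF vt v(2)] by simp
  then show ?thesis using v by blast
 qed
 then obtain v0 where v0: "!!p. p \<in> B l ==> v0 p \<in> V 1 \<and> v0 p \<cdot> vx (target Q p) = v0 p \<and> x p = cl (v0 p)" by metis
 define v where "v p = (if p \<in> B l then v0 p else 0)" for p
 have v: "p \<in> B l ==> v p \<in> V 1 \<and> v p \<cdot> vx (target Q p) = v p" "p \<notin> B l ==> v p = 0" "x p = cl (v p)" for p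
  using v0 KL_vertex(2)[OF x(1)] by (auto simp: v_def cl_zero)
 have M: "\<exists>B'. compatible_basis Q (K l') B' \<and> (\<forall>r\<in>B'. (\<Sum>p\<in>B l. v p \<cdot> delta_R Q B' r p) \<in> M)" if l: "l = Suc l'" for l'
 proof (intro exI conjI ballI)
  show "compatible_basis Q (K l') (B l')" by (rule basis)
  fix r assume r: "r \<in> B l'"
  have VV: "v p \<cdot> dR l' r p \<in> V 2" if "p \<in> B l" for p
   using V_mult[of "v p" 1 "dR l' r p" 1] v(1)[OF that] dR_props(1)[OF _ r, of p] B_K[OF that] l by (simp add: numeral_2_eq_2)
  have "dL l' x r = finsum \<A> (%p. cl (v p \<cdot> dR l' r p)) (B l)"
   unfolding l dL_apply[OF x(1)[unfolded l]]
  proof (rule L.finsum_cong')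
   fix p assume p: "p \<in> B (Suc l')"
   have "x p \<otimes>\<^sub>\<A> cl (dR l' r p) = cl (v p) \<otimes>\<^sub>\<A> cl (dR l' r p)" by (simp only: v(3))
   also have "\<dots> = cl (v p \<cdot> dR l' r p)"
    by (rule cl_mult_V[of _ 1 _ 1]) (use v(1)[of p] p l dR_props(1)[OF B_K[OF p] r] in auto)
   finally show "x p \<otimes>\<^sub>\<A> cl (dR l' r p) = cl (v p \<cdot> dR l' r p)" .
  qed (use VV l in \<open>auto intro!: clI V_paths[OF VV]\<close>)
  also have "\<dots> = cl (\<Sum>p\<in>B l. v p \<cdot> dR l' r p)"
   by (rule cl_finsum[OF bd(5)]) (rule V_paths[OF VV])
  finally have "cl (\<Sum>p\<in>B l. v p \<cdot> dR l' r p) = \<zero>\<^sub>\<A>" using assms(3)[OF l] by simp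
  then show "(\<Sum>p\<in>B l. v p \<cdot> dR l' r p) \<in> M"
   using cl_V2_zero[OF V_sum[of "B l" "%p. v p \<cdot> dR l' r p", OF VV]] by simp
 qed
 note ke = koszul_lowest_exact[OF basis v(1,2) M]
 let ?q = "\<Sum>p\<in>B l. v p \<cdot> p"
 have q: "?q \<in> K (Suc l)" using ke(1) by blast
 obtain c where c: "(\<Sum>q\<in>B (Suc l). fscale (c q) q) = ?q" using scal_surj[OF q] by blast
 have d: "dR l p ?q = v p" for p using ke(2) by blast
 have "dL l (scal (Suc l) c) = x"
  unfolding dL_scal c by (rule ext) (simp only: rowL_def d v(3))
 then show ?thesis using KL0_scal by blast
qed

section \<open>Homogeneous components of chains\<close>

definition fcomp :: "nat => (('v, 'a, 'k) path_elem => ('v, 'a, 'k) path_elem set) =>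
  ('v, 'a, 'k) path_elem => ('v, 'a, 'k) path_elem set" where
 "fcomp m f = (%q. lcomp m (f q))"

lemma lcomp_zero: "lcomp m \<zero>\<^sub>\<A> = \<zero>\<^sub>\<A>"
 by (simp add: cl_zero lcomp_cl linD[OF lin_dcomp])

lemma fcomp_carrier: "f \<in> carrier (KL l) ==> fcomp m f \<in> carrier (KL l)"
proof (rule KL_I, goal_cases)
 case (1 q) then show ?case unfolding fcomp_def by (intro lcomp_closed KL_value)
next
 case (2 q) then show ?case unfolding fcomp_def by (intro lcomp_vertex bv(3) KL_value KL_vertex(1))
next
 case (3 q) then show ?case unfolding fcomp_def by (simp add: KL_vertex(2) lcomp_zero)
qed

lemma fcomp_V: "f \<in> carrier (KL l) ==> fcomp m f q \<in> cl ` V m"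
 unfolding fcomp_def by (rule lcomp_V[OF KL_value])

lemma fcomp_sum:
 assumes "f \<in> carrier (KL l)"
 shows "f = finsum (KL l) (%i. fcomp (nat (i - int l)) f) {int l..<int l + int ht}"
proof
 fix q
 have "finsum (KL l) (%i. fcomp (nat (i - int l)) f) {int l..<int l + int ht} q =
  finsum \<A> (%i. fcomp (nat (i - int l)) f q) {int l..<int l + int ht}"
  by (rule idem_family.idem_finsum[OF fam_KL]) (auto intro: fcomp_carrier[OF assms])
 also have "\<dots> = f q" unfolding fcomp_def by (rule lcomp_sum[OF KL_value[OF assms], symmetric])
 finally show "f q = finsum (KL l) (%i. fcomp (nat (i - int l)) f) {int l..<int l + int ht} q" ..
qed

text \<open>\<open>\<phi>\<close> shifts coefficient degrees by l, so it maps the decomposition of f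
  into a sum of homogeneous elements of distinct degrees, where components can be read off.\<close>

lemma gc_fcomp:
 assumes "graded_mod \<A> (qgrading Q M) P PG" and \<phi>: "\<phi> \<in> mod_hom \<A> (KL l) P"
  and gr: "!!m x. x \<in> carrier (KL l) ==> (!!q. x q \<in> cl ` V m) ==> \<phi> x \<in> PG (int l + int m)"
  and f: "f \<in> carrier (KL l)" and m: "m < ht"
 shows "graded_mod.gc P PG (\<phi> f) (int l + int m) = \<phi> (fcomp m f)"
proof -
 interpret P: graded_mod \<A> "qgrading Q M" P PG by fact
 let ?A = "{int l..<int l + int ht}"
 have "\<phi> f = \<phi> (finsum (KL l) (%i. fcomp (nat (i - int l)) f) ?A)"
  by (rule arg_cong[OF fcomp_sum[OF f]])
 also have "\<dots> = finsum P (%i. \<phi> (fcomp (nat (i - int l)) f)) ?A"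
  by (rule mod_hom_finsum[OF \<phi> left_module_KL P.left_module_axioms]) (auto intro: fcomp_carrier[OF f])
 finally have e: "\<phi> f = finsum P (%i. \<phi> (fcomp (nat (i - int l)) f)) ?A" .
 show ?thesis unfolding e
 proof (subst P.gc_finsum_homogeneous)
  fix j assume "j \<in> ?A"
  then show "\<phi> (fcomp (nat (j - int l)) f) \<in> PG j"
   using gr[OF fcomp_carrier[OF f] fcomp_V[OF f], of "nat (j - int l)"] by simp
 qed (use m in auto)
qed

lemma fcomp_high: "f \<in> carrier (KL l) ==> ht \<le> m ==> fcomp m f = (%q. \<zero>\<^sub>\<A>)"
proof
 fix q assume f: "f \<in> carrier (KL l)" and m: "ht \<le> m"
 obtain g where g: "fcomp m f q = cl g" "g \<in> V m" using fcomp_V[OF f] by (metis imageE)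
 have "g \<in> I" by (rule ht) (use g(2) m in \<open>auto simp: path_part_def\<close>)
 then show "fcomp m f q = \<zero>\<^sub>\<A>" by (simp add: g cl_eq_zero)
qed

text \<open>A matrix with entries in the k-th power of the radical raises the radical filtration by
  k. The case k = 1 carries the Nakayama-type arguments.\<close>

lemma hom_rad:
 assumes h: "h \<in> mod_hom \<A> (KL l) (KL l')" and u: "!!q p. q \<in> B l ==> h (idem_unit \<A> tidem q) p \<in> rad k"
  and f: "f \<in> carrier (KL l)" "!!q. f q \<in> rad m"
 shows "h f p \<in> rad (m + k)"
proof -
 interpret KL': left_module \<A> "KL l'" by (rule left_module_KL)
 have hu: "h (idem_unit \<A> tidem q) \<in> carrier (KL l')" if "q \<in> B l" for q
  by (rule mod_hom_closed[OF h unit_carrier[OF that]])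
 have "h f p = finsum (KL l') (%q. f q \<odot>\<^bsub>KL l'\<^esub> h (idem_unit \<A> tidem q)) (B l) p"
  by (rule fun_cong[OF idem_family.idem_hom_expand[OF fam_KL h left_module_KL f(1)]])
 also have "\<dots> = finsum \<A> (%q. (f q \<odot>\<^bsub>KL l'\<^esub> h (idem_unit \<A> tidem q)) p) (B l)"
  by (rule idem_family.idem_finsum[OF fam_KL bd(5)])
   (rule KL'.smult_closed[OF KL_value[OF f(1)] hu])
 also have "\<dots> \<in> rad (m + k)"
  by (rule L.finsum_additive_closed[OF bd(5) _ rad_zero rad_carrier rad_add])
   (auto simp: KL_ops intro!: rad_mult f(2) u)
 finally show ?thesis .
qed

text \<open>One step of the comparison with the graded resolution. \<open>N\<close> is S or the
  preceding term, and \<open>dK\<close> is the augmentation or the Koszul differential followed by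
  the isomorphism already found. The conditions \<open>a\<close>, \<open>b\<close>,
  \<open>c\<close>, \<open>e\<close> say that in lowest degree \<open>d\<close> and
  \<open>dK\<close> are injective with the same image, so the degree-l part of P, which generates
  it, corresponds to K_l.\<close>

lemma koszul_step:
 assumes gP: "graded_mod \<A> (qgrading Q M) P PG" and gen: "generated_by \<A> P (PG (int l))"
  and proj: "retract_of_free \<A> X P" and N: "left_module \<A> N" and d: "d \<in> mod_hom \<A> P N"
  and dK: "dK \<in> mod_hom \<A> (KL l) N"
  and a: "!!q. q \<in> B l ==> \<exists>y\<in>PG (int l). d y = dK (idem_unit \<A> tidem q)"
  and b: "!!y. y \<in> PG (int l) ==> \<exists>x\<in>KL0 l. d y = dK x"
  and c: "!!x. x \<in> KL0 l ==> dK x = \<zero>\<^sub>N ==> x = (%q. \<zero>\<^sub>\<A>)"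
  and e: "!!y. y \<in> PG (int l) ==> d y = \<zero>\<^sub>N ==> y = \<zero>\<^sub>P"
 shows "\<exists>\<phi>. \<phi> \<in> mod_hom \<A> (KL l) P \<and> bij_betw \<phi> (carrier (KL l)) (carrier P) \<and>
  (\<forall>x\<in>carrier (KL l). d (\<phi> x) = dK x) \<and>
  (\<forall>m. \<forall>x\<in>carrier (KL l). (\<forall>q. x q \<in> cl ` V m) --> \<phi> x \<in> PG (int l + int m))"
proof -
 interpret P: graded_mod \<A> "qgrading Q M" P PG by fact
 interpret N: left_module \<A> N by fact
 interpret KLl: left_module \<A> "KL l" by (rule left_module_KL)
 interpret idf: idem_family \<A> "B l" tidem by (rule fam_KL)
 obtain y' where y': "!!q. q \<in> B l ==> y' q \<in> PG (int l) \<and> d (y' q) = dK (idem_unit \<A> tidem q)"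
  using a by metis
 \<comment> \<open>The chosen preimages are multiplied by the idempotents, so that a homomorphism
   can send the generators of the Koszul term to them.\<close>
 define y where "y q = tidem q \<odot>\<^sub>P y' q" for q
 have tg: "tidem q \<in> qgrading Q M 0" if "q \<in> B l" for q
  using vx_V[OF bv(3)[OF that]] by (auto simp: qgrading_def)
 have y: "y q \<in> PG (int l)" if "q \<in> B l" for q
  unfolding y_def using P.smult_MG[OF tg[OF that], of "y' q" "int l"] y'[OF that] by simp
 have yc: "y q \<in> carrier P" if "q \<in> B l" for q using y[OF that] P.MG_closed(1) by blast
 have y'c: "y' q \<in> carrier P" if "q \<in> B l" for q using y'[OF that] P.MG_closed(1) by blast
 have ty: "tidem q \<odot>\<^sub>P y q = y q" if "q \<in> B l" for q
  unfolding y_def using y'c[OF that] vx_idem bv(3)[OF that] by (simp flip: P.smult_assoc)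
 define \<phi> where "\<phi> = lin_comb \<A> P y"
 have \<phi>: "\<phi> \<in> mod_hom \<A> (KL l) P"
  unfolding \<phi>_def by (rule idf.lin_comb_idem_hom[OF P.left_module_axioms yc])
 have \<phi>_ap: "\<phi> x = finsum P (%q. x q \<odot>\<^sub>P y q) (B l)" if "x \<in> carrier (KL l)" for x
  unfolding \<phi>_def by (rule idf.lin_comb_idem[OF P.left_module_axioms yc that])
 have \<phi>_u: "\<phi> (idem_unit \<A> tidem q) = y q" if "q \<in> B l" for q
  unfolding \<phi>_def using idf.lin_comb_unit[OF P.left_module_axioms yc that] ty[OF that] by simp
 have d\<phi>: "(%x. d (\<phi> x)) \<in> mod_hom \<A> (KL l) N" by (rule mod_hom_comp[OF \<phi> d])
 have comm: "d (\<phi> x) = dK x" if x: "x \<in> carrier (KL l)" for x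
 proof -
  have "d (\<phi> (idem_unit \<A> tidem q)) = dK (idem_unit \<A> tidem q)" if q: "q \<in> B l" for q
  proof -
   have "d (y q) = tidem q \<odot>\<^sub>N dK (idem_unit \<A> tidem q)"
    unfolding y_def using mod_hom_smult[OF d vx_idem(1)[OF bv(3)[OF q]] y'c[OF q]] y'[OF q] by simp
   also have "\<dots> = dK (tidem q \<odot>\<^bsub>KL l\<^esub> idem_unit \<A> tidem q)"
    by (rule mod_hom_smult[OF dK vx_idem(1)[OF bv(3)[OF q]] unit_carrier[OF q], symmetric])
   finally show ?thesis by (simp only: \<phi>_u[OF q] unit_smult[OF q])
  qed
  then have "finsum N (%q. x q \<odot>\<^sub>N d (\<phi> (idem_unit \<A> tidem q))) (B l) =
   finsum N (%q. x q \<odot>\<^sub>N dK (idem_unit \<A> tidem q)) (B l)"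
   by (intro N.M.finsum_cong')
    (auto intro!: N.smult_closed KL_value[OF x] mod_hom_closed[OF dK] unit_carrier)
  then show ?thesis
   using idf.idem_hom_expand[OF d\<phi> N x] idf.idem_hom_expand[OF dK N x] by simp
 qed
 have graded: "\<phi> x \<in> PG (int l + int m)" if x: "x \<in> carrier (KL l)" "!!q. x q \<in> cl ` V m" for x m
  unfolding \<phi>_ap[OF x(1)]
 proof (rule P.M.finsum_additive_closed[OF bd(5) _ P.MG_closed(2) _ P.MG_closed(3)])
  fix q assume q: "q \<in> B l"
  have "x q \<in> qgrading Q M (int m)" using x(2) by (simp add: qgrading_def)
  from P.smult_MG[OF this y[OF q]] show "x q \<odot>\<^sub>P y q \<in> PG (int l + int m)" by (simp add: add.commute)
 qed (use P.MG_closed(1) in blast)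
 have graded0: "\<phi> x \<in> PG (int l)" if "x \<in> KL0 l" for x
  using graded[of x 0] that by (auto simp: KL0_def)
 have sub: "submodule (\<phi> ` carrier (KL l)) \<A> P"
 proof (intro submodule.intro submodule_axioms.intro)
  have sm: "z \<odot>\<^sub>P w \<in> \<phi> ` carrier (KL l)" if z: "z \<in> carrier \<A>" and w: "w \<in> \<phi> ` carrier (KL l)" for z w
  proof -
   obtain x where x: "w = \<phi> x" "x \<in> carrier (KL l)" using w by blast
   then have "z \<odot>\<^sub>P w = \<phi> (z \<odot>\<^bsub>KL l\<^esub> x)" using mod_hom_smult[OF \<phi> z x(2)] by simp
   then show ?thesis using KLl.smult_closed[OF z x(2)] by blast
  qed
  then show "!!z w. z \<in> carrier \<A> ==> w \<in> \<phi> ` carrier (KL l) ==> z \<odot>\<^sub>P w \<in> \<phi> ` carrier (KL l)" .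
  show "subgroup (\<phi> ` carrier (KL l)) (add_monoid P)"
  proof (rule P.M.add.subgroupI)
   show "\<phi> ` carrier (KL l) \<subseteq> carrier P" using mod_hom_closed[OF \<phi>] by blast
   show "\<phi> ` carrier (KL l) \<noteq> {}" using KLl.M.zero_closed by blast
   fix w assume w: "w \<in> \<phi> ` carrier (KL l)"
   have wc: "w \<in> carrier P" using w mod_hom_closed[OF \<phi>] by blast
   have "(\<ominus>\<^sub>\<A> \<one>\<^sub>\<A>) \<odot>\<^sub>P w \<oplus>\<^sub>P \<one>\<^sub>\<A> \<odot>\<^sub>P w = \<zero>\<^sub>P"
    using wc by (simp flip: P.smult_l_distr add: L.l_neg)
   then have "\<ominus>\<^sub>P w = (\<ominus>\<^sub>\<A> \<one>\<^sub>\<A>) \<odot>\<^sub>P w"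
    using wc by (intro P.M.minus_equality) (auto simp: P.smult_one P.smult_closed)
   then show "\<ominus>\<^sub>P w \<in> \<phi> ` carrier (KL l)" using sm[OF _ w] by simp
  next
   fix w w' assume "w \<in> \<phi> ` carrier (KL l)" "w' \<in> \<phi> ` carrier (KL l)"
   then obtain x x' where "w = \<phi> x" "x \<in> carrier (KL l)" "w' = \<phi> x'" "x' \<in> carrier (KL l)" by blast
   then have "w \<oplus>\<^sub>P w' = \<phi> (x \<oplus>\<^bsub>KL l\<^esub> x')" "x \<oplus>\<^bsub>KL l\<^esub> x' \<in> carrier (KL l)"
    using mod_hom_add[OF \<phi>] KLl.M.a_closed by (simp_all del: idf.idem_ops)
   then show "w \<oplus>\<^sub>P w' \<in> \<phi> ` carrier (KL l)" by blast
  qed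
 qed
 have PGs: "PG (int l) \<subseteq> \<phi> ` carrier (KL l)"
 proof
  fix z assume z: "z \<in> PG (int l)"
  obtain x where x: "x \<in> KL0 l" "d z = dK x" using b[OF z] by blast
  have xc: "x \<in> carrier (KL l)" using x by (simp add: KL0_def)
  have px: "\<phi> x \<in> carrier P" "z \<in> carrier P" using mod_hom_closed[OF \<phi> xc] P.MG_closed(1)[OF z] by auto
  \<comment> \<open>Both elements lie in the lowest degree of P and have the same image under
    \<open>d\<close>, which is injective there.\<close>
  have "z \<ominus>\<^sub>P \<phi> x = \<zero>\<^sub>P"
  proof (rule e)
   show "z \<ominus>\<^sub>P \<phi> x \<in> PG (int l)"
    unfolding a_minus_def by (intro P.MG_closed(3) P.MG_closed(4) z graded0[OF x(1)])
   have "d (z \<ominus>\<^sub>P \<phi> x) = d z \<ominus>\<^sub>N d (\<phi> x)" by (rule mod_hom_minus[OF d P.left_module_axioms N px(2,1)])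
   then show "d (z \<ominus>\<^sub>P \<phi> x) = \<zero>\<^sub>N"
    using comm[OF xc] x(2) mod_hom_closed[OF dK xc] by (simp add: a_minus_def N.M.r_neg)
  qed
  then have "z = \<phi> x" by (rule P.M.minus_zero_eq[OF px(2,1)])
  then show "z \<in> \<phi> ` carrier (KL l)" using xc by blast
 qed
 have "\<Inter>{N. submodule N \<A> P \<and> PG (int l) \<subseteq> N} \<subseteq> \<phi> ` carrier (KL l)"
  by (rule Inter_lower) (simp only: mem_Collect_eq sub PGs simp_thms)
 then have "carrier P \<subseteq> \<phi> ` carrier (KL l)" unfolding gen[unfolded generated_by_def] .
 moreover have "\<phi> ` carrier (KL l) \<subseteq> carrier P" using mod_hom_closed[OF \<phi>] by (rule image_subsetI)
 ultimately have surj: "\<phi> ` carrier (KL l) = carrier P" by (rule equalityI[rotated])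
 \<comment> \<open>Projectivity of P splits the surjection; the complementary projection
   \<open>\<pi>\<close> defined below has its image in the kernel.\<close>
 obtain \<sigma> where \<sigma>: "\<sigma> \<in> mod_hom \<A> P (KL l)" "!!x. x \<in> carrier P ==> \<phi> (\<sigma> x) = x"
  using lifting[OF proj left_module_KL P.left_module_axioms \<phi> mod_hom_id[of \<A> P]] unfolding surj by blast
 \<comment> \<open>The coefficient-degree-0 part of a kernel element is killed by \<open>dK\<close>
   and hence zero, so all coefficients lie in the radical.\<close>
 have ker: "x q \<in> rad 1" if x: "x \<in> carrier (KL l)" "\<phi> x = \<zero>\<^sub>P" for x q
 proof (rule lcomp_zero_rad[OF KL_value[OF x(1)]])
  have x0: "fcomp 0 x \<in> KL0 l" using fcomp_carrier[OF x(1)] fcomp_V[OF x(1)] by (simp add: KL0_def)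
  have "\<phi> (fcomp 0 x) = \<zero>\<^sub>P"
  proof (cases "0 < ht")
   case True
   then show ?thesis using gc_fcomp[OF gP \<phi> graded x(1) True] x(2) by (simp add: P.gc_zero)
  next
   case False
   then show ?thesis using fcomp_high[OF x(1), of 0] mod_hom_zero[OF \<phi> left_module_KL P.left_module_axioms] by simp
  qed
  then have "dK (fcomp 0 x) = \<zero>\<^sub>N"
   using comm[OF fcomp_carrier[OF x(1)]] mod_hom_zero[OF d P.left_module_axioms N] by metis
  from c[OF x0 this] have "fcomp 0 x q = \<zero>\<^sub>\<A>" by simp
  then show "lcomp 0 (x q) = \<zero>\<^sub>\<A>" by (simp add: fcomp_def)
 qed
 have s\<phi>: "(%x. \<sigma> (\<phi> x)) \<in> mod_hom \<A> (KL l) (KL l)" by (rule mod_hom_comp[OF \<phi> \<sigma>(1)])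
 define \<pi> where "\<pi> x = x \<ominus>\<^bsub>KL l\<^esub> \<sigma> (\<phi> x)" for x
 have \<pi>: "\<pi> \<in> mod_hom \<A> (KL l) (KL l)"
  unfolding \<pi>_def by (rule mod_hom_minus_fun[OF mod_hom_id s\<phi> left_module_KL])
 have \<phi>\<pi>: "\<phi> (\<pi> x) = \<zero>\<^sub>P" if x: "x \<in> carrier (KL l)" for x
  unfolding \<pi>_def
  using mod_hom_minus[OF \<phi> left_module_KL P.left_module_axioms x mod_hom_closed[OF s\<phi> x]]
   \<sigma>(2)[OF mod_hom_closed[OF \<phi> x]] mod_hom_closed[OF \<phi> x]
  by (simp add: a_minus_def P.M.r_neg del: idf.idem_ops)
 have ker0: "x = \<zero>\<^bsub>KL l\<^esub>" if x: "x \<in> carrier (KL l)" "\<phi> x = \<zero>\<^sub>P" for x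
 proof -
  have "\<sigma> (\<phi> x) = \<zero>\<^bsub>KL l\<^esub>" using x(2) mod_hom_zero[OF \<sigma>(1) P.left_module_axioms left_module_KL] by metis
  then have \<pi>x: "\<pi> x = x" unfolding \<pi>_def
   using x(1) by (simp add: a_minus_def KLl.M.a_inv_zero del: idf.idem_ops)
  \<comment> \<open>A kernel element is fixed by \<open>\<pi>\<close>, whose matrix has entries in
    the radical, so its coefficients lie in every power of the radical. The power \<open>ht\<close>
    is zero.\<close>
  have "\<forall>q. x q \<in> rad m" for m
  proof (induction m)
   case 0 show ?case using KL_value[OF x(1)] by (simp add: rad_all)
  next
   case (Suc m)
   have "\<pi> x q \<in> rad (m + 1)" for q
    by (rule hom_rad[OF \<pi> _ x(1)])
     (use ker[OF mod_hom_closed[OF \<pi> unit_carrier] \<phi>\<pi>[OF unit_carrier]] Suc in auto)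
   then show ?case using \<pi>x by simp
  qed
  then have "x q = \<zero>\<^sub>\<A>" for q using rad_ht by blast
  then show ?thesis by (simp add: idf.idem_ops ext)
 qed
 have "inj_on \<phi> (carrier (KL l))"
 proof (rule inj_onI)
  fix x x' assume x: "x \<in> carrier (KL l)" "x' \<in> carrier (KL l)" "\<phi> x = \<phi> x'"
  have "\<phi> (x \<ominus>\<^bsub>KL l\<^esub> x') = \<zero>\<^sub>P"
   using mod_hom_minus[OF \<phi> left_module_KL P.left_module_axioms x(1,2)] x(3) mod_hom_closed[OF \<phi> x(2)]
   by (simp add: a_minus_def P.M.r_neg del: idf.idem_ops)
  from ker0[OF KLl.M.minus_closed[OF x(1,2)] this]
  show "x = x'" by (rule KLl.M.minus_zero_eq[OF x(1,2)])
 qed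
 then have "bij_betw \<phi> (carrier (KL l)) (carrier P)" using surj unfolding bij_betw_def by (rule conjI)
 then show ?thesis using \<phi> comm graded by (intro exI[of _ \<phi>] conjI allI ballI impI) simp_all
qed

section \<open>The module S and the augmentation of the left Koszul complex\<close>

lemma qtop_conv: "qtop Q M = quot (regular \<A>) (rad 1)"
 by (simp add: qtop_def rad_def)

definition tcl :: "('v, 'a, 'k) path_elem set => ('v, 'a, 'k) path_elem set set" where
 "tcl a = rad 1 +>\<^bsub>regular \<A>\<^esub> a"

lemma rad_subgroup: "abelian_subgroup (rad 1) (regular \<A>)"
proof (rule abelian_subgroupI3)
 have ab: "abelian_group (regular \<A>)" by (rule left_moduleD(2)[OF left_module_regular[OF ring_\<A>]])
 then show "abelian_group (regular \<A>)" .
 interpret r: abelian_group "regular \<A>" by (rule ab)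
 have "\<ominus>\<^bsub>regular \<A>\<^esub> x \<in> rad 1" if x: "x \<in> rad 1" for x
 proof -
  obtain f where f: "x = cl f" "keys f \<subseteq> {p \<in> paths Q. plen p \<ge> 1}"
   using x unfolding rad_def by blast
  have k: "keys (- f) \<subseteq> {p \<in> paths Q. plen p \<ge> 1}"
   using fs.subspace_neg[OF subspace_keys, of f] f(2) by simp
  then have mem: "cl (- f) \<in> rad 1" unfolding rad_def by blast
  have "cl (- f) \<oplus>\<^sub>\<A> x = \<zero>\<^sub>\<A>" by (simp add: f cl_add cl_zero)
  then have "\<ominus>\<^bsub>regular \<A>\<^esub> x = cl (- f)"
   using mem x rad_carrier by (intro r.minus_equality) (auto simp: regular_simps)
  then show ?thesis using mem by simp
 qed
 then show "additive_subgroup (rad 1) (regular \<A>)"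
  using rad_carrier[of 1] rad_zero[of 1] rad_add[of _ 1]
  by (intro additive_subgroup.intro r.add.subgroupI) (auto simp: regular_simps)
qed

lemma tcl_simps:
 "carrier (qtop Q M) = tcl ` carrier \<A>"
 "x \<in> carrier \<A> ==> tcl x = \<zero>\<^bsub>qtop Q M\<^esub> \<longleftrightarrow> x \<in> rad 1"
 "x \<in> carrier \<A> ==> y \<in> carrier \<A> ==> tcl x \<oplus>\<^bsub>qtop Q M\<^esub> tcl y = tcl (x \<oplus>\<^sub>\<A> y)"
 "a \<in> carrier \<A> ==> x \<in> carrier \<A> ==> a \<odot>\<^bsub>qtop Q M\<^esub> tcl x = tcl (a \<otimes>\<^sub>\<A> x)"
proof -
 interpret r: abelian_subgroup "rad 1" "regular \<A>" by (rule rad_subgroup)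
 show "carrier (qtop Q M) = tcl ` carrier \<A>"
  by (auto simp: qtop_conv quot_simps A_RCOSETS_def' tcl_def[abs_def] regular_simps)
 show "tcl x = \<zero>\<^bsub>qtop Q M\<^esub> \<longleftrightarrow> x \<in> rad 1" if x: "x \<in> carrier \<A>"
  using r.a_coset_join1[OF _ _ r.a_subgroup] r.a_coset_join2[OF _ r.a_subgroup] x
  by (auto simp: qtop_conv quot_simps tcl_def regular_simps)
 show "tcl x \<oplus>\<^bsub>qtop Q M\<^esub> tcl y = tcl (x \<oplus>\<^sub>\<A> y)" if "x \<in> carrier \<A>" "y \<in> carrier \<A>"
  using r.a_rcos_sum[of x y] that by (simp add: qtop_conv quot_simps tcl_def regular_simps)
 show "a \<odot>\<^bsub>qtop Q M\<^esub> tcl x = tcl (a \<otimes>\<^sub>\<A> x)" if a: "a \<in> carrier \<A>" and x: "x \<in> carrier \<A>"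
 proof -
  have "rad 1 +>\<^bsub>regular \<A>\<^esub> (a \<otimes>\<^sub>\<A> z) = tcl (a \<otimes>\<^sub>\<A> x)" if z: "z \<in> tcl x" for z
  proof -
   obtain h where h: "h \<in> rad 1" "z = h \<oplus>\<^sub>\<A> x"
    using z by (auto simp: tcl_def a_r_coset_def' regular_simps)
   have hc: "h \<in> carrier \<A>" using h rad_carrier by blast
   have ah: "a \<otimes>\<^sub>\<A> h \<in> rad 1" using rad_mult[of a 0 h 1] a h by (simp add: rad_all)
   have "a \<otimes>\<^sub>\<A> z = a \<otimes>\<^sub>\<A> h \<oplus>\<^sub>\<A> a \<otimes>\<^sub>\<A> x" using a x hc by (simp add: h L.r_distr)
   then have "a \<otimes>\<^sub>\<A> z \<in> rad 1 +>\<^bsub>regular \<A>\<^esub> (a \<otimes>\<^sub>\<A> x)"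
    using ah by (auto simp: a_r_coset_def' regular_simps)
   from r.a_repr_independence'[OF this] show ?thesis using a x by (simp add: tcl_def regular_simps)
  qed
  moreover have "x \<in> tcl x" using r.a_rcos_self[of x] x by (simp add: tcl_def regular_simps)
  ultimately have "(\<Union>z\<in>tcl x. rad 1 +>\<^bsub>regular \<A>\<^esub> (a \<otimes>\<^sub>\<A> z)) = tcl (a \<otimes>\<^sub>\<A> x)"
   by (intro SUP_eq_const) blast+
  then show ?thesis by (simp add: qtop_conv quot_simps regular_simps tcl_def)
 qed
qed

lemma V_rad: "f \<in> V m ==> k \<le> m ==> cl f \<in> rad k"
 unfolding rad_def by (rule imageI) (auto simp: path_part_def)

lemma V0_rad: "f \<in> V 0 ==> cl f \<in> rad 1 ==> f = 0"
proof -
 assume f: "f \<in> V 0" and "cl f \<in> rad 1"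
 then obtain g where g: "cl f = cl g" "keys g \<subseteq> {p \<in> paths Q. plen p \<ge> 1}"
  unfolding rad_def by blast
 then have "dcomp 0 (f - g) = 0" using I_low(1) by (simp add: cl_eq)
 moreover have "dcomp 0 g = 0"
 proof (rule poly_mapping_eqI)
  fix p
  have "plen p = 0 ==> p \<notin> keys g" using g(2) by auto
  then show "lookup (dcomp 0 g) p = lookup 0 p" by (simp add: lookup_dcomp in_keys_iff)
 qed
 ultimately show ?thesis using f by (simp add: linD[OF lin_dcomp] dcomp_of_V)
qed

text \<open>\<open>B 0\<close> is any compatible basis of S; its elements are multiples of vertices
  and are sent to their own classes.\<close>

definition epsL where "epsL = lin_comb \<A> (qtop Q M) (%q. tcl (cl q))"

lemma epsL_apply:
 assumes S: "left_module \<A> (qtop Q M)" and x: "x \<in> carrier (KL 0)" and f: "!!q. q \<in> B 0 ==> x q \<otimes>\<^sub>\<A> cl q = cl (f q)"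
  "!!q. q \<in> B 0 ==> in_kQ (f q)"
 shows "epsL x = tcl (cl (\<Sum>q\<in>B 0. f q))"
proof -
 interpret S: left_module \<A> "qtop Q M" by (rule S)
 have c: "cl q \<in> carrier \<A>" if "q \<in> B 0" for q by (rule clI[OF V_paths[OF B_V[OF that]]])
 have tc: "tcl a \<in> carrier (qtop Q M)" if "a \<in> carrier \<A>" for a using that by (simp add: tcl_simps(1))
 have "epsL x = finsum (qtop Q M) (%q. x q \<odot>\<^bsub>qtop Q M\<^esub> tcl (cl q)) (B 0)"
  unfolding epsL_def by (rule idem_family.lin_comb_idem[OF fam_KL S _ x]) (intro tc c)
 also have "\<dots> = finsum (qtop Q M) (%q. tcl (cl (f q))) (B 0)"
  by (rule S.M.finsum_cong') (auto simp: tcl_simps(4)[OF KL_value[OF x] c] f(1) intro!: tc clI f(2) del: subsetI)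
 also have "\<dots> = tcl (finsum \<A> (%q. cl (f q)) (B 0))"
  by (rule finsum_hom[where h=tcl and G=\<A>, symmetric, OF L.is_abelian_group S.M.abelian_group_axioms bd(5)])
   (auto simp: tcl_simps(2,3) rad_zero intro!: tc clI f(2) del: subsetI)
 also have "finsum \<A> (%q. cl (f q)) (B 0) = cl (\<Sum>q\<in>B 0. f q)"
  by (rule cl_finsum[OF bd(5) f(2)])
 finally show ?thesis .
qed

theorem left_koszul_resolution:
 assumes "koszul Q M"
 shows "resolution \<A> (qtop Q M) B KL dL epsL"
proof -
 obtain P :: "nat => (('v, 'a, 'k) path_elem set, ('v, 'a, 'k) path_elem set set) resolution_term" and PG d \<epsilon>
  where pr: "projective_resolution \<A> (qtop Q M) P d \<epsilon>"
  and gm0: "\<forall>l. graded_module \<A> (qgrading Q M) (P l) (PG l) \<and> generated_by \<A> (P l) (PG l (int l))"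
  and eps0: "\<forall>i. \<epsilon> ` PG 0 i \<subseteq> qtop_grading Q M i" and dg0: "\<forall>l i. d l ` PG (Suc l) i \<subseteq> PG l i"
  using assms unfolding koszul_def by (elim exE conjE)
 obtain A :: "nat => ((('v, 'a, 'k) path_elem set set \<times> ('v, 'a, 'k) path_elem set) list => ('v, 'a, 'k) path_elem set) set"
  where res: "resolution \<A> (qtop Q M) A P d \<epsilon>"
  using projective_resolution_imp_resolution[OF pr] by (rule exE)
 note a = resolutionD[OF res]
 have gm: "graded_mod \<A> (qgrading Q M) (P l) (PG l)" for l
  by (rule graded_mod.intro) (rule gm0[rule_format, THEN conjunct1])
 have gen: "generated_by \<A> (P l) (PG l (int l))" for l by (rule gm0[rule_format, THEN conjunct2])
 have low: "x = \<zero>\<^bsub>P l\<^esub>" if "x \<in> PG l i" "i < int l" for x l i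
  by (rule graded_low_zero[OF gm gen that(2,1)])
 have eps: "\<epsilon> x \<in> qtop_grading Q M i" if "x \<in> PG 0 i" for x i using eps0 that by blast
 have dg: "d l x \<in> PG l i" if "x \<in> PG (Suc l) i" for x l i using dg0 that by blast
 interpret S: left_module \<A> "qtop Q M" by (rule a(1))
 have PGc: "x \<in> carrier (P l)" if "x \<in> PG l i" for x l i by (rule graded_mod.MG_closed(1)[OF gm that])
 have tc: "tcl b \<in> carrier (qtop Q M)" if "b \<in> carrier \<A>" for b using that by (simp add: tcl_simps(1))
 have eh: "epsL \<in> mod_hom \<A> (KL 0) (qtop Q M)"
  unfolding epsL_def
  by (rule idem_family.lin_comb_idem_hom[OF fam_KL a(1)]) (intro tc clI V_paths[OF B_V])
 have es: "epsL (scal 0 c) = tcl (cl (\<Sum>q\<in>B 0. fscale (c q) q))" for c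
 proof (rule epsL_apply[OF a(1) scal_carrier])
  fix q assume q: "q \<in> B 0"
  show "scal 0 c q \<otimes>\<^sub>\<A> cl q = cl (fscale (c q) q)"
   using q cl_mult_V[OF fs.subspace_scale[OF subspace_V vx_V[OF bv(3)[OF q]]] B_V[OF q], of "c q"] bv(4)[OF q]
   by (simp add: scal_def pmul_left)
  show "in_kQ (fscale (c q) q)" by (rule keys_scale[OF V_paths[OF B_V[OF q]]])
 qed
 have er: "epsL (rowL 0 q) = \<zero>\<^bsub>qtop Q M\<^esub>" if q: "q \<in> B (Suc 0)" for q
 proof -
  have "epsL (rowL 0 q) = tcl (cl (\<Sum>p\<in>B 0. dR 0 p q \<cdot> p))"
  proof (rule epsL_apply[OF a(1) rowL_carrier[OF B_K[OF q]]])
   fix p assume p: "p \<in> B 0"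
   show "rowL 0 q p \<otimes>\<^sub>\<A> cl p = cl (dR 0 p q \<cdot> p)"
    unfolding rowL_def by (rule cl_mult_V[OF dR_props(1)[OF B_K[OF q] p] B_V[OF p]])
   show "in_kQ (dR 0 p q \<cdot> p)"
    by (rule V_paths[OF V_mult[OF dR_props(1)[OF B_K[OF q] p] B_V[OF p]]])
  qed
  also have "\<dots> = tcl (cl q)" by (simp only: delta_R_sum[OF basis B_K[OF q]])
  also have "\<dots> = \<zero>\<^bsub>qtop Q M\<^esub>"
   using V_rad[OF B_V[OF q], of 1] tcl_simps(2)[OF clI[OF V_paths[OF B_V[OF q]]]] by simp
  finally show ?thesis .
 qed
 \<comment> \<open>The cycle condition in position l, with the augmentation in position 0; it lets l
   = 0 and l > 0 share one induction.\<close>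
 define prev where "prev l y = (case l of 0 => \<epsilon> y = \<zero>\<^bsub>qtop Q M\<^esub> | Suc k => d k y = \<zero>\<^bsub>P k\<^esub>)" for l y
 have prevD: "y \<in> d l ` carrier (P (Suc l))" if "prev l y" "y \<in> carrier (P l)" for l y
  using that a(7)[of y] a(9)[of y "l - 1"] by (cases l) (simp_all add: prev_def)
 have prevI: "prev l (d l y)" if "y \<in> carrier (P (Suc l))" for l y
  using that a(8)[of y] a(10)[of y "l - 1"] by (cases l) (simp_all add: prev_def)
 \<comment> \<open>Besides being a graded isomorphism, \<open>\<phi>\<close> has to send the rows of
   the next Koszul differential to cycles and to reflect cycles. These two facts are what conditions
   \<open>a\<close> and \<open>b\<close> of the next step are derived from.\<close>
 define T where "T l \<phi> \<longleftrightarrow> \<phi> \<in> mod_hom \<A> (KL l) (P l) \<and> bij_betw \<phi> (carrier (KL l)) (carrier (P l)) \<and>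
  (\<forall>m. \<forall>x\<in>carrier (KL l). (\<forall>q. x q \<in> cl ` V m) --> \<phi> x \<in> PG l (int l + int m)) \<and>
  (\<forall>q\<in>B (Suc l). prev l (\<phi> (rowL l q))) \<and>
  (\<forall>x\<in>carrier (KL l). prev l (\<phi> x) --> (\<forall>l'. l = Suc l' --> dL l' x = (%q. \<zero>\<^sub>\<A>))) \<and>
  (l = 0 --> (\<forall>x\<in>carrier (KL 0). \<epsilon> (\<phi> x) = epsL x))" for l \<phi>
 have "\<exists>f. \<forall>l. T l (f l) \<and> (\<forall>x\<in>carrier (KL (Suc l)). d l (f (Suc l) x) = f l (dL l x))"
 proof (rule dependent_nat_choice)
  interpret P0: graded_mod \<A> "qgrading Q M" "P 0" "PG 0" by (rule gm)
  have "\<exists>\<phi>. \<phi> \<in> mod_hom \<A> (KL 0) (P 0) \<and> bij_betw \<phi> (carrier (KL 0)) (carrier (P 0)) \<and>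
   (\<forall>x\<in>carrier (KL 0). \<epsilon> (\<phi> x) = epsL x) \<and>
   (\<forall>m. \<forall>x\<in>carrier (KL 0). (\<forall>q. x q \<in> cl ` V m) --> \<phi> x \<in> PG 0 (int 0 + int m))"
  proof (rule koszul_step[OF gm gen a(3) a(1) a(4) eh])
   fix q assume q: "q \<in> B 0"
   have "epsL (idem_unit \<A> tidem q) \<in> \<epsilon> ` carrier (P 0)"
    unfolding a(6) by (rule mod_hom_closed[OF eh unit_carrier[OF q]])
   then obtain y where yy: "epsL (idem_unit \<A> tidem q) = \<epsilon> y" "y \<in> carrier (P 0)" by (rule imageE)
   note y = yy(2) yy(1)[symmetric]
   \<comment> \<open>S is concentrated in degree 0, so the augmentation sees only the degree-0
     component of \<open>y\<close>, and that component is the required preimage.\<close>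
   let ?A = "insert 0 {i. P0.gc y i \<noteq> \<zero>\<^bsub>P 0\<^esub>}"
   have fA: "finite ?A" using P0.gc_finite[OF y(1)] by simp
   have "finsum (P 0) (P0.gc y) ?A = y"
    by (subst P0.gc_sum[OF y(1), symmetric], rule P0.M.add.finprod_mono_neutral_cong_left[symmetric])
     (use fA P0.gc_carrier[OF y(1)] in auto)
   then have "\<epsilon> y = \<epsilon> (finsum (P 0) (P0.gc y) ?A)" by simp
   also have "\<dots> = finsum (qtop Q M) (%i. \<epsilon> (P0.gc y i)) ?A"
    by (rule mod_hom_finsum[OF a(4) a(2) a(1) fA P0.gc_carrier[OF y(1)]])
   also have "\<dots> = finsum (qtop Q M) (%i. \<epsilon> (P0.gc y i)) {0}"
   proof (rule S.M.add.finprod_mono_neutral_cong_left[symmetric])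
    fix i assume "i \<in> ?A - {0}"
    then have "i \<noteq> 0" by blast
    then show "\<epsilon> (P0.gc y i) = \<zero>\<^bsub>qtop Q M\<^esub>"
     using eps[OF P0.gc_MG[OF y(1)], of i] by (simp add: qtop_grading_def)
   qed (use fA mod_hom_closed[OF a(4) P0.gc_carrier[OF y(1)]] in auto)
   also have "\<dots> = \<epsilon> (P0.gc y 0)" using mod_hom_closed[OF a(4) P0.gc_carrier[OF y(1)]] by simp
   finally show "\<exists>y\<in>PG 0 (int 0). \<epsilon> y = epsL (idem_unit \<A> tidem q)"
    using P0.gc_MG[OF y(1), of 0] y(2) by (intro bexI[of _ "P0.gc y 0"]) simp_all
  next
   fix y assume y: "y \<in> PG 0 (int 0)"
   have "\<epsilon> y \<in> tcl ` carrier \<A>" using mod_hom_closed[OF a(4) PGc[OF y]] by (simp add: tcl_simps(1))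
   then obtain b where b: "\<epsilon> y = tcl b" "b \<in> carrier \<A>" by blast
   obtain f where f: "b = cl f" "in_kQ f" using b(2) by (rule clE)
   have cc: "cl (dcomp 0 f) \<in> carrier \<A>" "cl (f - dcomp 0 f) \<in> carrier \<A>"
    using V_paths[OF dcomp_V[OF f(2)], of 0] fs.subspace_diff[OF subspace_keys, of f "paths Q" "dcomp 0 f"] f(2)
    by (auto intro!: clI simp del: subset_iff)
   \<comment> \<open>Modulo the radical, \<open>f\<close> agrees with its degree-0 part, which is a
     combination of the basis \<open>B 0\<close>.\<close>
   have "dcomp 0 (dcomp 0 f) = dcomp 0 f" using dcomp_of_V[OF dcomp_V[OF f(2)], of 0 0] by simp
   then have "cl (f - dcomp 0 f) \<in> rad 1"
    by (intro lcomp_zero_rad[OF cc(2)]) (simp add: lcomp_cl linD[OF lin_dcomp] cl_zero)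
   moreover have "b = cl (dcomp 0 f) \<oplus>\<^sub>\<A> cl (f - dcomp 0 f)" by (simp add: f(1) cl_add)
   ultimately have "\<epsilon> y = tcl (cl (dcomp 0 f)) \<oplus>\<^bsub>qtop Q M\<^esub> \<zero>\<^bsub>qtop Q M\<^esub>"
    using b(1) tcl_simps(3)[OF cc] tcl_simps(2)[OF cc(2)] by simp
   then have ey: "\<epsilon> y = tcl (cl (dcomp 0 f))" using tc[OF cc(1)] by simp
   have "dcomp 0 f \<in> K 0" using dcomp_V[OF f(2)] by (simp add: K_low)
   from scal_surj[OF this] obtain c where "(\<Sum>q\<in>B 0. fscale (c q) q) = dcomp 0 f" by blast
   then have "\<epsilon> y = epsL (scal 0 c)" by (simp add: es ey)
   moreover have "scal 0 c \<in> KL0 0" using KL0_scal by blast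
   ultimately show "\<exists>x\<in>KL0 0. \<epsilon> y = epsL x" by blast
  next
   fix x assume x: "x \<in> KL0 0" "epsL x = \<zero>\<^bsub>qtop Q M\<^esub>"
   obtain c where c: "x = scal 0 c" using x(1) KL0_scal by blast
   let ?z = "\<Sum>q\<in>B 0. fscale (c q) q"
   have z: "?z \<in> V 0" using scal_K[of c 0] K_V by blast
   have "cl ?z \<in> rad 1" using x(2) tcl_simps(2)[OF clI[OF V_paths[OF z]]] by (simp add: c es)
   then have "?z = 0" by (rule V0_rad[OF z])
   then show "x = (%q. \<zero>\<^sub>\<A>)" unfolding c by (rule scal_zero)
  next
   fix y assume y: "y \<in> PG 0 (int 0)" "\<epsilon> y = \<zero>\<^bsub>qtop Q M\<^esub>"
   \<comment> \<open>A kernel element of degree 0 is the image of the degree-0 component of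
     \<open>w\<close>. This component is zero, the next term being generated in degree 1.\<close>
   obtain w where w: "w \<in> carrier (P (Suc 0))" "y = d 0 w" using a(7)[OF PGc[OF y(1)] y(2)] by blast
   interpret P1: graded_mod \<A> "qgrading Q M" "P (Suc 0)" "PG (Suc 0)" by (rule gm)
   have "d 0 (P1.gc w 0) = P0.gc (d 0 w) 0" by (rule graded_hom_gc[OF gm gm a(5) dg w(1)])
   also have "\<dots> = y" using P0.gc_homogeneous[of y 0] y(1) w(2) by simp
   finally have "d 0 (P1.gc w 0) = y" .
   moreover have "P1.gc w 0 = \<zero>\<^bsub>P (Suc 0)\<^esub>" by (rule low[OF P1.gc_MG[OF w(1)]]) simp
   ultimately show "y = \<zero>\<^bsub>P 0\<^esub>" using mod_hom_zero[OF a(5) a(2) a(2)] by metis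
  qed
  then obtain \<phi> where \<phi>: "\<phi> \<in> mod_hom \<A> (KL 0) (P 0)" "bij_betw \<phi> (carrier (KL 0)) (carrier (P 0))"
   "\<forall>x\<in>carrier (KL 0). \<epsilon> (\<phi> x) = epsL x"
   "\<forall>m. \<forall>x\<in>carrier (KL 0). (\<forall>q. x q \<in> cl ` V m) --> \<phi> x \<in> PG 0 (int 0 + int m)"
   by (elim exE conjE)
  have "T 0 \<phi>" unfolding T_def
   using \<phi> er rowL_carrier[OF B_K] by (simp add: prev_def)
  then show "\<exists>\<phi>. T 0 \<phi>" by (intro exI[of _ \<phi>])
 next
  fix \<phi> l assume T: "T l \<phi>"
  note t = T[unfolded T_def]
  have \<phi>: "\<phi> \<in> mod_hom \<A> (KL l) (P l)" by (rule t[THEN conjunct1])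
  have bij: "bij_betw \<phi> (carrier (KL l)) (carrier (P l))" by (rule t[THEN conjunct2, THEN conjunct1])
  have gr: "\<phi> x \<in> PG l (int l + int m)" if "x \<in> carrier (KL l)" "!!q. x q \<in> cl ` V m" for x m
   using t[THEN conjunct2, THEN conjunct2, THEN conjunct1] that by blast
  have row: "prev l (\<phi> (rowL l q))" if "q \<in> B (Suc l)" for q
   using t[THEN conjunct2, THEN conjunct2, THEN conjunct2, THEN conjunct1] that by blast
  have cyc: "dL l' x = (%q. \<zero>\<^sub>\<A>)" if "x \<in> carrier (KL l)" "prev l (\<phi> x)" "l = Suc l'" for x l'
   using t[THEN conjunct2, THEN conjunct2, THEN conjunct2, THEN conjunct2, THEN conjunct1] that by blast
  have inj: "x = y" if "x \<in> carrier (KL l)" "y \<in> carrier (KL l)" "\<phi> x = \<phi> y" for x y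
   by (rule inj_onD[OF bij_betw_imp_inj_on[OF bij] that(3,1,2)])
  have \<phi>0: "\<phi> (%q. \<zero>\<^sub>\<A>) = \<zero>\<^bsub>P l\<^esub>" and z: "(%q. \<zero>\<^sub>\<A>) \<in> carrier (KL l)"
   using mod_hom_zero[OF \<phi> left_module_KL a(2)]
    abelian_monoid.zero_closed[OF abelian_group.axioms(1)[OF left_moduleD(2)[OF left_module_KL]], of l]
   by (simp_all add: KL_ops)
  have dK: "(%x. \<phi> (dL l x)) \<in> mod_hom \<A> (KL (Suc l)) (P l)" by (rule mod_hom_comp[OF dL_hom \<phi>])
  interpret Pl: graded_mod \<A> "qgrading Q M" "P l" "PG l" by (rule gm)
  interpret Pl1: graded_mod \<A> "qgrading Q M" "P (Suc l)" "PG (Suc l)" by (rule gm)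
  interpret Pl2: graded_mod \<A> "qgrading Q M" "P (Suc (Suc l))" "PG (Suc (Suc l))" by (rule gm)
  have rowV: "rowL l x q \<in> cl ` V 1" if "x \<in> K (Suc l)" for x q
   unfolding rowL_def
   by (rule imageI, cases "q \<in> B l") (use dR_props(1)[OF that] dR_outside[OF that] fs.subspace_0[OF subspace_V] in auto)
  have rowG: "\<phi> (rowL l x) \<in> PG l (int (Suc l))" if "x \<in> K (Suc l)" for x
   using gr[OF rowL_carrier[OF that] rowV[OF that]] by (simp add: add.commute)
  have "\<exists>\<phi>'. \<phi>' \<in> mod_hom \<A> (KL (Suc l)) (P (Suc l)) \<and> bij_betw \<phi>' (carrier (KL (Suc l))) (carrier (P (Suc l))) \<and>
   (\<forall>x\<in>carrier (KL (Suc l)). d l (\<phi>' x) = \<phi> (dL l x)) \<and>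
   (\<forall>m. \<forall>x\<in>carrier (KL (Suc l)). (\<forall>q. x q \<in> cl ` V m) --> \<phi>' x \<in> PG (Suc l) (int (Suc l) + int m))"
  proof (rule koszul_step[OF gm gen a(3) a(2) a(5) dK])
   fix q assume q: "q \<in> B (Suc l)"
   obtain y where yy: "\<phi> (rowL l q) = d l y" "y \<in> carrier (P (Suc l))"
    using prevD[OF row[OF q] mod_hom_closed[OF \<phi> rowL_carrier[OF B_K[OF q]]]] by (rule imageE)
   note y = yy(2) yy(1)[symmetric]
   have "d l (Pl1.gc y (int (Suc l))) = Pl.gc (d l y) (int (Suc l))"
    by (rule graded_hom_gc[OF gm gm a(5) dg y(1)])
   also have "\<dots> = \<phi> (rowL l q)" unfolding y(2) Pl.gc_homogeneous[OF rowG[OF B_K[OF q]]] by simp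
   finally show "\<exists>y\<in>PG (Suc l) (int (Suc l)). d l y = \<phi> (dL l (idem_unit \<A> tidem q))"
    unfolding dL_unit[OF q] using Pl1.gc_MG[OF y(1)] by (rule bexI)
  next
   fix y assume y: "y \<in> PG (Suc l) (int (Suc l))"
   have dy: "d l y \<in> PG l (int (Suc l))" by (rule dg[OF y])
   have "d l y \<in> \<phi> ` carrier (KL l)" unfolding bij_betw_imp_surj_on[OF bij] by (rule PGc[OF dy])
   then obtain x where xx: "d l y = \<phi> x" "x \<in> carrier (KL l)" by (rule imageE)
   note x = xx(2) xx(1)[symmetric]
   \<comment> \<open>The element \<open>d l y\<close> has internal degree l + 1 in a term generated
     in degree l, so its preimage under \<open>\<phi>\<close> has coefficients of degree exactly
     1.\<close>
   have comp0: "fcomp m x = (%q. \<zero>\<^sub>\<A>)" if m: "m \<noteq> 1" for m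
   proof (cases "m < ht")
    case True
    have "\<phi> (fcomp m x) = Pl.gc (\<phi> x) (int l + int m)" by (rule gc_fcomp[OF gm \<phi> gr x(1) True, symmetric])
    also have "\<dots> = \<zero>\<^bsub>P l\<^esub>" unfolding x(2) Pl.gc_homogeneous[OF dy] using m by simp
    finally show ?thesis using inj[OF fcomp_carrier[OF x(1)] z] \<phi>0 by simp
   next
    case False then show ?thesis by (intro fcomp_high[OF x(1)]) simp
   qed
   have x1: "x q \<in> cl ` V 1" for q
   proof -
    have "x q = finsum \<A> (%i. lcomp (nat (i - int 0)) (x q)) {int 0..<int 0 + int ht}"
     by (rule lcomp_sum[OF KL_value[OF x(1)]])
    also have "\<dots> \<in> cl ` V 1"
    proof (rule L.finsum_additive_closed)
     show zV: "\<zero>\<^sub>\<A> \<in> cl ` V 1" unfolding cl_zero by (rule imageI[OF fs.subspace_0[OF subspace_V]])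
     fix i assume "i \<in> {int 0..<int 0 + int ht}"
     show "lcomp (nat (i - int 0)) (x q) \<in> cl ` V 1"
     proof (cases "nat (i - int 0) = 1")
      case True then show ?thesis using lcomp_V[OF KL_value[OF x(1)], of 1] by simp
     next
      case False
      from fun_cong[OF comp0[OF this], of q] show ?thesis using zV by (simp add: fcomp_def)
     qed
    next
     fix u w assume "u \<in> cl ` V 1" "w \<in> cl ` V 1"
     then obtain f g where fg: "u = cl f" "w = cl g" "f \<in> V 1" "g \<in> V 1" by blast
     show "u \<oplus>\<^sub>\<A> w \<in> cl ` V 1"
      unfolding fg(1,2) cl_add by (rule imageI[OF fs.subspace_add[OF subspace_V fg(3,4)]])
    qed (use clV_carrier in auto)
    finally show ?thesis .
   qed
   have "prev l (\<phi> x)" unfolding x(2) by (rule prevI[OF PGc[OF y]])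
   then have "\<exists>x'\<in>KL0 (Suc l). dL l x' = x" by (intro degree_one_cycle[OF x(1) x1] cyc[OF x(1)])
   then show "\<exists>x\<in>KL0 (Suc l). d l y = \<phi> (dL l x)" using x(2) by metis
  next
   fix x assume x: "x \<in> KL0 (Suc l)" "\<phi> (dL l x) = \<zero>\<^bsub>P l\<^esub>"
   obtain c where c: "x = scal (Suc l) c" using x(1) KL0_scal by blast
   have "dL l x \<in> carrier (KL l)" unfolding c by (rule mod_hom_closed[OF dL_hom scal_carrier])
   then have "dL l x = (%q. \<zero>\<^sub>\<A>)" using inj[OF _ z] x(2) \<phi>0 by simp
   then have "(\<Sum>q\<in>B (Suc l). fscale (c q) q) = 0"
    unfolding c dL_scal by (rule rowL_zero[OF scal_K])
   then show "x = (%q. \<zero>\<^sub>\<A>)" unfolding c by (rule scal_zero)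
  next
   fix y assume y: "y \<in> PG (Suc l) (int (Suc l))" "d l y = \<zero>\<^bsub>P l\<^esub>"
   obtain w where w: "w \<in> carrier (P (Suc (Suc l)))" "y = d (Suc l) w" using a(9)[OF PGc[OF y(1)] y(2)] by blast
   have "d (Suc l) (Pl2.gc w (int (Suc l))) = Pl1.gc (d (Suc l) w) (int (Suc l))"
    by (rule graded_hom_gc[OF gm gm a(5) dg w(1)])
   also have "\<dots> = y" using Pl1.gc_homogeneous[OF y(1)] w(2) by simp
   finally have "d (Suc l) (Pl2.gc w (int (Suc l))) = y" .
   moreover have "Pl2.gc w (int (Suc l)) = \<zero>\<^bsub>P (Suc (Suc l))\<^esub>" by (rule low[OF Pl2.gc_MG[OF w(1)]]) simp
   ultimately show "y = \<zero>\<^bsub>P (Suc l)\<^esub>" using mod_hom_zero[OF a(5) a(2) a(2)] by metis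
  qed
  then obtain \<phi>' where \<phi>': "\<phi>' \<in> mod_hom \<A> (KL (Suc l)) (P (Suc l))"
   "bij_betw \<phi>' (carrier (KL (Suc l))) (carrier (P (Suc l)))"
   "\<forall>x\<in>carrier (KL (Suc l)). d l (\<phi>' x) = \<phi> (dL l x)"
   "\<forall>m. \<forall>x\<in>carrier (KL (Suc l)). (\<forall>q. x q \<in> cl ` V m) --> \<phi>' x \<in> PG (Suc l) (int (Suc l) + int m)"
   by (elim exE conjE)
  have p1: "prev (Suc l) (\<phi>' (rowL (Suc l) q))" if q: "q \<in> B (Suc (Suc l))" for q
   unfolding prev_def
   using \<phi>'(3)[rule_format, OF rowL_carrier[OF B_K[OF q]]] \<phi>0 by (simp add: dL_rowL[OF B_K[OF q]])
  have p2: "dL l' x = (%q. \<zero>\<^sub>\<A>)" if "x \<in> carrier (KL (Suc l))" "prev (Suc l) (\<phi>' x)" "Suc l = Suc l'" for x l'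
  proof -
   have "\<phi> (dL l x) = \<zero>\<^bsub>P l\<^esub>" using that(2) \<phi>'(3)[rule_format, OF that(1)] by (simp add: prev_def)
   then have "dL l x = (%q. \<zero>\<^sub>\<A>)" using inj[OF mod_hom_closed[OF dL_hom that(1)] z] \<phi>0 by simp
   then show ?thesis using that(3) by simp
  qed
  have "T (Suc l) \<phi>'" unfolding T_def
   by (intro conjI \<phi>'(1,2,4) ballI impI allI p1 p2) simp_all
  then show "\<exists>\<phi>'. T (Suc l) \<phi>' \<and> (\<forall>x\<in>carrier (KL (Suc l)). d l (\<phi>' x) = \<phi> (dL l x))"
   using \<phi>'(3) by (intro exI[of _ \<phi>'] conjI)
 qed
 then obtain f where f: "\<forall>l. T l (f l) \<and> (\<forall>x\<in>carrier (KL (Suc l)). d l (f (Suc l) x) = f l (dL l x))" by (rule exE)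
 have fT: "T l (f l)" for l by (rule f[rule_format, THEN conjunct1])
 have fd: "d l (f (Suc l) x) = f l (dL l x)" if "x \<in> carrier (KL (Suc l))" for l x
  using f[rule_format, THEN conjunct2] that by blast
 have fh: "f l \<in> mod_hom \<A> (KL l) (P l)" for l by (rule fT[unfolded T_def, THEN conjunct1])
 have fb: "bij_betw (f l) (carrier (KL l)) (carrier (P l))" for l
  by (rule fT[unfolded T_def, THEN conjunct2, THEN conjunct1])
 have fe: "\<epsilon> (f 0 x) = epsL x" if "x \<in> carrier (KL 0)" for x
  using fT[of 0, unfolded T_def] that by simp
 have finj: "x = y" if "x \<in> carrier (KL l)" "y \<in> carrier (KL l)" "f l x = f l y" for x y l
  by (rule inj_onD[OF bij_betw_imp_inj_on[OF fb] that(3,1,2)])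
 have fs: "\<exists>x\<in>carrier (KL l). f l x = y" if "y \<in> carrier (P l)" for y l
 proof -
  have "y \<in> f l ` carrier (KL l)" using bij_betw_imp_surj_on[OF fb, of l] that by (simp only:)
  then obtain x where "y = f l x" "x \<in> carrier (KL l)" by (rule imageE)
  then show ?thesis by (intro bexI[of _ x]) simp_all
 qed
 have f0: "f l \<zero>\<^bsub>KL l\<^esub> = \<zero>\<^bsub>P l\<^esub>" for l by (rule mod_hom_zero[OF fh left_module_KL a(2)])
 have zc: "\<zero>\<^bsub>KL l\<^esub> \<in> carrier (KL l)" for l
  by (rule abelian_monoid.zero_closed[OF abelian_group.axioms(1)[OF left_moduleD(2)[OF left_module_KL]]])
 \<comment> \<open>Boundaries of the given resolution pull back to boundaries of the Koszul complex;
   this transports exactness.\<close>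
 have lift: "x \<in> dL l ` carrier (KL (Suc l))" if x: "x \<in> carrier (KL l)" and fx: "f l x \<in> d l ` carrier (P (Suc l))" for x l
 proof -
  obtain w where w: "w \<in> carrier (P (Suc l))" "f l x = d l w" using fx by blast
  obtain x' where x': "x' \<in> carrier (KL (Suc l))" "f (Suc l) x' = w" using fs[OF w(1)] by blast
  have "f l x = f l (dL l x')" using fd[OF x'(1)] x'(2) w(2) by simp
  then have "x = dL l x'" by (rule finj[OF x mod_hom_closed[OF dL_hom x'(1)]])
  then show ?thesis using x'(1) by blast
 qed
 show ?thesis unfolding resolution_def
 proof (intro conjI allI)
  show "left_module \<A> (qtop Q M)" by (rule a(1))
  show "retract_of_free \<A> (B l) (KL l)" for l by (rule idem_family.retract_of_free_idem[OF fam_KL])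
  show "epsL \<in> mod_hom \<A> (KL 0) (qtop Q M)" by (rule eh)
  show "dL l \<in> mod_hom \<A> (KL (Suc l)) (KL l)" for l by (rule dL_hom)
  show "epsL ` carrier (KL 0) = carrier (qtop Q M)"
  proof (intro equalityI subsetI)
   fix s assume "s \<in> carrier (qtop Q M)"
   then have "s \<in> \<epsilon> ` carrier (P 0)" unfolding a(6) .
   then obtain y where y: "s = \<epsilon> y" "y \<in> carrier (P 0)" by (rule imageE)
   obtain x where x: "x \<in> carrier (KL 0)" "f 0 x = y" using fs[OF y(2)] by blast
   then have "s = epsL x" using fe[OF x(1)] y(1) by simp
   then show "s \<in> epsL ` carrier (KL 0)" using x(1) by (rule image_eqI)
  qed (use mod_hom_closed[OF eh] in blast)
  show "{x \<in> carrier (KL 0). epsL x = \<zero>\<^bsub>qtop Q M\<^esub>} = dL 0 ` carrier (KL 1)"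
  proof (intro equalityI subsetI)
   fix x assume x: "x \<in> {x \<in> carrier (KL 0). epsL x = \<zero>\<^bsub>qtop Q M\<^esub>}"
   then have xc: "x \<in> carrier (KL 0)" and "\<epsilon> (f 0 x) = \<zero>\<^bsub>qtop Q M\<^esub>" using fe by auto
   from lift[OF xc a(7)[OF mod_hom_closed[OF fh xc] this(2)]] show "x \<in> dL 0 ` carrier (KL 1)" by simp
  next
   fix x assume "x \<in> dL 0 ` carrier (KL 1)"
   then obtain w where w: "w \<in> carrier (KL (Suc 0))" "x = dL 0 w" by auto
   have xc: "x \<in> carrier (KL 0)" unfolding w(2) by (rule mod_hom_closed[OF dL_hom w(1)])
   have "epsL x = \<epsilon> (d 0 (f (Suc 0) w))" using fe[OF xc] fd[OF w(1)] w(2) by simp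
   then show "x \<in> {x \<in> carrier (KL 0). epsL x = \<zero>\<^bsub>qtop Q M\<^esub>}"
    using a(8)[OF mod_hom_closed[OF fh w(1)]] xc by simp
  qed
  show "{x \<in> carrier (KL (Suc l)). dL l x = \<zero>\<^bsub>KL l\<^esub>} = dL (Suc l) ` carrier (KL (Suc (Suc l)))" for l
  proof (intro equalityI subsetI)
   fix x assume "x \<in> {x \<in> carrier (KL (Suc l)). dL l x = \<zero>\<^bsub>KL l\<^esub>}"
   then have xc: "x \<in> carrier (KL (Suc l))" and x0: "dL l x = \<zero>\<^bsub>KL l\<^esub>" by auto
   have "d l (f (Suc l) x) = \<zero>\<^bsub>P l\<^esub>" unfolding fd[OF xc] x0 by (rule f0)
   from lift[OF xc a(9)[OF mod_hom_closed[OF fh xc] this]] show "x \<in> dL (Suc l) ` carrier (KL (Suc (Suc l)))" .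
  next
   fix x assume "x \<in> dL (Suc l) ` carrier (KL (Suc (Suc l)))"
   then obtain w where w: "w \<in> carrier (KL (Suc (Suc l)))" "x = dL (Suc l) w" by blast
   have xc: "x \<in> carrier (KL (Suc l))" unfolding w(2) by (rule mod_hom_closed[OF dL_hom w(1)])
   have "f l (dL l x) = d l (d (Suc l) (f (Suc (Suc l)) w))" using fd[OF xc] fd[OF w(1)] w(2) by simp
   also have "\<dots> = f l \<zero>\<^bsub>KL l\<^esub>" unfolding f0 by (rule a(10)[OF mod_hom_closed[OF fh w(1)]])
   finally have "dL l x = \<zero>\<^bsub>KL l\<^esub>" by (rule finj[OF mod_hom_closed[OF dL_hom xc] zc])
   then show "x \<in> {x \<in> carrier (KL (Suc l)). dL l x = \<zero>\<^bsub>KL l\<^esub>}" using xc by simp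
  qed
 qed
qed

end

section \<open>Vanishing of the Koszul spaces above the global dimension\<close>

text \<open>An infimum in \<open>enat\<close> that is bounded by a finite number is attained, and a
  resolution that stops earlier is also zero above n.\<close>

lemma short_projective_resolution:
 fixes R :: "('r, 's) ring_scheme" and X :: "('r, 'r set) module"
 assumes "gl_dim R = enat n" "left_module R X"
 shows "\<exists>(P :: nat => ('r, 'r set) resolution_term) d \<epsilon>.
  projective_resolution R X P d \<epsilon> \<and> (\<forall>l>n. carrier (P l) = {\<zero>\<^bsub>P l\<^esub>})"
proof -
 define S where "S = {enat m | m. \<exists>(P :: nat => ('r, 'r set) resolution_term) d \<epsilon>.
  projective_resolution R X P d \<epsilon> \<and> (\<forall>l>m. carrier (P l) = {\<zero>\<^bsub>P l\<^esub>})}"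
 have "proj_dim R X \<le> gl_dim R" unfolding gl_dim_def by (rule SUP_upper) (simp add: assms(2))
 then have "Inf S \<le> enat n" by (simp add: assms(1) proj_dim_def S_def)
 then have "S \<noteq> {}" by (intro notI) (simp add: Inf_enat_def)
 then have "Inf S \<in> S" by (rule wellorder_InfI[OF some_in_eq[THEN iffD2]])
 then obtain m and P :: "nat => ('r, 'r set) resolution_term" and d \<epsilon> where "Inf S = enat m"
  and P: "projective_resolution R X P d \<epsilon>" "\<forall>l>m. carrier (P l) = {\<zero>\<^bsub>P l\<^esub>}"
  unfolding S_def by blast
 then have "m \<le> n" using \<open>Inf S \<le> enat n\<close> by simp
 have "\<forall>l>n. carrier (P l) = {\<zero>\<^bsub>P l\<^esub>}"
 proof (intro allI impI)
  fix l assume "l > n"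
  then have "l > m" using \<open>m \<le> n\<close> by simp
  then show "carrier (P l) = {\<zero>\<^bsub>P l\<^esub>}" by (rule P(2)[rule_format])
 qed
 then show ?thesis using P(1) by (intro exI conjI)
qed

lemma idem_unit_same: "idem_unit R e q q = e q"
 by (simp add: idem_unit_def)

context koszul_bases
begin

lemma rowL_rad: "q \<in> K (Suc l) ==> rowL l q p \<in> rad 1"
 by (cases "p \<in> B l") (auto simp: rowL_def dR_outside intro!: V_rad[OF dR_props(1)] V_rad[OF fs.subspace_0[OF subspace_V[of 1]]])

text \<open>The Koszul complex is a minimal resolution, so that it is a summand of every resolution.\<close>

lemma B_above_gl_dim:
 assumes "koszul Q M" "gl_dim \<A> = enat n"
 shows "B (Suc n) = {}"
proof (rule equals0I)
 fix q assume q: "q \<in> B (Suc n)"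
 note KR = left_koszul_resolution[OF assms(1)]
 note k = resolutionD[OF KR]
 obtain P :: "nat => (('v, 'a, 'k) path_elem set, ('v, 'a, 'k) path_elem set set) resolution_term" and d \<epsilon>
  where P: "projective_resolution \<A> (qtop Q M) P d \<epsilon>" "\<forall>l>n. carrier (P l) = {\<zero>\<^bsub>P l\<^esub>}"
  using short_projective_resolution[OF assms(2) k(1)] by (elim exE conjE)
 obtain A :: "nat => ((('v, 'a, 'k) path_elem set set \<times> ('v, 'a, 'k) path_elem set) list => ('v, 'a, 'k) path_elem set) set"
  where PR: "resolution \<A> (qtop Q M) A P d \<epsilon>"
  using projective_resolution_imp_resolution[OF P(1)] by (rule exE)
 obtain \<phi> where \<phi>: "chain_map \<A> KL dL epsL P d \<epsilon> \<phi>" using chain_map_exists[OF KR PR] by (rule exE)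
 obtain \<psi> where \<psi>: "chain_map \<A> P d \<epsilon> KL dL epsL \<psi>" using chain_map_exists[OF PR KR] by (rule exE)
 obtain s where s: "!!l. s l \<in> mod_hom \<A> (KL l) (KL (Suc l))"
  and sd: "!!l x. x \<in> carrier (KL (Suc l)) ==> x \<ominus>\<^bsub>KL (Suc l)\<^esub> \<psi> (Suc l) (\<phi> (Suc l) x) =
    dL (Suc l) (s (Suc l) x) \<oplus>\<^bsub>KL (Suc l)\<^esub> s l (dL l x)"
  using chain_homotopy_exists[OF KR KR chain_map_id chain_map_comp[OF \<phi> \<psi>]] by blast
 interpret KS: left_module \<A> "KL (Suc n)" by (rule left_module_KL)
 let ?u = "idem_unit \<A> tidem q"
 have u: "?u \<in> carrier (KL (Suc n))" by (rule unit_carrier[OF q])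
 \<comment> \<open>The other resolution has no term in position n + 1, so there the identity of the
   Koszul complex is null-homotopic.\<close>
 have "\<phi> (Suc n) ?u = \<zero>\<^bsub>P (Suc n)\<^esub>"
  using mod_hom_closed[OF chain_mapD(1)[OF \<phi>] u] P(2)[rule_format, of "Suc n"] by simp
 then have "\<psi> (Suc n) (\<phi> (Suc n) ?u) = \<zero>\<^bsub>KL (Suc n)\<^esub>"
  using mod_hom_zero[OF chain_mapD(1)[OF \<psi>] resolutionD(2)[OF PR] k(2)] by simp
 then have "?u \<ominus>\<^bsub>KL (Suc n)\<^esub> \<psi> (Suc n) (\<phi> (Suc n) ?u) = ?u"
  using u by (simp add: a_minus_def KS.M.a_inv_zero del: KL_ops)
 then have "?u = dL (Suc n) (s (Suc n) ?u) \<oplus>\<^bsub>KL (Suc n)\<^esub> s n (rowL n q)"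
  using sd[OF u] by (simp only: dL_unit[OF q])
 \<comment> \<open>Read at position q, the left side is a vertex idempotent, while both summands on
   the right lie in the radical, each containing one factor from a Koszul differential.\<close>
 then have "?u q = (dL (Suc n) (s (Suc n) ?u) \<oplus>\<^bsub>KL (Suc n)\<^esub> s n (rowL n q)) q" by (rule fun_cong)
 then have "?u q = dL (Suc n) (s (Suc n) ?u) q \<oplus>\<^sub>\<A> s n (rowL n q) q"
  by (simp only: KL_ops)
 then have "tidem q = dL (Suc n) (s (Suc n) ?u) q \<oplus>\<^sub>\<A> s n (rowL n q) q"
  by (simp only: idem_unit_same)
 moreover have "dL (Suc n) (s (Suc n) ?u) q \<in> rad (0 + 1)"
 proof (rule hom_rad[OF dL_hom])
  show "dL (Suc n) (idem_unit \<A> tidem r) p \<in> rad 1" if "r \<in> B (Suc (Suc n))" for r p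
   unfolding dL_unit[OF that] by (rule rowL_rad[OF B_K[OF that]])
  show "s (Suc n) ?u \<in> carrier (KL (Suc (Suc n)))" by (rule mod_hom_closed[OF s u])
  then show "s (Suc n) ?u r \<in> rad 0" for r unfolding rad_all by (rule KL_value)
 qed
 moreover have "s n (rowL n q) q \<in> rad (1 + 0)"
 proof (rule hom_rad[OF s])
  show "s n (idem_unit \<A> tidem r) p \<in> rad 0" if "r \<in> B n" for r p
   unfolding rad_all by (rule KL_value[OF mod_hom_closed[OF s unit_carrier[OF that]]])
  show "rowL n q \<in> carrier (KL n)" by (rule rowL_carrier[OF B_K[OF q]])
  show "rowL n q r \<in> rad 1" for r by (rule rowL_rad[OF B_K[OF q]])
 qed
 ultimately have "tidem q \<in> rad 1" using rad_add[of _ 1] by simp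
 then show False using rad_vx[OF bv(3)[OF q]] by contradiction
qed

end

section \<open>Tensor products over a field\<close>

text \<open>Vector spaces over the type \<open>'k\<close> on an explicit carrier, so that \<Lambda>,
  its left and right ideals and their tensor products are all instances.\<close>

locale kspace = abelian_group G for G :: "('k::field, 'c, 's) module_scheme" (structure) +
 assumes ks_closed: "x \<in> carrier G ==> (c :: 'k) \<odot> x \<in> carrier G"
  and ks_add_left: "x \<in> carrier G ==> (c + d :: 'k) \<odot> x = c \<odot> x \<oplus> d \<odot> x"
  and ks_add_right: "x \<in> carrier G ==> y \<in> carrier G ==> (c :: 'k) \<odot> (x \<oplus> y) = c \<odot> x \<oplus> c \<odot> y"
  and ks_assoc: "x \<in> carrier G ==> (c * d :: 'k) \<odot> x = c \<odot> (d \<odot> x)"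
  and ks_one: "x \<in> carrier G ==> (1 :: 'k) \<odot> x = x"

definition ks_ext :: "('k::field, 'c, 's) module_scheme => ('x => 'c) => ('x \<Rightarrow>\<^sub>0 'k) => 'c" where
 "ks_ext G h f = finsum G (%p. lookup f p \<odot>\<^sub>G h p) (keys f)"

context kspace
begin

lemma ks_zero: "x \<in> carrier G ==> (0 :: 'k) \<odot> x = \<zero>"
 using ks_add_left[of x 0 0] ks_closed[of x 0] add.r_cancel_one[of "0 \<odot> x" "0 \<odot> x"] by simp

lemma ks_zero_right: "(c :: 'k) \<odot> \<zero> = \<zero>"
 using ks_add_right[of \<zero> \<zero> c] ks_closed[of \<zero> c] add.r_cancel_one[of "c \<odot> \<zero>" "c \<odot> \<zero>"] by simp

lemma ks_finsum:
 assumes "finite S" "!!i. i \<in> S ==> f i \<in> carrier G"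
 shows "(c :: 'k) \<odot> finsum G f S = finsum G (%i. c \<odot> f i) S"
 by (rule finsum_hom[OF abelian_group_axioms abelian_group_axioms assms(1)])
  (use assms(2) in \<open>simp_all add: ks_closed ks_add_right ks_zero_right\<close>)

lemma ks_ext_superset:
 assumes "finite S" "keys f \<subseteq> S" "!!p. p \<in> S ==> h p \<in> carrier G"
 shows "ks_ext G h f = finsum G (%p. lookup f p \<odot> h p) S"
 unfolding ks_ext_def
 by (rule add.finprod_mono_neutral_cong_left)
  (use assms in \<open>auto simp: ks_closed ks_zero in_keys_iff\<close>)

lemma ks_ext_add:
 assumes "keys f \<subseteq> X" "keys g \<subseteq> X" "!!p. p \<in> X ==> h p \<in> carrier G"
 shows "ks_ext G h (f + g) = ks_ext G h f \<oplus> ks_ext G h g"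
proof -
 let ?S = "keys f \<union> keys g"
 have h: "h p \<in> carrier G" if "p \<in> ?S" for p using assms that by blast
 have "ks_ext G h (f + g) = finsum G (%p. lookup (f + g) p \<odot> h p) ?S"
  by (rule ks_ext_superset[OF _ keys_add h]) simp_all
 also have "\<dots> = finsum G (%p. lookup f p \<odot> h p \<oplus> lookup g p \<odot> h p) ?S"
  by (rule finsum_cong') (use h in \<open>auto simp: lookup_add ks_add_left ks_closed\<close>)
 also have "\<dots> = finsum G (%p. lookup f p \<odot> h p) ?S \<oplus> finsum G (%p. lookup g p \<odot> h p) ?S"
  by (rule finsum_addf) (use h in \<open>auto simp: ks_closed\<close>)
 also have "\<dots> = ks_ext G h f \<oplus> ks_ext G h g"
  using ks_ext_superset[of ?S f h] ks_ext_superset[of ?S g h] h by simp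
 finally show ?thesis .
qed

lemma ks_ext_scale:
 assumes "!!p. p \<in> keys f ==> h p \<in> carrier G"
 shows "ks_ext G h (fscale c f) = c \<odot> ks_ext G h f"
proof -
 let ?S = "keys f"
 have "ks_ext G h (fscale c f) = finsum G (%p. lookup (fscale c f) p \<odot> h p) ?S"
  by (rule ks_ext_superset) (use assms in \<open>auto simp: in_keys_iff\<close>)
 also have "\<dots> = finsum G (%p. c \<odot> (lookup f p \<odot> h p)) ?S"
  by (rule finsum_cong') (use assms in \<open>auto simp: ks_assoc ks_closed\<close>)
 also have "\<dots> = c \<odot> ks_ext G h f" unfolding ks_ext_def
  by (rule ks_finsum[symmetric]) (use assms in \<open>auto simp: ks_closed\<close>)
 finally show ?thesis .
qed

lemma ks_ext_single: "h p \<in> carrier G ==> ks_ext G h (single p 1) = h p"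
 by (simp add: ks_ext_def ks_one)

lemma ks_ext_closed: "(!!p. p \<in> keys f ==> h p \<in> carrier G) ==> ks_ext G h f \<in> carrier G"
 unfolding ks_ext_def by (rule finsum_closed) (auto simp: ks_closed)

lemma ks_ext_diff_zero:
 assumes "keys f \<subseteq> X" "keys g \<subseteq> X" "!!p. p \<in> X ==> h p \<in> carrier G"
  "ks_ext G h f = ks_ext G h g"
 shows "ks_ext G h (f - g) = \<zero>"
proof -
 have k: "keys (f - g) \<subseteq> X"
  using fs.subspace_diff[OF subspace_keys, of f X g] assms by simp
 have c: "ks_ext G h u \<in> carrier G" if "keys u \<subseteq> X" for u
  by (rule ks_ext_closed) (use assms that in blast)
 have "ks_ext G h f = ks_ext G h (f - g + g)" by simp
 also have "\<dots> = ks_ext G h (f - g) \<oplus> ks_ext G h g" by (rule ks_ext_add[OF k assms(2,3)])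
 finally show ?thesis
  using c[OF k] c[OF assms(2)] assms(4) add.l_cancel_one[of "ks_ext G h g" "ks_ext G h (f - g)"] by simp
qed

end

lemma keys_scaled_single: "p \<in> X ==> keys (fscale c (single p 1)) \<subseteq> X"
 by (auto simp: in_keys_iff lookup_single when_def split: if_splits)

section \<open>The universal property of the tensor product\<close>

definition bilinear_map ::
 "('k::field, 'a, 's) module_scheme => ('k, 'b, 't) module_scheme => ('k, 'c, 'u) module_scheme =>
  ('a => 'b => 'c) => bool"
where
 "bilinear_map A B G h \<longleftrightarrow>
   (\<forall>a\<in>carrier A. \<forall>b\<in>carrier B. h a b \<in> carrier G) \<and>
   (\<forall>a\<in>carrier A. \<forall>a'\<in>carrier A. \<forall>b\<in>carrier B. h (a \<oplus>\<^sub>A a') b = h a b \<oplus>\<^sub>G h a' b) \<and>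
   (\<forall>a\<in>carrier A. \<forall>b\<in>carrier B. \<forall>b'\<in>carrier B. h a (b \<oplus>\<^sub>B b') = h a b \<oplus>\<^sub>G h a b') \<and>
   (\<forall>c. \<forall>a\<in>carrier A. \<forall>b\<in>carrier B. h (c \<odot>\<^sub>A a) b = c \<odot>\<^sub>G h a b) \<and>
   (\<forall>c. \<forall>a\<in>carrier A. \<forall>b\<in>carrier B. h a (c \<odot>\<^sub>B b) = c \<odot>\<^sub>G h a b)"

lemma bilinear_mapI:
 assumes "!!a b. a \<in> carrier A ==> b \<in> carrier B ==> h a b \<in> carrier G"
  "!!a a' b. a \<in> carrier A ==> a' \<in> carrier A ==> b \<in> carrier B ==> h (a \<oplus>\<^sub>A a') b = h a b \<oplus>\<^sub>G h a' b"
  "!!a b b'. a \<in> carrier A ==> b \<in> carrier B ==> b' \<in> carrier B ==> h a (b \<oplus>\<^sub>B b') = h a b \<oplus>\<^sub>G h a b'"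
  "!!c a b. a \<in> carrier A ==> b \<in> carrier B ==> h (c \<odot>\<^sub>A a) b = c \<odot>\<^sub>G h a b"
  "!!c a b. a \<in> carrier A ==> b \<in> carrier B ==> h a (c \<odot>\<^sub>B b) = c \<odot>\<^sub>G h a b"
 shows "bilinear_map A B G h"
 unfolding bilinear_map_def using assms by (intro conjI ballI allI)

text \<open>The map out of the tensor product that belongs to a bilinear h. A class is sent to the
  value of the linear extension of h on its representatives; \<open>ext_const\<close> shows that
  they all give the same value.\<close>

definition induced :: "('k::field, 'c, 's) module_scheme => ('a => 'b => 'c) => (('a \<times> 'b) \<Rightarrow>\<^sub>0 'k) set => 'c" where
 "induced G h x = the_elem (ks_ext G (%(a, b). h a b) ` x)"

locale tensor_product =
 fixes A :: "('k::field, 'a, 's) module_scheme" and B :: "('k, 'b, 't) module_scheme"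
 assumes kA: "kspace A" and kB: "kspace B"
begin

sublocale A: kspace A by (rule kA)
sublocale B: kspace B by (rule kB)

abbreviation "pairs \<equiv> carrier A \<times> carrier B"
abbreviation "rel \<equiv> tensor_rel A B"
abbreviation "T \<equiv> tensor A B"
abbreviation "t \<equiv> tensor_elem A B"
abbreviation sgl :: "'a => 'b => ('a \<times> 'b) \<Rightarrow>\<^sub>0 'k" where "sgl a b \<equiv> single (a, b) 1"

sublocale q: algebra_quotient "pair_algebra A B" pairs
 "%(a, b) (a', b'). single (a \<otimes>\<^sub>A a', b \<otimes>\<^sub>B b') 1"
 "single (\<one>\<^sub>A, \<one>\<^sub>B) 1" rel
 by (intro algebra_quotient.intro) (simp_all add: pair_algebra_def tensor_rel_def Let_def fs.subspace_span)

lemma t_conv: "t a b = q.cls (sgl a b)"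
 by (simp add: tensor_elem_def)

lemmas T_conv = tensor_def[of A B]

lemma rel_add_left: "a \<in> carrier A ==> a' \<in> carrier A ==> b \<in> carrier B ==>
  sgl (a \<oplus>\<^sub>A a') b - sgl a b - sgl a' b \<in> rel"
 and rel_add_right: "a \<in> carrier A ==> b \<in> carrier B ==> b' \<in> carrier B ==>
  sgl a (b \<oplus>\<^sub>B b') - sgl a b - sgl a b' \<in> rel"
 and rel_smult_left: "a \<in> carrier A ==> b \<in> carrier B ==> sgl (c \<odot>\<^sub>A a) b - fscale c (sgl a b) \<in> rel"
 and rel_smult_right: "a \<in> carrier A ==> b \<in> carrier B ==> sgl a (c \<odot>\<^sub>B b) - fscale c (sgl a b) \<in> rel"
 unfolding tensor_rel_def Let_def by (rule fs.span_base, blast)+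

text \<open>Each generator is written as a difference of two elements, the form in which bilinearity
  says that a linear extension takes equal values on both.\<close>

lemma rel_induct:
 assumes "f \<in> rel" "fs.subspace S"
  "!!a a' b. a \<in> carrier A ==> a' \<in> carrier A ==> b \<in> carrier B ==> sgl (a \<oplus>\<^sub>A a') b - (sgl a b + sgl a' b) \<in> S"
  "!!a b b'. a \<in> carrier A ==> b \<in> carrier B ==> b' \<in> carrier B ==> sgl a (b \<oplus>\<^sub>B b') - (sgl a b + sgl a b') \<in> S"
  "!!c a b. a \<in> carrier A ==> b \<in> carrier B ==> sgl (c \<odot>\<^sub>A a) b - fscale c (sgl a b) \<in> S"
  "!!c a b. a \<in> carrier A ==> b \<in> carrier B ==> sgl a (c \<odot>\<^sub>B b) - fscale c (sgl a b) \<in> S"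
 shows "f \<in> S"
proof -
 have "rel \<subseteq> S" unfolding tensor_rel_def Let_def
  by (rule fs.span_minimal[OF _ assms(2)]) (auto simp: diff_diff_eq assms(3-6))
 then show ?thesis using assms(1) by blast
qed

lemma elem_closed: "a \<in> carrier A ==> b \<in> carrier B ==> t a b \<in> carrier T"
 unfolding t_conv T_conv by (rule q.carrierI) simp

lemma elem_add_left: "a \<in> carrier A ==> a' \<in> carrier A ==> b \<in> carrier B ==>
  t (a \<oplus>\<^sub>A a') b = t a b \<oplus>\<^sub>T t a' b"
 using rel_add_left[of a a' b] by (simp add: t_conv T_conv q.cls_add q.cls_eq diff_diff_eq)

lemma elem_add_right: "a \<in> carrier A ==> b \<in> carrier B ==> b' \<in> carrier B ==>
  t a (b \<oplus>\<^sub>B b') = t a b \<oplus>\<^sub>T t a b'"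
 using rel_add_right[of a b b'] by (simp add: t_conv T_conv q.cls_add q.cls_eq diff_diff_eq)

lemma elem_smult_left: "a \<in> carrier A ==> b \<in> carrier B ==> t (c \<odot>\<^sub>A a) b = c \<odot>\<^sub>T t a b"
 using rel_smult_left[of a b c] by (simp add: t_conv T_conv q.cls_smult q.cls_eq)

lemma elem_smult_right: "a \<in> carrier A ==> b \<in> carrier B ==> t a (c \<odot>\<^sub>B b) = c \<odot>\<^sub>T t a b"
 using rel_smult_right[of a b c] by (simp add: t_conv T_conv q.cls_smult q.cls_eq)

lemma kspace_T: "kspace T"
proof (rule kspace.intro)
 show "abelian_group T" unfolding T_conv by (rule q.abelian_group_quot)
 show "kspace_axioms T"
 proof (unfold_locales, goal_cases)
  case (1 x c)
  then show ?case unfolding T_conv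
   by (elim q.carrierE) (auto simp: q.cls_smult in_keys_iff intro!: q.carrierI)
 next
  case (2 x c d)
  then show ?case unfolding T_conv by (elim q.carrierE) (simp add: q.cls_smult q.cls_add fs.scale_left_distrib)
 next
  case (3 x y c)
  then show ?case unfolding T_conv by (elim q.carrierE) (simp add: q.cls_smult q.cls_add fs.scale_right_distrib)
 next
  case (4 x c d)
  then show ?case unfolding T_conv by (elim q.carrierE) (simp add: q.cls_smult)
 next
  case (5 x)
  then show ?case unfolding T_conv by (elim q.carrierE) (simp add: q.cls_smult)
 qed
qed

sublocale T: kspace T by (rule kspace_T)

text \<open>Scalars have no case of their own, being absorbed into the left factor of an elementary
  tensor.\<close>

lemma tensor_induct [consumes 1, case_names zero elem add]:
 assumes "x \<in> carrier T" "P \<zero>\<^sub>T" "!!a b. a \<in> carrier A ==> b \<in> carrier B ==> P (t a b)"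
  "!!x y. x \<in> carrier T ==> y \<in> carrier T ==> P x ==> P y ==> P (x \<oplus>\<^sub>T y)"
 shows "P x"
proof -
 obtain f where f: "x = q.cls f" "keys f \<subseteq> pairs" using assms(1) unfolding T_conv by (rule q.carrierE)
 let ?K = "keys f"
 let ?s = "%p. fscale (lookup f p) (single p 1)"
 have ab: "fst p \<in> carrier A" "snd p \<in> carrier B" if "p \<in> ?K" for p using f(2) that by auto
 have el: "q.cls (?s p) = t (lookup f p \<odot>\<^sub>A fst p) (snd p)" if "p \<in> ?K" for p
  using elem_smult_left[OF ab[OF that], of "lookup f p"] by (simp add: t_conv T_conv q.cls_smult)
 have "x = q.cls (\<Sum>p\<in>?K. ?s p)" unfolding f(1) by (subst poly_mapping_expand) simp
 also have "\<dots> = finsum T (%p. q.cls (?s p)) ?K"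
  unfolding T_conv by (rule q.cls_finsum[symmetric], simp, rule keys_scaled_single, rule subsetD[OF f(2)])
 also have "\<dots> = finsum T (%p. t (lookup f p \<odot>\<^sub>A fst p) (snd p)) ?K"
  by (rule T.finsum_cong') (use f(2) in \<open>auto simp: el intro!: elem_closed A.ks_closed\<close>)
 finally have x: "x = finsum T (%p. t (lookup f p \<odot>\<^sub>A fst p) (snd p)) ?K" .
 have "x \<in> {y \<in> carrier T. P y}" unfolding x
 proof (rule T.finsum_additive_closed)
  show "t (lookup f p \<odot>\<^sub>A fst p) (snd p) \<in> {y \<in> carrier T. P y}" if "p \<in> ?K" for p
   using assms(3) elem_closed A.ks_closed ab[OF that] by simp
 qed (use assms(2,4) in auto)
 then show ?thesis by simp
qed

text \<open>The linear extension of a bilinear map is additive on elements supported on pairs from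
  the carriers. Relations have such support, so with one representative of a class all of them
  qualify.\<close>

lemma rel_keys: "f \<in> rel ==> keys f \<subseteq> pairs"
proof -
 assume "f \<in> rel"
 then have "f \<in> {f. keys f \<subseteq> pairs}"
  by (rule rel_induct[OF _ subspace_keys];
    intro fs.subspace_diff[OF subspace_keys] fs.subspace_add[OF subspace_keys] fs.subspace_scale[OF subspace_keys])
   (simp_all add: A.ks_closed B.ks_closed)
 then show ?thesis by simp
qed

context
 fixes G :: "('k, 'c, 'u) module_scheme" and h
 assumes G: "kspace G" and h: "bilinear_map A B G h"
begin

interpretation G: kspace G by (rule G)

lemma bilinear_map_simps:
 "a \<in> carrier A ==> b \<in> carrier B ==> h a b \<in> carrier G"
 "a \<in> carrier A ==> a' \<in> carrier A ==> b \<in> carrier B ==> h (a \<oplus>\<^sub>A a') b = h a b \<oplus>\<^sub>G h a' b"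
 "a \<in> carrier A ==> b \<in> carrier B ==> b' \<in> carrier B ==> h a (b \<oplus>\<^sub>B b') = h a b \<oplus>\<^sub>G h a b'"
 "a \<in> carrier A ==> b \<in> carrier B ==> h (c \<odot>\<^sub>A a) b = c \<odot>\<^sub>G h a b"
 "a \<in> carrier A ==> b \<in> carrier B ==> h a (c \<odot>\<^sub>B b) = c \<odot>\<^sub>G h a b"
 using h unfolding bilinear_map_def by blast+

abbreviation (input) "hx \<equiv> ks_ext G (%(a, b). h a b)"

lemma pair_value: "p \<in> pairs ==> (case p of (a, b) => h a b) \<in> carrier G"
 by (auto simp: bilinear_map_simps(1))

lemma ext_sgl: "a \<in> carrier A ==> b \<in> carrier B ==> hx (sgl a b) = h a b"
 by (subst G.ks_ext_single) (simp_all add: bilinear_map_simps(1))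

lemma ext_rel: "f \<in> rel ==> hx f = \<zero>\<^sub>G"
proof -
 define S where "S = {f. keys f \<subseteq> pairs \<and> hx f = \<zero>\<^sub>G}"
 have add: "hx (f + g) = hx f \<oplus>\<^sub>G hx g" if "keys f \<subseteq> pairs" "keys g \<subseteq> pairs" for f g
  by (rule G.ks_ext_add[OF that pair_value])
 have scale: "hx (fscale c f) = c \<odot>\<^sub>G hx f" if "keys f \<subseteq> pairs" for c f
  by (rule G.ks_ext_scale) (use that pair_value in blast)
 have S: "fs.subspace S"
  unfolding fs.subspace_def
 proof (intro conjI ballI allI)
  show "0 \<in> S" by (simp add: S_def ks_ext_def)
  show "f + g \<in> S" if "f \<in> S" "g \<in> S" for f g
   using that fs.subspace_add[OF subspace_keys, of f pairs g] add[of f g] by (simp add: S_def)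
  show "fscale c f \<in> S" if "f \<in> S" for f c
   using that fs.subspace_scale[OF subspace_keys, of f pairs c] scale[of f c] by (simp add: S_def G.ks_zero_right)
 qed
 have diff: "f - g \<in> S" if "keys f \<subseteq> pairs" "keys g \<subseteq> pairs" "hx f = hx g" for f g
  unfolding S_def using G.ks_ext_diff_zero[OF that(1,2) pair_value that(3)]
   fs.subspace_diff[OF subspace_keys, of f pairs g] that by simp
 have k: "keys (sgl a b) \<subseteq> pairs" if "a \<in> carrier A" "b \<in> carrier B" for a b using that by simp
 have k2: "keys (f + g) \<subseteq> pairs" if "keys f \<subseteq> pairs" "keys g \<subseteq> pairs"
  for f g :: "('a \<times> 'b) \<Rightarrow>\<^sub>0 'k" using fs.subspace_add[OF subspace_keys, of f pairs g] that by simp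
 have k3: "keys (fscale c f) \<subseteq> pairs" if "keys f \<subseteq> pairs" for c and f :: "('a \<times> 'b) \<Rightarrow>\<^sub>0 'k"
  using fs.subspace_scale[OF subspace_keys, of f pairs c] that by simp
 assume "f \<in> rel"
 then have "f \<in> S"
 proof (rule rel_induct[OF _ S], goal_cases)
  case (1 a a' b)
  then show ?case
   by (intro diff k k2 A.a_closed) (simp_all only: add[OF k k] ext_sgl A.a_closed bilinear_map_simps)
 next
  case (2 a b b')
  then show ?case
   by (intro diff k k2 B.a_closed) (simp_all only: add[OF k k] ext_sgl B.a_closed bilinear_map_simps)
 next
  case (3 c a b)
  then show ?case
   by (intro diff k k3 A.ks_closed) (simp_all only: scale[OF k] ext_sgl A.ks_closed bilinear_map_simps)
 next
  case (4 c a b)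
  then show ?case
   by (intro diff k k3 B.ks_closed) (simp_all only: scale[OF k] ext_sgl B.ks_closed bilinear_map_simps)
 qed
 then show ?thesis by (simp add: S_def)
qed

lemma ext_const:
 assumes "keys f \<subseteq> pairs" "g \<in> q.cls f"
 shows "keys g \<subseteq> pairs" "hx g = hx f"
proof -
 have r: "g - f \<in> rel" using assms(2) by (simp add: q.mem_cls)
 have kr: "keys (g - f) \<subseteq> pairs" by (rule rel_keys[OF r])
 have "hx (g - f + f) = hx (g - f) \<oplus>\<^sub>G hx f" by (rule G.ks_ext_add[OF kr assms(1) pair_value])
 moreover have "hx f \<in> carrier G" by (rule G.ks_ext_closed) (use assms(1) pair_value in blast)
 ultimately show "hx g = hx f" by (simp add: ext_rel[OF r])
 show "keys g \<subseteq> pairs" using fs.subspace_add[OF subspace_keys, of "g - f" pairs f] kr assms(1) by simp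
qed

lemma induced_cls: "keys f \<subseteq> pairs ==> induced G h (q.cls f) = hx f"
proof -
 assume f: "keys f \<subseteq> pairs"
 have "hx ` q.cls f = {hx f}"
 proof (intro equalityI subsetI)
  fix y assume "y \<in> hx ` q.cls f"
  then obtain g where "y = hx g" "g \<in> q.cls f" by (rule imageE)
  then show "y \<in> {hx f}" using ext_const(2)[OF f] by simp
 next
  fix y assume "y \<in> {hx f}"
  moreover have "f \<in> q.cls f" by (simp add: q.mem_cls fs.subspace_0[OF q.subspace_T])
  ultimately show "y \<in> hx ` q.cls f" by simp
 qed
 then show ?thesis by (simp add: induced_def)
qed

lemma induced_elem: "a \<in> carrier A ==> b \<in> carrier B ==> induced G h (t a b) = h a b"
 unfolding t_conv by (subst induced_cls) (simp_all add: ext_sgl)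

lemma induced_closed: "x \<in> carrier T ==> induced G h x \<in> carrier G"
proof -
 assume "x \<in> carrier T"
 then obtain f where f: "x = q.cls f" "keys f \<subseteq> pairs" unfolding T_conv by (rule q.carrierE)
 show ?thesis unfolding f(1) induced_cls[OF f(2)]
  by (rule G.ks_ext_closed) (use f(2) pair_value in blast)
qed

lemma induced_add: "x \<in> carrier T ==> y \<in> carrier T ==>
 induced G h (x \<oplus>\<^sub>T y) = induced G h x \<oplus>\<^sub>G induced G h y"
proof -
 assume "x \<in> carrier T" "y \<in> carrier T"
 then obtain f g where f: "x = q.cls f" "keys f \<subseteq> pairs" and g: "y = q.cls g" "keys g \<subseteq> pairs"
  unfolding T_conv by (elim q.carrierE)
 have "keys (f + g) \<subseteq> pairs" using fs.subspace_add[OF subspace_keys, of f pairs g] f g by simp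
 then show ?thesis
  unfolding f(1) g(1) T_conv q.cls_add
  by (simp only: induced_cls f(2) g(2)) (rule G.ks_ext_add[OF f(2) g(2) pair_value])
qed

lemma induced_zero: "induced G h \<zero>\<^sub>T = \<zero>\<^sub>G"
 by (rule additive_zero[OF T.abelian_group_axioms G.abelian_group_axioms])
  (simp_all add: induced_closed flip: induced_add)

end

end

text \<open>\<open>tensor_map\<close> is a union of cosets over all representatives. Bilinearity
  makes these cosets equal, which gives access to the universal property.\<close>

lemma tensor_map_induced:
 fixes A :: "('k::field, 'a, 's) module_scheme" and B :: "('k, 'b, 't) module_scheme"
 assumes "tensor_product A B" "bilinear_map A B (tensor A B) (%a b. tensor_elem A B (\<phi> a) (\<psi> b))"
  "!!a. a \<in> carrier A ==> \<phi> a \<in> carrier A" "!!b. b \<in> carrier B ==> \<psi> b \<in> carrier B"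
  "x \<in> carrier (tensor A B)"
 shows "tensor_map A B \<phi> \<psi> x = induced (tensor A B) (%a b. tensor_elem A B (\<phi> a) (\<psi> b)) x"
proof -
 interpret tensor_product A B by fact
 let ?s = "%(x, y). single (\<phi> x, \<psi> y) 1 :: ('a \<times> 'b) \<Rightarrow>\<^sub>0 'k"
 obtain f where f: "x = q.cls f" "keys f \<subseteq> pairs" using assms(5) unfolding T_conv by (rule q.carrierE)
 have e: "q.cls (lin_ext ?s g) = ks_ext T (%(a, b). t (\<phi> a) (\<psi> b)) g" if g: "keys g \<subseteq> pairs" for g
 proof -
  have "q.cls (lin_ext ?s g) = finsum T (%p. q.cls (fscale (lookup g p) (?s p))) (keys g)"
   unfolding lin_ext_def T_conv
  proof (rule q.cls_finsum[symmetric])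
   fix p assume "p \<in> keys g"
   then have "p \<in> pairs" using g by blast
   then show "keys (fscale (lookup g p) (?s p)) \<subseteq> pairs"
    using assms(3,4) by (cases p) (simp, rule keys_scaled_single, simp)
  qed simp
  also have "\<dots> = ks_ext T (%(a, b). t (\<phi> a) (\<psi> b)) g"
   unfolding ks_ext_def
  proof (rule T.finsum_cong')
   show "(%p. lookup g p \<odot>\<^sub>T (case p of (a, b) => t (\<phi> a) (\<psi> b))) \<in> keys g \<rightarrow> carrier T"
    using g assms(3,4) by (auto intro!: T.ks_closed elem_closed)
   fix p assume "p \<in> keys g"
   show "q.cls (fscale (lookup g p) (?s p)) = lookup g p \<odot>\<^sub>T (case p of (a, b) => t (\<phi> a) (\<psi> b))"
    unfolding T_conv t_conv q.cls_smult[symmetric] by (simp split: prod.split)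
  qed simp
  finally show ?thesis .
 qed
 have "tensor_map A B \<phi> \<psi> x = (\<Union>g\<in>q.cls f. q.cls (lin_ext ?s g))"
  by (simp add: tensor_map_def f(1))
 also have "\<dots> = (\<Union>g\<in>q.cls f. ks_ext T (%(a, b). t (\<phi> a) (\<psi> b)) f)"
 proof (rule SUP_cong[OF refl])
  fix g assume g: "g \<in> q.cls f"
  note c = ext_const[OF kspace_T assms(2) f(2) g]
  show "q.cls (lin_ext ?s g) = ks_ext T (%(a, b). t (\<phi> a) (\<psi> b)) f" using e[OF c(1)] c(2) by simp
 qed
 also have "\<dots> = ks_ext T (%(a, b). t (\<phi> a) (\<psi> b)) f"
  using fs.subspace_0[OF q.subspace_T] q.mem_cls[of f f] by auto
 also have "\<dots> = induced T (%a b. t (\<phi> a) (\<psi> b)) x"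
  unfolding f(1) by (rule induced_cls[OF kspace_T assms(2) f(2), symmetric])
 finally show ?thesis .
qed

section \<open>The enveloping algebra\<close>

lemma op_algebra_simps [simp]:
 "carrier (op_algebra A) = carrier A" "x \<otimes>\<^bsub>op_algebra A\<^esub> y = y \<otimes>\<^sub>A x" "\<one>\<^bsub>op_algebra A\<^esub> = \<one>\<^sub>A"
 "\<zero>\<^bsub>op_algebra A\<^esub> = \<zero>\<^sub>A" "x \<oplus>\<^bsub>op_algebra A\<^esub> y = x \<oplus>\<^sub>A y" "c \<odot>\<^bsub>op_algebra A\<^esub> x = c \<odot>\<^sub>A x"
 by (simp_all add: op_algebra_def)

lemma env_diagonal_simps:
 "carrier (env_diagonal A) = carrier A" "\<zero>\<^bsub>env_diagonal A\<^esub> = \<zero>\<^sub>A" "x \<oplus>\<^bsub>env_diagonal A\<^esub> y = x \<oplus>\<^sub>A y"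
 "u \<odot>\<^bsub>env_diagonal A\<^esub> x = induced A (%a b. a \<otimes>\<^sub>A x \<otimes>\<^sub>A b) u"
 by (simp_all add: env_diagonal_def ring.defs module.defs induced_def ks_ext_def case_prod_unfold)

lemma kspace_op_algebra: "kspace A ==> kspace (op_algebra A)"
proof -
 assume "kspace A"
 then interpret kspace A .
 have inv: "\<exists>y\<in>carrier A. y \<oplus>\<^sub>A x = \<zero>\<^sub>A" if "x \<in> carrier A" for x
  using that by (intro bexI[of _ "\<ominus>\<^sub>A x"]) (auto simp: l_neg)
 have "abelian_group (op_algebra A)"
  by (rule abelian_groupI) (simp_all add: a_ac inv)
 then show ?thesis
  by (intro kspace.intro kspace_axioms.intro)
   (simp_all add: ks_closed ks_add_left ks_add_right ks_assoc ks_one)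
qed

context tensor_product
begin

text \<open>If the product of cosets is closed, it is the coset of the product, even without knowing that
 the relations form an ideal.\<close>

lemma elem_mult:
 assumes "ring T" "a \<in> carrier A" "b \<in> carrier B" "c \<in> carrier A" "d \<in> carrier B"
 shows "t a b \<otimes>\<^sub>T t c d = t (a \<otimes>\<^sub>A c) (b \<otimes>\<^sub>B d)"
proof -
 interpret R: ring T by fact
 have "t a b \<otimes>\<^sub>T t c d \<in> carrier T" using assms by (simp add: elem_closed)
 then obtain f where f: "t a b \<otimes>\<^sub>T t c d = q.cls f" unfolding T_conv by (elim q.carrierE)
 have self: "g \<in> q.cls g" for g by (simp add: q.mem_cls fs.subspace_0[OF q.subspace_T])
 have m: "sgl a b \<otimes>\<^bsub>pair_algebra A B\<^esub> sgl c d = sgl (a \<otimes>\<^sub>A c) (b \<otimes>\<^sub>B d)"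
  by (simp add: pair_algebra_def del: amul_single) (simp add: amul_single)
 have "q.cls (sgl a b \<otimes>\<^bsub>pair_algebra A B\<^esub> sgl c d) \<subseteq> t a b \<otimes>\<^sub>T t c d"
  unfolding T_conv quot_simps rcoset_mult_def t_conv
  using self[of "sgl a b"] self[of "sgl c d"] by blast
 then have "sgl (a \<otimes>\<^sub>A c) (b \<otimes>\<^sub>B d) \<in> q.cls f" using self f m by auto
 then have "q.cls (sgl (a \<otimes>\<^sub>A c) (b \<otimes>\<^sub>B d)) = q.cls f" by (simp add: q.mem_cls q.cls_eq)
 then show ?thesis unfolding f by (simp only: t_conv)
qed

end

context quadratic_quiver
begin

lemma kspace_\<A>: "kspace \<A>"
proof (rule kspace.intro)
 show "abelian_group \<A>" by (rule L.is_abelian_group)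
 show "kspace_axioms \<A>"
 proof (unfold_locales, goal_cases)
  case (1 x c) then show ?case by (elim clE) (simp add: cl_smult clI keys_scale)
 next
  case (2 x c d) then show ?case by (elim clE) (simp add: cl_smult cl_add fs.scale_left_distrib)
 next
  case (3 x y c) then show ?case by (elim clE) (simp add: cl_smult cl_add fs.scale_right_distrib)
 next
  case (4 x c d) then show ?case by (elim clE) (simp add: cl_smult)
 next
  case (5 x) then show ?case by (elim clE) (simp add: cl_smult)
 qed
qed

sublocale LV: kspace \<A> by (rule kspace_\<A>)

lemma smult_mult:
 assumes "x \<in> carrier \<A>" "y \<in> carrier \<A>"
 shows "(c \<odot>\<^sub>\<A> x) \<otimes>\<^sub>\<A> y = c \<odot>\<^sub>\<A> (x \<otimes>\<^sub>\<A> y)" "x \<otimes>\<^sub>\<A> (c \<odot>\<^sub>\<A> y) = c \<odot>\<^sub>\<A> (x \<otimes>\<^sub>\<A> y)"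
 using assms by (elim clE, simp add: cl_smult cl_mult keys_scale kQ_simps pmul_left pmul_right)+

sublocale E: tensor_product \<A> "op_algebra \<A>"
 by (intro tensor_product.intro kspace_\<A> kspace_op_algebra)

abbreviation E where "E \<equiv> env \<A>"

abbreviation "\<D> \<equiv> env_diagonal \<A>"

abbreviation te (infixl "\<boxtimes>" 72) where "te \<equiv> tensor_elem \<A> (op_algebra \<A>)"

lemma E_conv: "E = tensor \<A> (op_algebra \<A>)"
 by (simp add: env_def)

lemma te_closed: "a \<in> carrier \<A> ==> b \<in> carrier \<A> ==> a \<boxtimes> b \<in> carrier E"
 using E.elem_closed[of a b] by (simp add: E_conv)

lemma te_add_left: "a \<in> carrier \<A> ==> a' \<in> carrier \<A> ==> b \<in> carrier \<A> ==>
  (a \<oplus>\<^sub>\<A> a') \<boxtimes> b = a \<boxtimes> b \<oplus>\<^sub>E a' \<boxtimes> b"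
 using E.elem_add_left[of a a' b] by (simp add: E_conv)

lemma te_add_right: "a \<in> carrier \<A> ==> b \<in> carrier \<A> ==> b' \<in> carrier \<A> ==>
  a \<boxtimes> (b \<oplus>\<^sub>\<A> b') = a \<boxtimes> b \<oplus>\<^sub>E a \<boxtimes> b'"
 using E.elem_add_right[of a b b'] by (simp add: E_conv)

lemma te_swap_scalar: "a \<in> carrier \<A> ==> b \<in> carrier \<A> ==> a \<boxtimes> (c \<odot>\<^sub>\<A> b) = (c \<odot>\<^sub>\<A> a) \<boxtimes> b"
 using E.elem_smult_left[of a b c] E.elem_smult_right[of a b c] by simp

lemmas E_abelian = E.T.abelian_group_axioms[folded E_conv]

lemma te_zero: "a \<in> carrier \<A> ==> a \<boxtimes> \<zero>\<^sub>\<A> = \<zero>\<^sub>E" "b \<in> carrier \<A> ==> \<zero>\<^sub>\<A> \<boxtimes> b = \<zero>\<^sub>E"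
proof -
 show "a \<in> carrier \<A> ==> a \<boxtimes> \<zero>\<^sub>\<A> = \<zero>\<^sub>E"
  by (rule additive_zero[OF L.is_abelian_group E_abelian, of "%x. a \<boxtimes> x"]) (simp_all add: te_closed flip: te_add_right)
 show "b \<in> carrier \<A> ==> \<zero>\<^sub>\<A> \<boxtimes> b = \<zero>\<^sub>E"
  by (rule additive_zero[OF L.is_abelian_group E_abelian, of "%x. x \<boxtimes> b"]) (simp_all add: te_closed flip: te_add_left)
qed

lemma te_finsum_right:
 assumes "a \<in> carrier \<A>" "finite J" "!!i. i \<in> J ==> f i \<in> carrier \<A>"
 shows "a \<boxtimes> finsum \<A> f J = finsum E (%i. a \<boxtimes> f i) J"
 by (rule finsum_hom[OF L.is_abelian_group E_abelian assms(2), where h="%x. a \<boxtimes> x"])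
  (use assms in \<open>simp_all add: te_closed te_zero te_add_right\<close>)

lemma te_finsum_left:
 assumes "b \<in> carrier \<A>" "finite J" "!!i. i \<in> J ==> f i \<in> carrier \<A>"
 shows "finsum \<A> f J \<boxtimes> b = finsum E (%i. f i \<boxtimes> b) J"
 by (rule finsum_hom[OF L.is_abelian_group E_abelian assms(2), where h="%x. x \<boxtimes> b"])
  (use assms in \<open>simp_all add: te_closed te_zero te_add_left\<close>)

lemma te_induct [consumes 1, case_names zero elem add]:
 assumes "x \<in> carrier E" "P \<zero>\<^sub>E" "!!a b. a \<in> carrier \<A> ==> b \<in> carrier \<A> ==> P (a \<boxtimes> b)"
  "!!x y. x \<in> carrier E ==> y \<in> carrier E ==> P x ==> P y ==> P (x \<oplus>\<^sub>E y)"
 shows "P x"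
 using E.tensor_induct[of x P] assms by (simp add: E_conv)

lemma te_mult:
 assumes "ring E" "a \<in> carrier \<A>" "b \<in> carrier \<A>" "c \<in> carrier \<A>" "d \<in> carrier \<A>"
 shows "a \<boxtimes> b \<otimes>\<^sub>E c \<boxtimes> d = (a \<otimes>\<^sub>\<A> c) \<boxtimes> (d \<otimes>\<^sub>\<A> b)"
 using E.elem_mult[of a b c d] assms by (simp add: E_conv)

lemma diagonal_smult:
 assumes "a \<in> carrier \<A>" "b \<in> carrier \<A>" "x \<in> carrier \<A>"
 shows "(a \<boxtimes> b) \<odot>\<^bsub>\<D>\<^esub> x = a \<otimes>\<^sub>\<A> x \<otimes>\<^sub>\<A> b"
 unfolding env_diagonal_simps
proof (rule E.induced_elem[OF kspace_\<A>])
 show "bilinear_map \<A> (op_algebra \<A>) \<A> (%a b. a \<otimes>\<^sub>\<A> x \<otimes>\<^sub>\<A> b)"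
  by (rule bilinear_mapI) (use assms in \<open>simp_all add: L.l_distr L.r_distr smult_mult\<close>)
qed (use assms in simp_all)

end

section \<open>Slices along the right tensor factor\<close>

context fd_quadratic_quiver
begin

text \<open>The map id \<otimes> \<beta>* onto \<Lambda>, where \<beta>* is the coordinate function
  at \<beta> of the basis \<open>NB\<close>. Thus \<open>E\<close> is treated as a free left
  \<Lambda>-module whose basis is given by the paths in the second factor.\<close>

definition slice :: "'v \<times> 'a list => ((('v, 'a, 'k) path_elem set \<times> ('v, 'a, 'k) path_elem set) \<Rightarrow>\<^sub>0 'k) set =>
  ('v, 'a, 'k) path_elem set" where
 "slice \<beta> = induced \<A> (%a b. coord \<beta> b \<odot>\<^sub>\<A> a)"

lemma bilinear_slice: "bilinear_map \<A> (op_algebra \<A>) \<A> (%a b. coord \<beta> b \<odot>\<^sub>\<A> a)"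
 by (rule bilinear_mapI)
  (simp_all add: coord_add coord_smult LV.ks_closed LV.ks_add_left LV.ks_add_right mult.commute flip: LV.ks_assoc)

lemma slice_te: "a \<in> carrier \<A> ==> b \<in> carrier \<A> ==> slice \<beta> (a \<boxtimes> b) = coord \<beta> b \<odot>\<^sub>\<A> a"
 unfolding slice_def by (rule E.induced_elem[OF kspace_\<A> bilinear_slice]) simp_all

lemma slice_closed: "x \<in> carrier E ==> slice \<beta> x \<in> carrier \<A>"
 unfolding slice_def E_conv by (rule E.induced_closed[OF kspace_\<A> bilinear_slice])

lemma slice_add: "x \<in> carrier E ==> y \<in> carrier E ==> slice \<beta> (x \<oplus>\<^sub>E y) = slice \<beta> x \<oplus>\<^sub>\<A> slice \<beta> y"
 unfolding slice_def E_conv by (rule E.induced_add[OF kspace_\<A> bilinear_slice])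

lemma slice_zero: "slice \<beta> \<zero>\<^sub>E = \<zero>\<^sub>\<A>"
 unfolding slice_def E_conv by (rule E.induced_zero[OF kspace_\<A> bilinear_slice])

lemma slice_finsum:
 assumes "finite J" "!!i. i \<in> J ==> f i \<in> carrier E"
 shows "slice \<beta> (finsum E f J) = finsum \<A> (%i. slice \<beta> (f i)) J"
 by (rule finsum_hom[OF E_abelian L.is_abelian_group assms(1)])
  (use assms(2) in \<open>simp_all add: slice_closed slice_zero slice_add\<close>)

abbreviation nb :: "'v \<times> 'a list => ('v, 'a, 'k) path_elem set" where "nb \<beta> \<equiv> cl (psingle \<beta>)"

lemma nb_V: "\<beta> \<in> NB ==> psingle \<beta> \<in> V (plen \<beta>)"
 using NB(1) by (auto simp: path_part_def)

lemma nb_closed: "\<beta> \<in> NB ==> nb \<beta> \<in> carrier \<A>"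
 by (rule clI[OF V_paths[OF nb_V]])

lemma slice_expand: "x \<in> carrier E ==> x = finsum E (%\<beta>. slice \<beta> x \<boxtimes> nb \<beta>) NB"
proof (induction x rule: te_induct)
 interpret EG: abelian_group E by (rule E_abelian)
 case zero
 have "finsum E (%\<beta>. slice \<beta> \<zero>\<^sub>E \<boxtimes> nb \<beta>) NB = finsum E (%\<beta>. \<zero>\<^sub>E) NB"
  by (rule EG.finsum_cong') (simp_all add: slice_zero te_zero nb_closed)
 then show ?case by simp
next
 interpret EG: abelian_group E by (rule E_abelian)
 case (elem a b)
 have c: "coord \<beta> b \<odot>\<^sub>\<A> nb \<beta> \<in> carrier \<A>" if "\<beta> \<in> NB" for \<beta> by (rule LV.ks_closed[OF nb_closed[OF that]])
 have "a \<boxtimes> b = a \<boxtimes> finsum \<A> (%\<beta>. coord \<beta> b \<odot>\<^sub>\<A> nb \<beta>) NB" using coord_expand[OF elem(2)] by simp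
 also have "\<dots> = finsum E (%\<beta>. a \<boxtimes> (coord \<beta> b \<odot>\<^sub>\<A> nb \<beta>)) NB"
  by (rule te_finsum_right[OF elem(1) finite_NB c])
 also have "\<dots> = finsum E (%\<beta>. slice \<beta> (a \<boxtimes> b) \<boxtimes> nb \<beta>) NB"
  by (rule EG.finsum_cong') (use elem in \<open>auto simp: slice_te te_swap_scalar nb_closed LV.ks_closed te_closed\<close>)
 finally show ?case .
next
 interpret EG: abelian_group E by (rule E_abelian)
 case (add x y)
 have s: "slice \<beta> x \<boxtimes> nb \<beta> \<in> carrier E" "slice \<beta> y \<boxtimes> nb \<beta> \<in> carrier E" if "\<beta> \<in> NB" for \<beta>
  using add(1,2) that by (simp_all add: te_closed slice_closed nb_closed)
 have "x \<oplus>\<^sub>E y = finsum E (%\<beta>. slice \<beta> x \<boxtimes> nb \<beta>) NB \<oplus>\<^sub>E finsum E (%\<beta>. slice \<beta> y \<boxtimes> nb \<beta>) NB"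
  using add(3,4) by simp
 also have "\<dots> = finsum E (%\<beta>. slice \<beta> x \<boxtimes> nb \<beta> \<oplus>\<^sub>E slice \<beta> y \<boxtimes> nb \<beta>) NB"
  by (rule EG.finsum_addf[symmetric]) (auto simp: s)
 also have "\<dots> = finsum E (%\<beta>. slice \<beta> (x \<oplus>\<^sub>E y) \<boxtimes> nb \<beta>) NB"
  by (rule EG.finsum_cong') (use add(1,2) in \<open>auto simp: slice_add te_add_left slice_closed nb_closed te_closed\<close>)
 finally show ?case .
qed

lemma slices_zero: "x \<in> carrier E ==> (!!\<beta>. \<beta> \<in> NB ==> slice \<beta> x = \<zero>\<^sub>\<A>) ==> x = \<zero>\<^sub>E"
proof -
 interpret EG: abelian_group E by (rule E_abelian)
 assume x: "x \<in> carrier E" and z: "!!\<beta>. \<beta> \<in> NB ==> slice \<beta> x = \<zero>\<^sub>\<A>"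
 have "finsum E (%\<beta>. slice \<beta> x \<boxtimes> nb \<beta>) NB = finsum E (%\<beta>. \<zero>\<^sub>E) NB"
  by (rule EG.finsum_cong') (simp_all add: z te_zero nb_closed)
 then show ?thesis using slice_expand[OF x] by simp
qed

lemma slice_nb: "a \<in> carrier \<A> ==> \<beta> \<in> NB ==> \<gamma> \<in> NB ==> slice \<gamma> (a \<boxtimes> nb \<beta>) = (if \<gamma> = \<beta> then a else \<zero>\<^sub>\<A>)"
 by (simp add: slice_te nb_closed coord_basis LV.ks_one LV.ks_zero)

text \<open>Right multiplication by a \<boxtimes> b multiplies the first factor by a on the right
  and, since the second factor belongs to the opposite algebra, the second one by b on the left.
  Only the latter mixes slices.\<close>

lemma slice_mult:
 assumes E: "ring E" and x: "x \<in> carrier E" and a: "a \<in> carrier \<A>" and b: "b \<in> carrier \<A>"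
 shows "slice \<gamma> (x \<otimes>\<^sub>E a \<boxtimes> b) = finsum \<A> (%\<beta>. coord \<gamma> (b \<otimes>\<^sub>\<A> nb \<beta>) \<odot>\<^sub>\<A> (slice \<beta> x \<otimes>\<^sub>\<A> a)) NB"
proof -
 interpret E: ring E by fact
 have s: "slice \<beta> x \<boxtimes> nb \<beta> \<in> carrier E" if "\<beta> \<in> NB" for \<beta>
  using x that by (simp add: te_closed slice_closed nb_closed)
 have "x \<otimes>\<^sub>E a \<boxtimes> b = finsum E (%\<beta>. slice \<beta> x \<boxtimes> nb \<beta>) NB \<otimes>\<^sub>E a \<boxtimes> b" using slice_expand[OF x] by simp
 also have "\<dots> = finsum E (%\<beta>. slice \<beta> x \<boxtimes> nb \<beta> \<otimes>\<^sub>E a \<boxtimes> b) NB"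
  by (rule E.finsum_ldistr[OF finite_NB te_closed[OF a b]]) (simp add: s)
 finally have e: "x \<otimes>\<^sub>E a \<boxtimes> b = finsum E (%\<beta>. slice \<beta> x \<boxtimes> nb \<beta> \<otimes>\<^sub>E a \<boxtimes> b) NB" .
 have "slice \<gamma> (x \<otimes>\<^sub>E a \<boxtimes> b) = finsum \<A> (%\<beta>. slice \<gamma> (slice \<beta> x \<boxtimes> nb \<beta> \<otimes>\<^sub>E a \<boxtimes> b)) NB"
  unfolding e by (rule slice_finsum[OF finite_NB]) (simp add: s te_closed a b)
 also have "\<dots> = finsum \<A> (%\<beta>. coord \<gamma> (b \<otimes>\<^sub>\<A> nb \<beta>) \<odot>\<^sub>\<A> (slice \<beta> x \<otimes>\<^sub>\<A> a)) NB"
  by (rule L.finsum_cong')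
   (use a b x in \<open>auto simp: te_mult[OF E] slice_closed nb_closed slice_te intro!: LV.ks_closed\<close>)
 finally show ?thesis .
qed

lemma vx_nb: "i \<in> verts Q ==> \<beta> \<in> NB ==> cl (vx i) \<otimes>\<^sub>\<A> nb \<beta> = (if ptarget \<beta> = i then nb \<beta> else \<zero>\<^sub>\<A>)"
 using NB(1) by (auto simp: cl_mult_V[OF vx_V nb_V] vx_psingle cl_zero)

text \<open>A vertex keeps or kills a basis path, so no mixing of slices takes place.\<close>

lemma slice_mult_vertex:
 assumes E: "ring E" and x: "x \<in> carrier E" and a: "a \<in> carrier \<A>" and i: "i \<in> verts Q" and \<gamma>: "\<gamma> \<in> NB"
 shows "slice \<gamma> (x \<otimes>\<^sub>E a \<boxtimes> cl (vx i)) = (if ptarget \<gamma> = i then slice \<gamma> x \<otimes>\<^sub>\<A> a else \<zero>\<^sub>\<A>)"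
proof -
 let ?y = "%\<beta>. if ptarget \<beta> = i then slice \<beta> x \<otimes>\<^sub>\<A> a else \<zero>\<^sub>\<A>"
 have y: "?y \<beta> \<in> carrier \<A>" for \<beta> using slice_closed[OF x] a by simp
 have c0: "coord \<delta> \<zero>\<^sub>\<A> = 0" for \<delta> using coord_smult[of "\<zero>\<^sub>\<A>" \<delta> 0] LV.ks_zero[of "\<zero>\<^sub>\<A>"] by simp
 have "slice \<gamma> (x \<otimes>\<^sub>E a \<boxtimes> cl (vx i)) =
   finsum \<A> (%\<beta>. coord \<gamma> (cl (vx i) \<otimes>\<^sub>\<A> nb \<beta>) \<odot>\<^sub>\<A> (slice \<beta> x \<otimes>\<^sub>\<A> a)) NB"
  by (rule slice_mult[OF E x a clI[OF vx_paths[OF i]]])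
 also have "\<dots> = finsum \<A> (%\<beta>. if \<gamma> = \<beta> then ?y \<beta> else \<zero>\<^sub>\<A>) NB"
  by (rule L.finsum_cong')
   (use \<gamma> y slice_closed[OF x] a c0 in \<open>simp_all add: vx_nb[OF i] coord_basis LV.ks_one LV.ks_zero\<close>)
 also have "\<dots> = ?y \<gamma>" by (rule L.finsum_singleton[OF \<gamma> finite_NB]) (use y in simp)
 finally show ?thesis .
qed

text \<open>An arrow lengthens the path that it multiplies, so the slice at \<gamma> of the product
  is fed by strictly shorter basis paths only.\<close>

lemma slice_mult_arrow:
 assumes E: "ring E" and x: "x \<in> carrier E" and a: "a \<in> carrier \<A>" and b: "b \<in> V 1"
  and low: "!!\<beta>. \<beta> \<in> NB ==> plen \<beta> < plen \<gamma> ==> slice \<beta> x = \<zero>\<^sub>\<A>"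
 shows "slice \<gamma> (x \<otimes>\<^sub>E a \<boxtimes> cl b) = \<zero>\<^sub>\<A>"
proof -
 have "slice \<gamma> (x \<otimes>\<^sub>E a \<boxtimes> cl b) = finsum \<A> (%\<beta>. coord \<gamma> (cl b \<otimes>\<^sub>\<A> nb \<beta>) \<odot>\<^sub>\<A> (slice \<beta> x \<otimes>\<^sub>\<A> a)) NB"
  by (rule slice_mult[OF E x a clI[OF V_paths[OF b]]])
 also have "\<dots> = finsum \<A> (%\<beta>. \<zero>\<^sub>\<A>) NB"
 proof (rule L.finsum_cong')
  fix \<beta> assume \<beta>: "\<beta> \<in> NB"
  show "coord \<gamma> (cl b \<otimes>\<^sub>\<A> nb \<beta>) \<odot>\<^sub>\<A> (slice \<beta> x \<otimes>\<^sub>\<A> a) = \<zero>\<^sub>\<A>"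
  proof (cases "plen \<beta> < plen \<gamma>")
   case True
   then show ?thesis using low[OF \<beta>] a by (simp add: LV.ks_zero_right)
  next
   case False
   have "coord \<gamma> (cl b \<otimes>\<^sub>\<A> nb \<beta>) = 0"
    unfolding cl_mult_V[OF b nb_V[OF \<beta>]]
    by (rule coord_V[OF V_mult[OF b nb_V[OF \<beta>]]]) (use False in simp)
   then show ?thesis using slice_closed[OF x] a by (simp add: LV.ks_zero)
  qed
 qed simp_all
 finally show ?thesis by simp
qed

end

section \<open>The Koszul bimodule resolution\<close>

context fd_quadratic_quiver
begin

lemma coord_rad: "x \<in> rad k ==> plen \<gamma> < k ==> coord \<gamma> x = 0"
proof -
 assume x: "x \<in> rad k" and k: "plen \<gamma> < k"
 obtain f where f: "x = cl f" "f \<in> {f. keys f \<subseteq> {p \<in> paths Q. plen p \<ge> k}}"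
  using x unfolding rad_def by (rule imageE)
 let ?s = "%p. cl (fscale (lookup f p) (psingle p))"
 have V: "fscale (lookup f p) (psingle p) \<in> V (plen p)" if "p \<in> keys f" for p
  using f(2) that by (intro V_scale) (auto simp: path_part_def)
 have c: "?s p \<in> carrier \<A> \<and> coord \<gamma> (?s p) = 0" if p: "p \<in> keys f" for p
 proof
  show "?s p \<in> carrier \<A>" by (rule clI[OF V_paths[OF V[OF p]]])
  have "plen \<gamma> \<noteq> plen p" using f(2) p k by auto
  then show "coord \<gamma> (?s p) = 0" by (intro coord_V[OF V[OF p]])
 qed
 have "x = cl (\<Sum>p\<in>keys f. fscale (lookup f p) (psingle p))"
  unfolding f(1) by (subst poly_mapping_expand) simp
 also have "\<dots> = finsum \<A> ?s (keys f)"
  by (rule cl_finsum[symmetric]) (simp_all add: V_paths[OF V])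
 also have "\<dots> \<in> {x \<in> carrier \<A>. coord \<gamma> x = 0}"
 proof (rule L.finsum_additive_closed)
  have "coord \<gamma> \<zero>\<^sub>\<A> = 0" using coord_smult[of "\<zero>\<^sub>\<A>" \<gamma> 0] LV.ks_zero[of "\<zero>\<^sub>\<A>"] by simp
  then show "\<zero>\<^sub>\<A> \<in> {x \<in> carrier \<A>. coord \<gamma> x = 0}" by simp
  show "?s p \<in> {x \<in> carrier \<A>. coord \<gamma> x = 0}" if "p \<in> keys f" for p using c[OF that] by simp
 qed (auto simp: coord_add)
 finally show ?thesis by simp
qed

text \<open>There are no relations in degree one, so a linear element is its own normal
  form.\<close>

lemma coord_V1: "f \<in> V 1 ==> coord \<gamma> (cl f) = lookup f \<gamma>"
proof -
 assume f: "f \<in> V 1"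
 have "nf f = f" by (rule cl_inj_low[OF nf_V[OF f] f]) (simp_all add: cl_nf[OF V_paths[OF f]])
 then show ?thesis by (simp add: coord_cl[OF V_paths[OF f]])
qed

text \<open>Right multiplication by the vertex i removes all trivial paths but the one at i;
  subtracting the corresponding multiple of e_i leaves paths of positive length.\<close>

lemma vertex_component:
 assumes z: "z \<in> carrier \<A>" "z \<otimes>\<^sub>\<A> cl (vx i) = z" and i: "i \<in> verts Q"
 shows "\<exists>c r. r \<in> rad 1 \<and> z = cl (fscale c (vx i)) \<oplus>\<^sub>\<A> r"
proof -
 obtain g where g: "z = cl g" "in_kQ g" using z(1) by (rule clE)
 let ?c = "lookup g (i, [])"
 let ?r = "g \<cdot> vx i - fscale ?c (vx i)"
 have k: "keys ?r \<subseteq> {p \<in> paths Q. plen p \<ge> 1}"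
 proof
  fix p assume p: "p \<in> keys ?r"
  have "lookup (vx i :: ('v, 'a, 'k) path_elem) p = (if p = (i, []) then 1 else 0)"
   by (auto simp: vertex_idem_def lookup_single when_def)
  then have "lookup ?r p = (if fst p = i then lookup g p else 0) - ?c * (if p = (i, []) then 1 else 0)"
   by (simp add: lookup_minus lookup_vx_right)
  moreover have "lookup ?r p \<noteq> 0" using p by (simp add: in_keys_iff)
  ultimately have "p \<noteq> (i, [])" "fst p = i" "lookup g p \<noteq> 0" by (auto split: if_splits)
  then show "p \<in> {p \<in> paths Q. plen p \<ge> 1}" using g(2) by (cases p) (auto simp: in_keys_iff Suc_le_eq)
 qed
 have "z = cl (g \<cdot> vx i)" using z(2) g cl_mult[OF g(2) vx_paths[OF i]] by (simp add: kQ_simps)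
 also have "\<dots> = cl (fscale ?c (vx i) + ?r)" by simp
 also have "\<dots> = cl (fscale ?c (vx i)) \<oplus>\<^sub>\<A> cl ?r" by (rule cl_add[symmetric])
 finally show ?thesis using k by (intro exI[of _ ?c] exI[of _ "cl ?r"]) (auto simp: rad_def)
qed

end

text \<open>The assumption \<open>diagonal\<close> includes that \<open>E\<close> is a ring. It is
  available because the resolution given in the theorem is one of this module.\<close>

locale env_koszul = koszul_bases Q M B
 for Q :: "('v, 'a) pre_digraph" and M :: "('v, 'a, 'k::field) path_elem set" and B +
 assumes diagonal: "left_module (env (qalg Q M)) (env_diagonal (qalg Q M))" and koszul: "koszul Q M"
begin

lemma ring_E: "ring E" by (rule left_moduleD(1)[OF diagonal])

sublocale ER: ring E by (rule ring_E)
sublocale D: left_module E "\<D>" by (rule diagonal)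

lemmas tm = te_mult[OF ring_E]

abbreviation sidem :: "('v, 'a, 'k) path_elem => ('v, 'a, 'k) path_elem set" where
 "sidem q \<equiv> cl (vx (source Q q))"

abbreviation "bidem q \<equiv> tidem q \<boxtimes> sidem q"

abbreviation KB where "KB l \<equiv> idem_module E (B l) bidem"

text \<open>The left coefficients with the sign that they carry in the bimodule differential from
  position l + 1 to position l. The alternation makes the mixed terms cancel, and for l + 1 = n it
  yields the sign (-1)^n of the relations.\<close>

definition dS :: "nat => ('v, 'a, 'k) path_elem => ('v, 'a, 'k) path_elem => ('v, 'a, 'k) path_elem" where
 "dS l p q = fscale ((- 1) ^ Suc l) (delta_L Q (B l) p q)"

abbreviation cR where "cR l p q \<equiv> cl (dR l p q)"
abbreviation cS where "cS l p q \<equiv> cl (dS l p q)"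

definition rowB where "rowB l q = (%p. cR l p q \<boxtimes> sidem q \<oplus>\<^sub>E tidem q \<boxtimes> cS l p q)"

definition dB where "dB l = lin_comb E (KB l) (rowB l)"

lemma ti: "q \<in> B l ==> tidem q \<in> carrier \<A>" "q \<in> B l ==> tidem q \<otimes>\<^sub>\<A> tidem q = tidem q"
 "q \<in> B l ==> sidem q \<in> carrier \<A>" "q \<in> B l ==> sidem q \<otimes>\<^sub>\<A> sidem q = sidem q"
 by (simp_all add: vx_idem bv)

lemma dR_V: "q \<in> B (Suc l) ==> dR l p q \<in> V 1"
 using dR_props(1)[OF B_K, of q l p] dR_outside[OF B_K, of q l p] fs.subspace_0[OF subspace_V, of 1]
 by (cases "p \<in> B l") simp_all

lemma dS_outside: "q \<in> B (Suc l) ==> p \<notin> B l ==> dS l p q = 0"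
 using delta_L_coeff[OF basis B_K, of q l] by (simp add: is_coeff_L_def dS_def)

lemma dS_V: "q \<in> B (Suc l) ==> dS l p q \<in> V 1"
proof (cases "p \<in> B l")
 case True
 assume q: "q \<in> B (Suc l)"
 show ?thesis unfolding dS_def by (intro V_scale delta_L_props(1)[OF basis B_K[OF q] True])
next
 case False
 assume q: "q \<in> B (Suc l)"
 show ?thesis unfolding dS_outside[OF q False] by (rule fs.subspace_0[OF subspace_V])
qed

lemma cR_closed: "q \<in> B (Suc l) ==> cR l p q \<in> carrier \<A>"
 by (rule clI[OF V_paths[OF dR_V]])

lemma cS_closed: "q \<in> B (Suc l) ==> cS l p q \<in> carrier \<A>"
 by (rule clI[OF V_paths[OF dS_V]])

lemma vx_cl: "f \<in> V m ==> i \<in> verts Q ==> vx i \<cdot> f = f ==> cl (vx i) \<otimes>\<^sub>\<A> cl f = cl f"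
 using cl_mult_V[OF vx_V, of i f m] by simp

lemma cR_target: "q \<in> B (Suc l) ==> tidem q \<otimes>\<^sub>\<A> cR l p q = cR l p q"
proof (cases "p \<in> B l")
 case True
 assume q: "q \<in> B (Suc l)"
 show ?thesis by (rule vx_cl[OF dR_V[OF q] bv(3)[OF q] dR_target[OF q True]])
next
 case False
 assume q: "q \<in> B (Suc l)"
 show ?thesis using ti(1)[OF q] by (simp add: dR_outside[OF B_K[OF q] False] flip: cl_zero)
qed

lemma cR_source: "q \<in> B (Suc l) ==> p \<in> B l ==> cR l p q \<otimes>\<^sub>\<A> tidem p = cR l p q"
 by (rule cl_mult_vx[OF dR_V bv(3) dR_props(2)[OF B_K]])

lemma cR_zero: "q \<in> B (Suc l) ==> p \<in> B l ==> source Q p \<noteq> source Q q ==> cR l p q = \<zero>\<^sub>\<A>"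
 using delta_R_props(4)[OF basis B_K _ bv(2), of q l p] by (simp add: cl_zero)

lemma cS_source: "q \<in> B (Suc l) ==> cS l p q \<otimes>\<^sub>\<A> sidem q = cS l p q"
proof (cases "p \<in> B l")
 case True
 assume q: "q \<in> B (Suc l)"
 show ?thesis
  by (rule cl_mult_vx[OF dS_V[OF q] bv(1)[OF q]])
   (simp add: dS_def pmul_left delta_L_props(3)[OF basis B_K[OF q] True bv(2)[OF q] bv(1)[OF q]])
next
 case False
 assume q: "q \<in> B (Suc l)"
 show ?thesis using ti(3)[OF q] by (simp only: dS_outside[OF q False]) (simp flip: cl_zero)
qed

lemma cS_target: "q \<in> B (Suc l) ==> p \<in> B l ==> sidem p \<otimes>\<^sub>\<A> cS l p q = cS l p q"
 by (rule vx_cl[OF dS_V bv(1)]) (simp_all add: dS_def pmul_right delta_L_props(2)[OF basis B_K])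

lemma cS_zero: "q \<in> B (Suc l) ==> p \<in> B l ==> target Q p \<noteq> target Q q ==> cS l p q = \<zero>\<^sub>\<A>"
 using delta_L_props(4)[OF basis B_K _ bv(4), of q l p] by (simp add: dS_def cl_zero fs.scale_zero_right)

lemma bidem_closed: "q \<in> B l ==> bidem q \<in> carrier E"
 by (simp add: te_closed ti)

lemma fam_KB: "idem_family E (B l) bidem"
 by (intro idem_family.intro idem_family_axioms.intro ring_E) (auto simp: bd(5) bidem_closed tm ti)

lemma left_module_KB: "left_module E (KB l)"
 by (rule idem_family.left_module_idem[OF fam_KB])

lemmas KB_ops = idem_family.idem_ops[OF fam_KB]

lemma KB_I:
 assumes "!!q. q \<in> B l ==> f q \<in> carrier E" "!!q. q \<in> B l ==> f q \<otimes>\<^sub>E bidem q = f q"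
  "!!q. q \<notin> B l ==> f q = \<zero>\<^sub>E"
 shows "f \<in> carrier (KB l)"
 unfolding idem_family.idem_carrier[OF fam_KB] using assms by blast

lemma KB_value: "f \<in> carrier (KB l) ==> f q \<in> carrier E"
 by (rule idem_family.idem_value[OF fam_KB])

lemma KB_vertex: "f \<in> carrier (KB l) ==> q \<in> B l ==> f q \<otimes>\<^sub>E bidem q = f q"
 "f \<in> carrier (KB l) ==> q \<notin> B l ==> f q = \<zero>\<^sub>E"
 by (auto simp: idem_family.idem_carrier[OF fam_KB])

lemma rowB_closed: "q \<in> B (Suc l) ==> rowB l q p \<in> carrier E"
 unfolding rowB_def by (simp add: te_closed cR_closed cS_closed ti)

lemma rowB_outside: "q \<in> B (Suc l) ==> p \<notin> B l ==> rowB l q p = \<zero>\<^sub>E"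
 unfolding rowB_def using dR_outside[OF B_K, of q l p] dS_outside[of q l p] te_zero[OF ti(1)] te_zero[OF ti(3)]
 by (simp flip: cl_zero)

text \<open>An idempotent could only disturb a term when vertices do not match, but
  \<open>cR\<close> vanishes unless p and q share the source, and \<open>cS\<close> vanishes unless
  they share the target.\<close>

lemma rowB_right: "q \<in> B (Suc l) ==> p \<in> B l ==> rowB l q p \<otimes>\<^sub>E bidem p = rowB l q p"
proof -
 assume q: "q \<in> B (Suc l)" and p: "p \<in> B l"
 have "(cR l p q \<otimes>\<^sub>\<A> tidem p) \<boxtimes> (sidem p \<otimes>\<^sub>\<A> sidem q) = cR l p q \<boxtimes> sidem q"
  by (cases "source Q p = source Q q") (simp_all add: cR_source[OF q p] cR_zero[OF q p] ti[OF p] ti[OF q] te_zero)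
 moreover have "(tidem q \<otimes>\<^sub>\<A> tidem p) \<boxtimes> (sidem p \<otimes>\<^sub>\<A> cS l p q) = tidem q \<boxtimes> cS l p q"
  by (cases "target Q p = target Q q") (simp_all add: cS_target[OF q p] cS_zero[OF q p] ti[OF p] ti[OF q] te_zero)
 ultimately show ?thesis
  by (simp add: rowB_def ER.l_distr te_closed tm cR_closed[OF q] cS_closed[OF q] ti[OF p] ti[OF q])
qed

lemma rowB_left: "q \<in> B (Suc l) ==> bidem q \<otimes>\<^sub>E rowB l q p = rowB l q p"
 by (simp add: rowB_def ER.r_distr te_closed tm cR_closed cS_closed ti cR_target cS_source)

lemma rowB_carrier: "q \<in> B (Suc l) ==> rowB l q \<in> carrier (KB l)"
 by (rule KB_I) (simp_all add: rowB_closed rowB_right rowB_outside)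

lemma dB_hom: "dB l \<in> mod_hom E (KB (Suc l)) (KB l)"
 unfolding dB_def by (rule idem_family.lin_comb_idem_hom[OF fam_KB left_module_KB rowB_carrier])

lemma dB_apply: "f \<in> carrier (KB (Suc l)) ==> dB l f p = finsum E (%q. f q \<otimes>\<^sub>E rowB l q p) (B (Suc l))"
 unfolding dB_def by (rule idem_matrix_apply[OF fam_KB fam_KB rowB_carrier])

abbreviation unitB where "unitB \<equiv> idem_unit E bidem"

lemma unitB_carrier: "q \<in> B l ==> unitB q \<in> carrier (KB l)"
 by (rule idem_family.idem_unit_carrier[OF fam_KB])

lemma dB_unit: "q \<in> B (Suc l) ==> dB l (unitB q) = rowB l q"
proof -
 assume q: "q \<in> B (Suc l)"
 have "dB l (unitB q) = bidem q \<odot>\<^bsub>KB l\<^esub> rowB l q"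
  unfolding dB_def by (rule idem_family.lin_comb_unit[OF fam_KB left_module_KB rowB_carrier q])
 also have "\<dots> = rowB l q" by (rule ext) (simp only: KB_ops rowB_left[OF q])
 finally show ?thesis .
qed

text \<open>Slicing takes out the right tensor factor, which is linear, and the left one is compared
  arrow by arrow. What remains is the commutation of left and right contractions in
  \<open>delta_R_delta_L\<close>, the two orders having opposite signs.\<close>

lemma mixed_terms_zero:
 assumes q: "q \<in> B (Suc (Suc l))" and r: "r \<in> B l"
 shows "finsum E (%p. cR (Suc l) p q \<boxtimes> cS l r p \<oplus>\<^sub>E cR l r p \<boxtimes> cS (Suc l) p q) (B (Suc l)) = \<zero>\<^sub>E"
  (is "finsum E ?f ?B = _")
proof (rule slices_zero)
 have V: "dR (Suc l) p q \<in> V 1" "dS l r p \<in> V 1" "dR l r p \<in> V 1" "dS (Suc l) p q \<in> V 1" if "p \<in> ?B" for p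
  by (rule dR_V[OF q], rule dS_V[OF that], rule dR_V[OF that], rule dS_V[OF q])
 note c = clI[OF V_paths[OF V(1)]] clI[OF V_paths[OF V(2)]] clI[OF V_paths[OF V(3)]] clI[OF V_paths[OF V(4)]]
 have f: "?f p \<in> carrier E" if "p \<in> ?B" for p using c[OF that] by (intro ER.a_closed te_closed)
 show "finsum E ?f ?B \<in> carrier E" using f by (intro ER.finsum_closed) auto
 fix \<gamma> assume \<gamma>: "\<gamma> \<in> NB"
 let ?u = "%p. fscale (lookup (dS l r p) \<gamma>) (dR (Suc l) p q) + fscale (lookup (dS (Suc l) p q) \<gamma>) (dR l r p)"
 have uV: "?u p \<in> V 1" if "p \<in> ?B" for p
  by (intro fs.subspace_add[OF subspace_V] V_scale V that)
 have "slice \<gamma> (finsum E ?f ?B) = finsum \<A> (%p. slice \<gamma> (?f p)) ?B" by (rule slice_finsum[OF bd(5) f])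
 also have "\<dots> = finsum \<A> (%p. cl (?u p)) ?B"
 proof (rule L.finsum_cong')
  fix p assume p: "p \<in> ?B"
  show "slice \<gamma> (?f p) = cl (?u p)"
   using c[OF p] V[OF p] by (simp only: slice_add slice_te te_closed coord_V1 cl_smult cl_add)
 qed (use uV in \<open>auto intro!: clI V_paths[OF uV]\<close>)
 also have "\<dots> = cl (\<Sum>p\<in>?B. ?u p)" by (rule cl_finsum[OF bd(5)]) (rule V_paths[OF uV])
 also have "(\<Sum>p\<in>?B. ?u p) = 0"
 proof (cases "plen \<gamma> = 1")
  case True
  then obtain b where b: "\<gamma> = (tail Q b, [b])"
   using NB(1) \<gamma> by (cases \<gamma>) (auto simp: length_Suc_conv paths_single)
  show ?thesis
  proof (rule V1_eqI)
   show "(\<Sum>p\<in>?B. ?u p) \<in> V 1" by (rule V_sum[OF uV])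
   fix a
   have "coeff (\<Sum>p\<in>?B. ?u p) a = (- 1) ^ Suc l * ((\<Sum>p\<in>?B. coeff (dR (Suc l) p q) a * coeff (delta_L Q (B l) r p) b) -
     (\<Sum>p\<in>?B. coeff (dR l r p) a * coeff (delta_L Q (B (Suc l)) p q) b))"
    by (simp add: dS_def lookup_sum lookup_add lookup_minus b sum_subtractf[symmetric] sum_distrib_left)
     (rule sum.cong, simp_all add: lookup_add lookup_minus algebra_simps)
   then show "coeff (\<Sum>p\<in>?B. ?u p) a = coeff 0 a"
    using delta_R_delta_L[OF basis basis B_K[OF q] r, of a b] by simp
  qed (rule fs.subspace_0[OF subspace_V])
 next
  case False
  then have "lookup g \<gamma> = 0" if "g \<in> V 1" for g
   using V_keys[OF that, of \<gamma>] by (auto simp: in_keys_iff)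
  then show ?thesis using V by (intro sum.neutral) (auto simp del: lookup_fscale)
 qed
 finally show "slice \<gamma> (finsum E ?f ?B) = \<zero>\<^sub>\<A>" by (simp add: cl_zero)
qed

text \<open>Of the four products of summands, two involve only one tensor factor and sum to zero
  because \<open>delta_R_delta_R\<close> and \<open>delta_L_delta_L\<close> put the sums into M; the
  other two are the mixed terms.\<close>

lemma dB_rowB: "q \<in> B (Suc (Suc l)) ==> dB l (rowB (Suc l) q) = (%r. \<zero>\<^sub>E)"
proof
 fix r assume q: "q \<in> B (Suc (Suc l))"
 let ?B = "B (Suc l)"
 note tq = ti[OF q]
 show "dB l (rowB (Suc l) q) r = \<zero>\<^sub>E"
 proof (cases "r \<in> B l")
  case False
  have "dB l (rowB (Suc l) q) r = finsum E (%p. \<zero>\<^sub>E) ?B"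
   unfolding dB_apply[OF rowB_carrier[OF q]]
   by (rule ER.finsum_cong') (simp_all add: rowB_outside False rowB_closed[OF q])
  then show ?thesis by simp
 next
  case True
  note r = True
  let ?g = "%p. cR (Suc l) p q \<boxtimes> cS l r p \<oplus>\<^sub>E cR l r p \<boxtimes> cS (Suc l) p q"
  let ?x = "%p. dR (Suc l) p q \<cdot> dR l r p" and ?y = "%p. dS l r p \<cdot> dS (Suc l) p q"
  have c: "cR (Suc l) p q \<in> carrier \<A>" "cS l r p \<in> carrier \<A>" "cR l r p \<in> carrier \<A>" "cS (Suc l) p q \<in> carrier \<A>"
   if "p \<in> ?B" for p
   by (rule cR_closed[OF q], rule cS_closed[OF that], rule cR_closed[OF that], rule cS_closed[OF q])
  have x: "cR (Suc l) p q \<otimes>\<^sub>\<A> cR l r p = cl (?x p)" "cS l r p \<otimes>\<^sub>\<A> cS (Suc l) p q = cl (?y p)"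
   "?x p \<in> V (1 + 1)" "?y p \<in> V (1 + 1)" if p: "p \<in> ?B" for p
   by (intro cl_mult_V[OF dR_V[OF q] dR_V[OF p]] cl_mult_V[OF dS_V[OF p] dS_V[OF q]]
    V_mult[OF dR_V[OF q] dR_V[OF p]] V_mult[OF dS_V[OF p] dS_V[OF q]])+
  have xc: "cl (?x p) \<in> carrier \<A>" "cl (?y p) \<in> carrier \<A>" if p: "p \<in> ?B" for p
   by (rule clI[OF V_paths[OF x(3)[OF p]]], rule clI[OF V_paths[OF x(4)[OF p]]])
  have prodeq: "rowB (Suc l) q p \<otimes>\<^sub>E rowB l p r = (cl (?x p) \<boxtimes> sidem q \<oplus>\<^sub>E tidem q \<boxtimes> cl (?y p)) \<oplus>\<^sub>E ?g p"
   if p: "p \<in> ?B" for p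
  proof -
   note tp = ti[OF p] and c = c[OF p]
   have 1: "(cR (Suc l) p q \<otimes>\<^sub>\<A> cR l r p) \<boxtimes> (sidem p \<otimes>\<^sub>\<A> sidem q) = cl (?x p) \<boxtimes> sidem q"
    by (cases "source Q p = source Q q") (use c tp tq in \<open>simp_all add: cR_zero[OF q p] te_zero flip: x(1)[OF p]\<close>)
   have 2: "(tidem q \<otimes>\<^sub>\<A> tidem p) \<boxtimes> (cS l r p \<otimes>\<^sub>\<A> cS (Suc l) p q) = tidem q \<boxtimes> cl (?y p)"
   proof (cases "target Q p = target Q q")
    case True
    then show ?thesis using tp by (simp add: x(2)[OF p])
   next
    case False
    show ?thesis unfolding x(2)[OF p, symmetric] cS_zero[OF q p False] using c tp tq by (simp add: te_zero)
   qed
   have 3: "(cR (Suc l) p q \<otimes>\<^sub>\<A> tidem p) \<boxtimes> (cS l r p \<otimes>\<^sub>\<A> sidem q) = cR (Suc l) p q \<boxtimes> cS l r p"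
   proof (cases "source Q p = source Q q")
    case True
    then show ?thesis using cS_source[OF p, of r] by (simp only: cR_source[OF q p])
   next
    case False
    show ?thesis unfolding cR_zero[OF q p False] using c tp tq by (simp add: te_zero)
   qed
   have 4: "(tidem q \<otimes>\<^sub>\<A> cR l r p) \<boxtimes> (sidem p \<otimes>\<^sub>\<A> cS (Suc l) p q) = cR l r p \<boxtimes> cS (Suc l) p q"
   proof (cases "target Q p = target Q q")
    case True
    then show ?thesis using cR_target[OF p, of r] by (simp only: cS_target[OF q p])
   next
    case False
    show ?thesis unfolding cS_zero[OF q p False] using c tp tq by (simp add: te_zero)
   qed
   have "rowB (Suc l) q p \<otimes>\<^sub>E rowB l p r =
    (cR (Suc l) p q \<otimes>\<^sub>\<A> cR l r p) \<boxtimes> (sidem p \<otimes>\<^sub>\<A> sidem q) \<oplus>\<^sub>E (tidem q \<otimes>\<^sub>\<A> cR l r p) \<boxtimes> (sidem p \<otimes>\<^sub>\<A> cS (Suc l) p q)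
    \<oplus>\<^sub>E ((cR (Suc l) p q \<otimes>\<^sub>\<A> tidem p) \<boxtimes> (cS l r p \<otimes>\<^sub>\<A> sidem q) \<oplus>\<^sub>E (tidem q \<otimes>\<^sub>\<A> tidem p) \<boxtimes> (cS l r p \<otimes>\<^sub>\<A> cS (Suc l) p q))"
    unfolding rowB_def using c tp tq by (simp only: ER.l_distr ER.r_distr te_closed tm ER.a_closed)
   also have "\<dots> = (cl (?x p) \<boxtimes> sidem q \<oplus>\<^sub>E tidem q \<boxtimes> cl (?y p)) \<oplus>\<^sub>E ?g p"
    unfolding 1 2 3 4 using c tp tq xc[OF p]
    by (simp only: ER.a_ac te_closed ER.a_closed)
   finally show ?thesis .
  qed
  have gc: "?g p \<in> carrier E" if "p \<in> ?B" for p using c[OF that] by (intro ER.a_closed te_closed)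
  have xyc: "cl (?x p) \<boxtimes> sidem q \<in> carrier E" "tidem q \<boxtimes> cl (?y p) \<in> carrier E" if "p \<in> ?B" for p
   using xc[OF that] tq by (auto intro: te_closed)
  have s1: "finsum E (%p. cl (?x p) \<boxtimes> sidem q) ?B = \<zero>\<^sub>E"
  proof -
   have "finsum \<A> (%p. cl (?x p)) ?B = cl (\<Sum>p\<in>?B. ?x p)"
    by (rule cl_finsum[OF bd(5)]) (rule V_paths[OF x(3)])
   also have "\<dots> = \<zero>\<^sub>\<A>" using delta_R_delta_R[OF basis basis B_K[OF q] r] M_I by (auto simp: cl_eq_zero)
   finally show ?thesis
    using te_finsum_left[OF tq(3) bd(5)[of "Suc l"], of "%p. cl (?x p)"] xc tq(3) by (simp add: te_zero)
  qed
  have s2: "finsum E (%p. tidem q \<boxtimes> cl (?y p)) ?B = \<zero>\<^sub>E"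
  proof -
   have "finsum \<A> (%p. cl (?y p)) ?B = cl (\<Sum>p\<in>?B. ?y p)"
    by (rule cl_finsum[OF bd(5)]) (rule V_paths[OF x(4)])
   also have "(\<Sum>p\<in>?B. ?y p) = fscale ((- 1) ^ Suc l * (- 1) ^ Suc (Suc l)) (\<Sum>p\<in>?B. delta_L Q (B l) r p \<cdot> delta_L Q (B (Suc l)) p q)"
    by (simp add: dS_def pmul_left pmul_right fs.scale_sum_right)
   also have "cl \<dots> = \<zero>\<^sub>\<A>"
    unfolding cl_eq_zero
    by (rule fs.subspace_scale[OF subspace_I]) (use delta_L_delta_L[OF basis basis B_K[OF q] r] M_I in blast)
   finally show ?thesis
    using te_finsum_right[OF tq(1) bd(5)[of "Suc l"], of "%p. cl (?y p)"] xc tq(1) by (simp add: te_zero)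
  qed
  have "dB l (rowB (Suc l) q) r = finsum E (%p. (cl (?x p) \<boxtimes> sidem q \<oplus>\<^sub>E tidem q \<boxtimes> cl (?y p)) \<oplus>\<^sub>E ?g p) ?B"
   unfolding dB_apply[OF rowB_carrier[OF q]]
   by (rule ER.finsum_cong') (use prodeq gc xyc in auto)
  also have "\<dots> = finsum E (%p. cl (?x p) \<boxtimes> sidem q) ?B \<oplus>\<^sub>E finsum E (%p. tidem q \<boxtimes> cl (?y p)) ?B \<oplus>\<^sub>E finsum E ?g ?B"
   using gc xyc by (simp add: ER.finsum_addf Pi_def)
  also have "\<dots> = \<zero>\<^sub>E" unfolding s1 s2 mixed_terms_zero[OF q r] by simp
  finally show ?thesis .
 qed
qed

lemma unit_determines:
 assumes "h \<in> mod_hom E (KB l) N" "left_module E N" "!!q. q \<in> B l ==> h (unitB q) = \<zero>\<^sub>N" "f \<in> carrier (KB l)"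
 shows "h f = \<zero>\<^sub>N"
proof -
 interpret N: left_module E N by fact
 have "h f = finsum N (%q. f q \<odot>\<^sub>N h (unitB q)) (B l)"
  by (rule idem_family.idem_hom_expand[OF fam_KB assms(1,2,4)])
 also have "\<dots> = finsum N (%q. \<zero>\<^sub>N) (B l)"
  by (rule N.M.finsum_cong') (auto simp: assms(3) KB_value[OF assms(4)])
 finally show ?thesis by simp
qed

lemma dB_dB: "f \<in> carrier (KB (Suc (Suc l))) ==> dB l (dB (Suc l) f) = \<zero>\<^bsub>KB l\<^esub>"
 by (rule unit_determines[OF mod_hom_comp[OF dB_hom dB_hom] left_module_KB])
  (simp_all only: dB_unit dB_rowB KB_ops)

end

context env_koszul
begin

section \<open>Exactness by means of slices\<close>

lemma slice_vertex:
 assumes f: "f \<in> carrier (KB l)" and q: "q \<in> B l" and \<gamma>: "\<gamma> \<in> NB"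
 shows "slice \<gamma> (f q) = (if ptarget \<gamma> = source Q q then slice \<gamma> (f q) \<otimes>\<^sub>\<A> tidem q else \<zero>\<^sub>\<A>)"
 using slice_mult_vertex[OF ring_E KB_value[OF f] ti(1)[OF q] bv(1)[OF q] \<gamma>, of q] KB_vertex(1)[OF f q] by simp

lemma slice_KL: "f \<in> carrier (KB l) ==> \<gamma> \<in> NB ==> (%q. slice \<gamma> (f q)) \<in> carrier (KL l)"
proof (rule KL_I, goal_cases)
 case (1 q) then show ?case by (simp add: slice_closed KB_value)
next
 case (2 q)
 then show ?case using slice_vertex[OF 2(1,3,2)] ti(1)[OF 2(3)] by (cases "ptarget \<gamma> = source Q q") simp_all
next
 case (3 q) then show ?case using KB_vertex(2)[OF 3(1,3)] by (simp add: slice_zero)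
qed

text \<open>Membership in the m-th step of the filtration by length of the right tensor factor.
  Every element satisfies it for m = 0, and for m = \<open>ht\<close> only zero does among
  chains.\<close>

definition low_zero :: "nat => (('v, 'a, 'k) path_elem => ((('v, 'a, 'k) path_elem set \<times> ('v, 'a, 'k) path_elem set) \<Rightarrow>\<^sub>0 'k) set) => bool" where
 "low_zero m f \<longleftrightarrow> (\<forall>q. \<forall>\<beta>\<in>NB. plen \<beta> < m --> slice \<beta> (f q) = \<zero>\<^sub>\<A>)"

lemma low_zeroD: "low_zero m f ==> \<beta> \<in> NB ==> plen \<beta> < m ==> slice \<beta> (f q) = \<zero>\<^sub>\<A>"
 by (simp add: low_zero_def)

text \<open>On the associated graded object, the differential only involves the left tensor factor.\<close>

lemma slice_dB:
 assumes f: "f \<in> carrier (KB (Suc l))" and \<gamma>: "\<gamma> \<in> NB" and low: "low_zero (plen \<gamma>) f"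
 shows "slice \<gamma> (dB l f p) = dL l (%q. slice \<gamma> (f q)) p"
proof -
 have c: "f q \<otimes>\<^sub>E rowB l q p \<in> carrier E" if "q \<in> B (Suc l)" for q
  by (rule ER.m_closed[OF KB_value[OF f] rowB_closed[OF that]])
 have "slice \<gamma> (dB l f p) = finsum \<A> (%q. slice \<gamma> (f q \<otimes>\<^sub>E rowB l q p)) (B (Suc l))"
  unfolding dB_apply[OF f] by (rule slice_finsum[OF bd(5) c])
 also have "\<dots> = finsum \<A> (%q. slice \<gamma> (f q) \<otimes>\<^sub>\<A> cl (dR l p q)) (B (Suc l))"
 proof (rule L.finsum_cong')
  fix q assume q: "q \<in> B (Suc l)"
  note fq = KB_value[OF f, of q] and t = ti[OF q] and cc = cR_closed[OF q, of p] cS_closed[OF q, of p]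
  have "slice \<gamma> (f q \<otimes>\<^sub>E cR l p q \<boxtimes> sidem q) = slice \<gamma> (f q) \<otimes>\<^sub>\<A> cl (dR l p q)"
   using slice_mult_vertex[OF ring_E fq cc(1) bv(1)[OF q] \<gamma>] slice_vertex[OF f q \<gamma>] cc
   by (cases "ptarget \<gamma> = source Q q") simp_all
  moreover have "slice \<gamma> (f q \<otimes>\<^sub>E tidem q \<boxtimes> cS l p q) = \<zero>\<^sub>\<A>"
   by (rule slice_mult_arrow[OF ring_E fq t(1) dS_V[OF q]]) (rule low_zeroD[OF low])
  ultimately show "slice \<gamma> (f q \<otimes>\<^sub>E rowB l q p) = slice \<gamma> (f q) \<otimes>\<^sub>\<A> cl (dR l p q)"
   unfolding rowB_def using fq t cc by (simp add: ER.r_distr te_closed slice_add slice_closed)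
 qed (auto simp: slice_closed[OF KB_value[OF f]] cR_closed)
 also have "\<dots> = dL l (%q. slice \<gamma> (f q)) p" by (rule dL_apply[OF slice_KL[OF f \<gamma>], symmetric])
 finally show ?thesis .
qed

text \<open>Each slice at a path \<gamma> of length m is a boundary of the left complex;
  \<open>h\<close> collects the tensors of the preimages with these paths. Subtracting
  \<open>dB l h\<close> clears the slices of length m and leaves the shorter ones zero.\<close>

lemma lift_leading_slices:
 assumes f: "f \<in> carrier (KB l)" and low: "low_zero m f"
  and im: "!!\<gamma>. \<gamma> \<in> NB ==> plen \<gamma> = m ==> (%q. slice \<gamma> (f q)) \<in> dL l ` carrier (KL (Suc l))"
 shows "\<exists>h\<in>carrier (KB (Suc l)). \<exists>g\<in>carrier (KB l). low_zero (Suc m) g \<and> f = g \<oplus>\<^bsub>KB l\<^esub> dB l h"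
proof -
 interpret KBl: left_module E "KB l" by (rule left_module_KB)
 let ?N = "{\<gamma> \<in> NB. plen \<gamma> = m}"
 have fN: "finite ?N" using finite_NB by simp
 have "\<exists>w. \<forall>\<gamma>\<in>?N. w \<gamma> \<in> carrier (KL (Suc l)) \<and> (%q. slice \<gamma> (f q)) = dL l (w \<gamma>)"
  by (rule bchoice) (use im in blast)
 then obtain w where w: "!!\<gamma>. \<gamma> \<in> ?N ==> w \<gamma> \<in> carrier (KL (Suc l))"
  "!!\<gamma>. \<gamma> \<in> ?N ==> (%q. slice \<gamma> (f q)) = dL l (w \<gamma>)" by blast
 \<comment> \<open>Position q admits on the right only paths that end at the source of q, so the
   other coordinates of the preimage are dropped. As \<open>dL\<close> relates only positions with
   equal source, its value does not suffer.\<close>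
 define v where "v \<gamma> q = (if source Q q = ptarget \<gamma> then w \<gamma> q else \<zero>\<^sub>\<A>)" for \<gamma> q
 have v: "v \<gamma> \<in> carrier (KL (Suc l))" if \<gamma>: "\<gamma> \<in> ?N" for \<gamma>
 proof (rule KL_I)
  show "v \<gamma> q \<in> carrier \<A>" for q using KL_value[OF w(1)[OF \<gamma>]] by (simp add: v_def)
  show "v \<gamma> q \<otimes>\<^sub>\<A> tidem q = v \<gamma> q" if "q \<in> B (Suc l)" for q
   using KL_vertex(1)[OF w(1)[OF \<gamma>] that] ti(1)[OF that] by (simp add: v_def)
  show "v \<gamma> q = \<zero>\<^sub>\<A>" if "q \<notin> B (Suc l)" for q
   using KL_vertex(2)[OF w(1)[OF \<gamma>] that] by (simp add: v_def)
 qed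
 have dv: "dL l (v \<gamma>) p = slice \<gamma> (f p)" if \<gamma>: "\<gamma> \<in> ?N" for \<gamma> p
 proof (cases "p \<in> B l")
  case False
  then show ?thesis
   using KL_vertex(2)[OF mod_hom_closed[OF dL_hom v[OF \<gamma>]] False] KB_vertex(2)[OF f False] by (simp add: slice_zero)
 next
  case p: True
  have t: "w \<gamma> q \<in> carrier \<A>" "v \<gamma> q \<in> carrier \<A>" for q
   by (rule KL_value[OF w(1)[OF \<gamma>]], rule KL_value[OF v[OF \<gamma>]])
  show ?thesis
  proof (cases "source Q p = ptarget \<gamma>")
   case True
   have "dL l (v \<gamma>) p = dL l (w \<gamma>) p"
    unfolding dL_apply[OF v[OF \<gamma>]] dL_apply[OF w(1)[OF \<gamma>]]
   proof (rule L.finsum_cong')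
    fix q assume q: "q \<in> B (Suc l)"
    show "v \<gamma> q \<otimes>\<^sub>\<A> cl (dR l p q) = w \<gamma> q \<otimes>\<^sub>\<A> cl (dR l p q)"
    proof (cases "source Q p = source Q q")
     case True
     then show ?thesis using \<open>source Q p = ptarget \<gamma>\<close> by (simp add: v_def)
    qed (use t[of q] in \<open>simp add: cR_zero[OF q p]\<close>)
   qed (use t in \<open>auto intro!: cR_closed\<close>)
   then show ?thesis using fun_cong[OF w(2)[OF \<gamma>], of p] by simp
  next
   case False
   have "dL l (v \<gamma>) p = finsum \<A> (%q. \<zero>\<^sub>\<A>) (B (Suc l))"
    unfolding dL_apply[OF v[OF \<gamma>]]
   proof (rule L.finsum_cong')
    fix q assume q: "q \<in> B (Suc l)"
    show "v \<gamma> q \<otimes>\<^sub>\<A> cl (dR l p q) = \<zero>\<^sub>\<A>"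
    proof (cases "source Q p = source Q q")
     case True
     then have "v \<gamma> q = \<zero>\<^sub>\<A>" using False by (simp add: v_def)
     then show ?thesis using cR_closed[OF q] by simp
    qed (use t[of q] in \<open>simp add: cR_zero[OF q p]\<close>)
   qed simp_all
   moreover have "slice \<gamma> (f p) = \<zero>\<^sub>\<A>" using slice_vertex[OF f p, of \<gamma>] \<gamma> False by simp
   ultimately show ?thesis by simp
  qed
 qed
 define h where "h q = finsum E (%\<gamma>. v \<gamma> q \<boxtimes> nb \<gamma>) ?N" for q
 have vn: "v \<gamma> q \<boxtimes> nb \<gamma> \<in> carrier E" if "\<gamma> \<in> ?N" for \<gamma> q
  using KL_value[OF v[OF that]] that by (simp add: te_closed nb_closed)
 have hc: "h q \<in> carrier E" for q unfolding h_def using vn by (intro ER.finsum_closed) auto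
 have h: "h \<in> carrier (KB (Suc l))"
 proof (rule KB_I[OF hc])
  fix q assume q: "q \<in> B (Suc l)"
  have "h q \<otimes>\<^sub>E bidem q = finsum E (%\<gamma>. v \<gamma> q \<boxtimes> nb \<gamma> \<otimes>\<^sub>E bidem q) ?N"
   unfolding h_def by (rule ER.finsum_ldistr[OF fN bidem_closed[OF q]]) (use vn in simp)
  also have "\<dots> = h q" unfolding h_def
  proof (rule ER.finsum_cong')
   fix \<gamma> assume \<gamma>: "\<gamma> \<in> ?N"
   have vq: "v \<gamma> q \<in> carrier \<A>" "v \<gamma> q \<otimes>\<^sub>\<A> tidem q = v \<gamma> q"
    by (rule KL_value[OF v[OF \<gamma>]], rule KL_vertex(1)[OF v[OF \<gamma>] q])
   have nc: "nb \<gamma> \<in> carrier \<A>" using \<gamma> by (simp add: nb_closed)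
   have "v \<gamma> q \<boxtimes> nb \<gamma> \<otimes>\<^sub>E bidem q = v \<gamma> q \<boxtimes> (sidem q \<otimes>\<^sub>\<A> nb \<gamma>)"
    using tm[OF vq(1) nc ti(1)[OF q] ti(3)[OF q]] vq(2) by simp
   also have "\<dots> = v \<gamma> q \<boxtimes> nb \<gamma>"
   proof (cases "source Q q = ptarget \<gamma>")
    case True
    then show ?thesis using vx_nb[OF bv(1)[OF q], of \<gamma>] \<gamma> by simp
   next
    case False
    then show ?thesis using nc ti(3)[OF q] by (simp add: v_def te_zero)
   qed
   finally show "v \<gamma> q \<boxtimes> nb \<gamma> \<otimes>\<^sub>E bidem q = v \<gamma> q \<boxtimes> nb \<gamma>" .
  qed (use vn in auto)
  finally show "h q \<otimes>\<^sub>E bidem q = h q" .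
 next
  fix q assume q: "q \<notin> B (Suc l)"
  have "h q = finsum E (%\<gamma>. \<zero>\<^sub>E) ?N" unfolding h_def
   by (rule ER.finsum_cong') (use KL_vertex(2)[OF v q] in \<open>simp_all add: te_zero nb_closed\<close>)
  then show "h q = \<zero>\<^sub>E" by simp
 qed
 have sh: "slice \<beta> (h q) = (if plen \<beta> = m then v \<beta> q else \<zero>\<^sub>\<A>)" if \<beta>: "\<beta> \<in> NB" for \<beta> q
 proof -
  have vc: "v \<gamma> q \<in> carrier \<A>" if "\<gamma> \<in> ?N" for \<gamma> by (rule KL_value[OF v[OF that]])
  have "slice \<beta> (h q) = finsum \<A> (%\<gamma>. slice \<beta> (v \<gamma> q \<boxtimes> nb \<gamma>)) ?N"
   unfolding h_def by (rule slice_finsum[OF fN vn])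
  also have "\<dots> = finsum \<A> (%\<gamma>. if \<beta> = \<gamma> then v \<gamma> q else \<zero>\<^sub>\<A>) ?N"
   by (rule L.finsum_cong') (use vc slice_nb \<beta> in auto)
  also have "\<dots> = (if plen \<beta> = m then v \<beta> q else \<zero>\<^sub>\<A>)"
  proof (cases "plen \<beta> = m")
   case True
   then show ?thesis using L.finsum_singleton[of \<beta> ?N "%\<gamma>. v \<gamma> q"] \<beta> fN vc by auto
  next
   case False
   then have "finsum \<A> (%\<gamma>. if \<beta> = \<gamma> then v \<gamma> q else \<zero>\<^sub>\<A>) ?N = finsum \<A> (%\<gamma>. \<zero>\<^sub>\<A>) ?N"
    by (intro L.finsum_cong') auto
   then show ?thesis using False by simp
  qed
  finally show ?thesis .
 qed
 have hl: "low_zero m h" by (auto simp: low_zero_def sh)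
 have dh: "dB l h \<in> carrier (KB l)" by (rule mod_hom_closed[OF dB_hom h])
 have sdh: "slice \<gamma> (dB l h p) = slice \<gamma> (f p)" if \<gamma>: "\<gamma> \<in> NB" "plen \<gamma> \<le> m" for \<gamma> p
 proof -
  have lowg: "low_zero (plen \<gamma>) h" using hl \<gamma>(2) by (auto simp: low_zero_def)
  show ?thesis
  proof (cases "plen \<gamma> = m")
   case True
   then have "(%q. slice \<gamma> (h q)) = v \<gamma>" using sh[OF \<gamma>(1)] by auto
   then show ?thesis using slice_dB[OF h \<gamma>(1) lowg, of p] dv[of \<gamma> p] \<gamma> True by simp
  next
   case False
   then have "(%q. slice \<gamma> (h q)) = \<zero>\<^bsub>KL (Suc l)\<^esub>"
    using sh[OF \<gamma>(1)] by (auto simp: KL_ops)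
   then have "slice \<gamma> (dB l h p) = \<zero>\<^bsub>KL l\<^esub> p"
    using slice_dB[OF h \<gamma>(1) lowg, of p] mod_hom_zero[OF dL_hom left_module_KL left_module_KL, of l] by simp
   then show ?thesis using low_zeroD[OF low \<gamma>(1), of p] False \<gamma>(2)
    by (simp add: KL_ops)
  qed
 qed
 define g where "g = f \<ominus>\<^bsub>KB l\<^esub> dB l h"
 have g: "g \<in> carrier (KB l)" unfolding g_def using f dh by (rule KBl.M.minus_closed)
 have fg: "f = g \<oplus>\<^bsub>KB l\<^esub> dB l h"
  using f dh by (simp add: g_def a_minus_def KBl.M.a_assoc KBl.M.l_neg KBl.M.r_zero del: KB_ops)
 have "low_zero (Suc m) g"
  unfolding low_zero_def
 proof (intro allI ballI impI)
  fix q \<beta> assume \<beta>: "\<beta> \<in> NB" "plen \<beta> < Suc m"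
  have "f q = g q \<oplus>\<^sub>E dB l h q" using fun_cong[OF fg, of q] by (simp only: KB_ops)
  then have "slice \<beta> (f q) = slice \<beta> (g q) \<oplus>\<^sub>\<A> slice \<beta> (dB l h q)"
   by (simp only: slice_add[OF KB_value[OF g] KB_value[OF dh]])
  then have "slice \<beta> (f q) = slice \<beta> (g q) \<oplus>\<^sub>\<A> slice \<beta> (f q)" using sdh[OF \<beta>(1), of q] \<beta>(2) by simp
  then show "slice \<beta> (g q) = \<zero>\<^sub>\<A>"
   using L.add.l_cancel_one[of "slice \<beta> (f q)" "slice \<beta> (g q)"] slice_closed[OF KB_value[OF g]] slice_closed[OF KB_value[OF f]] by simp
 qed
 then show ?thesis using h g fg by (intro bexI[of _ h] bexI[of _ g] conjI)
qed

text \<open>\<open>C\<close> is the cycle condition, for \<open>dB\<close> or for the augmentation;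
  the last hypothesis says that it survives the subtraction of a boundary. The procedure ends
  because all paths in \<open>NB\<close> are shorter than \<open>ht\<close>.\<close>

lemma boundary_by_filtration:
 assumes "f \<in> carrier (KB l)" "C f"
  and step: "!!m f \<gamma>. f \<in> carrier (KB l) ==> C f ==> low_zero m f ==> \<gamma> \<in> NB ==> plen \<gamma> = m ==>
   (%q. slice \<gamma> (f q)) \<in> dL l ` carrier (KL (Suc l))"
  and C: "!!g h. g \<in> carrier (KB l) ==> h \<in> carrier (KB (Suc l)) ==> C (g \<oplus>\<^bsub>KB l\<^esub> dB l h) ==> C g"
 shows "f \<in> dB l ` carrier (KB (Suc l))"
proof -
 interpret K1: left_module E "KB (Suc l)" by (rule left_module_KB)
 \<comment> \<open>\<open>k\<close> counts the filtration steps still to go; for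
   \<open>k = 0\<close> the element is zero.\<close>
 have "f \<in> dB l ` carrier (KB (Suc l))" if "f \<in> carrier (KB l)" "C f" "low_zero (ht - k) f" for k f
  using that
 proof (induction k arbitrary: f)
  case 0
  have "f = \<zero>\<^bsub>KB l\<^esub>"
  proof
   fix q
   have "f q = \<zero>\<^sub>E"
    by (rule slices_zero[OF KB_value[OF 0(1)]]) (use 0(3) NB_length in \<open>simp add: low_zero_def\<close>)
   then show "f q = \<zero>\<^bsub>KB l\<^esub> q" by (simp only: KB_ops)
  qed
  then have "f = dB l \<zero>\<^bsub>KB (Suc l)\<^esub>" using mod_hom_zero[OF dB_hom left_module_KB left_module_KB] by (simp only:)
  then show ?case using K1.M.zero_closed by (rule image_eqI)
 next
  case (Suc k)
  obtain h g where hg: "h \<in> carrier (KB (Suc l))" "g \<in> carrier (KB l)" "low_zero (Suc (ht - Suc k)) g" "f = g \<oplus>\<^bsub>KB l\<^esub> dB l h"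
   using lift_leading_slices[OF Suc.prems(1,3) step[OF Suc.prems]] by blast
  have "low_zero (ht - k) g" using hg(3) by (auto simp: low_zero_def)
  moreover have "C g" by (rule C[OF hg(2,1)]) (use Suc.prems(2) hg(4) in simp)
  ultimately have "g \<in> dB l ` carrier (KB (Suc l))" by (intro Suc.IH[OF hg(2)])
  then obtain u where u: "g = dB l u" "u \<in> carrier (KB (Suc l))" by (rule imageE)
  have "f = dB l (u \<oplus>\<^bsub>KB (Suc l)\<^esub> h)" unfolding hg(4) u(1) by (rule mod_hom_add[OF dB_hom u(2) hg(1), symmetric])
  then show ?case using K1.M.a_closed[OF u(2) hg(1)] by (rule image_eqI)
 qed
 from this[of f ht] assms(1,2) show ?thesis by (simp add: low_zero_def)
qed

lemma exact_KB:
 assumes f: "f \<in> carrier (KB (Suc l))" "dB l f = \<zero>\<^bsub>KB l\<^esub>"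
 shows "f \<in> dB (Suc l) ` carrier (KB (Suc (Suc l)))"
proof (rule boundary_by_filtration[OF f(1), of "%f. dB l f = \<zero>\<^bsub>KB l\<^esub>"])
 interpret KBl: left_module E "KB l" by (rule left_module_KB)
 show "dB l f = \<zero>\<^bsub>KB l\<^esub>" by (rule f(2))
 fix m f \<gamma> assume f: "f \<in> carrier (KB (Suc l))" "dB l f = \<zero>\<^bsub>KB l\<^esub>" "low_zero m f" "\<gamma> \<in> NB" "plen \<gamma> = m"
 have "dL l (%q. slice \<gamma> (f q)) = \<zero>\<^bsub>KL l\<^esub>"
 proof
  fix p
  have "dL l (%q. slice \<gamma> (f q)) p = slice \<gamma> (dB l f p)"
   by (rule slice_dB[OF f(1,4), symmetric]) (use f in simp)
  then show "dL l (%q. slice \<gamma> (f q)) p = \<zero>\<^bsub>KL l\<^esub> p"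
   unfolding f(2) KB_ops by (simp only: KL_ops slice_zero)
 qed
 then show "(%q. slice \<gamma> (f q)) \<in> dL (Suc l) ` carrier (KL (Suc (Suc l)))"
  by (rule resolutionD(9)[OF left_koszul_resolution[OF koszul] slice_KL[OF f(1,4)]])
next
 interpret KBl: left_module E "KB l" by (rule left_module_KB)
 fix g h assume g: "g \<in> carrier (KB (Suc l))" and h: "h \<in> carrier (KB (Suc (Suc l)))"
  and z: "dB l (g \<oplus>\<^bsub>KB (Suc l)\<^esub> dB (Suc l) h) = \<zero>\<^bsub>KB l\<^esub>"
 have "dB l g = dB l g \<oplus>\<^bsub>KB l\<^esub> dB l (dB (Suc l) h)"
  unfolding dB_dB[OF h] using mod_hom_closed[OF dB_hom g] by (rule KBl.M.r_zero[symmetric])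
 also have "\<dots> = \<zero>\<^bsub>KB l\<^esub>" using mod_hom_add[OF dB_hom g mod_hom_closed[OF dB_hom h]] z by (simp only:)
 finally show "dB l g = \<zero>\<^bsub>KB l\<^esub>" .
qed

text \<open>Up to the radical \<open>a\<close> is c times the end vertex of \<beta>, and the radical
  part only contributes paths longer than \<beta>. Among the paths that are not longer, the product
  has its only coordinate, c, at \<beta>.\<close>

lemma leading_coord:
 assumes a: "a \<in> carrier \<A>" "a \<otimes>\<^sub>\<A> cl (vx (ptarget \<beta>)) = a" and \<beta>: "\<beta> \<in> NB"
 shows "\<exists>c. (c = 0 --> a \<in> rad 1) \<and>
  (\<forall>\<gamma>\<in>NB. plen \<gamma> \<le> plen \<beta> --> coord \<gamma> (a \<otimes>\<^sub>\<A> nb \<beta>) = (if \<gamma> = \<beta> then c else 0))"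
proof -
 have i: "ptarget \<beta> \<in> verts Q" using NB(1) \<beta> path_target_verts by blast
 obtain c r where r: "r \<in> rad 1" and ar: "a = cl (fscale c (vx (ptarget \<beta>))) \<oplus>\<^sub>\<A> r"
  using vertex_component[OF a i] by blast
 have rc: "r \<in> carrier \<A>" using r rad_carrier by blast
 have V0: "fscale c (vx (ptarget \<beta>)) \<in> V 0" by (intro V_scale vx_V i)
 have "a \<otimes>\<^sub>\<A> nb \<beta> = cl (fscale c (vx (ptarget \<beta>))) \<otimes>\<^sub>\<A> nb \<beta> \<oplus>\<^sub>\<A> r \<otimes>\<^sub>\<A> nb \<beta>"
  unfolding ar by (rule L.l_distr[OF clI[OF V_paths[OF V0]] rc nb_closed[OF \<beta>]])
 also have "cl (fscale c (vx (ptarget \<beta>))) \<otimes>\<^sub>\<A> nb \<beta> = c \<odot>\<^sub>\<A> nb \<beta>"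
  unfolding cl_mult_V[OF V0 nb_V[OF \<beta>]] cl_smult by (simp add: pmul_left vx_psingle)
 finally have e: "a \<otimes>\<^sub>\<A> nb \<beta> = c \<odot>\<^sub>\<A> nb \<beta> \<oplus>\<^sub>\<A> r \<otimes>\<^sub>\<A> nb \<beta>" .
 have rr: "r \<otimes>\<^sub>\<A> nb \<beta> \<in> rad (1 + plen \<beta>)"
  by (rule rad_mult[OF r V_rad[OF nb_V[OF \<beta>]]]) simp
 have "coord \<gamma> (a \<otimes>\<^sub>\<A> nb \<beta>) = (if \<gamma> = \<beta> then c else 0)"
  if \<gamma>: "\<gamma> \<in> NB" "plen \<gamma> \<le> plen \<beta>" for \<gamma>
  using coord_rad[OF rr, of \<gamma>] \<gamma> rc nb_closed[OF \<beta>] unfolding e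
  by (simp add: coord_add coord_smult LV.ks_closed coord_basis[OF \<gamma>(1) \<beta>])
 moreover have "a \<in> rad 1" if "c = 0"
  using ar r rc that by (simp flip: cl_zero)
 ultimately show ?thesis by (intro exI[of _ c]) blast
qed

section \<open>The augmentation of the bimodule complex\<close>

lemma coord_finsum:
 assumes "finite J" "!!i. i \<in> J ==> f i \<in> carrier \<A>"
 shows "coord \<gamma> (finsum \<A> f J) = (\<Sum>i\<in>J. coord \<gamma> (f i))"
 using assms
proof (induction J rule: finite_induct)
 case empty
 show ?case using coord_smult[of "\<zero>\<^sub>\<A>" \<gamma> 0] LV.ks_zero[of "\<zero>\<^sub>\<A>"] by simp
next
 case (insert i J)
 then have "f \<in> J \<rightarrow> carrier \<A>" "f i \<in> carrier \<A>" by auto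
 then show ?case using insert by (simp add: L.finsum_insert coord_add)
qed

text \<open>The multiplication map from \<Lambda> \<otimes> S \<otimes> \<Lambda> to \<Lambda>,
  which sends a \<otimes> q \<otimes> b to a q b.\<close>

definition epsB where "epsB = lin_comb E (\<D>) cl"

lemma finsum_diagonal:
 assumes "finite J" "!!i. i \<in> J ==> f i \<in> carrier \<A>"
 shows "finsum (\<D>) f J = finsum \<A> f J"
 by (rule finsum_hom[OF D.M.abelian_group_axioms L.is_abelian_group assms(1), where h="%x. x"])
  (use assms(2) in \<open>simp_all add: env_diagonal_simps\<close>)

lemma cl_B: "q \<in> B l ==> cl q \<in> carrier \<A>"
 by (rule clI[OF V_paths[OF B_V]])

lemma cl_B_diagonal: "q \<in> B l ==> cl q \<in> carrier (\<D>)"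
 by (simp add: env_diagonal_simps cl_B)

lemma epsB_hom: "epsB \<in> mod_hom E (KB 0) (\<D>)"
 unfolding epsB_def by (rule idem_family.lin_comb_idem_hom[OF fam_KB diagonal cl_B_diagonal])

lemma diagonal_closed: "x \<in> carrier E ==> a \<in> carrier \<A> ==> x \<odot>\<^bsub>\<D>\<^esub> a \<in> carrier \<A>"
 using D.smult_closed[of x a] by (simp only: env_diagonal_simps(1))

lemma diagonal_distr: "x \<in> carrier E ==> y \<in> carrier E ==> a \<in> carrier \<A> ==>
  (x \<oplus>\<^sub>E y) \<odot>\<^bsub>\<D>\<^esub> a = x \<odot>\<^bsub>\<D>\<^esub> a \<oplus>\<^sub>\<A> y \<odot>\<^bsub>\<D>\<^esub> a"
 using D.smult_l_distr[of x y a] by (simp only: env_diagonal_simps(1,3))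

lemma epsB_apply:
 assumes f: "f \<in> carrier (KB 0)"
 shows "epsB f = finsum \<A> (%q. f q \<odot>\<^bsub>\<D>\<^esub> cl q) (B 0)"
proof -
 have "epsB f = finsum (\<D>) (%q. f q \<odot>\<^bsub>\<D>\<^esub> cl q) (B 0)"
  unfolding epsB_def by (rule idem_family.lin_comb_idem[OF fam_KB diagonal cl_B_diagonal f])
 also have "\<dots> = finsum \<A> (%q. f q \<odot>\<^bsub>\<D>\<^esub> cl q) (B 0)"
  by (rule finsum_diagonal[OF bd(5)]) (rule diagonal_closed[OF KB_value[OF f] cl_B])
 finally show ?thesis .
qed

text \<open>The coordinate at \<gamma> of the augmentation is computed. Shorter paths contribute
  nothing by \<open>low_zero\<close>, and the other paths, being at least as long as \<gamma>,
  contribute nothing by \<open>leading_coord\<close>. So the scalar that belongs to \<gamma> itself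
  is zero, and this means membership in the radical.\<close>

lemma leading_slice_cycle:
 assumes f: "f \<in> carrier (KB 0)" "epsB f = \<zero>\<^sub>\<A>" "low_zero (plen \<gamma>) f" and \<gamma>: "\<gamma> \<in> NB"
 shows "finsum \<A> (%q. slice \<gamma> (f q) \<otimes>\<^sub>\<A> cl q) (B 0) \<in> rad 1"
proof -
 let ?a = "%\<beta> q. slice \<beta> (f q) \<otimes>\<^sub>\<A> cl q"
 let ?e = "%\<beta>. cl (vx (ptarget \<beta>))"
 have tv: "ptarget \<beta> \<in> verts Q" if "\<beta> \<in> NB" for \<beta> using NB(1) that path_target_verts by blast
 have sc: "slice \<beta> (f q) \<in> carrier \<A>" for \<beta> q by (rule slice_closed[OF KB_value[OF f(1)]])
 have ac: "?a \<beta> q \<in> carrier \<A>" if "q \<in> B 0" for \<beta> q by (rule L.m_closed[OF sc cl_B[OF that]])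
 have ae: "?a \<beta> q \<otimes>\<^sub>\<A> ?e \<beta> = ?a \<beta> q" if \<beta>: "\<beta> \<in> NB" and q: "q \<in> B 0" for \<beta> q
 proof (cases "ptarget \<beta> = source Q q")
  case True
  have "cl q \<otimes>\<^sub>\<A> ?e \<beta> = cl q" unfolding True by (rule cl_mult_vx[OF B_V[OF q] bv(1)[OF q] bv(2)[OF q]])
  then show ?thesis using sc cl_B[OF q] vx_idem(1)[OF tv[OF \<beta>]] by (simp add: L.m_assoc)
 next
  case False
  then have "slice \<beta> (f q) = \<zero>\<^sub>\<A>" using slice_vertex[OF f(1) q \<beta>] by simp
  then show ?thesis using cl_B[OF q] vx_idem(1)[OF tv[OF \<beta>]] by simp
 qed
 have eq: "f q \<odot>\<^bsub>\<D>\<^esub> cl q = finsum \<A> (%\<beta>. ?a \<beta> q \<otimes>\<^sub>\<A> nb \<beta>) NB" if q: "q \<in> B 0" for q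
 proof -
  have tc: "slice \<beta> (f q) \<boxtimes> nb \<beta> \<in> carrier E" if "\<beta> \<in> NB" for \<beta> by (rule te_closed[OF sc nb_closed[OF that]])
  have "f q \<odot>\<^bsub>\<D>\<^esub> cl q = finsum E (%\<beta>. slice \<beta> (f q) \<boxtimes> nb \<beta>) NB \<odot>\<^bsub>\<D>\<^esub> cl q"
   by (subst slice_expand[OF KB_value[OF f(1)]]) simp
  also have "\<dots> = finsum (\<D>) (%\<beta>. (slice \<beta> (f q) \<boxtimes> nb \<beta>) \<odot>\<^bsub>\<D>\<^esub> cl q) NB"
   by (rule D.finsum_smult_left[OF finite_NB cl_B_diagonal[OF q] tc])
  also have "\<dots> = finsum \<A> (%\<beta>. (slice \<beta> (f q) \<boxtimes> nb \<beta>) \<odot>\<^bsub>\<D>\<^esub> cl q) NB"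
   by (rule finsum_diagonal[OF finite_NB]) (rule diagonal_closed[OF tc cl_B[OF q]])
  also have "\<dots> = finsum \<A> (%\<beta>. ?a \<beta> q \<otimes>\<^sub>\<A> nb \<beta>) NB"
   by (rule L.finsum_cong') (use ac[OF q] in \<open>auto simp: diagonal_smult[OF sc nb_closed cl_B[OF q]] nb_closed\<close>)
  finally show ?thesis .
 qed
 let ?z = "finsum \<A> (?a \<gamma>) (B 0)"
 have zc: "?z \<in> carrier \<A>" using ac by (intro L.finsum_closed) auto
 have "?z \<otimes>\<^sub>\<A> ?e \<gamma> = finsum \<A> (%q. ?a \<gamma> q \<otimes>\<^sub>\<A> ?e \<gamma>) (B 0)"
  by (rule L.finsum_ldistr[OF bd(5) vx_idem(1)[OF tv[OF \<gamma>]]]) (use ac in simp)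
 also have "\<dots> = ?z" by (rule L.finsum_cong') (use ac ae[OF \<gamma>] in auto)
 finally have ze: "?z \<otimes>\<^sub>\<A> ?e \<gamma> = ?z" .
 have off: "coord \<gamma> (?a \<beta> q \<otimes>\<^sub>\<A> nb \<beta>) = 0" if q: "q \<in> B 0" and \<beta>: "\<beta> \<in> NB" "\<beta> \<noteq> \<gamma>" for \<beta> q
 proof (cases "plen \<beta> < plen \<gamma>")
  case True
  then have "?a \<beta> q \<otimes>\<^sub>\<A> nb \<beta> = \<zero>\<^sub>\<A>"
   using low_zeroD[OF f(3) \<beta>(1), of q] cl_B[OF q] nb_closed[OF \<beta>(1)] by simp
  then show ?thesis using coord_finsum[of "{}"] by simp
 next
  case False
  then have "plen \<gamma> \<le> plen \<beta>" by simp
  then show ?thesis using leading_coord[OF ac[OF q] ae[OF \<beta>(1) q] \<beta>(1)] \<gamma> \<beta>(2) by auto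
 qed
 have "0 = coord \<gamma> (epsB f)" unfolding f(2) using coord_finsum[of "{}"] by simp
 also have "\<dots> = (\<Sum>q\<in>B 0. coord \<gamma> (f q \<odot>\<^bsub>\<D>\<^esub> cl q))"
  unfolding epsB_apply[OF f(1)] by (rule coord_finsum[OF bd(5)]) (rule diagonal_closed[OF KB_value[OF f(1)] cl_B])
 also have "\<dots> = (\<Sum>q\<in>B 0. coord \<gamma> (?a \<gamma> q \<otimes>\<^sub>\<A> nb \<gamma>))"
 proof (rule sum.cong[OF refl])
  fix q assume q: "q \<in> B 0"
  have "coord \<gamma> (f q \<odot>\<^bsub>\<D>\<^esub> cl q) = (\<Sum>\<beta>\<in>NB. coord \<gamma> (?a \<beta> q \<otimes>\<^sub>\<A> nb \<beta>))"
   unfolding eq[OF q] by (rule coord_finsum[OF finite_NB]) (rule L.m_closed[OF ac[OF q] nb_closed])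
  also have "\<dots> = (\<Sum>\<beta>\<in>NB. if \<beta> = \<gamma> then coord \<gamma> (?a \<gamma> q \<otimes>\<^sub>\<A> nb \<gamma>) else 0)"
   by (rule sum.cong) (simp_all add: off[OF q])
  also have "\<dots> = coord \<gamma> (?a \<gamma> q \<otimes>\<^sub>\<A> nb \<gamma>)" using \<gamma> finite_NB by simp
  finally show "coord \<gamma> (f q \<odot>\<^bsub>\<D>\<^esub> cl q) = coord \<gamma> (?a \<gamma> q \<otimes>\<^sub>\<A> nb \<gamma>)" .
 qed
 also have "\<dots> = coord \<gamma> (finsum \<A> (%q. ?a \<gamma> q \<otimes>\<^sub>\<A> nb \<gamma>) (B 0))"
  by (rule coord_finsum[OF bd(5), symmetric]) (rule L.m_closed[OF ac nb_closed[OF \<gamma>]])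
 also have "finsum \<A> (%q. ?a \<gamma> q \<otimes>\<^sub>\<A> nb \<gamma>) (B 0) = ?z \<otimes>\<^sub>\<A> nb \<gamma>"
  by (rule L.finsum_ldistr[OF bd(5) nb_closed[OF \<gamma>], symmetric]) (use ac in simp)
 finally have "coord \<gamma> (?z \<otimes>\<^sub>\<A> nb \<gamma>) = 0" by simp
 then show ?thesis using leading_coord[OF zc ze \<gamma>] \<gamma> by auto
qed

text \<open>The left complex is augmented to \<Lambda> modulo its radical, so membership in the
  radical, as given by \<open>leading_slice_cycle\<close>, is the cycle condition for the leading
  slice.\<close>

lemma exact_KB_0:
 assumes f: "f \<in> carrier (KB 0)" "epsB f = \<zero>\<^sub>\<A>" and eps_dB: "!!h. h \<in> carrier (KB (Suc 0)) ==> epsB (dB 0 h) = \<zero>\<^sub>\<A>"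
 shows "f \<in> dB 0 ` carrier (KB (Suc 0))"
proof (rule boundary_by_filtration[OF f(1), of "%f. epsB f = \<zero>\<^sub>\<A>"])
 note KR = left_koszul_resolution[OF koszul]
 show "epsB f = \<zero>\<^sub>\<A>" by (rule f(2))
 fix m f \<gamma> assume f: "f \<in> carrier (KB 0)" "epsB f = \<zero>\<^sub>\<A>" "low_zero m f" "\<gamma> \<in> NB" "plen \<gamma> = m"
 have sl: "(%q. slice \<gamma> (f q)) \<in> carrier (KL 0)" by (rule slice_KL[OF f(1,4)])
 have sc: "slice \<gamma> (f q) \<otimes>\<^sub>\<A> cl q \<in> carrier \<A>" if "q \<in> B 0" for q
  by (rule L.m_closed[OF slice_closed[OF KB_value[OF f(1)]] cl_B[OF that]])
 have "\<exists>r. \<forall>q\<in>B 0. slice \<gamma> (f q) \<otimes>\<^sub>\<A> cl q = cl (r q) \<and> in_kQ (r q)"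
  by (rule bchoice) (use sc clE in blast)
 then obtain r where r: "!!q. q \<in> B 0 ==> slice \<gamma> (f q) \<otimes>\<^sub>\<A> cl q = cl (r q)"
  "!!q. q \<in> B 0 ==> in_kQ (r q)" by blast
 have z: "finsum \<A> (%q. slice \<gamma> (f q) \<otimes>\<^sub>\<A> cl q) (B 0) = cl (\<Sum>q\<in>B 0. r q)"
 proof -
  have "finsum \<A> (%q. slice \<gamma> (f q) \<otimes>\<^sub>\<A> cl q) (B 0) = finsum \<A> (%q. cl (r q)) (B 0)"
   by (rule L.finsum_cong') (use r in \<open>auto intro!: clI\<close>)
  also have "\<dots> = cl (\<Sum>q\<in>B 0. r q)" by (rule cl_finsum[OF bd(5) r(2)])
  finally show ?thesis .
 qed
 have "finsum \<A> (%q. slice \<gamma> (f q) \<otimes>\<^sub>\<A> cl q) (B 0) \<in> rad 1"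
  by (rule leading_slice_cycle[OF f(1,2) _ f(4)]) (use f in simp)
 then have "tcl (cl (\<Sum>q\<in>B 0. r q)) = \<zero>\<^bsub>qtop Q M\<^esub>"
  unfolding z using tcl_simps(2)[of "cl (\<Sum>q\<in>B 0. r q)"] rad_carrier by blast
 then have "epsL (%q. slice \<gamma> (f q)) = \<zero>\<^bsub>qtop Q M\<^esub>"
  using epsL_apply[OF resolutionD(1)[OF KR] sl r] by simp
 then show "(%q. slice \<gamma> (f q)) \<in> dL 0 ` carrier (KL (Suc 0))" by (rule resolutionD(7)[OF KR sl])
next
 fix g h assume g: "g \<in> carrier (KB 0)" and h: "h \<in> carrier (KB (Suc 0))" and z: "epsB (g \<oplus>\<^bsub>KB 0\<^esub> dB 0 h) = \<zero>\<^sub>\<A>"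
 have "epsB (g \<oplus>\<^bsub>KB 0\<^esub> dB 0 h) = epsB g \<oplus>\<^sub>\<A> epsB (dB 0 h)"
  using mod_hom_add[OF epsB_hom g mod_hom_closed[OF dB_hom h]] by (simp only: env_diagonal_simps)
 moreover have "epsB g \<in> carrier \<A>" using mod_hom_closed[OF epsB_hom g] by (simp only: env_diagonal_simps)
 ultimately show "epsB g = \<zero>\<^sub>\<A>" using z eps_dB[OF h] by simp
qed

text \<open>Both expansions of q sum to q, and for l = 0 the left one carries the sign -1.\<close>

lemma epsB_rowB:
 assumes q: "q \<in> B (Suc 0)"
 shows "epsB (rowB 0 q) = \<zero>\<^sub>\<A>"
proof -
 let ?u = "%p. dR 0 p q \<cdot> p + p \<cdot> dS 0 p q"
 have uV: "?u p \<in> V 1" if "p \<in> B 0" for p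
  using V_mult[OF dR_V[OF q] B_V[OF that]] V_mult[OF B_V[OF that] dS_V[OF q]] by (intro fs.subspace_add[OF subspace_V]) simp_all
 have "epsB (rowB 0 q) = finsum \<A> (%p. rowB 0 q p \<odot>\<^bsub>\<D>\<^esub> cl p) (B 0)"
  by (rule epsB_apply[OF rowB_carrier[OF q]])
 also have "\<dots> = finsum \<A> (%p. cl (?u p)) (B 0)"
 proof (rule L.finsum_cong')
  fix p assume p: "p \<in> B 0"
  note c = cR_closed[OF q, of p] cS_closed[OF q, of p] ti[OF q] cl_B[OF p]
  have 1: "cR 0 p q \<otimes>\<^sub>\<A> cl p \<otimes>\<^sub>\<A> sidem q = cl (dR 0 p q \<cdot> p)"
  proof (cases "source Q p = source Q q")
   case True
   have "cl p \<otimes>\<^sub>\<A> sidem q = cl p" unfolding True[symmetric] by (rule cl_mult_vx[OF B_V[OF p] bv(1)[OF p] bv(2)[OF p]])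
   then show ?thesis using L.m_assoc[OF c(1) c(7) c(5)] by (simp only: cl_mult_V[OF dR_V[OF q] B_V[OF p]])
  next
   case False
   have "cl (dR 0 p q \<cdot> p) = cR 0 p q \<otimes>\<^sub>\<A> cl p" by (rule cl_mult_V[OF dR_V[OF q] B_V[OF p], symmetric])
   then show ?thesis using c by (simp add: cR_zero[OF q p False])
  qed
  have 2: "tidem q \<otimes>\<^sub>\<A> cl p \<otimes>\<^sub>\<A> cS 0 p q = cl (p \<cdot> dS 0 p q)"
  proof (cases "target Q p = target Q q")
   case True
   have "tidem q \<otimes>\<^sub>\<A> cl p = cl p" unfolding True[symmetric] by (rule vx_cl[OF B_V[OF p] bv(3)[OF p] bv(4)[OF p]])
   then show ?thesis using cl_mult_V[OF B_V[OF p] dS_V[OF q]] by simp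
  next
   case False
   have "cl (p \<cdot> dS 0 p q) = cl p \<otimes>\<^sub>\<A> cS 0 p q" by (rule cl_mult_V[OF B_V[OF p] dS_V[OF q], symmetric])
   then show ?thesis using c by (simp add: cS_zero[OF q p False])
  qed
  show "rowB 0 q p \<odot>\<^bsub>\<D>\<^esub> cl p = cl (?u p)"
   unfolding rowB_def cl_add[symmetric]
   by (simp only: diagonal_distr[OF te_closed[OF c(1) c(5)] te_closed[OF c(3) c(2)] c(7)]
    diagonal_smult[OF c(1) c(5) c(7)] diagonal_smult[OF c(3) c(2) c(7)] 1 2)
 qed (use uV in \<open>auto intro!: clI V_paths[OF uV]\<close>)
 also have "\<dots> = cl (\<Sum>p\<in>B 0. ?u p)" by (rule cl_finsum[OF bd(5)]) (rule V_paths[OF uV])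
 also have "(\<Sum>p\<in>B 0. ?u p) = (\<Sum>p\<in>B 0. dR 0 p q \<cdot> p) - (\<Sum>p\<in>B 0. p \<cdot> delta_L Q (B 0) p q)"
  by (simp add: dS_def sum_subtractf pmul_right)
 also have "\<dots> = 0" by (simp add: delta_R_sum[OF basis B_K[OF q]] delta_L_sum[OF basis B_K[OF q]])
 finally show ?thesis by (simp add: cl_zero)
qed

lemma epsB_dB: "h \<in> carrier (KB (Suc 0)) ==> epsB (dB 0 h) = \<zero>\<^sub>\<A>"
 using unit_determines[OF mod_hom_comp[OF dB_hom epsB_hom] diagonal]
 by (simp only: dB_unit epsB_rowB env_diagonal_simps)

lemma epsB_surj: "a \<in> carrier \<A> ==> a \<in> epsB ` carrier (KB 0)"
proof -
 assume a: "a \<in> carrier \<A>"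
 \<comment> \<open>The unit of \<Lambda> is expanded in \<open>B 0\<close>, whose elements need not
   be the vertices themselves; its coordinates c determine the preimage.\<close>
 have "(\<Sum>v\<in>verts Q. vx v) \<in> K 0" unfolding K_low[of 0, simplified] by (intro V_sum vx_V)
 then obtain c where c: "(\<Sum>q\<in>B 0. fscale (c q) q) = (\<Sum>v\<in>verts Q. vx v)" using scal_surj by blast
 define f where "f q = (if q \<in> B 0 then (c q \<odot>\<^sub>\<A> (a \<otimes>\<^sub>\<A> tidem q)) \<boxtimes> sidem q else \<zero>\<^sub>E)" for q
 have at: "a \<otimes>\<^sub>\<A> tidem q \<in> carrier \<A>" if "q \<in> B 0" for q using a ti[OF that] by simp
 have f: "f \<in> carrier (KB 0)"
  by (rule KB_I) (use a in \<open>simp_all add: f_def te_closed tm ti at LV.ks_closed smult_mult L.m_assoc\<close>)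
 have sq: "fscale (c q) q \<in> V 0" if "q \<in> B 0" for q by (rule fs.subspace_scale[OF subspace_V B_V[OF that]])
 have "epsB f = finsum \<A> (%q. a \<otimes>\<^sub>\<A> cl (fscale (c q) q)) (B 0)"
  unfolding epsB_apply[OF f]
 proof (rule L.finsum_cong')
  fix q assume q: "q \<in> B 0"
  note t = ti[OF q] at[OF q] cl_B[OF q]
  have "f q \<odot>\<^bsub>\<D>\<^esub> cl q = c q \<odot>\<^sub>\<A> (a \<otimes>\<^sub>\<A> (tidem q \<otimes>\<^sub>\<A> cl q \<otimes>\<^sub>\<A> sidem q))"
   using q a t by (simp add: f_def diagonal_smult LV.ks_closed smult_mult L.m_assoc)
  also have "tidem q \<otimes>\<^sub>\<A> cl q \<otimes>\<^sub>\<A> sidem q = cl q"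
   by (simp only: vx_cl[OF B_V[OF q] bv(3)[OF q] bv(4)[OF q]] cl_mult_vx[OF B_V[OF q] bv(1)[OF q] bv(2)[OF q]])
  also have "c q \<odot>\<^sub>\<A> (a \<otimes>\<^sub>\<A> cl q) = a \<otimes>\<^sub>\<A> cl (fscale (c q) q)"
   unfolding cl_smult[symmetric] using a t by (simp add: smult_mult)
  finally show "f q \<odot>\<^bsub>\<D>\<^esub> cl q = a \<otimes>\<^sub>\<A> cl (fscale (c q) q)" .
 qed (use a sq in \<open>auto intro!: L.m_closed clI V_paths[OF sq]\<close>)
 also have "\<dots> = a \<otimes>\<^sub>\<A> finsum \<A> (%q. cl (fscale (c q) q)) (B 0)"
  by (rule L.finsum_rdistr[OF bd(5) a, symmetric]) (use sq in \<open>auto intro!: clI V_paths[OF sq]\<close>)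
 also have "finsum \<A> (%q. cl (fscale (c q) q)) (B 0) = \<one>\<^sub>\<A>"
  unfolding cl_one c[symmetric] by (rule cl_finsum[OF bd(5)]) (rule V_paths[OF sq])
 finally have "epsB f = a" using a by simp
 then show ?thesis using f by (intro image_eqI[of _ _ f]) simp_all
qed

theorem bimodule_koszul_resolution: "resolution E (\<D>) B KB dB epsB"
 unfolding resolution_def
proof (intro conjI allI)
 show "left_module E (\<D>)" by (rule diagonal)
 show "retract_of_free E (B l) (KB l)" for l by (rule idem_family.retract_of_free_idem[OF fam_KB])
 show "epsB \<in> mod_hom E (KB 0) (\<D>)" by (rule epsB_hom)
 show "dB l \<in> mod_hom E (KB (Suc l)) (KB l)" for l by (rule dB_hom)
 show "epsB ` carrier (KB 0) = carrier (\<D>)"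
  using mod_hom_closed[OF epsB_hom] epsB_surj by (auto simp: env_diagonal_simps)
 show "{x \<in> carrier (KB 0). epsB x = \<zero>\<^bsub>\<D>\<^esub>} = dB 0 ` carrier (KB 1)"
  using exact_KB_0 epsB_dB mod_hom_closed[OF dB_hom] by (auto simp: env_diagonal_simps)
 show "{x \<in> carrier (KB (Suc l)). dB l x = \<zero>\<^bsub>KB l\<^esub>} = dB (Suc l) ` carrier (KB (Suc (Suc l)))" for l
 proof (intro equalityI subsetI)
  fix x assume "x \<in> {x \<in> carrier (KB (Suc l)). dB l x = \<zero>\<^bsub>KB l\<^esub>}"
  then show "x \<in> dB (Suc l) ` carrier (KB (Suc (Suc l)))" by (intro exact_KB) (simp_all del: KB_ops)
 next
  fix x assume "x \<in> dB (Suc l) ` carrier (KB (Suc (Suc l)))"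
  then obtain w where w: "x = dB (Suc l) w" "w \<in> carrier (KB (Suc (Suc l)))" by (rule imageE)
  then show "x \<in> {x \<in> carrier (KB (Suc l)). dB l x = \<zero>\<^bsub>KB l\<^esub>}"
   using dB_dB[OF w(2)] mod_hom_closed[OF dB_hom w(2)] by (simp del: KB_ops)
 qed
qed

end

section \<open>Quotients of bimodules\<close>

lemma quot_bimodule_simps:
 "carrier (quot_bimodule M N) = a_rcosets\<^bsub>M\<^esub> N" "ring.zero (quot_bimodule M N) = N"
 "ring.add (quot_bimodule M N) = set_add M"
 "module.smult (quot_bimodule M N) = (%a X. \<Union>x\<in>X. N +>\<^sub>M (a \<odot>\<^sub>M x))"
 "rsmult (quot_bimodule M N) = (%X a. \<Union>x\<in>X. N +>\<^sub>M (rsmult M x a))"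
 by (simp_all add: quot_bimodule_def module.defs bimodule.defs quot_simps)

context abelian_subgroup
begin

text \<open>The operations of a quotient are defined as unions over a coset; such a union collapses
  as soon as all representatives give the same set.\<close>

lemma coset_union:
 assumes "x \<in> carrier G" "!!y. y \<in> H ==> K (y \<oplus> x) = K x"
 shows "(\<Union>z\<in>H +> x. K z) = K x"
proof -
 have "K z = K x" if "z \<in> H +> x" for z using that assms(2) by (auto simp: a_r_coset_def')
 moreover have "x \<in> H +> x" by (rule a_rcos_self[OF assms(1)])
 ultimately show ?thesis by blast
qed

lemma coset_shift: "x \<in> carrier G ==> y \<in> H ==> H +> (y \<oplus> x) = H +> x"
proof -
 assume x: "x \<in> carrier G" and y: "y \<in> H"
 have "y \<oplus> x \<in> H +> x" using y by (auto simp: a_r_coset_def')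
 then show ?thesis by (rule a_repr_independence[OF _ x a_subgroup, symmetric])
qed

lemma coset_eqD: "x \<in> carrier G ==> y \<in> carrier G ==> H +> x = H +> y ==> \<exists>h\<in>H. x = h \<oplus> y"
 using a_rcos_self[of x] by (auto simp: a_r_coset_def')

end

text \<open>The isomorphism from M modulo the preimage of G to N modulo G, where \<theta> is onto
  modulo G. In this form \<theta> can be defined on cocycles and may reach its target up to
  boundaries.\<close>

lemma quot_bimodule_iso:
 fixes M :: "('r, 'm) bimodule" and N :: "('r, 'n) bimodule" and A :: "('r, 's) ring_scheme"
 assumes M: "abelian_group M" and N: "abelian_group N" and G: "sub_bimodule A G N"
  and H: "H = {x \<in> carrier M. \<theta> x \<in> G}"
  and \<theta>: "!!x. x \<in> carrier M ==> \<theta> x \<in> carrier N"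
   "!!x y. x \<in> carrier M ==> y \<in> carrier M ==> \<theta> (x \<oplus>\<^sub>M y) = \<theta> x \<oplus>\<^sub>N \<theta> y"
   "!!a x. a \<in> carrier A ==> x \<in> carrier M ==> \<theta> (a \<odot>\<^sub>M x) = a \<odot>\<^sub>N \<theta> x"
   "!!a x. a \<in> carrier A ==> x \<in> carrier M ==> \<theta> (rsmult M x a) = rsmult N (\<theta> x) a"
  and onto: "!!y. y \<in> carrier N ==> \<exists>x\<in>carrier M. \<exists>g\<in>G. y = g \<oplus>\<^sub>N \<theta> x"
  and MA: "!!a x. a \<in> carrier A ==> x \<in> carrier M ==> a \<odot>\<^sub>M x \<in> carrier M"
   "!!a x. a \<in> carrier A ==> x \<in> carrier M ==> rsmult M x a \<in> carrier M"
   "!!a x y. a \<in> carrier A ==> x \<in> carrier M ==> y \<in> carrier M ==> a \<odot>\<^sub>M (x \<oplus>\<^sub>M y) = a \<odot>\<^sub>M x \<oplus>\<^sub>M a \<odot>\<^sub>M y"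
   "!!a x y. a \<in> carrier A ==> x \<in> carrier M ==> y \<in> carrier M ==> rsmult M (x \<oplus>\<^sub>M y) a = rsmult M x a \<oplus>\<^sub>M rsmult M y a"
  and NA: "!!a x. a \<in> carrier A ==> x \<in> carrier N ==> a \<odot>\<^sub>N x \<in> carrier N"
   "!!a x. a \<in> carrier A ==> x \<in> carrier N ==> rsmult N x a \<in> carrier N"
   "!!a x y. a \<in> carrier A ==> x \<in> carrier N ==> y \<in> carrier N ==> a \<odot>\<^sub>N (x \<oplus>\<^sub>N y) = a \<odot>\<^sub>N x \<oplus>\<^sub>N a \<odot>\<^sub>N y"
   "!!a x y. a \<in> carrier A ==> x \<in> carrier N ==> y \<in> carrier N ==> rsmult N (x \<oplus>\<^sub>N y) a = rsmult N x a \<oplus>\<^sub>N rsmult N y a"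
 shows "\<exists>h. h \<in> bimodule_iso A (quot_bimodule M H) (quot_bimodule N G)"
proof -
 interpret M: abelian_group M by fact
 interpret N: abelian_group N by fact
 have Gs: "subgroup G (add_monoid N)" "!!a x. a \<in> carrier A ==> x \<in> G ==> a \<odot>\<^sub>N x \<in> G"
  "!!a x. a \<in> carrier A ==> x \<in> G ==> rsmult N x a \<in> G"
  using G by (auto simp: sub_bimodule_def submodule_def submodule_axioms_def)
 interpret G: abelian_subgroup G N
  by (intro abelian_subgroupI3 additive_subgroup.intro N Gs(1))
 have \<theta>0: "\<theta> \<zero>\<^sub>M = \<zero>\<^sub>N"
  by (rule additive_zero[OF M N]) (simp_all only: \<theta>(1,2) M.zero_closed)
 have \<theta>n: "\<theta> (\<ominus>\<^sub>M x) = \<ominus>\<^sub>N \<theta> x" if "x \<in> carrier M" for x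
 proof -
  have "\<theta> (\<ominus>\<^sub>M x) \<oplus>\<^sub>N \<theta> x = \<zero>\<^sub>N"
   using \<theta>(2)[of "\<ominus>\<^sub>M x" x] that \<theta>0 by (simp add: M.l_neg)
  then show ?thesis using that \<theta>(1) by (simp add: N.minus_equality)
 qed
 have subH: "subgroup H (add_monoid M)"
 proof (rule subgroup.intro, goal_cases)
  case 1 show ?case by (auto simp: H)
 next
  case (2 x y) then show ?case using \<theta>(2) by (auto simp: H)
 next
  case 3 show ?case using \<theta>0 by (simp add: H)
 next
  case (4 x)
  then have x: "x \<in> carrier M" "\<theta> x \<in> G" by (auto simp: H)
  then have "\<ominus>\<^sub>M x \<in> H" using G.a_inv_closed[OF x(2)] \<theta>n[OF x(1)] by (simp add: H)
  then show ?case by (simp add: a_inv_def)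
 qed
 have HI: "x \<in> H" if "x \<in> carrier M" "\<theta> x \<in> G" for x using that unfolding H by blast
 have HG: "\<theta> x \<in> G" if "x \<in> H" for x using that unfolding H by blast
 interpret H: abelian_subgroup H M
  by (rule abelian_subgroupI3[OF additive_subgroup.intro[OF subH] M])
 have Hc: "x \<in> carrier M" if "x \<in> H" for x using that by (rule H.a_Hcarr)
 have Gc: "x \<in> carrier N" if "x \<in> G" for x using that by (rule G.a_Hcarr)
 define h where "h X = (\<Union>x\<in>X. G +>\<^sub>N \<theta> x)" for X
 have hc: "h (H +>\<^sub>M x) = G +>\<^sub>N \<theta> x" if x: "x \<in> carrier M" for x
  unfolding h_def
 proof (rule H.coset_union[OF x])
  fix y assume y: "y \<in> H"
  have "\<theta> (y \<oplus>\<^sub>M x) = \<theta> y \<oplus>\<^sub>N \<theta> x" by (rule \<theta>(2)[OF Hc[OF y] x])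
  then show "G +>\<^sub>N \<theta> (y \<oplus>\<^sub>M x) = G +>\<^sub>N \<theta> x"
   using G.coset_shift[OF \<theta>(1)[OF x] HG[OF y]] by (simp only:)
 qed
 have Hs: "a \<odot>\<^sub>M x \<in> H" "rsmult M x a \<in> H" if "a \<in> carrier A" "x \<in> H" for a x
  using \<theta>(3,4)[OF that(1) Hc[OF that(2)]] MA(1,2)[OF that(1) Hc[OF that(2)]] Gs(2,3)[OF that(1) HG[OF that(2)]]
  by (simp_all add: HI)
 have sm: "a \<odot>\<^bsub>quot_bimodule M H\<^esub> (H +>\<^sub>M x) = H +>\<^sub>M (a \<odot>\<^sub>M x)"
  "rsmult (quot_bimodule M H) (H +>\<^sub>M x) a = H +>\<^sub>M (rsmult M x a)"
  if a: "a \<in> carrier A" and x: "x \<in> carrier M" for a x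
  unfolding quot_bimodule_simps
  by (rule H.coset_union[OF x], simp add: MA(3)[OF a Hc x] H.coset_shift[OF MA(1)[OF a x] Hs(1)[OF a]],
    rule H.coset_union[OF x], simp add: MA(4)[OF a Hc x] H.coset_shift[OF MA(2)[OF a x] Hs(2)[OF a]])
 have sn: "a \<odot>\<^bsub>quot_bimodule N G\<^esub> (G +>\<^sub>N x) = G +>\<^sub>N (a \<odot>\<^sub>N x)"
  "rsmult (quot_bimodule N G) (G +>\<^sub>N x) a = G +>\<^sub>N (rsmult N x a)"
  if a: "a \<in> carrier A" and x: "x \<in> carrier N" for a x
  unfolding quot_bimodule_simps
  by (rule G.coset_union[OF x], simp add: NA(3)[OF a Gc x] G.coset_shift[OF NA(1)[OF a x] Gs(2)[OF a]],
    rule G.coset_union[OF x], simp add: NA(4)[OF a Gc x] G.coset_shift[OF NA(2)[OF a x] Gs(3)[OF a]])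
 have cM: "carrier (quot_bimodule M H) = (%x. H +>\<^sub>M x) ` carrier M"
  and cN: "carrier (quot_bimodule N G) = (%x. G +>\<^sub>N x) ` carrier N"
  by (auto simp: quot_bimodule_simps A_RCOSETS_def')
 have "h \<in> mod_hom A (quot_bimodule M H) (quot_bimodule N G)"
 proof (rule mod_homI)
  fix X assume "X \<in> carrier (quot_bimodule M H)"
  then show "h X \<in> carrier (quot_bimodule N G)" unfolding cM cN using hc \<theta>(1) by auto
 next
  fix X Y assume "X \<in> carrier (quot_bimodule M H)" "Y \<in> carrier (quot_bimodule M H)"
  then obtain x y where x: "x \<in> carrier M" "X = H +>\<^sub>M x" and y: "y \<in> carrier M" "Y = H +>\<^sub>M y" unfolding cM by auto
  show "h (X \<oplus>\<^bsub>quot_bimodule M H\<^esub> Y) = h X \<oplus>\<^bsub>quot_bimodule N G\<^esub> h Y"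
   using x y by (simp add: quot_bimodule_simps H.a_rcos_sum G.a_rcos_sum hc \<theta>)
 next
  fix a X assume a: "a \<in> carrier A" and "X \<in> carrier (quot_bimodule M H)"
  then obtain x where x: "x \<in> carrier M" "X = H +>\<^sub>M x" unfolding cM by auto
  show "h (a \<odot>\<^bsub>quot_bimodule M H\<^esub> X) = a \<odot>\<^bsub>quot_bimodule N G\<^esub> h X"
   unfolding x(2) using a x(1) by (simp add: sm sn hc \<theta> MA)
 qed
 moreover have "bij_betw h (carrier (quot_bimodule M H)) (carrier (quot_bimodule N G))"
  unfolding bij_betw_def
 proof
  show "inj_on h (carrier (quot_bimodule M H))"
  proof (rule inj_onI)
   fix X Y assume "X \<in> carrier (quot_bimodule M H)" "Y \<in> carrier (quot_bimodule M H)" and e: "h X = h Y"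
   then obtain x y where x: "x \<in> carrier M" "X = H +>\<^sub>M x" and y: "y \<in> carrier M" "Y = H +>\<^sub>M y" unfolding cM by auto
   have "G +>\<^sub>N \<theta> x = G +>\<^sub>N \<theta> y" using e x y by (simp add: hc)
   then obtain g where g: "g \<in> G" "\<theta> x = g \<oplus>\<^sub>N \<theta> y" using G.coset_eqD[OF \<theta>(1)[OF x(1)] \<theta>(1)[OF y(1)]] by blast
   have "\<theta> (x \<oplus>\<^sub>M (\<ominus>\<^sub>M y)) = g"
    using g x(1) y(1) \<theta>(1) Gc[OF g(1)] by (simp add: \<theta>(2) \<theta>n N.a_assoc N.r_neg)
   then have d: "x \<oplus>\<^sub>M (\<ominus>\<^sub>M y) \<in> H" using g(1) x(1) y(1) by (intro HI) simp_all
   have "x = (x \<oplus>\<^sub>M (\<ominus>\<^sub>M y)) \<oplus>\<^sub>M y" using x(1) y(1) by (simp add: M.a_assoc M.l_neg)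
   then show "X = Y" using H.coset_shift[OF y(1) d] x(2) y(2) by simp
  qed
  show "h ` carrier (quot_bimodule M H) = carrier (quot_bimodule N G)"
  proof (intro equalityI subsetI)
   fix Y assume "Y \<in> carrier (quot_bimodule N G)"
   then obtain y where y: "y \<in> carrier N" "Y = G +>\<^sub>N y" unfolding cN by auto
   obtain x g where x: "x \<in> carrier M" "g \<in> G" "y = g \<oplus>\<^sub>N \<theta> x" using onto[OF y(1)] by blast
   have "Y = h (H +>\<^sub>M x)" unfolding y(2) x(3) hc[OF x(1)] by (rule G.coset_shift[OF \<theta>(1)[OF x(1)] x(2)])
   then show "Y \<in> h ` carrier (quot_bimodule M H)" unfolding cM using x(1) by blast
  next
   fix Y assume "Y \<in> h ` carrier (quot_bimodule M H)"
   then show "Y \<in> carrier (quot_bimodule N G)" unfolding cM cN using hc \<theta>(1) by auto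
  qed
 qed
 moreover have "h (rsmult (quot_bimodule M H) X a) = rsmult (quot_bimodule N G) (h X) a"
  if "X \<in> carrier (quot_bimodule M H)" and a: "a \<in> carrier A" for X a
 proof -
  have "X \<in> (%x. H +>\<^sub>M x) ` carrier M" using that(1) by (simp only: cM)
  then obtain x where x': "X = H +>\<^sub>M x" "x \<in> carrier M" by (rule imageE)
  note x = x'(2,1)
  show ?thesis unfolding x(2) using a x(1) by (simp add: sm sn hc \<theta> MA)
 qed
 ultimately show ?thesis by (intro exI[of _ h]) (simp add: bimodule_iso_def)
qed

section \<open>The summands of the top bimodule\<close>

lemma kspace_restrict:
 assumes "kspace G" "H \<subseteq> carrier G" "\<zero>\<^sub>G \<in> H"
  "!!x y. [|x \<in> H; y \<in> H|] ==> x \<oplus>\<^sub>G y \<in> H" "!!c x. x \<in> H ==> c \<odot>\<^sub>G x \<in> H"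
 shows "kspace (G\<lparr>carrier := H\<rparr>)"
proof -
 interpret kspace G by fact
 have H: "x \<in> carrier G" if "x \<in> H" for x using assms(2) that by blast
 have inv: "\<exists>y\<in>H. y \<oplus>\<^sub>G x = \<zero>\<^sub>G" if x: "x \<in> H" for x
 proof
  show "(- 1) \<odot>\<^sub>G x \<in> H" by (rule assms(5)[OF x])
  have "(- 1) \<odot>\<^sub>G x \<oplus>\<^sub>G 1 \<odot>\<^sub>G x = \<zero>\<^sub>G"
   using H[OF x] by (simp flip: ks_add_left add: ks_zero)
  then show "(- 1) \<odot>\<^sub>G x \<oplus>\<^sub>G x = \<zero>\<^sub>G" using H[OF x] by (simp add: ks_one)
 qed
 have "abelian_group (G\<lparr>carrier := H\<rparr>)"
  by (rule abelian_groupI) (use assms(3,4) H inv in \<open>simp_all add: a_ac\<close>)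
 then show ?thesis
  by (intro kspace.intro kspace_axioms.intro)
   (simp_all add: assms(5) H ks_add_left ks_add_right ks_assoc ks_one)
qed

context quadratic_quiver
begin

abbreviation "AL i \<equiv> \<A>\<lparr>carrier := left_proj Q M i\<rparr>"
abbreviation "AR j \<equiv> \<A>\<lparr>carrier := right_proj Q M j\<rparr>"
abbreviation "TT i j \<equiv> tensor (AL i) (AR j)"
abbreviation "tt i j \<equiv> tensor_elem (AL i) (AR j)"
abbreviation "TB i j \<equiv> tensor_bimodule \<A> (left_proj Q M i) (right_proj Q M j)"
abbreviation vc :: "'v => ('v, 'a, 'k) path_elem set" where "vc i \<equiv> cl (vx i)"

lemma vc_closed: "i \<in> verts Q ==> vc i \<in> carrier \<A>"
 by (rule clI[OF vx_paths])

lemma vc_idem: "i \<in> verts Q ==> vc i \<otimes>\<^sub>\<A> vc i = vc i"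
 by (simp add: cl_mult_V[OF vx_V vx_V] vx_vx)

lemma left_proj_iff: "i \<in> verts Q ==> x \<in> left_proj Q M i \<longleftrightarrow> x \<in> carrier \<A> \<and> x \<otimes>\<^sub>\<A> vc i = x"
proof -
 assume i: "i \<in> verts Q"
 show ?thesis
 proof
  assume "x \<in> left_proj Q M i"
  then obtain y where "x = y \<otimes>\<^sub>\<A> vc i" "y \<in> carrier \<A>" unfolding left_proj_def principal_left_def by (rule imageE)
  then show "x \<in> carrier \<A> \<and> x \<otimes>\<^sub>\<A> vc i = x" using i by (simp add: L.m_assoc vc_closed vc_idem)
 next
  assume x: "x \<in> carrier \<A> \<and> x \<otimes>\<^sub>\<A> vc i = x"
  then show "x \<in> left_proj Q M i" unfolding left_proj_def principal_left_def by (intro image_eqI[of _ _ x]) simp_all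
 qed
qed

lemma right_proj_iff: "i \<in> verts Q ==> x \<in> right_proj Q M i \<longleftrightarrow> x \<in> carrier \<A> \<and> vc i \<otimes>\<^sub>\<A> x = x"
proof -
 assume i: "i \<in> verts Q"
 show ?thesis
 proof
  assume "x \<in> right_proj Q M i"
  then obtain y where "x = vc i \<otimes>\<^sub>\<A> y" "y \<in> carrier \<A>" unfolding right_proj_def principal_right_def by (rule imageE)
  then show "x \<in> carrier \<A> \<and> vc i \<otimes>\<^sub>\<A> x = x" using i by (simp add: vc_closed vc_idem flip: L.m_assoc)
 next
  assume x: "x \<in> carrier \<A> \<and> vc i \<otimes>\<^sub>\<A> x = x"
  then show "x \<in> right_proj Q M i" unfolding right_proj_def principal_right_def by (intro image_eqI[of _ _ x]) simp_all
 qed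
qed

lemma kspace_AL: "i \<in> verts Q ==> kspace (AL i)"
 by (rule kspace_restrict[OF kspace_\<A>])
  (auto simp: left_proj_iff L.l_distr vc_closed LV.ks_closed smult_mult)

lemma kspace_AR: "i \<in> verts Q ==> kspace (AR i)"
 by (rule kspace_restrict[OF kspace_\<A>])
  (auto simp: right_proj_iff L.r_distr vc_closed LV.ks_closed smult_mult)

section \<open>Exchange of the tensor factors\<close>

lemma kspace_E: "kspace E"
 unfolding E_conv by (rule E.kspace_T)

text \<open>The exchange of factors, combined with cutting down to \<Lambda> e_i and e_j \<Lambda>
  so that it is defined on all of \<open>E\<close>. Restricted to (e_j \<boxtimes> e_i) E it is
  bijective, with inverse \<open>unsw\<close>.\<close>

definition sw where
 "sw i j = induced (TT i j) (%x y. tt i j (y \<otimes>\<^sub>\<A> vc i) (vc j \<otimes>\<^sub>\<A> x))"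

definition unsw :: "(('v, 'a, 'k) path_elem set \<times> ('v, 'a, 'k) path_elem set \<Rightarrow>\<^sub>0 'k) set => _" where
 "unsw = induced E (%u v. v \<boxtimes> u)"

lemma TB_simps:
 "carrier (TB i j) = carrier (TT i j)" "\<zero>\<^bsub>TB i j\<^esub> = \<zero>\<^bsub>TT i j\<^esub>" "x \<oplus>\<^bsub>TB i j\<^esub> y = x \<oplus>\<^bsub>TT i j\<^esub> y"
 "a \<odot>\<^bsub>TB i j\<^esub> x = tensor_map (AL i) (AR j) (%x. a \<otimes>\<^sub>\<A> x) (%y. y) x"
 "rsmult (TB i j) x a = tensor_map (AL i) (AR j) (%x. x) (%y. y \<otimes>\<^sub>\<A> a) x"
 by (simp_all add: tensor_bimodule_def Let_def)

context
 fixes i j assumes i: "i \<in> verts Q" and j: "j \<in> verts Q"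
begin

lemma tensor_product_TT: "tensor_product (AL i) (AR j)"
 by (intro tensor_product.intro kspace_AL kspace_AR i j)

interpretation TP: tensor_product "AL i" "AR j" by (rule tensor_product_TT)

lemma abelian_group_TT: "abelian_group (TT i j)"
 by (rule TP.T.abelian_group_axioms)

lemma AL_iff: "x \<in> carrier (AL i) \<longleftrightarrow> x \<in> carrier \<A> \<and> x \<otimes>\<^sub>\<A> vc i = x"
 using left_proj_iff[OF i] by simp

lemma AR_iff: "x \<in> carrier (AR j) \<longleftrightarrow> x \<in> carrier \<A> \<and> vc j \<otimes>\<^sub>\<A> x = x"
 using right_proj_iff[OF j] by simp

lemma to_AL: "x \<in> carrier \<A> ==> x \<otimes>\<^sub>\<A> vc i \<in> carrier (AL i)"
 unfolding AL_iff using i by (simp add: vc_closed vc_idem L.m_assoc)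

lemma to_AR: "x \<in> carrier \<A> ==> vc j \<otimes>\<^sub>\<A> x \<in> carrier (AR j)"
 unfolding AR_iff using j by (simp add: vc_closed vc_idem flip: L.m_assoc)

lemma AL_mult: "a \<in> carrier \<A> ==> x \<in> carrier (AL i) ==> a \<otimes>\<^sub>\<A> x \<in> carrier (AL i)"
 unfolding AL_iff using i by (simp add: vc_closed L.m_assoc)

lemma AR_mult: "a \<in> carrier \<A> ==> x \<in> carrier (AR j) ==> x \<otimes>\<^sub>\<A> a \<in> carrier (AR j)"
 unfolding AR_iff using j by (simp add: vc_closed flip: L.m_assoc)

lemma AL_sub: "x \<in> carrier (AL i) ==> x \<in> carrier \<A>"
 by (simp only: AL_iff)

lemma AR_sub: "y \<in> carrier (AR j) ==> y \<in> carrier \<A>"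
 by (simp only: AR_iff)

lemma tt_add_left: "u \<in> carrier (AL i) ==> u' \<in> carrier (AL i) ==> v \<in> carrier (AR j) ==>
  tt i j (u \<oplus>\<^sub>\<A> u') v = tt i j u v \<oplus>\<^bsub>TT i j\<^esub> tt i j u' v"
 and tt_add_right: "u \<in> carrier (AL i) ==> v \<in> carrier (AR j) ==> v' \<in> carrier (AR j) ==>
  tt i j u (v \<oplus>\<^sub>\<A> v') = tt i j u v \<oplus>\<^bsub>TT i j\<^esub> tt i j u v'"
 and tt_smult_left: "u \<in> carrier (AL i) ==> v \<in> carrier (AR j) ==> tt i j (c \<odot>\<^sub>\<A> u) v = c \<odot>\<^bsub>TT i j\<^esub> tt i j u v"
 and tt_smult_right: "u \<in> carrier (AL i) ==> v \<in> carrier (AR j) ==> tt i j u (c \<odot>\<^sub>\<A> v) = c \<odot>\<^bsub>TT i j\<^esub> tt i j u v"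
 using TP.elem_add_left[of u u' v] TP.elem_add_right[of u v v'] TP.elem_smult_left[of u v c] TP.elem_smult_right[of u v c]
 by simp_all

lemma bilinear_sw: "bilinear_map \<A> (op_algebra \<A>) (TT i j) (%x y. tt i j (y \<otimes>\<^sub>\<A> vc i) (vc j \<otimes>\<^sub>\<A> x))"
proof (rule bilinear_mapI, goal_cases)
 case (1 a b) then show ?case by (intro TP.elem_closed to_AL to_AR) simp_all
next
 case (2 a a' b)
 then show ?case using tt_add_right[OF to_AL to_AR to_AR, of b a a'] j by (simp add: L.r_distr vc_closed)
next
 case (3 a b b')
 then show ?case using tt_add_left[OF to_AL to_AL to_AR, of b b' a] i by (simp add: L.l_distr vc_closed)
next
 case (4 c a b)
 then show ?case using tt_smult_right[OF to_AL to_AR, of b a c] j by (simp add: smult_mult vc_closed)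
next
 case (5 c a b)
 then show ?case using tt_smult_left[OF to_AL to_AR, of b a c] i by (simp add: smult_mult vc_closed)
qed

lemma sw_te: "a \<in> carrier \<A> ==> b \<in> carrier \<A> ==> sw i j (a \<boxtimes> b) = tt i j (b \<otimes>\<^sub>\<A> vc i) (vc j \<otimes>\<^sub>\<A> a)"
 unfolding sw_def by (rule E.induced_elem[OF TP.kspace_T bilinear_sw]) simp_all

lemma sw_closed: "x \<in> carrier E ==> sw i j x \<in> carrier (TT i j)"
 unfolding sw_def E_conv by (rule E.induced_closed[OF TP.kspace_T bilinear_sw])

lemma sw_add: "x \<in> carrier E ==> y \<in> carrier E ==> sw i j (x \<oplus>\<^sub>E y) = sw i j x \<oplus>\<^bsub>TT i j\<^esub> sw i j y"
 unfolding sw_def E_conv by (rule E.induced_add[OF TP.kspace_T bilinear_sw])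

lemma sw_zero: "sw i j \<zero>\<^sub>E = \<zero>\<^bsub>TT i j\<^esub>"
 unfolding sw_def E_conv by (rule E.induced_zero[OF TP.kspace_T bilinear_sw])

lemma bilinear_unsw: "bilinear_map (AL i) (AR j) E (%u v. v \<boxtimes> u)"
proof (rule bilinear_mapI, goal_cases)
 case (1 a b) then show ?case by (intro te_closed AL_sub AR_sub)
next
 case (2 a a' b) then show ?case using te_add_right[of b a a'] AL_sub[of a] AL_sub[of a'] AR_sub[of b] by simp
next
 case (3 a b b') then show ?case using te_add_left[of b b' a] AL_sub[of a] AR_sub[of b] AR_sub[of b'] by simp
next
 case (4 c a b) then show ?case using E.elem_smult_right[of b a c] AL_sub[of a] AR_sub[of b] by (simp add: E_conv)
next
 case (5 c a b) then show ?case using E.elem_smult_left[of b a c] AL_sub[of a] AR_sub[of b] by (simp add: E_conv)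
qed

lemma unsw_tt: "u \<in> carrier (AL i) ==> v \<in> carrier (AR j) ==> unsw (tt i j u v) = v \<boxtimes> u"
 unfolding unsw_def by (rule TP.induced_elem[OF kspace_E bilinear_unsw])

lemma unsw_closed: "t \<in> carrier (TT i j) ==> unsw t \<in> carrier E"
 unfolding unsw_def by (rule TP.induced_closed[OF kspace_E bilinear_unsw])

lemma unsw_add: "t \<in> carrier (TT i j) ==> t' \<in> carrier (TT i j) ==> unsw (t \<oplus>\<^bsub>TT i j\<^esub> t') = unsw t \<oplus>\<^sub>E unsw t'"
 unfolding unsw_def by (rule TP.induced_add[OF kspace_E bilinear_unsw])

lemma unsw_zero: "unsw \<zero>\<^bsub>TT i j\<^esub> = \<zero>\<^sub>E"
 unfolding unsw_def by (rule TP.induced_zero[OF kspace_E bilinear_unsw])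

text \<open>As the product in the second factor is reversed, left multiplication by e_j \<boxtimes>
  e_i takes a \<boxtimes> b to e_j a \<boxtimes> b e_i, the same cut that \<open>sw\<close>
  performs.\<close>

lemma unsw_sw:
 assumes E: "ring E" and x: "x \<in> carrier E"
 shows "unsw (sw i j x) = vc j \<boxtimes> vc i \<otimes>\<^sub>E x"
 using x
proof (induction x rule: te_induct)
 interpret ER: ring E by fact
 case zero
 show ?case unfolding sw_zero unsw_zero using i j by (simp add: te_closed vc_closed)
next
 case (elem a b)
 then show ?case
  unfolding sw_te[OF elem] unsw_tt[OF to_AL[OF elem(2)] to_AR[OF elem(1)]]
  using i j by (simp add: te_mult[OF E] vc_closed)
next
 interpret ER: ring E by fact
 case (add x y)
 then show ?case using i j by (simp add: sw_add sw_closed unsw_add ER.r_distr te_closed vc_closed)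
qed

lemma sw_unsw: "t \<in> carrier (TT i j) ==> sw i j (unsw t) = t"
proof (induction t rule: TP.tensor_induct)
 case zero show ?case by (simp add: unsw_zero sw_zero)
next
 case (elem u v)
 have uv: "u \<in> carrier \<A>" "u \<otimes>\<^sub>\<A> vc i = u" "v \<in> carrier \<A>" "vc j \<otimes>\<^sub>\<A> v = v"
  using elem by (simp_all only: AL_iff AR_iff)
 then show ?case unfolding unsw_tt[OF elem] sw_te[OF uv(3,1)] by simp
next
 case (add t t') then show ?case by (simp add: unsw_add sw_add unsw_closed)
qed

lemma bilinear_left: "a \<in> carrier \<A> ==> bilinear_map (AL i) (AR j) (TT i j) (%u v. tt i j (a \<otimes>\<^sub>\<A> u) v)"
proof (rule bilinear_mapI, goal_cases)
 case (1 u v) then show ?case by (intro TP.elem_closed AL_mult)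
next
 case (2 u u' v)
 then show ?case using tt_add_left[OF AL_mult AL_mult, of a u a u' v] AL_sub[of u] AL_sub[of u'] by (simp add: L.r_distr)
next
 case (3 u v v') then show ?case using tt_add_right[OF AL_mult, of a u v v'] by simp
next
 case (4 c u v) then show ?case using tt_smult_left[OF AL_mult, of a u v c] AL_sub[of u] by (simp add: smult_mult)
next
 case (5 c u v) then show ?case using tt_smult_right[OF AL_mult, of a u v c] by simp
qed

lemma bilinear_right: "a \<in> carrier \<A> ==> bilinear_map (AL i) (AR j) (TT i j) (%u v. tt i j u (v \<otimes>\<^sub>\<A> a))"
proof (rule bilinear_mapI, goal_cases)
 case (1 u v) then show ?case by (intro TP.elem_closed AR_mult)
next
 case (2 u u' v) then show ?case using tt_add_left[OF _ _ AR_mult, of u u' a v] by simp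
next
 case (3 u v v')
 then show ?case using tt_add_right[OF _ AR_mult AR_mult, of u a v a v'] AR_sub[of v] AR_sub[of v'] by (simp add: L.l_distr)
next
 case (4 c u v) then show ?case using tt_smult_left[OF _ AR_mult, of u a v c] by simp
next
 case (5 c u v) then show ?case using tt_smult_right[OF _ AR_mult, of u a v c] AR_sub[of v] by (simp add: smult_mult)
qed

lemma TB_smult: "a \<in> carrier \<A> ==> t \<in> carrier (TT i j) ==>
  a \<odot>\<^bsub>TB i j\<^esub> t = induced (TT i j) (%u v. tt i j (a \<otimes>\<^sub>\<A> u) v) t"
 unfolding TB_simps by (rule tensor_map_induced[OF tensor_product_TT bilinear_left AL_mult])

lemma TB_rsmult: "a \<in> carrier \<A> ==> t \<in> carrier (TT i j) ==>
  rsmult (TB i j) t a = induced (TT i j) (%u v. tt i j u (v \<otimes>\<^sub>\<A> a)) t"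
 unfolding TB_simps by (rule tensor_map_induced[OF tensor_product_TT bilinear_right _ AR_mult])

lemma TB_actions:
 assumes "a \<in> carrier \<A>" "t \<in> carrier (TT i j)"
 shows "a \<odot>\<^bsub>TB i j\<^esub> t \<in> carrier (TT i j)" "rsmult (TB i j) t a \<in> carrier (TT i j)"
  "t' \<in> carrier (TT i j) ==> a \<odot>\<^bsub>TB i j\<^esub> (t \<oplus>\<^bsub>TT i j\<^esub> t') = a \<odot>\<^bsub>TB i j\<^esub> t \<oplus>\<^bsub>TT i j\<^esub> a \<odot>\<^bsub>TB i j\<^esub> t'"
  "t' \<in> carrier (TT i j) ==> rsmult (TB i j) (t \<oplus>\<^bsub>TT i j\<^esub> t') a = rsmult (TB i j) t a \<oplus>\<^bsub>TT i j\<^esub> rsmult (TB i j) t' a"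
 using TP.induced_closed[OF TP.kspace_T bilinear_left[OF assms(1)] assms(2)] TP.induced_closed[OF TP.kspace_T bilinear_right[OF assms(1)] assms(2)]
  TP.induced_add[OF TP.kspace_T bilinear_left[OF assms(1)] assms(2), of t'] TP.induced_add[OF TP.kspace_T bilinear_right[OF assms(1)] assms(2), of t']
 by (simp_all add: TB_smult[OF assms(1)] TB_rsmult[OF assms(1)] assms(2))

text \<open>The inner bimodule structure becomes the outer one: a multiplier enters on the left of
  the second factor or on the right of the first, and the exchange moves both places to the
  outside.\<close>

lemma sw_mult:
 assumes E: "ring E" and x: "x \<in> carrier E" and a: "a \<in> carrier \<A>"
 shows "sw i j (x \<otimes>\<^sub>E \<one>\<^sub>\<A> \<boxtimes> a) = a \<odot>\<^bsub>TB i j\<^esub> sw i j x"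
  "sw i j (x \<otimes>\<^sub>E a \<boxtimes> \<one>\<^sub>\<A>) = rsmult (TB i j) (sw i j x) a"
proof -
 interpret ER: ring E by fact
 have "sw i j (x \<otimes>\<^sub>E \<one>\<^sub>\<A> \<boxtimes> a) = a \<odot>\<^bsub>TB i j\<^esub> sw i j x \<and> sw i j (x \<otimes>\<^sub>E a \<boxtimes> \<one>\<^sub>\<A>) = rsmult (TB i j) (sw i j x) a"
  using x
 proof (induction x rule: te_induct)
  case zero
  have "a \<odot>\<^bsub>TB i j\<^esub> \<zero>\<^bsub>TT i j\<^esub> = \<zero>\<^bsub>TT i j\<^esub>" "rsmult (TB i j) \<zero>\<^bsub>TT i j\<^esub> a = \<zero>\<^bsub>TT i j\<^esub>"
   by (simp_all add: TB_smult[OF a] TB_rsmult[OF a]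
    TP.induced_zero[OF TP.kspace_T bilinear_left[OF a]] TP.induced_zero[OF TP.kspace_T bilinear_right[OF a]])
  then show ?case using a by (simp add: sw_zero te_closed)
 next
  case (elem c d)
  note c = to_AL[OF elem(2)] to_AR[OF elem(1)]
  have 1: "sw i j (c \<boxtimes> d \<otimes>\<^sub>E \<one>\<^sub>\<A> \<boxtimes> a) = tt i j (a \<otimes>\<^sub>\<A> (d \<otimes>\<^sub>\<A> vc i)) (vc j \<otimes>\<^sub>\<A> c)"
   using elem a i by (simp add: te_mult[OF E] sw_te L.m_assoc vc_closed)
  have 2: "sw i j (c \<boxtimes> d \<otimes>\<^sub>E a \<boxtimes> \<one>\<^sub>\<A>) = tt i j (d \<otimes>\<^sub>\<A> vc i) (vc j \<otimes>\<^sub>\<A> c \<otimes>\<^sub>\<A> a)"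
   using elem a j by (simp add: te_mult[OF E] sw_te L.m_assoc vc_closed)
  show ?case
   unfolding 1 2 sw_te[OF elem] TB_smult[OF a TP.elem_closed[OF c]] TB_rsmult[OF a TP.elem_closed[OF c]]
   by (simp only: TP.induced_elem[OF TP.kspace_T bilinear_left[OF a] c] TP.induced_elem[OF TP.kspace_T bilinear_right[OF a] c])
 next
  case (add x y)
  then show ?case using a by (simp add: ER.l_distr te_closed sw_add sw_closed TB_actions)
 qed
 note c = this
 show "sw i j (x \<otimes>\<^sub>E \<one>\<^sub>\<A> \<boxtimes> a) = a \<odot>\<^bsub>TB i j\<^esub> sw i j x" by (rule c[THEN conjunct1])
 show "sw i j (x \<otimes>\<^sub>E a \<boxtimes> \<one>\<^sub>\<A>) = rsmult (TB i j) (sw i j x) a" by (rule c[THEN conjunct2])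
qed

end

end

section \<open>The top cohomology\<close>

lemma env_inner_simps:
 "a \<odot>\<^bsub>env_inner A\<^esub> x = x \<otimes>\<^bsub>env A\<^esub> tensor_elem A (op_algebra A) \<one>\<^sub>A a"
 "rsmult (env_inner A) x a = x \<otimes>\<^bsub>env A\<^esub> tensor_elem A (op_algebra A) a \<one>\<^sub>A"
 by (simp_all add: env_inner_def Let_def)

context env_koszul
begin

abbreviation "reg \<equiv> regular E"
abbreviation topB where "topB l \<equiv> top_bimodule Q M (B l)"
abbreviation TTq where "TTq q \<equiv> TT (source Q q) (target Q q)"
abbreviation TBq where "TBq q \<equiv> TB (source Q q) (target Q q)"
abbreviation swq where "swq q \<equiv> sw (source Q q) (target Q q)"

lemma left_module_reg: "left_module E reg"
 by (rule left_module_regular[OF ring_E])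

lemma reg_hom:
 assumes "\<eta> \<in> mod_hom E X reg"
 shows "x \<in> carrier X ==> \<eta> x \<in> carrier E"
  "x \<in> carrier X ==> y \<in> carrier X ==> \<eta> (x \<oplus>\<^sub>X y) = \<eta> x \<oplus>\<^sub>E \<eta> y"
  "a \<in> carrier E ==> x \<in> carrier X ==> \<eta> (a \<odot>\<^sub>X x) = a \<otimes>\<^sub>E \<eta> x"
 using mod_homD[OF assms] by (simp_all add: regular_simps)

lemma reg_hom_add: "\<eta> \<in> mod_hom E X reg ==> \<eta>' \<in> mod_hom E X reg ==> (%x. \<eta> x \<oplus>\<^sub>E \<eta>' x) \<in> mod_hom E X reg"
 using mod_hom_add_fun[OF _ _ left_module_reg] by (simp add: regular_simps)

lemma reg_hom_zero: "(%x. \<zero>\<^sub>E) \<in> mod_hom E X reg"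
 using mod_hom_zero_fun[OF left_module_reg] by (simp add: regular_simps)

lemma reg_hom_neg: "\<eta> \<in> mod_hom E X reg ==> (%x. \<ominus>\<^sub>E \<eta> x) \<in> mod_hom E X reg"
 by (rule mod_homI) (simp_all add: regular_simps reg_hom ER.minus_add ER.r_minus)

lemma reg_hom_mult: "\<eta> \<in> mod_hom E X reg ==> y \<in> carrier E ==> (%x. \<eta> x \<otimes>\<^sub>E y) \<in> mod_hom E X reg"
 by (rule mod_homI) (simp_all add: regular_simps reg_hom ER.l_distr ER.m_assoc)

lemma top_simps:
 "g \<in> carrier (topB l) \<longleftrightarrow> g \<in> (\<Pi>\<^sub>E q\<in>B l. carrier (TTq q))"
 "\<zero>\<^bsub>topB l\<^esub> = (\<lambda>q\<in>B l. \<zero>\<^bsub>TTq q\<^esub>)" "g \<oplus>\<^bsub>topB l\<^esub> h = (\<lambda>q\<in>B l. g q \<oplus>\<^bsub>TTq q\<^esub> h q)"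
 "a \<odot>\<^bsub>topB l\<^esub> g = (\<lambda>q\<in>B l. a \<odot>\<^bsub>TBq q\<^esub> g q)" "rsmult (topB l) g a = (\<lambda>q\<in>B l. rsmult (TBq q) (g q) a)"
 using bd(5)[of l] by (simp_all add: top_bimodule_def dsum_bimodule_def TB_simps(1-3))

lemma abelian_TTq: "q \<in> B l ==> abelian_group (TTq q)"
 by (rule abelian_group_TT) (simp_all add: bv)

lemma abelian_group_top: "abelian_group (topB l)"
proof (rule abelian_groupI, goal_cases)
 case (1 x y)
 then show ?case
  by (auto simp: top_simps PiE_iff abelian_groupE(1)[OF abelian_TTq])
next
 case 2
 then show ?case by (auto simp: top_simps abelian_groupE(2)[OF abelian_TTq])
next
 case (3 x y z)
 then show ?case by (auto simp: top_simps PiE_iff abelian_groupE(3)[OF abelian_TTq] intro!: restrict_ext)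
next
 case (4 x y)
 then show ?case by (auto simp: top_simps PiE_iff abelian_groupE(4)[OF abelian_TTq] intro!: restrict_ext)
next
 case (5 x)
 show ?case
 proof (rule ext)
  fix q
  show "(\<zero>\<^bsub>topB l\<^esub> \<oplus>\<^bsub>topB l\<^esub> x) q = x q"
   using 5 abelian_groupE(5)[OF abelian_TTq, of q l "x q"]
   by (cases "q \<in> B l") (auto simp: top_simps PiE_iff extensional_def)
 qed
next
 case (6 x)
 let ?y = "\<lambda>q\<in>B l. \<ominus>\<^bsub>TTq q\<^esub> x q"
 have x: "x q \<in> carrier (TTq q)" if "q \<in> B l" for q using 6 that by (auto simp: top_simps)
 show ?case
 proof (rule bexI[of _ ?y])
  show "?y \<oplus>\<^bsub>topB l\<^esub> x = \<zero>\<^bsub>topB l\<^esub>"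
   by (auto simp: top_simps abelian_group.l_neg[OF abelian_TTq x] intro!: restrict_ext)
  show "?y \<in> carrier (topB l)"
   by (auto simp: top_simps abelian_group.a_inv_closed[OF abelian_TTq x])
 qed
qed

lemma top_actions:
 assumes "a \<in> carrier \<A>" "g \<in> carrier (topB l)"
 shows "a \<odot>\<^bsub>topB l\<^esub> g \<in> carrier (topB l)" "rsmult (topB l) g a \<in> carrier (topB l)"
  "h \<in> carrier (topB l) ==> a \<odot>\<^bsub>topB l\<^esub> (g \<oplus>\<^bsub>topB l\<^esub> h) = a \<odot>\<^bsub>topB l\<^esub> g \<oplus>\<^bsub>topB l\<^esub> a \<odot>\<^bsub>topB l\<^esub> h"
  "h \<in> carrier (topB l) ==> rsmult (topB l) (g \<oplus>\<^bsub>topB l\<^esub> h) a = rsmult (topB l) g a \<oplus>\<^bsub>topB l\<^esub> rsmult (topB l) h a"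
proof -
 have g: "g q \<in> carrier (TTq q)" if "q \<in> B l" for q using assms(2) that by (auto simp: top_simps)
 note act = TB_actions[OF bv(1) bv(3) assms(1) g]
 show "a \<odot>\<^bsub>topB l\<^esub> g \<in> carrier (topB l)" "rsmult (topB l) g a \<in> carrier (topB l)"
  by (auto simp: top_simps(1,4,5) intro!: act)
 show "a \<odot>\<^bsub>topB l\<^esub> (g \<oplus>\<^bsub>topB l\<^esub> h) = a \<odot>\<^bsub>topB l\<^esub> g \<oplus>\<^bsub>topB l\<^esub> a \<odot>\<^bsub>topB l\<^esub> h"
  "rsmult (topB l) (g \<oplus>\<^bsub>topB l\<^esub> h) a = rsmult (topB l) g a \<oplus>\<^bsub>topB l\<^esub> rsmult (topB l) h a" if "h \<in> carrier (topB l)"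
 proof -
  have h: "h q \<in> carrier (TTq q)" if "q \<in> B l" for q using \<open>h \<in> carrier (topB l)\<close> that by (auto simp: top_simps)
  show "a \<odot>\<^bsub>topB l\<^esub> (g \<oplus>\<^bsub>topB l\<^esub> h) = a \<odot>\<^bsub>topB l\<^esub> g \<oplus>\<^bsub>topB l\<^esub> a \<odot>\<^bsub>topB l\<^esub> h"
   unfolding top_simps by (rule restrict_ext) (simp add: act(3) h)
  show "rsmult (topB l) (g \<oplus>\<^bsub>topB l\<^esub> h) a = rsmult (topB l) g a \<oplus>\<^bsub>topB l\<^esub> rsmult (topB l) h a"
   unfolding top_simps by (rule restrict_ext) (simp add: act(4) h)
 qed
qed

text \<open>A homomorphism from the bimodule generated by \<open>K\<^sub>l\<close> is given by its values on the generators \<open>q : i \<rightarrow> j\<close>,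
 which lie in \<open>(e\<^sub>j \<otimes> e\<^sub>i) \<Lambda>\<^sup>e\<close>; exchanging the tensor factors identifies this with \<open>\<Lambda> e\<^sub>i \<otimes> e\<^sub>j \<Lambda>\<close>.\<close>

definition gv where "gv l \<eta> = (\<lambda>q\<in>B l. swq q (\<eta> (unitB q)))"

lemma gv_cong: "(!!q. q \<in> B l ==> \<eta> (unitB q) = \<eta>' (unitB q)) ==> gv l \<eta> = gv l \<eta>'"
 unfolding gv_def by (rule restrict_ext) simp

lemma gv_closed: "(!!q. q \<in> B l ==> \<eta> (unitB q) \<in> carrier E) ==> gv l \<eta> \<in> carrier (topB l)"
 by (auto simp: gv_def top_simps bv intro!: sw_closed)

lemma gv_add: "(!!q. q \<in> B l ==> \<eta> (unitB q) \<in> carrier E) ==> (!!q. q \<in> B l ==> \<eta>' (unitB q) \<in> carrier E) ==>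
  gv l (%x. \<eta> x \<oplus>\<^sub>E \<eta>' x) = gv l \<eta> \<oplus>\<^bsub>topB l\<^esub> gv l \<eta>'"
 unfolding gv_def top_simps by (rule restrict_ext) (simp add: sw_add bv)

lemma gv_zero: "gv l (%x. \<zero>\<^sub>E) = \<zero>\<^bsub>topB l\<^esub>"
 unfolding gv_def top_simps by (rule restrict_ext) (simp add: sw_zero bv)

lemma gv_smult: "(!!q. q \<in> B l ==> \<eta> (unitB q) \<in> carrier E) ==> a \<in> carrier \<A> ==>
  gv l (%x. \<eta> x \<otimes>\<^sub>E \<one>\<^sub>\<A> \<boxtimes> a) = a \<odot>\<^bsub>topB l\<^esub> gv l \<eta>"
 unfolding gv_def top_simps by (rule restrict_ext) (simp add: sw_mult[OF _ _ ring_E] bv)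

lemma gv_rsmult: "(!!q. q \<in> B l ==> \<eta> (unitB q) \<in> carrier E) ==> a \<in> carrier \<A> ==>
  gv l (%x. \<eta> x \<otimes>\<^sub>E a \<boxtimes> \<one>\<^sub>\<A>) = rsmult (topB l) (gv l \<eta>) a"
 unfolding gv_def top_simps by (rule restrict_ext) (simp add: sw_mult[OF _ _ ring_E] bv)

lemma unit_value:
 assumes "\<eta> \<in> mod_hom E (KB l) reg" "q \<in> B l"
 shows "bidem q \<otimes>\<^sub>E \<eta> (unitB q) = \<eta> (unitB q)"
proof -
 have "bidem q \<odot>\<^bsub>KB l\<^esub> unitB q = unitB q"
  by (rule ext) (simp add: KB_ops idem_unit_def bidem_closed[OF assms(2)] idem_family.e_idem[OF fam_KB assms(2)])
 then show ?thesis using reg_hom(3)[OF assms(1) bidem_closed[OF assms(2)] unitB_carrier[OF assms(2)]] by (simp only:)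
qed

text \<open>\<open>unsw\<close> recovers the value at a generator, since this value is fixed by the
  idempotent of the generator.\<close>

lemma gv_inj:
 assumes \<eta>: "\<eta> \<in> mod_hom E (KB l) reg" "\<eta>' \<in> mod_hom E (KB l) reg" and eq: "gv l \<eta> = gv l \<eta>'"
  and x: "x \<in> carrier (KB l)"
 shows "\<eta> x = \<eta>' x"
proof -
 interpret R: left_module E reg by (rule left_module_reg)
 have u: "\<eta> (unitB q) = \<eta>' (unitB q)" if q: "q \<in> B l" for q
 proof -
  note c = reg_hom(1)[OF \<eta>(1) unitB_carrier[OF q]] reg_hom(1)[OF \<eta>(2) unitB_carrier[OF q]]
  have "swq q (\<eta> (unitB q)) = swq q (\<eta>' (unitB q))" using fun_cong[OF eq, of q] q by (simp add: gv_def)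
  then have "unsw (swq q (\<eta> (unitB q))) = unsw (swq q (\<eta>' (unitB q)))" by (simp only:)
  then show ?thesis
   by (simp only: unsw_sw[OF bv(1)[OF q] bv(3)[OF q] ring_E c(1)] unsw_sw[OF bv(1)[OF q] bv(3)[OF q] ring_E c(2)]
    unit_value[OF \<eta>(1) q] unit_value[OF \<eta>(2) q])
 qed
 have "\<eta> x = finsum reg (%q. x q \<odot>\<^sub>reg \<eta> (unitB q)) (B l)"
  by (rule idem_family.idem_hom_expand[OF fam_KB \<eta>(1) left_module_reg x])
 also have "\<dots> = finsum reg (%q. x q \<odot>\<^sub>reg \<eta>' (unitB q)) (B l)"
  by (rule R.M.finsum_cong') (auto simp: u intro!: R.smult_closed KB_value[OF x] mod_hom_closed[OF \<eta>(2)] unitB_carrier)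
 also have "\<dots> = \<eta>' x"
  by (rule idem_family.idem_hom_expand[OF fam_KB \<eta>(2) left_module_reg x, symmetric])
 finally show ?thesis .
qed

lemma gv_surj:
 assumes t: "t \<in> carrier (topB l)"
 shows "\<exists>\<eta>\<in>mod_hom E (KB l) reg. gv l \<eta> = t"
proof -
 have tc: "t q \<in> carrier (TTq q)" if "q \<in> B l" for q using t that by (auto simp: top_simps)
 define y where "y q = unsw (t q)" for q
 have y: "y q \<in> carrier E" if "q \<in> B l" for q unfolding y_def by (rule unsw_closed[OF bv(1)[OF that] bv(3)[OF that] tc[OF that]])
 have yr: "y q \<in> carrier reg" if "q \<in> B l" for q using y[OF that] by (simp add: regular_simps)
 have sy: "swq q (y q) = t q" if "q \<in> B l" for q unfolding y_def by (rule sw_unsw[OF bv(1)[OF that] bv(3)[OF that] tc[OF that]])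
 have yb: "bidem q \<otimes>\<^sub>E y q = y q" if "q \<in> B l" for q
  using unsw_sw[OF bv(1)[OF that] bv(3)[OF that] ring_E y[OF that]] unfolding sy[OF that] by (simp add: y_def)
 have hom: "lin_comb E reg y \<in> mod_hom E (KB l) reg"
  by (rule idem_family.lin_comb_idem_hom[OF fam_KB left_module_reg yr])
 have "lin_comb E reg y (unitB q) = y q" if "q \<in> B l" for q
  using idem_family.lin_comb_unit[OF fam_KB left_module_reg yr that] yb[OF that] by (simp add: regular_simps)
 then have "gv l (lin_comb E reg y) = (\<lambda>q\<in>B l. t q)"
  unfolding gv_def by (intro restrict_ext) (simp add: sy)
 also have "\<dots> = t" by (rule extensional_restrict) (use t in \<open>simp add: top_simps PiE_def\<close>)
 finally show ?thesis using hom by (intro bexI)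
qed

section \<open>The dual of the last differential\<close>

lemma KB_hom_dB: "\<xi> \<in> mod_hom E (KB m) reg ==> (%x. \<xi> (dB m x)) \<in> mod_hom E (KB (Suc m)) reg"
 by (rule mod_hom_comp[OF dB_hom])

text \<open>The relation belonging to p is the dual differential applied to the coordinate function
  at p; the vertex idempotents in it are those with which \<open>sw\<close> multiplies.\<close>

lemma relation_gv:
 assumes p: "p \<in> B m"
 shows "top_relation Q M (Suc m) (B (Suc m)) (B m) p = gv (Suc m) (%x. dB m x p)"
 unfolding top_relation_def gv_def Let_def
proof (rule restrict_ext)
 fix q assume q: "q \<in> B (Suc m)"
 note ij = bv(1)[OF q] bv(3)[OF q]
 note c = cR_closed[OF q, of p] cS_closed[OF q, of p] ti[OF q]
 have dl: "cl (delta_L Q (B m) p q) \<in> carrier \<A>" by (rule clI[OF V_paths[OF delta_L_props(1)[OF basis B_K[OF q] p]]])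
 have cs: "cS m p q = (- 1) ^ Suc m \<odot>\<^sub>\<A> cl (delta_L Q (B m) p q)" by (simp only: dS_def cl_smult)
 have AR: "tidem q \<in> carrier (AR (target Q q))" using to_AR[OF ij L.one_closed] c(3) by simp
 have AL: "cl (delta_L Q (B m) p q) \<otimes>\<^sub>\<A> sidem q \<in> carrier (AL (source Q q))" by (rule to_AL[OF ij dl])
 have "swq q (dB m (unitB q) p) = swq q (cR m p q \<boxtimes> sidem q) \<oplus>\<^bsub>TTq q\<^esub> swq q (tidem q \<boxtimes> cS m p q)"
  unfolding dB_unit[OF q] rowB_def by (rule sw_add[OF ij te_closed[OF c(1) c(5)] te_closed[OF c(3) c(2)]])
 also have "swq q (cR m p q \<boxtimes> sidem q) = tt (source Q q) (target Q q) (sidem q) (tidem q \<otimes>\<^sub>\<A> cR m p q)"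
  unfolding sw_te[OF ij c(1) c(5)] c(6) ..
 also have "swq q (tidem q \<boxtimes> cS m p q) = tt (source Q q) (target Q q) (cS m p q \<otimes>\<^sub>\<A> sidem q) (tidem q)"
  unfolding sw_te[OF ij c(3) c(2)] c(4) ..
 also have "\<dots> = (- 1) ^ Suc m \<odot>\<^bsub>TTq q\<^esub> tt (source Q q) (target Q q) (cl (delta_L Q (B m) p q) \<otimes>\<^sub>\<A> sidem q) (tidem q)"
  unfolding cs smult_mult(1)[OF dl c(5)] by (rule tt_smult_left[OF ij AL AR])
 finally show "tt (source Q q) (target Q q) (sidem q) (tidem q \<otimes>\<^sub>\<A> cR m p q) \<oplus>\<^bsub>TTq q\<^esub>
   (- 1) ^ Suc m \<odot>\<^bsub>TTq q\<^esub> tt (source Q q) (target Q q) (cl (delta_L Q (B m) p q) \<otimes>\<^sub>\<A> sidem q) (tidem q) =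
  swq q (dB m (unitB q) p)" by simp
qed

definition boundaries where
 "boundaries m = (%\<xi>. gv (Suc m) (%x. \<xi> (dB m x))) ` mod_hom E (KB m) reg"

lemma sub_bimodule_boundaries: "sub_bimodule \<A> (boundaries m) (topB (Suc m))"
proof -
 interpret T: abelian_group "topB (Suc m)" by (rule abelian_group_top)
 have c: "\<xi> (dB m (unitB q)) \<in> carrier E" if "\<xi> \<in> mod_hom E (KB m) reg" "q \<in> B (Suc m)" for \<xi> q
  by (rule reg_hom(1)[OF KB_hom_dB[OF that(1)] unitB_carrier[OF that(2)]])
 have cl: "gv (Suc m) (%x. \<xi> (dB m x)) \<in> carrier (topB (Suc m))" if "\<xi> \<in> mod_hom E (KB m) reg" for \<xi>
  by (rule gv_closed) (rule c[OF that])
 have I: "gv (Suc m) (%x. \<xi> (dB m x)) \<in> boundaries m" if "\<xi> \<in> mod_hom E (KB m) reg" for \<xi>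
  unfolding boundaries_def using that by (intro image_eqI[of _ _ \<xi>]) simp_all
 have sub: "subgroup (boundaries m) (add_monoid (topB (Suc m)))"
 proof (rule subgroup.intro, goal_cases)
  case 1 show ?case using cl by (auto simp: boundaries_def)
 next
  case (2 x y)
  from 2(1) obtain \<xi> where \<xi>: "x = gv (Suc m) (%x. \<xi> (dB m x))" "\<xi> \<in> mod_hom E (KB m) reg"
   unfolding boundaries_def by (rule imageE)
  from 2(2) obtain \<zeta> where \<zeta>: "y = gv (Suc m) (%x. \<zeta> (dB m x))" "\<zeta> \<in> mod_hom E (KB m) reg"
   unfolding boundaries_def by (rule imageE)
  have "gv (Suc m) (%x. \<xi> (dB m x) \<oplus>\<^sub>E \<zeta> (dB m x)) = x \<oplus>\<^bsub>topB (Suc m)\<^esub> y"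
   unfolding \<xi>(1) \<zeta>(1) by (rule gv_add) (simp_all add: c \<xi>(2) \<zeta>(2))
  then show ?case using I[OF reg_hom_add[OF \<xi>(2) \<zeta>(2)]] by simp
 next
  case 3 show ?case using I[OF reg_hom_zero] by (simp add: gv_zero)
 next
  case (4 x)
  from 4 obtain \<xi> where \<xi>: "x = gv (Suc m) (%x. \<xi> (dB m x))" "\<xi> \<in> mod_hom E (KB m) reg"
   unfolding boundaries_def by (rule imageE)
  note n = reg_hom_neg[OF \<xi>(2)]
  have "gv (Suc m) (%x. \<ominus>\<^sub>E \<xi> (dB m x)) \<oplus>\<^bsub>topB (Suc m)\<^esub> x = gv (Suc m) (%x. \<ominus>\<^sub>E \<xi> (dB m x) \<oplus>\<^sub>E \<xi> (dB m x))"
   unfolding \<xi>(1) by (rule gv_add[symmetric]) (rule c[OF n], assumption, rule c[OF \<xi>(2)], assumption)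
  also have "\<dots> = gv (Suc m) (%x. \<zero>\<^sub>E)" by (rule gv_cong) (simp add: ER.l_neg c[OF \<xi>(2)])
  finally have "\<ominus>\<^bsub>topB (Suc m)\<^esub> x = gv (Suc m) (%x. \<ominus>\<^sub>E \<xi> (dB m x))"
   unfolding gv_zero using cl[OF \<xi>(2)] cl[OF n] \<xi>(1) by (intro T.minus_equality) simp_all
  then show ?case using I[OF n] by (simp add: a_inv_def)
 qed
 have act: "a \<odot>\<^bsub>topB (Suc m)\<^esub> x \<in> boundaries m \<and> rsmult (topB (Suc m)) x a \<in> boundaries m"
  if a: "a \<in> carrier \<A>" and x: "x \<in> boundaries m" for a x
 proof -
  from x obtain \<xi> where \<xi>: "x = gv (Suc m) (%x. \<xi> (dB m x))" "\<xi> \<in> mod_hom E (KB m) reg"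
   unfolding boundaries_def by (rule imageE)
  have "a \<odot>\<^bsub>topB (Suc m)\<^esub> x = gv (Suc m) (%x. \<xi> (dB m x) \<otimes>\<^sub>E \<one>\<^sub>\<A> \<boxtimes> a)"
   "rsmult (topB (Suc m)) x a = gv (Suc m) (%x. \<xi> (dB m x) \<otimes>\<^sub>E a \<boxtimes> \<one>\<^sub>\<A>)"
   unfolding \<xi>(1) by (rule gv_smult[symmetric], rule c[OF \<xi>(2)], assumption, rule a,
    rule gv_rsmult[symmetric], rule c[OF \<xi>(2)], assumption, rule a)
  note e = this
  show ?thesis
   unfolding e
   by (intro conjI I[OF reg_hom_mult[OF \<xi>(2) te_closed[OF L.one_closed a]]] I[OF reg_hom_mult[OF \<xi>(2) te_closed[OF a L.one_closed]]])
 qed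
 show ?thesis
  unfolding sub_bimodule_def by (intro conjI submodule.intro submodule_axioms.intro sub ballI) (simp_all add: act)
qed

text \<open>A functional is the sum of the coordinate functions multiplied on the right by its
  values at the generators. Right multiplication by an element of \<open>E\<close> is a sum of
  compositions of the two bimodule actions, so the relations generate all boundaries.\<close>

lemma gen_sub_bimodule_relations:
 "gen_sub_bimodule \<A> (topB (Suc m)) (top_relation Q M (Suc m) (B (Suc m)) (B m) ` B m) = boundaries m"
proof
 have ev: "(%f. f p) \<in> mod_hom E (KB m) reg" for p
  by (rule mod_homI) (simp_all add: regular_simps KB_value KB_ops)
 have "top_relation Q M (Suc m) (B (Suc m)) (B m) p \<in> boundaries m" if "p \<in> B m" for p
  unfolding relation_gv[OF that] boundaries_def using ev by (intro image_eqI[of _ _ "%f. f p"]) simp_all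
 then show "gen_sub_bimodule \<A> (topB (Suc m)) (top_relation Q M (Suc m) (B (Suc m)) (B m) ` B m) \<subseteq> boundaries m"
  unfolding gen_sub_bimodule_def using sub_bimodule_boundaries by blast
 show "boundaries m \<subseteq> gen_sub_bimodule \<A> (topB (Suc m)) (top_relation Q M (Suc m) (B (Suc m)) (B m) ` B m)"
  unfolding gen_sub_bimodule_def
 proof (intro Inter_greatest subsetI)
  fix N g assume N: "N \<in> {N. sub_bimodule \<A> N (topB (Suc m)) \<and> top_relation Q M (Suc m) (B (Suc m)) (B m) ` B m \<subseteq> N}"
   and g: "g \<in> boundaries m"
  have sN: "subgroup N (add_monoid (topB (Suc m)))" "!!a x. a \<in> carrier \<A> ==> x \<in> N ==> a \<odot>\<^bsub>topB (Suc m)\<^esub> x \<in> N"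
   "!!a x. a \<in> carrier \<A> ==> x \<in> N ==> rsmult (topB (Suc m)) x a \<in> N"
   using N by (auto simp: sub_bimodule_def submodule_def submodule_axioms_def)
  have addN: "x \<oplus>\<^bsub>topB (Suc m)\<^esub> y \<in> N" if "x \<in> N" "y \<in> N" for x y
   using subgroup.m_closed[OF sN(1) that] by simp
  have zeroN: "\<zero>\<^bsub>topB (Suc m)\<^esub> \<in> N" using subgroup.one_closed[OF sN(1)] by simp
  obtain \<xi> where \<xi>: "g = gv (Suc m) (%x. \<xi> (dB m x))" "\<xi> \<in> mod_hom E (KB m) reg"
   using g unfolding boundaries_def by (rule imageE)
  have dc: "dB m (unitB q) p \<in> carrier E" if "q \<in> B (Suc m)" for q p
   unfolding dB_unit[OF that] by (rule rowB_closed[OF that])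
  have mult: "gv (Suc m) (%x. dB m x p \<otimes>\<^sub>E y) \<in> N" if p: "p \<in> B m" and y: "y \<in> carrier E" for p y
   using y
  proof (induction y rule: te_induct)
   case zero
   have "gv (Suc m) (%x. dB m x p \<otimes>\<^sub>E \<zero>\<^sub>E) = gv (Suc m) (%x. \<zero>\<^sub>E)"
    by (rule gv_cong) (simp add: dc)
   then show ?case using zeroN by (simp add: gv_zero)
  next
   case (elem a b)
   have r: "gv (Suc m) (%x. dB m x p) \<in> N" using N p relation_gv[OF p] by auto
   \<comment> \<open>Since a \<boxtimes> b is the product of a \<boxtimes> 1 and 1 \<boxtimes> b,
     multiplying by it is the right action of a followed by the left action of b.\<close>
   have "gv (Suc m) (%x. dB m x p \<otimes>\<^sub>E a \<boxtimes> b) =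
     gv (Suc m) (%x. dB m x p \<otimes>\<^sub>E a \<boxtimes> \<one>\<^sub>\<A> \<otimes>\<^sub>E \<one>\<^sub>\<A> \<boxtimes> b)"
    by (rule gv_cong) (use elem in \<open>simp add: dc ER.m_assoc te_closed tm\<close>)
   also have "\<dots> = b \<odot>\<^bsub>topB (Suc m)\<^esub> gv (Suc m) (%x. dB m x p \<otimes>\<^sub>E a \<boxtimes> \<one>\<^sub>\<A>)"
    by (rule gv_smult[OF _ elem(2)]) (use elem in \<open>simp add: dc te_closed\<close>)
   also have "\<dots> = b \<odot>\<^bsub>topB (Suc m)\<^esub> rsmult (topB (Suc m)) (gv (Suc m) (%x. dB m x p)) a"
    by (subst gv_rsmult) (simp_all add: dc elem(1))
   finally show ?case using sN(2)[OF elem(2) sN(3)[OF elem(1) r]] by simp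
  next
   case (add y z)
   have "gv (Suc m) (%x. dB m x p \<otimes>\<^sub>E (y \<oplus>\<^sub>E z)) =
     gv (Suc m) (%x. dB m x p \<otimes>\<^sub>E y \<oplus>\<^sub>E dB m x p \<otimes>\<^sub>E z)"
    by (rule gv_cong) (use add(1,2) in \<open>simp add: dc ER.r_distr\<close>)
   also have "\<dots> = gv (Suc m) (%x. dB m x p \<otimes>\<^sub>E y) \<oplus>\<^bsub>topB (Suc m)\<^esub> gv (Suc m) (%x. dB m x p \<otimes>\<^sub>E z)"
    by (rule gv_add) (use add(1,2) in \<open>simp_all add: dc\<close>)
   finally show ?case using addN[OF add(3,4)] by simp
  qed
  let ?y = "%p. \<xi> (unitB p)"
  have yc: "?y p \<in> carrier E" if "p \<in> B m" for p by (rule reg_hom(1)[OF \<xi>(2) unitB_carrier[OF that]])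
  have fin: "gv (Suc m) (%x. finsum E (%p. dB m x p \<otimes>\<^sub>E ?y p) J) \<in> N" if "finite J" "J \<subseteq> B m" for J
   using that
  proof (induction J rule: finite_induct)
   case empty
   then show ?case using zeroN by (simp add: gv_zero)
  next
   case (insert p J)
   have c: "dB m (unitB q) p' \<otimes>\<^sub>E ?y p' \<in> carrier E" if "q \<in> B (Suc m)" "p' \<in> insert p J" for q p'
    using dc[OF that(1)] yc insert.prems that(2) by blast
   have fc: "finsum E (%p. dB m (unitB q) p \<otimes>\<^sub>E ?y p) J \<in> carrier E" if "q \<in> B (Suc m)" for q
    using c[OF that] by (intro ER.finsum_closed) auto
   have "gv (Suc m) (%x. finsum E (%p. dB m x p \<otimes>\<^sub>E ?y p) (insert p J)) =
     gv (Suc m) (%x. dB m x p \<otimes>\<^sub>E ?y p \<oplus>\<^sub>E finsum E (%p. dB m x p \<otimes>\<^sub>E ?y p) J)"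
   proof (rule gv_cong)
    fix q assume q: "q \<in> B (Suc m)"
    show "finsum E (%p. dB m (unitB q) p \<otimes>\<^sub>E ?y p) (insert p J) =
     dB m (unitB q) p \<otimes>\<^sub>E ?y p \<oplus>\<^sub>E finsum E (%p. dB m (unitB q) p \<otimes>\<^sub>E ?y p) J"
     by (rule ER.finsum_insert[OF insert.hyps]) (use c[OF q] in auto)
   qed
   also have "\<dots> = gv (Suc m) (%x. dB m x p \<otimes>\<^sub>E ?y p) \<oplus>\<^bsub>topB (Suc m)\<^esub>
     gv (Suc m) (%x. finsum E (%p. dB m x p \<otimes>\<^sub>E ?y p) J)"
    by (rule gv_add) (use c fc in auto)
   finally show ?case using addN[OF mult insert.IH] yc insert.prems by simp
  qed
  have "g = gv (Suc m) (%x. finsum E (%p. dB m x p \<otimes>\<^sub>E ?y p) (B m))"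
   unfolding \<xi>(1)
  proof (rule gv_cong)
   fix q assume q: "q \<in> B (Suc m)"
   let ?f = "dB m (unitB q)"
   have f: "?f \<in> carrier (KB m)" by (rule mod_hom_closed[OF dB_hom unitB_carrier[OF q]])
   have "\<xi> ?f = finsum reg (%p. ?f p \<odot>\<^sub>reg ?y p) (B m)"
    by (rule idem_family.idem_hom_expand[OF fam_KB \<xi>(2) left_module_reg f])
   also have "\<dots> = finsum E (%p. ?f p \<odot>\<^sub>reg ?y p) (B m)"
    by (rule finsum_hom[OF left_moduleD(2)[OF left_module_reg] ER.is_abelian_group bd(5), where h="%x. x"])
     (use dc[OF q] yc in \<open>simp_all add: regular_simps\<close>)
   finally show "\<xi> ?f = finsum E (%p. ?f p \<otimes>\<^sub>E ?y p) (B m)" by (simp add: regular_simps)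
  qed
  then show "g \<in> N" using fin[OF bd(5) subset_refl] by simp
 qed
qed

end

context env_koszul
begin

text \<open>Cocycles on an arbitrary resolution are pulled back to the Koszul resolution. Its term
  above position n is zero, so every functional on the n-th Koszul term is a cocycle and only
  boundaries have to be divided out.\<close>

lemma ext_iso:
 fixes P :: "nat => (_, 'p) module" and A :: "nat => 'x set"
 assumes gl: "gl_dim \<A> = enat (Suc m)" and res: "resolution E (\<D>) A P d \<epsilon>"
 shows "\<exists>h. h \<in> bimodule_iso \<A> (Ext_bimodule E P d reg (env_inner \<A>) (Suc m))
  (quot_bimodule (topB (Suc m)) (boundaries m))"
proof -
 let ?n = "Suc m"
 let ?W = "env_inner \<A>"
 let ?C = "carrier (P ?n)"
 note KR = bimodule_koszul_resolution
 note p = resolutionD[OF res] and k = resolutionD[OF KR]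
 have KB_above: "x = \<zero>\<^bsub>KB (Suc ?n)\<^esub>" if "x \<in> carrier (KB (Suc ?n))" for x
 proof
  fix q
  have "x q = \<zero>\<^sub>E" by (rule KB_vertex(2)[OF that]) (simp add: B_above_gl_dim[OF koszul gl])
  then show "x q = \<zero>\<^bsub>KB (Suc ?n)\<^esub> q" by (simp only: KB_ops)
 qed
 obtain \<phi> where \<phi>: "chain_map E KB dB epsB P d \<epsilon> \<phi>" using chain_map_exists[OF KR res] by (rule exE)
 obtain \<psi> where \<psi>: "chain_map E P d \<epsilon> KB dB epsB \<psi>" using chain_map_exists[OF res KR] by (rule exE)
 note f = chain_mapD[OF \<phi>] and g = chain_mapD[OF \<psi>]
 obtain s where s: "!!l. s l \<in> mod_hom E (KB l) (KB (Suc l))"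
  and sd: "!!l x. x \<in> carrier (KB (Suc l)) ==> x \<ominus>\<^bsub>KB (Suc l)\<^esub> \<psi> (Suc l) (\<phi> (Suc l) x) =
    dB (Suc l) (s (Suc l) x) \<oplus>\<^bsub>KB (Suc l)\<^esub> s l (dB l x)"
  using chain_homotopy_exists[OF KR KR chain_map_id chain_map_comp[OF \<phi> \<psi>]] by blast
 obtain t where t: "!!l. t l \<in> mod_hom E (P l) (P (Suc l))"
  and td: "!!l x. x \<in> carrier (P (Suc l)) ==> x \<ominus>\<^bsub>P (Suc l)\<^esub> \<phi> (Suc l) (\<psi> (Suc l) x) =
    d (Suc l) (t (Suc l) x) \<oplus>\<^bsub>P (Suc l)\<^esub> t l (d l x)"
  using chain_homotopy_exists[OF res res chain_map_id chain_map_comp[OF \<psi> \<phi>]] by blast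
 interpret Pn: left_module E "P ?n" by (rule p(2))
 interpret Kn: left_module E "KB ?n" by (rule k(2))
 interpret T: abelian_group "topB ?n" by (rule abelian_group_top)
 let ?Z = "cocycles E P d reg ?W ?n"
 let ?M = "(hom_bimodule E (P ?n) reg ?W)\<lparr>carrier := ?Z\<rparr>"
 have Z_iff: "f \<in> ?Z \<longleftrightarrow> f \<in> mod_hom E (P ?n) reg \<and> f \<in> extensional ?C \<and>
   (\<forall>p\<in>carrier (P (Suc ?n)). f (d ?n p) = \<zero>\<^sub>E)" for f
  by (auto simp: cocycles_def hom_bimodule_def regular_simps)
 have Zh: "f \<in> mod_hom E (P ?n) reg" and Ze: "f \<in> extensional ?C"
  and Zd: "!!p. p \<in> carrier (P (Suc ?n)) ==> f (d ?n p) = \<zero>\<^sub>E" if "f \<in> ?Z" for f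
  using that unfolding Z_iff by blast+
 have Zc: "f p \<in> carrier E" if "f \<in> ?Z" "p \<in> ?C" for f p by (rule reg_hom(1)[OF Zh[OF that(1)] that(2)])
 have dc: "d ?n p \<in> ?C" if "p \<in> carrier (P (Suc ?n))" for p by (rule mod_hom_closed[OF p(5) that])
 have ZI: "(\<lambda>p\<in>?C. h p) \<in> ?Z"
  if h: "h \<in> mod_hom E (P ?n) reg" and z: "!!p. p \<in> carrier (P (Suc ?n)) ==> h (d ?n p) = \<zero>\<^sub>E" for h
  unfolding Z_iff
 proof (intro conjI ballI)
  show "(\<lambda>p\<in>?C. h p) \<in> mod_hom E (P ?n) reg" by (rule mod_hom_cong[OF h _ p(2)]) simp
  show "(\<lambda>p\<in>?C. h p) (d ?n p) = \<zero>\<^sub>E" if "p \<in> carrier (P (Suc ?n))" for p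
   using z[OF that] dc[OF that] by simp
 qed simp
 have Mops: "f \<oplus>\<^sub>?M f' = (\<lambda>p\<in>?C. f p \<oplus>\<^sub>E f' p)" "\<zero>\<^sub>?M = (\<lambda>p\<in>?C. \<zero>\<^sub>E)"
  "a \<odot>\<^sub>?M f = (\<lambda>p\<in>?C. f p \<otimes>\<^sub>E \<one>\<^sub>\<A> \<boxtimes> a)" "rsmult ?M f a = (\<lambda>p\<in>?C. f p \<otimes>\<^sub>E a \<boxtimes> \<one>\<^sub>\<A>)"
  "carrier ?M = ?Z" for f f' a
  by (simp_all add: hom_bimodule_def regular_simps env_inner_simps)
 have Zadd: "(\<lambda>p\<in>?C. f p \<oplus>\<^sub>E f' p) \<in> ?Z" if "f \<in> ?Z" "f' \<in> ?Z" for f f'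
  by (rule ZI[OF reg_hom_add[OF Zh Zh]]) (simp_all add: that Zd)
 have Zmult: "(\<lambda>p\<in>?C. f p \<otimes>\<^sub>E y) \<in> ?Z" if "f \<in> ?Z" "y \<in> carrier E" for f y
  by (rule ZI[OF reg_hom_mult[OF Zh]]) (simp_all add: that Zd)
 have Zneg: "(\<lambda>p\<in>?C. \<ominus>\<^sub>E f p) \<in> ?Z" if "f \<in> ?Z" for f
  by (rule ZI[OF reg_hom_neg[OF Zh]]) (simp_all add: that Zd ER.a_inv_zero)
 have abM: "abelian_group ?M"
 proof (rule abelian_groupI, unfold Mops, goal_cases)
  case (1 x y) then show ?case by (rule Zadd)
 next
  case 2 show ?case by (rule ZI[OF reg_hom_zero]) simp
 next
  case (3 x y z) then show ?case by (auto simp: Zc ER.a_assoc intro!: restrict_ext)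
 next
  case (4 x y) then show ?case by (auto simp: Zc ER.a_comm intro!: restrict_ext)
 next
  case (5 x)
  show ?case
  proof
   fix p
   show "(\<lambda>p\<in>?C. (\<lambda>p\<in>?C. \<zero>\<^sub>E) p \<oplus>\<^sub>E x p) p = x p"
    using Zc[OF 5, of p] Ze[OF 5] by (cases "p \<in> ?C") (simp_all add: extensional_def)
  qed
 next
  case (6 x)
  show ?case
   by (rule bexI[OF _ Zneg[OF 6]]) (auto simp: Zc[OF 6] ER.l_neg intro!: restrict_ext)
 qed
 define \<theta> where "\<theta> f = gv ?n (%x. f (\<phi> ?n x))" for f :: "'p => _"
 have u: "\<phi> ?n (unitB q) \<in> ?C" if "q \<in> B ?n" for q by (rule mod_hom_closed[OF f(1) unitB_carrier[OF that]])
 have \<theta>c: "\<theta> f \<in> carrier (topB ?n)" if "f \<in> ?Z" for f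
  unfolding \<theta>_def by (rule gv_closed) (rule Zc[OF that u])
 have \<theta>r: "\<theta> (\<lambda>p\<in>?C. h p) = gv ?n (%x. h (\<phi> ?n x))" for h
  unfolding \<theta>_def by (rule gv_cong) (simp add: u)
 have bI: "gv ?n (%x. \<xi> (dB m x)) \<in> boundaries m" if "\<xi> \<in> mod_hom E (KB m) reg" for \<xi>
  unfolding boundaries_def using that by (intro image_eqI[of _ _ \<xi>]) simp_all
 have onto: "\<exists>x\<in>?Z. \<exists>b\<in>boundaries m. y = b \<oplus>\<^bsub>topB ?n\<^esub> \<theta> x" if y: "y \<in> carrier (topB ?n)" for y
 proof -
  obtain \<eta> where \<eta>: "\<eta> \<in> mod_hom E (KB ?n) reg" "gv ?n \<eta> = y" using gv_surj[OF y] by (rule bexE)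
  \<comment> \<open>A functional \<eta> differs from the pull-back of \<eta> \<psi> by \<eta> s d,
    the pull-back of a functional along the last differential. The other homotopy term vanishes
    together with the differential above n.\<close>
  let ?h = "%p. \<eta> (\<psi> ?n p)" and ?\<xi> = "%x. \<eta> (s m x)"
  have h: "?h \<in> mod_hom E (P ?n) reg" by (rule mod_hom_comp[OF g(1) \<eta>(1)])
  have \<xi>: "?\<xi> \<in> mod_hom E (KB m) reg" by (rule mod_hom_comp[OF s \<eta>(1)])
  have \<eta>0: "\<eta> \<zero>\<^bsub>KB ?n\<^esub> = \<zero>\<^sub>E" using mod_hom_zero[OF \<eta>(1) k(2) left_module_reg] by (simp only: regular_simps)
  have dB0: "dB ?n x = \<zero>\<^bsub>KB ?n\<^esub>" if "x \<in> carrier (KB (Suc ?n))" for x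
   using mod_hom_zero[OF k(5) k(2) k(2), of ?n] KB_above[OF that] by (simp only:)
  have hd: "?h (d ?n p) = \<zero>\<^sub>E" if "p \<in> carrier (P (Suc ?n))" for p
   using g(3)[OF that, symmetric] dB0[OF mod_hom_closed[OF g(1) that]] \<eta>0 by (simp only:)
  have eq: "\<eta> x = ?\<xi> (dB m x) \<oplus>\<^sub>E ?h (\<phi> ?n x)" if x: "x \<in> carrier (KB ?n)" for x
  proof -
   let ?y = "\<psi> ?n (\<phi> ?n x)" and ?z = "s m (dB m x)"
   have y: "?y \<in> carrier (KB ?n)" by (rule mod_hom_closed[OF g(1) mod_hom_closed[OF f(1) x]])
   have z: "?z \<in> carrier (KB ?n)" by (rule mod_hom_closed[OF s mod_hom_closed[OF dB_hom x]])
   have "x \<ominus>\<^bsub>KB ?n\<^esub> ?y = ?z"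
    unfolding sd[OF x] dB0[OF mod_hom_closed[OF s x]] using z by (rule Kn.M.l_zero)
   then have "x = ?z \<oplus>\<^bsub>KB ?n\<^esub> ?y"
    using x y by (simp add: a_minus_def Kn.M.a_assoc Kn.M.l_neg Kn.M.r_zero del: KB_ops flip: \<open>x \<ominus>\<^bsub>KB ?n\<^esub> ?y = ?z\<close>)
   then have "\<eta> x = \<eta> (?z \<oplus>\<^bsub>KB ?n\<^esub> ?y)" by (rule arg_cong)
   also have "\<dots> = \<eta> ?z \<oplus>\<^sub>E \<eta> ?y" by (rule reg_hom(2)[OF \<eta>(1) z y])
   finally show ?thesis .
  qed
  have "y = gv ?n (%x. ?\<xi> (dB m x) \<oplus>\<^sub>E ?h (\<phi> ?n x))"
   unfolding \<eta>(2)[symmetric] by (rule gv_cong, rule eq, rule unitB_carrier)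
  also have "\<dots> = gv ?n (%x. ?\<xi> (dB m x)) \<oplus>\<^bsub>topB ?n\<^esub> gv ?n (%x. ?h (\<phi> ?n x))"
   by (rule gv_add) (rule reg_hom(1)[OF KB_hom_dB[OF \<xi>] unitB_carrier], assumption, rule reg_hom(1)[OF h u], assumption)
  also have "\<dots> = gv ?n (%x. ?\<xi> (dB m x)) \<oplus>\<^bsub>topB ?n\<^esub> \<theta> (\<lambda>p\<in>?C. ?h p)" by (simp only: \<theta>r)
  finally show ?thesis using bI[OF \<xi>] ZI[OF h hd] by (intro bexI)
 qed
 have cob: "coboundaries E P d reg ?W ?n = {f \<in> carrier ?M. \<theta> f \<in> boundaries m}"
 proof (intro equalityI subsetI)
  fix f' assume "f' \<in> coboundaries E P d reg ?W ?n"
  then have "f' \<in> (%h. \<lambda>p\<in>?C. h (d m p)) ` carrier (hom_bimodule E (P m) reg ?W)" by simp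
  then obtain h where h: "f' = (\<lambda>p\<in>?C. h (d m p))" "h \<in> carrier (hom_bimodule E (P m) reg ?W)" by (rule imageE)
  have hh: "h \<in> mod_hom E (P m) reg" using h(2) by (simp add: hom_bimodule_def)
  have "h (d m (d ?n p)) = \<zero>\<^sub>E" if "p \<in> carrier (P (Suc ?n))" for p
   unfolding p(10)[OF that] using mod_hom_zero[OF hh p(2) left_module_reg] by (simp only: regular_simps)
  then have "f' \<in> ?Z" unfolding h(1) by (rule ZI[OF mod_hom_comp[OF p(5) hh]])
  moreover have "\<theta> f' = gv ?n (%x. h (\<phi> m (dB m x)))"
   unfolding h(1) \<theta>r by (rule gv_cong) (simp only: f(3)[OF unitB_carrier])
  ultimately show "f' \<in> {f \<in> carrier ?M. \<theta> f \<in> boundaries m}"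
   using bI[OF mod_hom_comp[OF f(1) hh]] by simp
 next
  fix f' assume "f' \<in> {f \<in> carrier ?M. \<theta> f \<in> boundaries m}"
  then have f': "f' \<in> ?Z" and "\<theta> f' \<in> boundaries m" by (simp_all add: Mops)
  then obtain \<xi> where \<xi>: "\<theta> f' = gv ?n (%x. \<xi> (dB m x))" "\<xi> \<in> mod_hom E (KB m) reg"
   unfolding boundaries_def by blast
  have e: "f' (\<phi> ?n x) = \<xi> (dB m x)" if "x \<in> carrier (KB ?n)" for x
   by (rule gv_inj[OF mod_hom_comp[OF f(1) Zh[OF f']] KB_hom_dB[OF \<xi>(2)] \<xi>(1)[unfolded \<theta>_def] that])
  \<comment> \<open>If the pull-back of f' to the Koszul complex is \<xi> d, the homotopy on P
    exhibits f' as the coboundary of \<xi> \<psi> + f' t; the remaining term f' d t is zero because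
    f' is a cocycle.\<close>
  let ?h = "%p. \<xi> (\<psi> m p) \<oplus>\<^sub>E f' (t m p)"
  have h: "?h \<in> mod_hom E (P m) reg"
   by (rule reg_hom_add[OF mod_hom_comp[OF g(1) \<xi>(2)] mod_hom_comp[OF t Zh[OF f']]])
  have hr: "(\<lambda>p\<in>carrier (P m). ?h p) \<in> carrier (hom_bimodule E (P m) reg ?W)"
   using mod_hom_cong[OF h _ p(2), of "\<lambda>p\<in>carrier (P m). ?h p"] by (simp add: hom_bimodule_def)
  have "f' x = (\<lambda>p\<in>?C. (\<lambda>p\<in>carrier (P m). ?h p) (d m p)) x" for x
  proof (cases "x \<in> ?C")
   case False then show ?thesis using Ze[OF f'] by (simp add: extensional_def)
  next
   case x: True
   let ?y = "\<phi> ?n (\<psi> ?n x)" and ?z = "d ?n (t ?n x)" and ?w = "t m (d m x)"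
   have dx: "d m x \<in> carrier (P m)" by (rule mod_hom_closed[OF p(5) x])
   have px: "\<psi> ?n x \<in> carrier (KB ?n)" by (rule mod_hom_closed[OF g(1) x])
   have c: "?y \<in> ?C" "?z \<in> ?C" "?w \<in> ?C"
    by (rule mod_hom_closed[OF f(1) px], rule dc[OF mod_hom_closed[OF t x]], rule mod_hom_closed[OF t dx])
   have "x = (x \<ominus>\<^bsub>P ?n\<^esub> ?y) \<oplus>\<^bsub>P ?n\<^esub> ?y"
    using x c(1) by (simp add: a_minus_def Pn.M.a_assoc Pn.M.l_neg)
   then have "x = (?z \<oplus>\<^bsub>P ?n\<^esub> ?w) \<oplus>\<^bsub>P ?n\<^esub> ?y" by (simp only: td[OF x])
   then have "f' x = f' ((?z \<oplus>\<^bsub>P ?n\<^esub> ?w) \<oplus>\<^bsub>P ?n\<^esub> ?y)" by (rule arg_cong)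
   also have "\<dots> = (f' ?z \<oplus>\<^sub>E f' ?w) \<oplus>\<^sub>E f' ?y"
    using c by (simp add: reg_hom(2)[OF Zh[OF f']])
   also have "f' ?z = \<zero>\<^sub>E" by (rule Zd[OF f' mod_hom_closed[OF t x]])
   also have "f' ?y = \<xi> (\<psi> m (d m x))" unfolding e[OF px] g(3)[OF x] ..
   also have "(\<zero>\<^sub>E \<oplus>\<^sub>E f' ?w) \<oplus>\<^sub>E \<xi> (\<psi> m (d m x)) = ?h (d m x)"
    using Zc[OF f' c(3)] reg_hom(1)[OF \<xi>(2) mod_hom_closed[OF g(1) dx]] by (simp add: ER.a_comm)
   finally show ?thesis using x dx by simp
  qed
  then have "f' = (\<lambda>p\<in>?C. (\<lambda>p\<in>carrier (P m). ?h p) (d m p))" by (rule ext)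
  then show "f' \<in> coboundaries E P d reg ?W ?n"
   unfolding coboundaries.simps by (rule image_eqI[OF _ hr])
 qed
 show ?thesis
  unfolding Ext_bimodule_def
 proof (rule quot_bimodule_iso[OF abM abelian_group_top sub_bimodule_boundaries cob])
  show "\<theta> x \<in> carrier (topB ?n)" if "x \<in> carrier ?M" for x using \<theta>c that by (simp add: Mops)
  show "\<theta> (x \<oplus>\<^sub>?M y) = \<theta> x \<oplus>\<^bsub>topB ?n\<^esub> \<theta> y" if "x \<in> carrier ?M" "y \<in> carrier ?M" for x y
  proof -
   have "x \<in> ?Z" "y \<in> ?Z" using that by (simp_all only: Mops)
   then show ?thesis
    unfolding Mops \<theta>r \<theta>_def[of x] \<theta>_def[of y] by (intro gv_add Zc u)
  qed
  show "\<theta> (a \<odot>\<^sub>?M x) = a \<odot>\<^bsub>topB ?n\<^esub> \<theta> x" if a: "a \<in> carrier \<A>" and "x \<in> carrier ?M" for a x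
  proof -
   have "x \<in> ?Z" using that(2) by (simp only: Mops)
   then show ?thesis unfolding Mops \<theta>r \<theta>_def[of x] using a by (intro gv_smult Zc u)
  qed
  show "\<theta> (rsmult ?M x a) = rsmult (topB ?n) (\<theta> x) a" if a: "a \<in> carrier \<A>" and "x \<in> carrier ?M" for a x
  proof -
   have "x \<in> ?Z" using that(2) by (simp only: Mops)
   then show ?thesis unfolding Mops \<theta>r \<theta>_def[of x] using a by (intro gv_rsmult Zc u)
  qed
  show "\<exists>x\<in>carrier ?M. \<exists>b\<in>boundaries m. y = b \<oplus>\<^bsub>topB ?n\<^esub> \<theta> x" if "y \<in> carrier (topB ?n)" for y
   using onto[OF that] by (simp only: Mops)
  show "a \<odot>\<^sub>?M x \<in> carrier ?M" "rsmult ?M x a \<in> carrier ?M" if "a \<in> carrier \<A>" "x \<in> carrier ?M" for a x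
   using that unfolding Mops by (auto intro!: Zmult te_closed)
  show "a \<odot>\<^sub>?M (x \<oplus>\<^sub>?M y) = a \<odot>\<^sub>?M x \<oplus>\<^sub>?M a \<odot>\<^sub>?M y"
   "rsmult ?M (x \<oplus>\<^sub>?M y) a = rsmult ?M x a \<oplus>\<^sub>?M rsmult ?M y a"
   if a: "a \<in> carrier \<A>" and "x \<in> carrier ?M" "y \<in> carrier ?M" for a x y
  proof -
   have xy: "x \<in> ?Z" "y \<in> ?Z" using that(2,3) by (simp_all only: Mops)
   show "a \<odot>\<^sub>?M (x \<oplus>\<^sub>?M y) = a \<odot>\<^sub>?M x \<oplus>\<^sub>?M a \<odot>\<^sub>?M y"
    unfolding Mops by (rule restrict_ext) (simp add: Zc[OF xy(1)] Zc[OF xy(2)] ER.l_distr te_closed a)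
   show "rsmult ?M (x \<oplus>\<^sub>?M y) a = rsmult ?M x a \<oplus>\<^sub>?M rsmult ?M y a"
    unfolding Mops by (rule restrict_ext) (simp add: Zc[OF xy(1)] Zc[OF xy(2)] ER.l_distr te_closed a)
  qed
 qed (simp_all only: top_actions)
qed

end

theorem theorem3p2:
  fixes Q :: "('v, 'a) pre_digraph"
    and M :: "('v, 'a, 'k::{alg_closed_field, field_char_0}) path_elem set"
    and n :: nat
    and Bn Bn' :: "('v, 'a, 'k) path_elem set"
    and P :: "nat \<Rightarrow> (_, 'p) module" and d :: "nat \<Rightarrow> 'p \<Rightarrow> 'p" and \<epsilon> :: "'p \<Rightarrow> _"
  assumes "fin_digraph Q"
    and "quadratic_relations Q M"
    and "fin_dim (qalg Q M)"
    and "basic (qalg Q M)"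
    and "koszul Q M"
    and "gl_dim (qalg Q M) = enat n" and "n \<ge> 1"
    and "compatible_basis Q (koszul_space Q M n) Bn"
    and "compatible_basis Q (koszul_space Q M (n - 1)) Bn'"
    and "projective_resolution (env (qalg Q M)) (env_diagonal (qalg Q M)) P d \<epsilon>"
  shows "\<exists>h. h \<in> bimodule_iso (qalg Q M)
      (Ext_bimodule (env (qalg Q M)) P d (regular (env (qalg Q M))) (env_inner (qalg Q M)) n)
      (quot_bimodule (top_bimodule Q M Bn)
        (gen_sub_bimodule (qalg Q M) (top_bimodule Q M Bn)
          (top_relation Q M n Bn Bn' ` Bn')))"
proof -
  obtain m where n: "n = Suc m" using assms(7) by (cases n) auto
  interpret quadratic_quiver Q M by (intro quadratic_quiver.intro quadratic_quiver_axioms.intro assms)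
  \<comment> \<open>The two prescribed bases are completed to a family for all degrees; as m differs
    from n, both can be kept.\<close>
  define B where "B l = (if l = n then Bn else if l = m then Bn' else SOME C. compatible_basis Q (koszul_space Q M l) C)" for l
  have B: "B n = Bn" "B m = Bn'" using n by (simp_all add: B_def)
  have "compatible_basis Q (koszul_space Q M l) (B l)" for l
    using assms(8,9) someI_ex[OF compatible_basis_exists, of l] n by (auto simp: B_def)
  moreover have "left_module (env (qalg Q M)) (env_diagonal (qalg Q M))"
    using assms(10) by (simp add: projective_resolution_def)
  ultimately interpret env_koszul Q M B
    by (intro env_koszul.intro env_koszul_axioms.intro koszul_bases.intro koszul_bases_axioms.intro
      fd_quadratic_quiver.intro fd_quadratic_quiver_axioms.intro quadratic_quiver_axioms assms)
  obtain A :: "nat \<Rightarrow> 'p set" where "resolution E (\<D>) A P d \<epsilon>"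
    using projective_resolution_imp_resolution[OF assms(10)] by (rule exE)
  from ext_iso[OF assms(6)[unfolded n] this] show ?thesis
    unfolding gen_sub_bimodule_relations[symmetric] B[unfolded n] n .
qed

end
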